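(* Let $M$ be a compact manifold of dimension $n$ and let $(M,g(t),\phi(t),t\in[0,T])$ be a family of time dependent metrics and potentials such that $$\frac12\frac{\partial g}{\partial t}+Ric(L)\ge Kg,\qquad \frac{\partial\phi}{\partial t}=\frac12\mathrm{Tr}\left(\frac{\partial g}{\partial t}\right),$$ where $K\in\mathbb{R}$. Then, for all $f\in C(M,(0,\infty))$ and all $t\in(0,T]$, $$\frac{d}{dt}W_K(f,t)=-(1+e^{2Kt})\int_M\left(\frac12\left[\frac{\partial g}{\partial t}+\Gamma_2\right]-Kg\right)(\nabla\log P_tf,\nabla\log P_tf)\,P_tf\,d\mu,$$ where $\Gamma_2(\nabla u,\nabla u)=2|\nabla^2u|^2+2Ric(L)(\nabla u,\nabla u)$. In particular, $$\frac{d}{dt}W_K(f,t)+(1+e^{2Kt})\int_M|\nabla^2\log P_tf|^2\,P_tf\,d\mu\le0,$$ and the equality holds on $(0,T]$ (for all non-constant $f$) if and only if $(M,g(t),\phi(t),t\in[0,T])$ is the $K$-Perelman Ricci flow $$\frac12\frac{\partial g}{\partial t}+Ric(L)=Kg,\qquad \frac{\partial\phi}{\partial t}=-R-\Delta\phi+nK.$$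
   Context: $L=\Delta_{g(t)}-\nabla_{g(t)}\phi(t)\cdot\nabla_{g(t)}$ is the time dependent Witten Laplacian; $Ric(L)=Ric_{g(t)}+\nabla^2\phi(t)$; $R$ is the scalar curvature of $g(t)$; traces, norms, gradients, Hessians at time $t$ are with respect to $g(t)$. $d\mu=e^{-\phi(t)}dv_{g(t)}$, which does not depend on $t$ because $\partial_t\phi=\frac12\mathrm{Tr}(\partial_tg)$. For $f\in C(M,(0,\infty))$, $P_tf=u(\cdot,t)$ is the positive solution of $\partial_tu=Lu$ with $u(\cdot,0)=f$. With $D_K(t)=\frac{2K}{1-e^{-2Kt}}$ for $K\neq0$ and $D_0(t)=\frac1t$, $$H_K(f,t)=D_K(t)\int_M\big(f\log f-P_tf\log P_tf\big)\,d\mu,\qquad W_K(f,t)=H_K(f,t)+\frac{\sinh(2Kt)}{2K}\frac{d}{dt}H_K(f,t),$$ where for $K=0$ the factor $\frac{\sinh(2Kt)}{2K}$ is read as $t$. *)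

theory Defs
  imports "HOL-Analysis.Analysis"
begin

subsection \<open>Smooth maps\<close>

text \<open>Derivatives are taken within the set, so that smoothness up to the boundary of sets such as
  \<open>{0..T} \<times> V\<close> with \<open>V\<close> open is meant one-sidedly in time.\<close>

primrec Ck_on :: "nat \<Rightarrow> 'a::real_normed_vector set \<Rightarrow> ('a \<Rightarrow> 'b::real_normed_vector) \<Rightarrow> bool" where
  "Ck_on 0 S f = continuous_on S f"
| "Ck_on (Suc k) S f = (\<exists>D. (\<forall>x\<in>S. (f has_derivative D x) (at x within S)) \<and>
     (\<forall>h. Ck_on k S (\<lambda>x. D x h)))"

definition smooth_on :: "'a::real_normed_vector set \<Rightarrow> ('a \<Rightarrow> 'b::real_normed_vector) \<Rightarrow> bool" where
  "smooth_on S f \<longleftrightarrow> (\<forall>k. Ck_on k S f)"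

subsection \<open>Manifolds\<close>

text \<open>A chart is a pair of its domain and its coordinate map.\<close>

type_synonym ('a, 'n) chart = "'a set \<times> ('a \<Rightarrow> (real, 'n) vec)"

abbreviation chart_inv :: "('a, 'n::finite) chart \<Rightarrow> real^'n \<Rightarrow> 'a" where
  "chart_inv c \<equiv> inv_into (fst c) (snd c)"

abbreviation chart_image :: "('a, 'n::finite) chart \<Rightarrow> (real^'n) set" where
  "chart_image c \<equiv> snd c ` fst c"

definition smooth_atlas :: "'a::t2_space set \<Rightarrow> ('a, 'n::finite) chart set \<Rightarrow> bool" where
  "smooth_atlas M A \<longleftrightarrow>
     (\<Union>c\<in>A. fst c) = M \<and>
     (\<forall>c\<in>A. openin (top_of_set M) (fst c) \<and> open (chart_image c) \<and>
        homeomorphism (fst c) (chart_image c) (snd c) (chart_inv c)) \<and>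
     (\<forall>c\<in>A. \<forall>d\<in>A. smooth_on (snd c ` (fst c \<inter> fst d)) (snd d \<circ> chart_inv c))"

text \<open>Second countability is not required: it is automatic for compact \<open>M\<close>.\<close>

definition chart_at :: "('a, 'n::finite) chart set \<Rightarrow> 'a \<Rightarrow> ('a, 'n) chart" where
  "chart_at A p = (SOME c. c \<in> A \<and> p \<in> fst c)"

definition coord :: "('a, 'n::finite) chart \<Rightarrow> ('a \<Rightarrow> 'b) \<Rightarrow> real^'n \<Rightarrow> 'b" where
  "coord c u = (\<lambda>x. u (chart_inv c x))"

text \<open>A covariant 2-tensor field \<open>S\<close> is given by its matrix of components \<open>S c x\<close> in each chart
  \<open>c\<close> at each point \<open>x\<close> of the coordinate domain, subject to the transformation law.\<close>

type_synonym ('a, 'n) tensor2 = "('a, 'n) chart \<Rightarrow> (real, 'n) vec \<Rightarrow> ((real, 'n) vec, 'n) vec"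

definition bil :: "real^'n^'n \<Rightarrow> real^'n \<Rightarrow> real^'n \<Rightarrow> real" where
  "bil S v w = v \<bullet> (S *v w)"

definition tensor_law :: "('a, 'n::finite) chart set \<Rightarrow> ('a, 'n) tensor2 \<Rightarrow> bool" where
  "tensor_law A S \<longleftrightarrow>
     (\<forall>c\<in>A. \<forall>d\<in>A. \<forall>p \<in> fst c \<inter> fst d. \<forall>v w.
        let J = frechet_derivative (snd d \<circ> chart_inv c) (at (snd c p))
        in bil (S c (snd c p)) v w = bil (S d (snd d p)) (J v) (J w))"

definition riemannian_metric :: "('a, 'n::finite) chart set \<Rightarrow> ('a, 'n) tensor2 \<Rightarrow> bool" where
  "riemannian_metric A G \<longleftrightarrow> tensor_law A G \<and>
     (\<forall>c\<in>A. \<forall>x\<in>chart_image c. transpose (G c x) = G c x \<and> (\<forall>v. v \<noteq> 0 \<longrightarrow> bil (G c x) v v > 0))"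

definition smooth_metrics :: "('a, 'n::finite) chart set \<Rightarrow> real \<Rightarrow> (real \<Rightarrow> ('a, 'n) tensor2) \<Rightarrow> bool" where
  "smooth_metrics A T g \<longleftrightarrow>
     (\<forall>t\<in>{0..T}. riemannian_metric A (g t)) \<and>
     (\<forall>c\<in>A. smooth_on ({0..T} \<times> chart_image c) (\<lambda>(t, x). g t c x))"

definition smooth_functions ::
    "('a, 'n::finite) chart set \<Rightarrow> real set \<Rightarrow> (real \<Rightarrow> 'a \<Rightarrow> real) \<Rightarrow> bool" where
  "smooth_functions A I u \<longleftrightarrow>
     (\<forall>c\<in>A. smooth_on (I \<times> chart_image c) (\<lambda>(t, x). coord c (u t) x))"

subsection \<open>Riemannian geometry in coordinates\<close>

text \<open>In this section \<open>G\<close> is the component matrix of a metric on an open subset of \<open>real^'n\<close>.\<close>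

definition pderiv_coord :: "'n::finite \<Rightarrow> (real^'n \<Rightarrow> real) \<Rightarrow> real^'n \<Rightarrow> real" where
  "pderiv_coord i F x = frechet_derivative F (at x) (axis i 1)"

text \<open>The index order is \<open>christoffel G x k i j\<close> for $\Gamma^k_{ij}$.\<close>

definition christoffel :: "(real^'n \<Rightarrow> real^'n^'n) \<Rightarrow> real^'n \<Rightarrow> 'n \<Rightarrow> 'n \<Rightarrow> 'n \<Rightarrow> real" where
  "christoffel G x k i j =
     (\<Sum>l\<in>UNIV. matrix_inv (G x) $ k $ l *
        (pderiv_coord i (\<lambda>y. G y $ j $ l) x + pderiv_coord j (\<lambda>y. G y $ i $ l) x
         - pderiv_coord l (\<lambda>y. G y $ i $ j) x)) / 2"

text \<open>\<open>riemann G x l k i j\<close> is the coefficient of $\partial_l$ in $R(\partial_i,\partial_j)\partial_k$,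
  where $R(X,Y)Z=\nabla_X\nabla_YZ-\nabla_Y\nabla_XZ-\nabla_{[X,Y]}Z$.\<close>

definition riemann ::
    "(real^'n \<Rightarrow> real^'n^'n) \<Rightarrow> real^'n \<Rightarrow> 'n \<Rightarrow> 'n \<Rightarrow> 'n \<Rightarrow> 'n \<Rightarrow> real" where
  "riemann G x l k i j =
     pderiv_coord i (\<lambda>y. christoffel G y l j k) x - pderiv_coord j (\<lambda>y. christoffel G y l i k) x
     + (\<Sum>m\<in>UNIV. christoffel G x m j k * christoffel G x l i m
                  - christoffel G x m i k * christoffel G x l j m)"

text \<open>With this sign convention round spheres have positive Ricci curvature.\<close>

definition ricci :: "(real^'n \<Rightarrow> real^'n^'n) \<Rightarrow> real^'n \<Rightarrow> real^'n^'n" where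
  "ricci G x = (\<chi> j k. \<Sum>i\<in>UNIV. riemann G x i k i j)"

definition hessian :: "(real^'n \<Rightarrow> real^'n^'n) \<Rightarrow> (real^'n \<Rightarrow> real) \<Rightarrow> real^'n \<Rightarrow> real^'n^'n" where
  "hessian G F x = (\<chi> i j. pderiv_coord i (pderiv_coord j F) x
     - (\<Sum>k\<in>UNIV. christoffel G x k i j * pderiv_coord k F x))"

definition gradient :: "(real^'n \<Rightarrow> real^'n^'n) \<Rightarrow> (real^'n \<Rightarrow> real) \<Rightarrow> real^'n \<Rightarrow> real^'n" where
  "gradient G F x = matrix_inv (G x) *v (\<chi> i. pderiv_coord i F x)"

definition tensor_trace :: "real^'n^'n \<Rightarrow> real^'n^'n \<Rightarrow> real" where
  "tensor_trace B S = (\<Sum>i\<in>UNIV. \<Sum>j\<in>UNIV. matrix_inv B $ i $ j * S $ i $ j)"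

definition tensor_norm2 :: "real^'n^'n \<Rightarrow> real^'n^'n \<Rightarrow> real" where
  "tensor_norm2 B S = (\<Sum>i\<in>UNIV. \<Sum>j\<in>UNIV. \<Sum>k\<in>UNIV. \<Sum>l\<in>UNIV.
     matrix_inv B $ i $ k * matrix_inv B $ j $ l * S $ i $ j * S $ k $ l)"

definition scalar_curvature :: "(real^'n \<Rightarrow> real^'n^'n) \<Rightarrow> real^'n \<Rightarrow> real" where
  "scalar_curvature G x = tensor_trace (G x) (ricci G x)"

definition laplacian :: "(real^'n \<Rightarrow> real^'n^'n) \<Rightarrow> (real^'n \<Rightarrow> real) \<Rightarrow> real^'n \<Rightarrow> real" where
  "laplacian G F x = tensor_trace (G x) (hessian G F x)"

definition witten_laplacian ::
    "(real^'n \<Rightarrow> real^'n^'n) \<Rightarrow> (real^'n \<Rightarrow> real) \<Rightarrow> (real^'n \<Rightarrow> real) \<Rightarrow> real^'n \<Rightarrow> real" where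
  "witten_laplacian G \<Phi> F x =
     laplacian G F x - bil (G x) (gradient G \<Phi> x) (gradient G F x)"

definition ricci_L :: "(real^'n \<Rightarrow> real^'n^'n) \<Rightarrow> (real^'n \<Rightarrow> real) \<Rightarrow> real^'n \<Rightarrow> real^'n^'n" where
  "ricci_L G \<Phi> x = ricci G x + hessian G \<Phi> x"

text \<open>$\Gamma_2(\nabla F,\nabla F)$, which involves second derivatives of \<open>F\<close>.\<close>

definition Gamma2 ::
    "(real^'n \<Rightarrow> real^'n^'n) \<Rightarrow> (real^'n \<Rightarrow> real) \<Rightarrow> (real^'n \<Rightarrow> real) \<Rightarrow> real^'n \<Rightarrow> real" where
  "Gamma2 G \<Phi> F x = 2 * tensor_norm2 (G x) (hessian G F x)
     + 2 * bil (ricci_L G \<Phi> x) (gradient G F x) (gradient G F x)"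

subsection \<open>Time dependent metrics and potentials\<close>

text \<open>The derivative in \<open>t \<in> {0..T}\<close>; one-sided at the end points.\<close>

definition time_deriv :: "real \<Rightarrow> (real \<Rightarrow> 'b::real_normed_vector) \<Rightarrow> real \<Rightarrow> 'b" where
  "time_deriv T F t = vector_derivative F (at t within {0..T})"

definition metric_deriv :: "real \<Rightarrow> (real \<Rightarrow> ('a, 'n::finite) tensor2) \<Rightarrow> real \<Rightarrow> ('a, 'n) tensor2" where
  "metric_deriv T g t c x = time_deriv T (\<lambda>s. g s c x) t"

definition conjugate_potential :: "('a, 'n::finite) chart set \<Rightarrow> real \<Rightarrow>
    (real \<Rightarrow> ('a, 'n) tensor2) \<Rightarrow> (real \<Rightarrow> 'a \<Rightarrow> real) \<Rightarrow> bool" where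
  "conjugate_potential A T g \<phi> \<longleftrightarrow> (\<forall>t\<in>{0..T}. \<forall>c\<in>A. \<forall>x\<in>chart_image c.
     time_deriv T (\<lambda>s. coord c (\<phi> s) x) t = 1/2 * tensor_trace (g t c x) (metric_deriv T g t c x))"

definition super_Perelman_Ricci_flow :: "('a, 'n::finite) chart set \<Rightarrow> real \<Rightarrow> real \<Rightarrow>
    (real \<Rightarrow> ('a, 'n) tensor2) \<Rightarrow> (real \<Rightarrow> 'a \<Rightarrow> real) \<Rightarrow> bool" where
  "super_Perelman_Ricci_flow A T K g \<phi> \<longleftrightarrow> (\<forall>t\<in>{0..T}. \<forall>c\<in>A. \<forall>x\<in>chart_image c. \<forall>v.
     bil ((1/2) *\<^sub>R metric_deriv T g t c x + ricci_L (g t c) (coord c (\<phi> t)) x) v v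
       \<ge> bil (K *\<^sub>R g t c x) v v)"

definition Perelman_Ricci_flow :: "('a, 'n::finite) chart set \<Rightarrow> real \<Rightarrow> real \<Rightarrow>
    (real \<Rightarrow> ('a, 'n) tensor2) \<Rightarrow> (real \<Rightarrow> 'a \<Rightarrow> real) \<Rightarrow> bool" where
  "Perelman_Ricci_flow A T K g \<phi> \<longleftrightarrow> (\<forall>t\<in>{0..T}. \<forall>c\<in>A. \<forall>x\<in>chart_image c.
     (1/2) *\<^sub>R metric_deriv T g t c x + ricci_L (g t c) (coord c (\<phi> t)) x = K *\<^sub>R g t c x \<and>
     time_deriv T (\<lambda>s. coord c (\<phi> s) x) t =
       - scalar_curvature (g t c) x - laplacian (g t c) (coord c (\<phi> t)) x + real CARD('n) * K)"

subsection \<open>Volume\<close>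

text \<open>For a Riemannian metric \<open>G\<close> on a compact \<open>M\<close> with smooth atlas \<open>A\<close>, the measure below exists and is
  unique: the densities $\sqrt{\det G}$ agree on overlaps, and finitely many charts cover \<open>M\<close>.\<close>

definition riemannian_volume ::
    "'a::t2_space set \<Rightarrow> ('a, 'n::finite) chart set \<Rightarrow> ('a, 'n) tensor2 \<Rightarrow> 'a measure" where
  "riemannian_volume M A G = (THE \<nu>. sets \<nu> = sets (restrict_space borel M) \<and>
     (\<forall>c\<in>A. \<forall>B\<in>sets borel. B \<subseteq> fst c \<longrightarrow>
        emeasure \<nu> B = (\<integral>\<^sup>+x \<in> snd c ` B. ennreal (sqrt (det (G c x))) \<partial>lborel)))"

definition weighted_volume :: "'a::t2_space set \<Rightarrow> ('a, 'n::finite) chart set \<Rightarrow>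
    (real \<Rightarrow> ('a, 'n) tensor2) \<Rightarrow> (real \<Rightarrow> 'a \<Rightarrow> real) \<Rightarrow> real \<Rightarrow> 'a measure" where
  "weighted_volume M A g \<phi> t =
     density (riemannian_volume M A (g t)) (\<lambda>p. ennreal (exp (- \<phi> t p)))"

subsection \<open>The heat semigroup\<close>

definition pos_continuous :: "'a::t2_space set \<Rightarrow> ('a \<Rightarrow> real) \<Rightarrow> bool" where
  "pos_continuous M f \<longleftrightarrow> continuous_on M f \<and> (\<forall>p\<in>M. 0 < f p)"

text \<open>Positive classical solutions of $\partial_tu=Lu$, $u(\cdot,0)=f$: continuous up to \<open>t = 0\<close>
  and smooth for positive times.\<close>

definition heat_solution :: "'a::t2_space set \<Rightarrow> ('a, 'n::finite) chart set \<Rightarrow> real \<Rightarrow>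
    (real \<Rightarrow> ('a, 'n) tensor2) \<Rightarrow> (real \<Rightarrow> 'a \<Rightarrow> real) \<Rightarrow> ('a \<Rightarrow> real) \<Rightarrow> (real \<Rightarrow> 'a \<Rightarrow> real) \<Rightarrow> bool" where
  "heat_solution M A T g \<phi> f u \<longleftrightarrow>
     continuous_on ({0..T} \<times> M) (\<lambda>(t, p). u t p) \<and>
     smooth_functions A {0<..T} u \<and>
     (\<forall>t\<in>{0..T}. \<forall>p\<in>M. 0 < u t p) \<and>
     (\<forall>p\<in>M. u 0 p = f p) \<and>
     (\<forall>t\<in>{0<..T}. \<forall>c\<in>A. \<forall>x\<in>chart_image c.
        time_deriv T (\<lambda>s. coord c (u s) x) t =
          witten_laplacian (g t c) (coord c (\<phi> t)) (coord c (u t)) x)"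

definition heat_semigroup :: "'a::t2_space set \<Rightarrow> ('a, 'n::finite) chart set \<Rightarrow> real \<Rightarrow>
    (real \<Rightarrow> ('a, 'n) tensor2) \<Rightarrow> (real \<Rightarrow> 'a \<Rightarrow> real) \<Rightarrow> (real \<Rightarrow> ('a \<Rightarrow> real) \<Rightarrow> 'a \<Rightarrow> real) \<Rightarrow> bool" where
  "heat_semigroup M A T g \<phi> P \<longleftrightarrow>
     (\<forall>f. pos_continuous M f \<longrightarrow> heat_solution M A T g \<phi> f (\<lambda>t. P t f))"

subsection \<open>The functionals \<open>H\<^sub>K\<close> and \<open>W\<^sub>K\<close>\<close>

definition D_coeff :: "real \<Rightarrow> real \<Rightarrow> real" where
  "D_coeff K t = (if K = 0 then 1 / t else 2 * K / (1 - exp (- 2 * K * t)))"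

definition sinh_coeff :: "real \<Rightarrow> real \<Rightarrow> real" where
  "sinh_coeff K t = (if K = 0 then t else sinh (2 * K * t) / (2 * K))"

definition H_entropy :: "'a::t2_space set \<Rightarrow> ('a, 'n::finite) chart set \<Rightarrow>
    (real \<Rightarrow> ('a, 'n) tensor2) \<Rightarrow> (real \<Rightarrow> 'a \<Rightarrow> real) \<Rightarrow> (real \<Rightarrow> ('a \<Rightarrow> real) \<Rightarrow> 'a \<Rightarrow> real) \<Rightarrow>
    real \<Rightarrow> ('a \<Rightarrow> real) \<Rightarrow> real \<Rightarrow> real" where
  "H_entropy M A g \<phi> P K f t = D_coeff K t *
     (\<integral>p. (f p * ln (f p) - P t f p * ln (P t f p)) \<partial>weighted_volume M A g \<phi> t)"

definition W_entropy :: "'a::t2_space set \<Rightarrow> ('a, 'n::finite) chart set \<Rightarrow> real \<Rightarrow>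
    (real \<Rightarrow> ('a, 'n) tensor2) \<Rightarrow> (real \<Rightarrow> 'a \<Rightarrow> real) \<Rightarrow> (real \<Rightarrow> ('a \<Rightarrow> real) \<Rightarrow> 'a \<Rightarrow> real) \<Rightarrow>
    real \<Rightarrow> ('a \<Rightarrow> real) \<Rightarrow> real \<Rightarrow> real" where
  "W_entropy M A T g \<phi> P K f t = H_entropy M A g \<phi> P K f t
     + sinh_coeff K t * time_deriv T (H_entropy M A g \<phi> P K f) t"

text \<open>The point value of $|\nabla^2w|^2$, and of
  $(\frac12[\partial_tg+\Gamma_2]-Kg)(\nabla w,\nabla w)$. The chart is
  chosen, but by the transformation law these scalars do not depend on the choice.\<close>

definition hessian_norm2 ::
    "('a, 'n::finite) chart set \<Rightarrow> ('a, 'n) tensor2 \<Rightarrow> ('a \<Rightarrow> real) \<Rightarrow> 'a \<Rightarrow> real" where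
  "hessian_norm2 A G w p = (let c = chart_at A p; x = snd c p
     in tensor_norm2 (G c x) (hessian (G c) (coord c w) x))"

definition W_integrand :: "('a, 'n::finite) chart set \<Rightarrow> real \<Rightarrow> real \<Rightarrow>
    (real \<Rightarrow> ('a, 'n) tensor2) \<Rightarrow> (real \<Rightarrow> 'a \<Rightarrow> real) \<Rightarrow> real \<Rightarrow> ('a \<Rightarrow> real) \<Rightarrow> 'a \<Rightarrow> real" where
  "W_integrand A T K g \<phi> t w p =
     (let c = chart_at A p; x = snd c p; v = gradient (g t c) (coord c w) x
      in 1/2 * (bil (metric_deriv T g t c x) v v + Gamma2 (g t c) (coord c (\<phi> t)) (coord c w) x)
         - K * bil (g t c x) v v)"

end

(* With w = log u, the Bochner formula gives the entropy H two derivatives whose combination in W_K is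
   -(1 + exp (2 K t)) times the integral of (|Hess w|^2 + S(grad w, grad w)) u, where
   S = 1/2 dg/dt + Ric(L) - K g >= 0. If equality holds for all initial values, then S(grad u, grad u) = 0,
   so S grad P_t f = 0 for all f. Hence the divergence of S grad h is orthogonal to the range of P_t for every
   smooth h. That range is dense in L^2: the frequency D/N of the backward heat flow is almost monotone, in
   Galerkin approximations with bounds independent of the dimension, so a nonzero function orthogonal to the
   range cannot exist. Therefore the divergence vanishes; testing against h gives S(grad h, grad h) = 0. *)

theory Submission
  imports Defs
begin

text \<open>Since S >= 0, the identity S(grad log u, grad log u) = 0 forces S grad u = 0. This is
  linear in u, so it can be tested against functions and is governed by the span of the P_t f. The
  metric moves with time, so P_t need not be self-adjoint and spectral theory does not show that its
  range is dense. A function z orthogonal to the range has to be followed from time t back towards 0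
  by the adjoint equation, whose solvability the hypotheses do not supply; projected to a finite
  dimensional space it is a linear ODE. The space is spanned by z and by samples of finitely many
  solutions P_s f, so the pairing of the backward flow with P_s f stays almost zero down to a small
  time, where P_s f is close to f. The frequency bound keeps the energy of the flow below a fixed
  multiple Q of its squared norm. A quantitative Rellich estimate (\<open>detection\<close>) then
  bounds the norm by its pairings with finitely many f, which are chosen from Q before the space is.
  These f must be non-constant, because equality is assumed only for such f.\<close>

abbreviation sum_all (binder "SU " 10) where "sum_all f \<equiv> sum f UNIV"

lemmas LINT_cong = Bochner_Integration.integral_cong and LINT_nonneg = Bochner_Integration.integral_nonneg
  and LINT_add = Bochner_Integration.integral_add and LINT_diff = Bochner_Integration.integral_diff
  and LINT_sum = Bochner_Integration.integral_sum

subsection \<open>Functions of class \<open>C\<^sup>k\<close>\<close>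

lemma Ck_on_SucI:
 assumes "!!x. x : S ==> (f has_derivative D x) (at x within S)" "!!h. Ck_on k S (%x. D x h)"
 shows "Ck_on (Suc k) S f"
 using assms unfolding Ck_on.simps by blast

lemma Ck_on_SucE:
 assumes "Ck_on (Suc k) S f"
 obtains D where "!!x. x : S ==> (f has_derivative D x) (at x within S)" "!!h. Ck_on k S (%x. D x h)"
 using assms unfolding Ck_on.simps by blast

lemma Ck_on_cong:
 assumes "Ck_on k S f" "!!x. x : S ==> f x = g x"
 shows "Ck_on k S g"
proof (cases k)
 case 0
 then show ?thesis using assms continuous_on_cong[of S S f g] by auto
next
 case (Suc l)
 then obtain D where D: "ALL x:S. (f has_derivative D x) (at x within S)" "ALL h. Ck_on l S (%x. D x h)"
  using assms by auto
 have "(g has_derivative D x) (at x within S)" if "x : S" for x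
  using has_derivative_transform[of x S g f "D x"] that assms(2) D(1) by auto
 then show ?thesis using Suc D by auto
qed

lemma Ck_on_subset: "Ck_on k S f ==> T \<subseteq> S ==> Ck_on k T f"
proof (induction k arbitrary: f)
 case 0
 then show ?case by (auto intro: continuous_on_subset)
next
 case (Suc k)
 obtain D where "!!x. x : S ==> (f has_derivative D x) (at x within S)" "!!h. Ck_on k S (%x. D x h)"
  using Ck_on_SucE[OF Suc.prems(1)] by blast
 then show ?case using Suc.prems(2)
  by (intro Ck_on_SucI[of _ _ D]) (auto intro: has_derivative_subset Suc.IH)
qed

lemma Ck_on_SucD: "Ck_on (Suc k) S f ==> Ck_on k S f"
proof (induction k arbitrary: f)
 case 0
 then show ?case by (auto intro: has_derivative_continuous_on)
next
 case (Suc k)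
 then obtain D where D: "ALL x:S. (f has_derivative D x) (at x within S)"
  "ALL h. Ck_on (Suc k) S (%x. D x h)"
  by (subst (asm) Ck_on.simps) auto
 show ?case unfolding Ck_on.simps(2)[of k] by (intro exI[of _ D]) (use D Suc.IH in blast)
qed

lemma Ck_on_mono: "Ck_on k S f ==> l <= k ==> Ck_on l S f"
 by (induction k arbitrary: l) (auto simp del: Ck_on.simps simp: le_Suc_eq dest: Ck_on_SucD)

lemma Ck_on_imp_continuous_on: "Ck_on k S f ==> continuous_on S f"
 using Ck_on_mono[of k S f 0] by simp

lemma Ck_on_const: "Ck_on k S (%x. c)"
proof (induction k arbitrary: c)
 case (Suc k)
 show ?case by (rule Ck_on_SucI[of _ _ "%x h. 0"]) (rule has_derivative_const, rule Suc)
qed simp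

lemma Ck_on_bounded_linear: "bounded_linear h ==> Ck_on k S h"
proof (cases k)
 case (Suc l)
 assume h: "bounded_linear h"
 show ?thesis unfolding Suc
  by (rule Ck_on_SucI[of _ _ "%x. h"]) (auto intro: bounded_linear_imp_has_derivative h Ck_on_const)
qed (auto intro: linear_continuous_on)

lemma Ck_on_bounded_linear_compose:
 assumes h: "bounded_linear h"
 shows "Ck_on k S f ==> Ck_on k S (%x. h (f x))"
proof (induction k arbitrary: f)
 case 0
 then show ?case using h by (auto intro: bounded_linear.continuous_on)
next
 case (Suc k)
 obtain D where D: "!!x. x : S ==> (f has_derivative D x) (at x within S)" "!!v. Ck_on k S (%x. D x v)"
  using Ck_on_SucE[OF Suc.prems] by blast
 show ?case
  by (rule Ck_on_SucI[of _ _ "%x v. h (D x v)"])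
   (auto intro: bounded_linear.has_derivative[OF h] D Suc.IH)
qed

lemma Ck_on_add: "Ck_on k S f ==> Ck_on k S g ==> Ck_on k S (%x. f x + g x)"
proof (induction k arbitrary: f g)
 case 0
 then show ?case by (auto intro: continuous_intros)
next
 case (Suc k)
 obtain D where D: "!!x. x : S ==> (f has_derivative D x) (at x within S)" "!!v. Ck_on k S (%x. D x v)"
  using Ck_on_SucE[OF Suc.prems(1)] by blast
 obtain E where E: "!!x. x : S ==> (g has_derivative E x) (at x within S)" "!!v. Ck_on k S (%x. E x v)"
  using Ck_on_SucE[OF Suc.prems(2)] by blast
 show ?case
  by (rule Ck_on_SucI[of _ _ "%x h. D x h + E x h"]) (auto intro: has_derivative_add D E Suc.IH)
qed

lemma Ck_on_sum: "(!!i. i : I ==> Ck_on k S (f i)) ==> Ck_on k S (%x. SUM i:I. f i x)"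
 by (induction I rule: infinite_finite_induct) (auto simp: Ck_on_const Ck_on_add)

lemma Ck_on_minus: "Ck_on k S f ==> Ck_on k S (%x. - f x)"
 by (rule Ck_on_bounded_linear_compose[OF bounded_linear_minus[OF bounded_linear_ident]])

lemma Ck_on_diff: "Ck_on k S f ==> Ck_on k S g ==> Ck_on k S (%x. f x - g x)"
 using Ck_on_add[OF _ Ck_on_minus] by fastforce

lemma Ck_on_mult:
 fixes f g :: "'a::real_normed_vector => real"
 shows "Ck_on k S f ==> Ck_on k S g ==> Ck_on k S (%x. f x * g x)"
proof (induction k arbitrary: f g)
 case 0
 then show ?case by (auto intro: continuous_intros)
next
 case (Suc k)
 obtain D where D: "!!x. x : S ==> (f has_derivative D x) (at x within S)" "!!v. Ck_on k S (%x. D x v)"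
  using Ck_on_SucE[OF Suc.prems(1)] by blast
 obtain E where E: "!!x. x : S ==> (g has_derivative E x) (at x within S)" "!!v. Ck_on k S (%x. E x v)"
  using Ck_on_SucE[OF Suc.prems(2)] by blast
 have "Ck_on k S f" "Ck_on k S g" by (rule Ck_on_SucD[OF Suc.prems(1)], rule Ck_on_SucD[OF Suc.prems(2)])
 then show ?case
  by (intro Ck_on_SucI[of _ _ "%x h. f x * E x h + D x h * g x"])
   (auto intro!: has_derivative_mult D E Ck_on_add Suc.IH)
qed

lemma Ck_on_power:
 fixes f :: "'a::real_normed_vector => real"
 shows "Ck_on k S f ==> Ck_on k S (%x. f x ^ n)"
 by (induction n) (auto intro: Ck_on_const Ck_on_mult)

lemma Ck_on_prod:
 fixes f :: "'i => 'a::real_normed_vector => real"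
 shows "(!!i. i : I ==> Ck_on k S (f i)) ==> Ck_on k S (%x. PROD i:I. f i x)"
 by (induction I rule: infinite_finite_induct) (auto simp: Ck_on_const Ck_on_mult)

lemma Ck_on_inverse:
 fixes f :: "'a::real_normed_vector => real"
 assumes nz: "!!x. x : S ==> f x ~= 0"
 shows "Ck_on k S f ==> Ck_on k S (%x. inverse (f x))"
proof (induction k)
 case 0
 then show ?case using nz by (auto intro: continuous_intros)
next
 case (Suc k)
 obtain D where D: "!!x. x : S ==> (f has_derivative D x) (at x within S)" "!!v. Ck_on k S (%x. D x v)"
  using Ck_on_SucE[OF Suc.prems] by blast
 have "Ck_on k S (%x. inverse (f x))" by (rule Suc.IH[OF Ck_on_SucD[OF Suc.prems]])
 then show ?case
  by (intro Ck_on_SucI[of _ _ "%x h. - (inverse (f x) * D x h * inverse (f x))"])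
   (auto intro!: Deriv.has_derivative_inverse nz D Ck_on_minus Ck_on_mult)
qed

lemma Ck_on_divide:
 fixes f g :: "'a::real_normed_vector => real"
 shows "Ck_on k S f ==> Ck_on k S g ==> (!!x. x : S ==> g x ~= 0) ==> Ck_on k S (%x. f x / g x)"
 unfolding divide_inverse by (intro Ck_on_mult Ck_on_inverse)

lemma Ck_on_exp:
 fixes f :: "'a::real_normed_vector => real"
 shows "Ck_on k S f ==> Ck_on k S (%x. exp (f x))"
proof (induction k)
 case 0
 then show ?case by (auto intro: continuous_intros)
next
 case (Suc k)
 obtain D where D: "!!x. x : S ==> (f has_derivative D x) (at x within S)" "!!v. Ck_on k S (%x. D x v)"
  using Ck_on_SucE[OF Suc.prems] by blast
 have "Ck_on k S (%x. exp (f x))" by (rule Suc.IH[OF Ck_on_SucD[OF Suc.prems]])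
 then show ?case
  by (intro Ck_on_SucI[of _ _ "%x h. exp (f x) * D x h"])
   (auto intro!: derivative_eq_intros D Ck_on_mult)
qed

lemma Ck_on_ln:
 fixes f :: "'a::real_normed_vector => real"
 assumes pos: "!!x. x : S ==> f x > 0" and f: "Ck_on k S f"
 shows "Ck_on k S (%x. ln (f x))"
proof (cases k)
 case 0
 then show ?thesis using pos f by (force intro: continuous_intros)
next
 case (Suc l)
 obtain D where D: "!!x. x : S ==> (f has_derivative D x) (at x within S)" "!!v. Ck_on l S (%x. D x v)"
  using Ck_on_SucE[OF f[unfolded Suc]] by blast
 have "Ck_on l S f" using Ck_on_SucD f[unfolded Suc] by blast
 then have *: "Ck_on l S (%x. D x h * inverse (f x))" for h
  using D pos by (intro Ck_on_mult Ck_on_inverse) (auto dest!: pos)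
 have "((%x. ln (f x)) has_derivative (%h. D x h * inverse (f x))) (at x within S)" if "x : S" for x
  using has_derivative_ln[OF pos[OF that] D(1)[OF that]] .
 then show ?thesis unfolding Suc
  by (intro Ck_on_SucI[of _ _ "%x h. D x h * inverse (f x)"]) (auto intro: *)
qed

lemma Ck_on_sqrt:
 fixes f :: "'a::real_normed_vector => real"
 assumes pos: "!!x. x : S ==> f x > 0"
 shows "Ck_on k S f ==> Ck_on k S (%x. sqrt (f x))"
proof -
 assume "Ck_on k S f"
 then have "Ck_on k S (%x. exp (1/2 * ln (f x)))"
  by (intro Ck_on_exp Ck_on_mult Ck_on_const Ck_on_ln pos)
 moreover have "exp (1/2 * ln (f x)) = sqrt (f x)" if "x : S" for x
  using pos[OF that] by (simp add: powr_half_sqrt[symmetric] powr_def)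
 ultimately show ?thesis by (rule Ck_on_cong)
qed

text \<open>Source of the differentiable bump functions: a truncated power vanishes to high order at
  the edge of its support, so its smoothness is governed by the exponent alone. Only the origin
  needs an argument, and there the difference quotient is itself a truncated power.\<close>

lemma DERIV_max_zero_power: "((%y::real. max 0 y ^ Suc (Suc m)) has_real_derivative real (Suc (Suc m)) * max 0 y ^ Suc m) (at y)"
proof -
 consider "y < 0" | "y = 0" | "y > 0" by linarith
 then show ?thesis
 proof cases
  case 1
  have "((%y::real. 0) has_real_derivative real (Suc (Suc m)) * max 0 y ^ Suc m) (at y)" using 1 by auto
  then show ?thesis
   by (rule has_field_derivative_transform_within_open[of _ _ _ "{..<0}"]) (use 1 in auto)
 next
  case 3
  have "((%y::real. y ^ Suc (Suc m)) has_real_derivative real (Suc (Suc m)) * max 0 y ^ Suc m) (at y)"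
   using 3 DERIV_pow[of "Suc (Suc m)" y] by (auto simp: max_def)
  then show ?thesis
   by (rule has_field_derivative_transform_within_open[of _ _ _ "{0<..}"]) (use 3 in auto)
 next
  case 2
  have "((%h::real. max 0 h * max 0 h ^ m) \<longlongrightarrow> 0) (at 0)"
   by (auto intro!: tendsto_eq_intros)
  then have "((%h::real. (max 0 h ^ Suc (Suc m)) / h) \<longlongrightarrow> 0) (at 0)"
   by (rule Lim_transform_eventually) (auto intro!: always_eventually simp: eventually_at_filter max_def field_simps)
  then show ?thesis using 2 by (simp add: has_field_derivative_iff)
 qed
qed

text \<open>For an affine inner map the derivative in direction \<open>v\<close> is the outer
  derivative in the fixed direction \<open>A v\<close>, so the induction closes without a chain rule
  for general inner maps. It serves to freeze the time or the point of a space-time function, or to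
  regard a function on space as constant in time.\<close>

lemma Ck_on_affine:
 assumes A: "bounded_linear A"
 shows "Ck_on k S f ==> (!!x. x : T ==> A x + b : S) ==> Ck_on k T (%x. f (A x + b))"
proof (induction k arbitrary: f)
 case 0
 then show ?case
  by (auto intro!: continuous_on_compose2[of S f] continuous_on_add continuous_on_const linear_continuous_on[OF A])
next
 case (Suc k)
 obtain D where D: "!!x. x : S ==> (f has_derivative D x) (at x within S)" "!!v. Ck_on k S (%x. D x v)"
  using Ck_on_SucE[OF Suc.prems(1)] by blast
 have "((%x. f (A x + b)) has_derivative (%v. D (A x + b) (A v))) (at x within T)" if "x : T" for x
 proof (rule has_derivative_in_compose2[of S f D "%x. A x + b" T])
  show "((%x. A x + b) has_derivative A) (at x within T)"
   using A by (auto intro!: derivative_eq_intros bounded_linear.has_derivative[OF A])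
 qed (use D Suc that in auto)
 then show ?case
  by (intro Ck_on_SucI[of _ _ "%x v. D (A x + b) (A v)"]) (auto intro: Suc.IH D Suc.prems(2))
qed

lemmas Ck_on_intros = Ck_on_const Ck_on_add Ck_on_sum Ck_on_minus Ck_on_diff Ck_on_mult
 Ck_on_power Ck_on_prod Ck_on_exp

lemma Ck_on_det:
 fixes M :: "'a::real_normed_vector => real^'n^'n"
 assumes "!!i j. Ck_on k S (%x. M x $ i $ j)"
 shows "Ck_on k S (%x. det (M x))"
 unfolding det_def by (intro Ck_on_intros assms)

lemma
 fixes M :: "real^'n^'n"
 assumes "det M ~= 0"
 shows matrix_inv_right: "M ** matrix_inv M = mat 1" and matrix_inv_left: "matrix_inv M ** M = mat 1"
proof -
 have "EX B. M ** B = mat 1 & B ** M = mat 1"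
  using assms by (simp add: invertible_det_nz[symmetric] invertible_def)
 then show "M ** matrix_inv M = mat 1" "matrix_inv M ** M = mat 1"
  unfolding matrix_inv_def by (metis (mono_tags, lifting) someI_ex)+
qed

text \<open>Cramer's rule makes the entries of the inverse quotients of polynomials in the entries
  of \<open>M\<close>, from which their smoothness is immediate.\<close>

lemma matrix_inv_cramer:
 fixes M :: "real^'n^'n"
 assumes "det M ~= 0"
 shows "matrix_inv M $ k $ j = det (\<chi> i l. if l = k then (axis j 1) $ i else M $ i $ l) / det M"
proof -
 have inv: "M ** matrix_inv M = mat 1"
  using assms by (simp add: invertible_det_nz matrix_inv_right)
 have "M *v (matrix_inv M *v axis j 1) = axis j 1"
  by (simp add: matrix_vector_mul_assoc inv)
 then have "(matrix_inv M *v axis j 1) = (\<chi> k. det (\<chi> i l. if l = k then (axis j 1) $ i else M $ i $ l) / det M)"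
  using cramer[OF assms] by blast
 moreover have "(matrix_inv M *v axis j 1) $ k = matrix_inv M $ k $ j"
  by (simp add: matrix_vector_mult_def axis_def if_distrib cong: if_cong)
 ultimately show ?thesis by simp
qed

lemma Ck_on_matrix_inv:
 fixes M :: "'a::real_normed_vector => real^'n^'n"
 assumes M: "!!i j. Ck_on k S (%x. M x $ i $ j)" and nz: "!!x. x : S ==> det (M x) ~= 0"
 shows "Ck_on k S (%x. matrix_inv (M x) $ i $ j)"
proof -
 have "Ck_on k S (%x. det (\<chi> i' l. if l = i then (axis j 1) $ i' else M x $ i' $ l) / det (M x))"
 proof (intro Ck_on_divide Ck_on_det nz M)
  fix a b
  show "Ck_on k S (%x. (\<chi> i' l. if l = i then (axis j 1) $ i' else M x $ i' $ l) $ a $ b)"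
   by (cases "b = i") (auto intro: M Ck_on_const)
 qed
 then show ?thesis by (rule Ck_on_cong) (simp add: matrix_inv_cramer nz)
qed

text \<open>Jacobi's formula. The product rule replaces one row i at a time by its derivative. That
  row is the combination of the rows of \<open>M x\<close> with coefficients \<open>?c\<close>, and
  by multilinearity only coefficient i survives in the determinant.\<close>

lemma det_has_derivative:
 fixes M :: "'a::real_normed_vector => real^'n^'n"
 assumes M: "!!i j. ((%y. M y $ i $ j) has_derivative M' i j) (at x within S)"
  and nz: "det (M x) ~= 0"
 shows "((%y. det (M y)) has_derivative
  (%h. det (M x) * (SU i j. matrix_inv (M x) $ j $ i * M' i j h))) (at x within S)"
proof -
 let ?R = "%i h. (\<chi> k l. if k = i then M' i l h else M x $ k $ l) :: real^'n^'n"
 have row: "det (?R i h) = det (M x) * (SU j. matrix_inv (M x) $ j $ i * M' i j h)" for i h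
 proof -
  let ?r = "(\<chi> l. M' i l h) :: real^'n"
  let ?c = "?r v* matrix_inv (M x)"
  have "?c v* M x = ?r"
   by (simp add: vector_matrix_mul_assoc matrix_inv_left nz invertible_det_nz)
  then have "(SU k. ?c $ k *s row k (M x)) = ?r"
   by (simp add: vector_matrix_mult_def vec_eq_iff row_def mult.commute)
  then have "?R i h = (\<chi> k. if k = i then (SU k. ?c $ k *s row k (M x)) else row k (M x))"
   by (simp add: vec_eq_iff row_def)
  then have "det (?R i h) = ?c $ i * det (M x)"
   by (simp only: cramer_lemma_transpose)
  then show ?thesis by (simp add: vector_matrix_mult_def mult.commute)
 qed
 have "((%y. det (M y)) has_derivative (%h. \<Sum>p | p permutes UNIV. of_int (sign p) *
   (SU i. M' i (p i) h * (PROD k:UNIV - {i}. M x $ k $ p k)))) (at x within S)"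
  unfolding det_def
  by (intro has_derivative_sum has_derivative_mult_right has_derivative_prod M)
 moreover have "(\<Sum>p | p permutes UNIV. of_int (sign p) *
   (SU i. M' i (p i) h * (PROD k:UNIV - {i}. M x $ k $ p k))) = (SU i. det (?R i h))" for h
 proof -
  have "(PROD k:UNIV. ?R i h $ k $ p k) = M' i (p i) h * (PROD k:UNIV - {i}. M x $ k $ p k)" for i p
  proof -
   have "(PROD k:UNIV. ?R i h $ k $ p k) = ?R i h $ i $ p i * (PROD k:UNIV - {i}. ?R i h $ k $ p k)"
    by (rule prod.remove) auto
   also have "(PROD k:UNIV - {i}. ?R i h $ k $ p k) = (PROD k:UNIV - {i}. M x $ k $ p k)"
    by (rule prod.cong) auto
   finally show ?thesis by simp
  qed
  then show ?thesis unfolding det_def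
   by (subst sum.swap) (simp add: sum_distrib_left)
 qed
 ultimately show ?thesis by (simp add: row sum_distrib_left)
qed

text \<open>The exponent exceeds the smoothness class by one: each differentiation costs one power,
  and what is left at the end must still be the continuous first power.\<close>

lemma Ck_on_max_zero_power:
 fixes f :: "'a::real_normed_vector => real"
 shows "Ck_on k S f ==> Ck_on k S (%x. max 0 (f x) ^ Suc k)"
proof (induction k)
 case 0
 then show ?case by (auto intro!: continuous_intros)
next
 case (Suc k)
 obtain D where D: "!!x. x : S ==> (f has_derivative D x) (at x within S)" "!!v. Ck_on k S (%x. D x v)"
  using Ck_on_SucE[OF Suc.prems] by blast
 have "((%x. max 0 (f x) ^ Suc (Suc k)) has_derivative
   (%h. D x h * (real (Suc (Suc k)) * max 0 (f x) ^ Suc k))) (at x within S)" if "x : S" for x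
  by (rule DERIV_compose_FDERIV[OF DERIV_max_zero_power D(1)[OF that]])
 moreover have "Ck_on k S (%x. max 0 (f x) ^ Suc k)" by (rule Suc.IH[OF Ck_on_SucD[OF Suc.prems]])
 ultimately show ?case
  by (intro Ck_on_SucI[of _ _ "%x h. D x h * (real (Suc (Suc k)) * max 0 (f x) ^ Suc k)"])
   (auto intro!: Ck_on_mult Ck_on_const D simp del: power_Suc)
qed

subsection \<open>Symmetry of second derivatives\<close>

lemma DERIV_along_line:
 fixes F :: "'a::real_normed_vector => real"
 assumes "(F has_derivative D) (at (p + s *\<^sub>R a))"
 shows "((%s. F (p + s *\<^sub>R a)) has_real_derivative D a) (at s)"
proof -
 have "((%s. p + s *\<^sub>R a) has_derivative (%h. h *\<^sub>R a)) (at s)"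
  by (auto intro!: derivative_eq_intros)
 from diff_chain_at[OF this assms]
 have "((%s. F (p + s *\<^sub>R a)) has_derivative (%h. D (h *\<^sub>R a))) (at s)"
  by (simp add: o_def)
 moreover have "D (h *\<^sub>R a) = D a * h" for h
  using linear_cmul[OF has_derivative_linear[OF assms], of h a] by simp
 ultimately show ?thesis by (simp add: has_field_derivative_def)
qed

lemma DERIV_cong_on:
 assumes "t : S" "!!s. s : S ==> F s = G s" "(G has_real_derivative d) (at t within S)"
 shows "(F has_real_derivative d) (at t within S)"
 using has_derivative_transform[of t S F G] assms unfolding has_field_derivative_def by blast

text \<open>The variable \<open>s\<close> will be time, so its derivatives are one-sided at
  \<open>a\<close> and \<open>b\<close>. Integrating \<open>F1\<close> in \<open>s\<close>,
  differentiating under the integral in \<open>y\<close> and applying the fundamental theorem in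
  \<open>s\<close> works up to these end points. The same lemma gives the symmetry of second spatial
  derivatives.\<close>

lemma mixed_derivative:
 fixes F F1 F2 F12 :: "real => real => real"
 assumes J: "open J" "convex J"
  and F1: "!!s y. s : {a..b} ==> y : J ==> ((%s. F s y) has_real_derivative F1 s y) (at s within {a..b})"
  and F2: "!!s y. s : {a..b} ==> y : J ==> (F s has_real_derivative F2 s y) (at y)"
  and F12: "!!s y. s : {a..b} ==> y : J ==> (F1 s has_real_derivative F12 s y) (at y)"
  and cont: "continuous_on (J \<times> {a..b}) (%q. F12 (snd q) (fst q))" and s: "s : {a..b}" and y: "y : J"
 shows "((%s. F2 s y) has_real_derivative F12 s y) (at s within {a..b})"
proof -
 have eq: "F2 s y = F2 a y + integral {a..s} (%r. F12 r y)" if s: "s : {a..b}" for s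
 proof -
  have sub: "{a..s} \<subseteq> {a..b}" and a: "a : {a..b}" using s by auto
  have I: "((%r. F1 r y) has_integral F s y - F a y) {a..s}" if "y : J" for y
   using s that by (intro fundamental_theorem_of_calculus)
    (auto simp: has_real_derivative_iff_has_vector_derivative[symmetric] intro: DERIV_subset[OF F1 sub])
  have "((%y. integral (cbox a s) (%r. F1 r y)) has_real_derivative integral (cbox a s) (%r. F12 r y)) (at y within J)"
   using I s by (intro leibniz_rule_field_derivative y J has_field_derivative_at_within[OF F12])
    (auto simp: case_prod_unfold intro: continuous_on_subset[OF cont])
  then have "((%y. F a y + integral {a..s} (%r. F1 r y)) has_real_derivative F2 a y + integral {a..s} (%r. F12 r y)) (at y)"
   unfolding at_within_open[OF y J(1)] by (intro DERIV_add F2 a y) simp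
  then have "(F s has_real_derivative F2 a y + integral {a..s} (%r. F12 r y)) (at y)"
   by (rule has_field_derivative_transform_within_open[OF _ J(1) y]) (use integral_unique[OF I] in simp)
  then show ?thesis using DERIV_unique F2[OF s y] by blast
 qed
 have "continuous_on {a..b} (%r. F12 r y)"
  using continuous_on_compose2[OF cont continuous_on_Pair[OF continuous_on_const continuous_on_id]] y by auto
 from DERIV_add[OF DERIV_const integral_has_real_derivative[OF this s]]
 have "((%s. F2 a y + integral {a..s} (%r. F12 r y)) has_real_derivative F12 s y) (at s within {a..b})" by simp
 then show ?thesis
  by (rule DERIV_cong_on[OF s, rotated]) (rule eq)
qed

subsection \<open>Partial derivatives\<close>

lemma pderiv_coord_eq: "(F has_derivative D) (at x) ==> pderiv_coord i F x = D (axis i 1)"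
 unfolding pderiv_coord_def using frechet_derivative_at by metis

lemma Ck_on_open_has_derivative:
 assumes "open U" "Ck_on (Suc k) U F" "x : U"
 shows "EX D. (F has_derivative D) (at x)"
 using Ck_on_SucE[OF assms(2)] assms(1,3) at_within_open by metis

lemma has_derivative_pderiv:
 fixes F :: "real^'n => real"
 assumes "open U" "Ck_on (Suc k) U F" "x : U"
 shows "(F has_derivative (%h. SU i. h $ i * pderiv_coord i F x)) (at x)"
proof -
 obtain D where D: "(F has_derivative D) (at x)" using Ck_on_open_has_derivative[OF assms] ..
 have "D h = (SU i. h $ i * pderiv_coord i F x)" for h
 proof -
  have "D h = D (SU i. h $ i *s axis i 1)" by (simp only: basis_expansion)
  also have "... = (SU i. h $ i * D (axis i 1))"
   by (simp add: linear_sum[OF has_derivative_linear[OF D]] scalar_mult_eq_scaleR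
     linear_cmul[OF has_derivative_linear[OF D]])
  finally show ?thesis using pderiv_coord_eq[OF D] by simp
 qed
 then show ?thesis using D by presburger
qed

lemma Ck_on_pderiv:
 assumes "open U" "Ck_on (Suc k) U F"
 shows "Ck_on k U (pderiv_coord i F)"
proof -
 obtain D where D: "!!x. x : U ==> (F has_derivative D x) (at x within U)" "!!h. Ck_on k U (%x. D x h)"
  using Ck_on_SucE[OF assms(2)] by blast
 have "D x (axis i 1) = pderiv_coord i F x" if "x : U" for x
  using pderiv_coord_eq[of F "D x" x i] D(1)[OF that] assms(1) that at_within_open by metis
 then show ?thesis by (rule Ck_on_cong[OF D(2)])
qed

lemma pderiv_cong:
 assumes "open U" "x : U" "!!y. y : U ==> F y = G y"
 shows "pderiv_coord i F x = pderiv_coord i G x"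
proof -
 have "(F has_derivative D) (at x) \<longleftrightarrow> (G has_derivative D) (at x)" for D
  using has_derivative_transform_within_open[of F D x UNIV U G]
   has_derivative_transform_within_open[of G D x UNIV U F] assms by auto
 then show ?thesis unfolding pderiv_coord_def frechet_derivative_def by simp
qed

lemma pderiv_const [simp]: "pderiv_coord i (%x. c) x = 0"
 by (rule pderiv_coord_eq[of _ "%h. 0"]) (rule has_derivative_const)

lemma pderiv_compose:
 assumes F: "F differentiable (at x)" and p: "(p has_real_derivative p') (at (F x))"
 shows "pderiv_coord i (%y. p (F y)) x = p' * pderiv_coord i F x"
proof -
 have D: "(F has_derivative frechet_derivative F (at x)) (at x)" using F frechet_derivative_works by blast
 show ?thesis
  using pderiv_coord_eq[OF DERIV_compose_FDERIV[OF p D]] by (simp add: pderiv_coord_def mult.commute)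
qed

lemma pderiv_add:
 assumes "F differentiable (at x)" "G differentiable (at x)"
 shows "pderiv_coord i (%y. F y + G y) x = pderiv_coord i F x + pderiv_coord i G x"
proof -
 have "(F has_derivative frechet_derivative F (at x)) (at x)" "(G has_derivative frechet_derivative G (at x)) (at x)"
  using assms frechet_derivative_works by blast+
 from pderiv_coord_eq[OF has_derivative_add[OF this]] show ?thesis by (simp add: pderiv_coord_def)
qed

lemma pderiv_mult:
 assumes "F differentiable (at x)" "G differentiable (at x)"
 shows "pderiv_coord i (%y. F y * G y) x = F x * pderiv_coord i G x + pderiv_coord i F x * G x"
proof -
 have "(F has_derivative frechet_derivative F (at x)) (at x)" "(G has_derivative frechet_derivative G (at x)) (at x)"
  using assms frechet_derivative_works by blast+
 from pderiv_coord_eq[OF has_derivative_mult[OF this]] show ?thesis by (simp add: pderiv_coord_def)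
qed

lemma pderiv_cmult:
 assumes "F differentiable (at x)"
 shows "pderiv_coord i (%y. c * F y) x = c * pderiv_coord i F x"
 using pderiv_mult[OF differentiable_const assms, of i c] by simp

lemma pderiv_minus:
 assumes "F differentiable (at x)"
 shows "pderiv_coord i (%y. - F y) x = - pderiv_coord i F x"
 using pderiv_cmult[OF assms, of i "-1"] by simp

lemma pderiv_diff:
 assumes "F differentiable (at x)" "G differentiable (at x)"
 shows "pderiv_coord i (%y. F y - G y) x = pderiv_coord i F x - pderiv_coord i G x"
 using pderiv_add[OF assms(1) differentiable_minus[OF assms(2)], of i] pderiv_minus[OF assms(2), of i] by simp

lemma pderiv_sum:
 assumes "finite I" "!!k. k : I ==> F k differentiable (at x)"
 shows "pderiv_coord i (%y. SUM k:I. F k y) x = (SUM k:I. pderiv_coord i (F k) x)"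
 using assms
proof (induction I rule: finite_induct)
 case (insert k I)
 then show ?case by (simp add: pderiv_add differentiable_sum)
qed simp

lemma Ck_on_open_differentiable:
 "open U ==> Ck_on (Suc k) U F ==> x : U ==> F differentiable (at x)"
 using Ck_on_open_has_derivative unfolding differentiable_def by blast

lemma pderiv_along_line:
 fixes F :: "real^'n => real"
 assumes "open U" "Ck_on (Suc k) U F" "p + y *\<^sub>R axis i 1 : U"
 shows "((%y. F (p + y *\<^sub>R axis i 1)) has_real_derivative pderiv_coord i F (p + y *\<^sub>R axis i 1)) (at y)"
proof -
 obtain D where D: "(F has_derivative D) (at (p + y *\<^sub>R axis i 1))" using Ck_on_open_has_derivative[OF assms] ..
 show ?thesis using DERIV_along_line[OF D] pderiv_coord_eq[OF D] by simp
qed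

lemma pderiv_commute:
 fixes F :: "real^'n => real"
 assumes U: "open U" "x : U" and F: "Ck_on 2 U F"
 shows "pderiv_coord i (pderiv_coord j F) x = pderiv_coord j (pderiv_coord i F) x"
proof -
 have F2: "Ck_on (Suc (Suc 0)) U F" using F by (simp add: numeral_2_eq_2)
 note PD = Ck_on_pderiv[OF U(1) F2]
 obtain r where r: "r > 0" "ball x r \<subseteq> U" using U openE by blast
 let ?e = "axis i 1 :: real^'n" and ?f = "axis j 1 :: real^'n" and ?p = "%s y. x + s *\<^sub>R axis j 1 + y *\<^sub>R axis i 1"
 have in_U: "?p s y : U" if "s : {-r/3..r/3}" "y : {-r/2<..<r/2}" for s y
 proof -
  have "norm (s *\<^sub>R ?f + y *\<^sub>R ?e) <= \<bar>s\<bar> + \<bar>y\<bar>" using norm_triangle_ineq[of "s *\<^sub>R ?f" "y *\<^sub>R ?e"] by simp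
  also have "... < r" using that r(1) by (auto simp: abs_if)
  finally have "norm (s *\<^sub>R ?f + y *\<^sub>R ?e) < r" .
  moreover have "dist x (x + v) = norm v" for v by (simp add: dist_norm)
  ultimately have "dist x (x + (s *\<^sub>R ?f + y *\<^sub>R ?e)) < r" by (simp only:)
  then show ?thesis using subsetD[OF r(2)] by (simp add: add.assoc)
 qed
 have sw: "?p s y = x + y *\<^sub>R ?e + s *\<^sub>R ?f" for s y by (simp add: algebra_simps)
 have "((%s. pderiv_coord i F (?p s 0)) has_real_derivative pderiv_coord i (pderiv_coord j F) (?p 0 0)) (at 0 within {-r/3..r/3})"
 proof (rule mixed_derivative[of "{-r/2<..<r/2}" _ _ "%s y. F (?p s y)" "%s y. pderiv_coord j F (?p s y)"
    "%s y. pderiv_coord i F (?p s y)" "%s y. pderiv_coord i (pderiv_coord j F) (?p s y)"])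
  show "((%s. F (?p s y)) has_real_derivative pderiv_coord j F (?p s y)) (at s within {-r/3..r/3})"
   if "s : {-r/3..r/3}" "y : {-r/2<..<r/2}" for s y
   using in_U[OF that] unfolding sw by (rule has_field_derivative_at_within[OF pderiv_along_line[OF U(1) F2]])
  show "((%y. F (?p s y)) has_real_derivative pderiv_coord i F (?p s y)) (at y)"
   "((%y. pderiv_coord j F (?p s y)) has_real_derivative pderiv_coord i (pderiv_coord j F) (?p s y)) (at y)"
   if "s : {-r/3..r/3}" "y : {-r/2<..<r/2}" for s y
   by (rule pderiv_along_line[OF U(1) F2 in_U[OF that]] pderiv_along_line[OF U(1) PD in_U[OF that]])+
  show "continuous_on ({-r/2<..<r/2} \<times> {-r/3..r/3}) (%q. pderiv_coord i (pderiv_coord j F) (?p (snd q) (fst q)))"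
   by (rule continuous_on_compose2[OF Ck_on_imp_continuous_on[OF Ck_on_pderiv[OF U(1) PD]]])
    (use in_U in \<open>auto intro!: continuous_intros\<close>)
 qed (use r(1) in auto)
 moreover have "at 0 within {-r/3..r/3} = at (0::real)" using r(1) by (intro at_within_interior) simp
 moreover have "((%s. pderiv_coord i F (?p s 0)) has_real_derivative pderiv_coord j (pderiv_coord i F) (?p 0 0)) (at 0)"
  using pderiv_along_line[OF U(1) PD, of x 0 j i] U(2) by simp
 ultimately show ?thesis using DERIV_unique by fastforce
qed

subsection \<open>Functions on space-time\<close>

text \<open>Metric and potential are smooth on the closed interval, heat solutions only for positive
  times. At a point of either interval the derivative within it is the derivative within
  \<open>{0..T}\<close>, so one set of lemmas serves both.\<close>

definition time_interval :: "real => real set => bool" where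
 "time_interval T I \<longleftrightarrow> 0 < T & (I = {0..T} | I = {0<..T})"

lemma at_within_time_interval:
 assumes "time_interval T I" "t : I"
 shows "at t within I = at t within {0..T}"
proof (cases "I = {0..T}")
 case False
 then have "I = {0<..T}" "0 < t" using assms by (auto simp: time_interval_def)
 then show ?thesis by (intro at_within_nhd[of t "{0<..}"]) auto
qed simp

lemma time_interval_subset: "time_interval T I ==> I \<subseteq> {0..T}"
 by (auto simp: time_interval_def)

lemma time_deriv_eq:
 fixes F :: "real => 'b::euclidean_space"
 assumes "0 < T" "t : {0..T}" "(F has_vector_derivative d) (at t within {0..T})"
 shows "time_deriv T F t = d"
 unfolding time_deriv_def by (rule vector_derivative_within_closed_interval[OF assms])

lemma spacetime_derivatives:
 fixes f :: "real => real^'n => 'b::euclidean_space"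
 assumes I: "time_interval T I" and U: "open U" and f: "Ck_on (Suc k) (I \<times> U) (%(t, x). f t x)"
 obtains D :: "real \<times> (real^'n) => real \<times> (real^'n) => 'b" where "!!t x. t : I ==> x : U ==> (f t has_derivative (%v. D (t, x) (0, v))) (at x)"
  "!!h. Ck_on k (I \<times> U) (%p. D p h)"
  "!!t x. t : I ==> x : U ==> ((%s. f s x) has_vector_derivative D (t, x) (1, 0)) (at t within {0..T})"
  "!!t x. t : I ==> x : U ==> time_deriv T (%s. f s x) t = D (t, x) (1, 0)"
proof -
 obtain D where D: "!!p. p : I \<times> U ==> ((%(t, x). f t x) has_derivative D p) (at p within I \<times> U)"
  "!!h. Ck_on k (I \<times> U) (%p. D p h)"
  using Ck_on_SucE[OF f] by blast
 have 1: "(f t has_derivative (%v. D (t, x) (0, v))) (at x)" if "t : I" "x : U" for t x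
 proof -
  have "((%y. case (t, y) of (t, x) => f t x) has_derivative (%v. D (t, x) (0, v))) (at x within U)"
   by (rule has_derivative_in_compose2[of "I \<times> U" _ D "%y. (t, y)"])
    (use that D in \<open>auto intro!: derivative_eq_intros\<close>)
  then show ?thesis using at_within_open[OF that(2) U] by simp
 qed
 have 2: "((%s. f s x) has_vector_derivative D (t, x) (1, 0)) (at t within {0..T})" if "t : I" "x : U" for t x
 proof -
  have "((%s. case (s, x) of (t, x) => f t x) has_derivative (%v. D (t, x) (v, 0))) (at t within I)"
   by (rule has_derivative_in_compose2[of "I \<times> U" _ D "%s. (s, x)"])
    (use that D in \<open>auto intro!: derivative_eq_intros\<close>)
  note der = this
  have "linear (D (t, x))" by (rule has_derivative_linear[OF D(1)]) (use that in auto)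
  then have "D (t, x) (v, 0) = v *\<^sub>R D (t, x) (1, 0)" for v
   using linear_cmul[of "D (t, x)" v "(1, 0)"] by simp
  then have "(%v. D (t, x) (v, 0)) = (%v. v *\<^sub>R D (t, x) (1, 0))" by (rule ext)
  from der[unfolded this] show ?thesis
   unfolding has_vector_derivative_def at_within_time_interval[OF I that(1)] by (simp only: split_conv)
 qed
 show ?thesis
 proof (rule that[of D])
  show "time_deriv T (%s. f s x) t = D (t, x) (1, 0)" if "t : I" "x : U" for t x
   using time_deriv_eq[OF _ _ 2[OF that]] I that time_interval_subset[OF I] by (auto simp: time_interval_def)
 qed (fact 1, fact D(2), fact 2)
qed

lemma Ck_on_spacetime_slice:
 assumes "Ck_on k (I \<times> U) (%(t, x). f t x)" "t : I"
 shows "Ck_on k U (f t)"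
proof -
 have "bounded_linear (%x::'b. (0::'a, x))" by (intro bounded_linear_Pair bounded_linear_zero bounded_linear_ident)
 from Ck_on_affine[OF this assms(1), of U "(t, 0)"] show ?thesis using assms(2) by simp
qed

lemma Ck_on_spacetime_pderiv:
 fixes f :: "real => real^'n => real"
 assumes I: "time_interval T I" and U: "open U" and f: "Ck_on (Suc k) (I \<times> U) (%(t, x). f t x)"
 shows "Ck_on k (I \<times> U) (%(t, x). pderiv_coord i (f t) x)"
proof -
 obtain D :: "real \<times> (real^'n) => real \<times> (real^'n) => real" where D: "!!t x. t : I ==> x : U ==> (f t has_derivative (%v. D (t, x) (0, v))) (at x)"
  "!!h. Ck_on k (I \<times> U) (%p. D p h)"
  "!!t x. t : I ==> x : U ==> ((%s. f s x) has_vector_derivative D (t, x) (1, 0)) (at t within {0..T})"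
  "!!t x. t : I ==> x : U ==> time_deriv T (%s. f s x) t = D (t, x) (1, 0)"
  by (rule spacetime_derivatives[OF I U f], rule that)
 show ?thesis
 proof (rule Ck_on_cong[OF D(2)[of "(0, axis i 1)"]])
  show "D p (0, axis i 1) = (case p of (t, x) => pderiv_coord i (f t) x)" if "p : I \<times> U" for p
   using pderiv_coord_eq[OF D(1)[of "fst p" "snd p"], of i] that by (cases p) simp
 qed
qed

lemma
 fixes f :: "real => real^'n => 'b::euclidean_space"
 assumes I: "time_interval T I" and U: "open U" and f: "Ck_on (Suc k) (I \<times> U) (%(t, x). f t x)"
 shows Ck_on_spacetime_time_deriv: "Ck_on k (I \<times> U) (%(t, x). time_deriv T (%s. f s x) t)"
  and has_time_deriv: "t : I ==> x : U ==>
   ((%s. f s x) has_vector_derivative time_deriv T (%s. f s x) t) (at t within {0..T})"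
proof -
 obtain D :: "real \<times> (real^'n) => real \<times> (real^'n) => 'b" where "!!t x. t : I ==> x : U ==> (f t has_derivative (%v. D (t, x) (0, v))) (at x)"
  and D: "!!h. Ck_on k (I \<times> U) (%p. D p h)"
  "!!t x. t : I ==> x : U ==> ((%s. f s x) has_vector_derivative D (t, x) (1, 0)) (at t within {0..T})"
  "!!t x. t : I ==> x : U ==> time_deriv T (%s. f s x) t = D (t, x) (1, 0)"
  by (rule spacetime_derivatives[OF I U f], rule that)
 show "Ck_on k (I \<times> U) (%(t, x). time_deriv T (%s. f s x) t)"
  by (rule Ck_on_cong[OF D(1)[of "(1, 0)"]]) (auto simp: D(3))
 show "((%s. f s x) has_vector_derivative time_deriv T (%s. f s x) t) (at t within {0..T})" if "t : I" "x : U"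
  using D(2,3)[OF that] by simp
qed

lemma time_deriv_pderiv_commute:
 fixes f :: "real => real^'n => real"
 assumes I: "time_interval T I" and U: "open U" and f: "Ck_on 2 (I \<times> U) (%(t, x). f t x)"
  and t: "t : I" and x: "x : U"
 shows "time_deriv T (%s. pderiv_coord i (f s) x) t = pderiv_coord i (%y. time_deriv T (%s. f s y) t) x"
proof -
 have f2: "Ck_on (Suc (Suc 0)) (I \<times> U) (%(t, x). f t x)" using f by (simp add: numeral_2_eq_2)
 \<comment> \<open>\<open>mixed_derivative\<close> works on a compact interval, while
   \<open>I\<close> may be open at 0. For t = 0 the interval \<open>I\<close> must be closed; for t
   > 0 the choice \<open>t / 2\<close> keeps \<open>{a..T}\<close> inside \<open>I\<close> and
   \<open>t\<close> away from the left end, so the two derivatives within agree.\<close>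
 define a where "a = (if t = 0 then 0 else t / 2)"
 have a: "0 <= a" "a <= t" "t <= T" "{a..T} \<subseteq> I" using t I by (auto simp: a_def time_interval_def)
 have at: "at t within {a..T} = at t within {0..T}"
 proof (cases "t = 0")
  case False
  then show ?thesis using a(1,2) by (intro at_within_nhd[of t "{a<..}"]) (auto simp: a_def)
 qed (simp add: a_def)
 obtain r where r: "r > 0" "ball x r \<subseteq> U" using U x openE by blast
 let ?p = "%y. x + y *\<^sub>R axis i 1"
 have p: "?p y : U" if "y : {-r<..<r}" for y using that r(2) by (auto simp: dist_norm)
 note dt = Ck_on_spacetime_time_deriv[OF I U f2]
 have "((%s. pderiv_coord i (f s) (?p 0)) has_real_derivative pderiv_coord i (%y. time_deriv T (%s. f s y) t) (?p 0)) (at t within {a..T})"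
 proof (rule mixed_derivative[of "{-r<..<r}" _ _ "%s y. f s (?p y)" "%s y. time_deriv T (%s. f s (?p y)) s"
    "%s y. pderiv_coord i (f s) (?p y)" "%s y. pderiv_coord i (%y. time_deriv T (%s. f s y) s) (?p y)"])
  show "((%s. f s (?p y)) has_real_derivative time_deriv T (%s. f s (?p y)) s) (at s within {a..T})"
   if "s : {a..T}" "y : {-r<..<r}" for s y
   unfolding has_real_derivative_iff_has_vector_derivative
   by (rule has_vector_derivative_within_subset[OF has_time_deriv[OF I U f2 subsetD[OF a(4) that(1)] p[OF that(2)]]]) (use a(1) in auto)
  show "((%y. f s (?p y)) has_real_derivative pderiv_coord i (f s) (?p y)) (at y)"
   "((%y. time_deriv T (%s. f s (?p y)) s) has_real_derivative pderiv_coord i (%y. time_deriv T (%s. f s y) s) (?p y)) (at y)"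
   if "s : {a..T}" "y : {-r<..<r}" for s y
   by (rule pderiv_along_line[OF U Ck_on_spacetime_slice[OF f2] p[OF that(2)]]
     pderiv_along_line[OF U Ck_on_spacetime_slice[OF dt] p[OF that(2)]], rule subsetD[OF a(4) that(1)])+
  have "continuous_on (I \<times> U) (%(t, x). pderiv_coord i (%y. time_deriv T (%s. f s y) t) x)"
   using Ck_on_spacetime_pderiv[OF I U dt] by simp
  then have "continuous_on ({-r<..<r} \<times> {a..T}) (%q. (%(t, x). pderiv_coord i (%y. time_deriv T (%s. f s y) t) x) (snd q, ?p (fst q)))"
  proof (rule continuous_on_compose2)
   show "(%q. (snd q, ?p (fst q))) ` ({-r<..<r} \<times> {a..T}) \<subseteq> I \<times> U" using p a(4) by auto
  qed (intro continuous_intros)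
  then show "continuous_on ({-r<..<r} \<times> {a..T}) (%q. pderiv_coord i (%y. time_deriv T (%s. f s y) (snd q)) (?p (fst q)))" by simp
 qed (use r(1) a in auto)
 then have "((%s. pderiv_coord i (f s) x) has_vector_derivative pderiv_coord i (%y. time_deriv T (%s. f s y) t) x) (at t within {0..T})"
  unfolding at has_real_derivative_iff_has_vector_derivative by simp
 then show ?thesis using I a by (intro time_deriv_eq) (auto simp: time_interval_def)
qed

subsection \<open>Smooth functions on a coordinate domain\<close>

lemma smooth_on_Ck: "smooth_on S f ==> Ck_on k S f"
 by (simp add: smooth_on_def)

lemma smooth_on_const: "smooth_on S (%x. c)"
 and smooth_on_minus: "smooth_on S f ==> smooth_on S (%x. - f x)"
 and smooth_on_add: "smooth_on S f ==> smooth_on S f' ==> smooth_on S (%x. f x + f' x)"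
 and smooth_on_diff: "smooth_on S f ==> smooth_on S f' ==> smooth_on S (%x. f x - f' x)"
 and smooth_on_sum: "(!!i. i : I ==> smooth_on S (F i)) ==> smooth_on S (%x. SUM i:I. F i x)"
 and smooth_on_bounded_linear_compose: "bounded_linear h ==> smooth_on S f ==> smooth_on S (%x. h (f x))"
 unfolding smooth_on_def
 by (blast intro: Ck_on_const Ck_on_minus Ck_on_add Ck_on_diff Ck_on_sum Ck_on_bounded_linear_compose)+

lemma
 fixes f f' :: "'a::real_normed_vector => real"
 shows smooth_on_mult: "smooth_on S f ==> smooth_on S f' ==> smooth_on S (%x. f x * f' x)"
 and smooth_on_divide: "smooth_on S f ==> smooth_on S f' ==> (!!x. x : S ==> f' x ~= 0) ==> smooth_on S (%x. f x / f' x)"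
 and smooth_on_exp: "smooth_on S f ==> smooth_on S (%x. exp (f x))"
 and smooth_on_ln: "smooth_on S f ==> (!!x. x : S ==> f x > 0) ==> smooth_on S (%x. ln (f x))"
 and smooth_on_sqrt: "smooth_on S f ==> (!!x. x : S ==> f x > 0) ==> smooth_on S (%x. sqrt (f x))"
 unfolding smooth_on_def
 by (blast intro: Ck_on_mult Ck_on_divide Ck_on_exp Ck_on_ln Ck_on_sqrt)+

lemma smooth_on_det:
 fixes M :: "'a::real_normed_vector => real^'n^'n"
 shows "(!!i j. smooth_on S (%x. M x $ i $ j)) ==> smooth_on S (%x. det (M x))"
 unfolding smooth_on_def by (blast intro: Ck_on_det)

lemma smooth_on_matrix_inv:
 fixes M :: "'a::real_normed_vector => real^'n^'n"
 shows "(!!i j. smooth_on S (%x. M x $ i $ j)) ==> (!!x. x : S ==> det (M x) ~= 0) ==>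
  smooth_on S (%x. matrix_inv (M x) $ i $ j)"
 unfolding smooth_on_def by (blast intro: Ck_on_matrix_inv)

lemmas smooth_on_intros = smooth_on_const smooth_on_minus smooth_on_add smooth_on_diff smooth_on_sum
 smooth_on_mult smooth_on_exp

lemma smooth_on_cong: "smooth_on S f ==> (!!x. x : S ==> f x = f' x) ==> smooth_on S f'"
 unfolding smooth_on_def using Ck_on_cong by blast

lemma smooth_on_subset: "smooth_on S f ==> S' \<subseteq> S ==> smooth_on S' f"
 unfolding smooth_on_def using Ck_on_subset by blast

lemma smooth_on_imp_continuous_on: "smooth_on S f ==> continuous_on S f"
 using smooth_on_Ck Ck_on_imp_continuous_on by blast

lemma smooth_on_pderiv: "open U ==> smooth_on U F ==> smooth_on U (pderiv_coord i F)"
 unfolding smooth_on_def using Ck_on_pderiv by blast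

lemma smooth_on_differentiable: "open U ==> smooth_on U F ==> x : U ==> F differentiable (at x)"
 unfolding smooth_on_def using Ck_on_open_differentiable by blast

lemma smooth_on_affine:
 "bounded_linear A ==> smooth_on S f ==> (!!x. x : S' ==> A x + b : S) ==> smooth_on S' (%x. f (A x + b))"
 unfolding smooth_on_def using Ck_on_affine by blast

lemma smooth_on_bounded_linear: "bounded_linear h ==> smooth_on S h"
 unfolding smooth_on_def using Ck_on_bounded_linear by blast

text \<open>Differentiability is known from Cramer's rule; only the value has to be found. In the
  identity \<open>eq\<close> the factor \<open>M y - M x\<close> vanishes at \<open>x\<close>, so
  the product rule removes the still unknown derivatives \<open>D\<close> of the inverse from the
  right side.\<close>

lemma matrix_inv_has_derivative:
 fixes M :: "'a::real_normed_vector => real^'n^'n"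
 assumes M: "!!i j. Ck_on 1 S (%x. M x $ i $ j)" and nz: "!!y. y : S ==> det (M y) ~= 0"
  and x: "x : S" and M': "!!i j. ((%y. M y $ i $ j) has_derivative M' i j) (at x within S)"
 shows "((%y. matrix_inv (M y) $ i $ j) has_derivative
  (%h. - (SU a b. matrix_inv (M x) $ i $ a * M' a b h * matrix_inv (M x) $ b $ j))) (at x within S)"
proof -
 let ?I = "%y. matrix_inv (M y)"
 have "EX D. ((%y. ?I y $ b $ j) has_derivative D) (at x within S)" for b
 proof -
  have "Ck_on (Suc 0) S (%y. ?I y $ b $ j)" using Ck_on_matrix_inv[OF M nz] by simp
  then show ?thesis by (rule Ck_on_SucE) (use x in blast)
 qed
 then obtain D where D: "!!b. ((%y. ?I y $ b $ j) has_derivative D b) (at x within S)" by metis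
 have sub: "(A - B) ** C = A ** C - B ** C" for A B C :: "real^'n^'n"
  by (simp add: matrix_matrix_mult_def vec_eq_iff left_diff_distrib sum_subtractf)
 have eq: "?I y $ i $ j = (SU a. ?I x $ i $ a * ((if a = j then 1 else 0) - (SU b. (M y $ a $ b - M x $ a $ b) * ?I y $ b $ j)))"
  if y: "y : S" for y
 proof -
  have "?I y = (?I x ** M x) ** ?I y" using matrix_inv_left[OF nz[OF x]] by simp
  also have "... = ?I x ** (mat 1 - (M y - M x) ** ?I y)"
   using matrix_inv_right[OF nz[OF y]] by (simp add: matrix_mul_assoc sub)
  finally have "?I y $ i $ j = (?I x ** (mat 1 - (M y - M x) ** ?I y)) $ i $ j" by simp
  then show ?thesis by (simp add: matrix_matrix_mult_def mat_def)
 qed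
 have "((%y. SU a. ?I x $ i $ a * ((if a = j then 1 else 0) - (SU b. (M y $ a $ b - M x $ a $ b) * ?I y $ b $ j)))
  has_derivative (%h. SU a. ?I x $ i $ a * (0 - (SU b. (M x $ a $ b - M x $ a $ b) * D b h + (M' a b h - 0) * ?I x $ b $ j))))
  (at x within S)"
  by (intro has_derivative_sum has_derivative_mult_right has_derivative_diff has_derivative_const
    has_derivative_mult M' D)
 then have "((%y. ?I y $ i $ j) has_derivative
  (%h. SU a. ?I x $ i $ a * (0 - (SU b. (M x $ a $ b - M x $ a $ b) * D b h + (M' a b h - 0) * ?I x $ b $ j))))
  (at x within S)"
  by (rule has_derivative_transform[OF x, rotated]) (rule eq)
 then show ?thesis by (simp add: sum_distrib_left mult.assoc sum_negf)
qed

lemma sum_delta_mult [simp]: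
 fixes f :: "'n::finite => real"
 shows "(SU j. (if i = j then 1 else 0) * f j) = f i" "(SU j. (if j = i then 1 else 0) * f j) = f i"
  "(SU j. f j * (if i = j then 1 else 0)) = f i" "(SU j. f j * (if j = i then 1 else 0)) = f i"
 by (simp_all add: if_distrib[of "%c. c * _"] if_distrib[of "%c. _ * c"] cong: if_cong)

lemma sum3_rotate: "(SUM l:A. SUM k:B. SUM p:C. f l k p) = (SUM p:C. SUM l:A. SUM k:B. (f l k p :: real))"
proof -
 have "(SUM l:A. SUM k:B. SUM p:C. f l k p) = (SUM l:A. SUM p:C. SUM k:B. f l k p)"
  by (rule sum.cong[OF refl sum.swap])
 also have "... = (SUM p:C. SUM l:A. SUM k:B. f l k p)" by (rule sum.swap)
 finally show ?thesis .
qed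

subsection \<open>The metric in a chart\<close>

locale local_metric =
 fixes U :: "(real^'n) set" and G :: "real^'n => real^'n^'n"
 assumes open_U: "open U" and G_smooth: "smooth_on U (%x. G x $ i $ j)"
  and G_sym: "x : U ==> transpose (G x) = G x"
  and G_pos: "x : U ==> v ~= 0 ==> bil (G x) v v > 0"
begin

abbreviation "gi x i j == matrix_inv (G x) $ i $ j"
abbreviation "Ch x k i j == christoffel G x k i j"
abbreviation "PD == pderiv_coord"

text \<open>The carre du champ, i.e. the inner product of the two gradients, written through
  differentials so that only the inverse metric enters.\<close>

definition gam :: "(real^'n => real) => (real^'n => real) => real^'n => real" where
 "gam a b x = (SU i j. gi x i j * PD i a x * PD j b x)"

lemma det_nonzero: "x : U ==> det (G x) ~= 0"
proof
 assume x: "x : U" and "det (G x) = 0"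
 then obtain v where v: "v ~= 0" "G x *v v = 0"
  using invertible_det_nz[of "G x"] matrix_left_invertible_ker[of "G x"] invertible_left_inverse[of "G x"] by blast
 then show False using G_pos[OF x v(1)] by (simp add: bil_def)
qed

lemma G_symD: "x : U ==> G x $ i $ j = G x $ j $ i"
 using arg_cong[OF G_sym, of x "%M. M $ j $ i"] by (simp add: transpose_def)

lemma inv_left: "x : U ==> (SU j. gi x i j * G x $ j $ k) = (if i = k then 1 else 0)"
 using arg_cong[OF matrix_inv_left[OF det_nonzero], of x "%M. M $ i $ k"]
 by (simp add: matrix_matrix_mult_def mat_def)

lemma inv_right: "x : U ==> (SU j. G x $ i $ j * gi x j k) = (if i = k then 1 else 0)"
 using arg_cong[OF matrix_inv_right[OF det_nonzero], of x "%M. M $ i $ k"]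
 by (simp add: matrix_matrix_mult_def mat_def)

lemma gi_symm:
 assumes x: "x : U" shows "transpose (matrix_inv (G x)) = matrix_inv (G x)"
proof -
 let ?I = "matrix_inv (G x)"
 have "transpose ?I ** G x = transpose (G x ** ?I)"
  using G_sym[OF x] by (simp add: matrix_transpose_mul)
 then have 1: "transpose ?I ** G x = mat 1" using matrix_inv_right[OF det_nonzero[OF x]] by (simp add: transpose_mat)
 have "transpose ?I = transpose ?I ** (G x ** ?I)" using matrix_inv_right[OF det_nonzero[OF x]] by simp
 also have "... = ?I" using 1 by (simp add: matrix_mul_assoc)
 finally show ?thesis .
qed

lemma gi_sym: "x : U ==> gi x i j = gi x j i"
 using arg_cong[OF gi_symm, of x "%M. M $ j $ i"] by (simp add: transpose_def)

lemma gi_smooth: "smooth_on U (%x. gi x i j)"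
 by (intro smooth_on_matrix_inv G_smooth det_nonzero)

lemma PD_smooth: "smooth_on U F ==> smooth_on U (PD i F)"
 using smooth_on_pderiv[OF open_U] .

lemma diff: "smooth_on U F ==> x : U ==> F differentiable (at x)"
 using smooth_on_differentiable[OF open_U] .

lemma christoffel_smooth: "smooth_on U (%x. Ch x k i j)"
 unfolding christoffel_def
 by (intro smooth_on_divide smooth_on_intros gi_smooth PD_smooth G_smooth) auto

lemma christoffel_sym: "x : U ==> Ch x k i j = Ch x k j i"
proof -
 assume x: "x : U"
 have "PD l (%y. G y $ i $ j) x = PD l (%y. G y $ j $ i) x" for l
  by (rule pderiv_cong[OF open_U x]) (rule G_symD)
 then show ?thesis by (simp add: christoffel_def algebra_simps)
qed

lemma gam_smooth: "smooth_on U a ==> smooth_on U b ==> smooth_on U (gam a b)"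
 unfolding gam_def[abs_def] by (intro smooth_on_intros gi_smooth PD_smooth)

lemma hessian_smooth: "smooth_on U F ==> smooth_on U (%x. hessian G F x $ i $ j)"
 unfolding hessian_def by (simp, intro smooth_on_intros christoffel_smooth PD_smooth)

lemma gradient_nth: "gradient G F x $ i = (SU j. gi x i j * PD j F x)"
 by (simp add: gradient_def matrix_vector_mult_def)

lemma gradient_smooth: "smooth_on U F ==> smooth_on U (%x. gradient G F x $ i)"
 unfolding gradient_nth by (intro smooth_on_intros gi_smooth PD_smooth)

lemma gam_gradient: "gam a b x = (SU i. PD i a x * gradient G b x $ i)"
 by (simp add: gam_def gradient_nth sum_distrib_left mult.assoc mult.left_commute)

lemma gam_sym: "x : U ==> gam a b x = gam b a x"
 unfolding gam_def by (subst sum.swap) (simp add: gi_sym mult.assoc mult.commute mult.left_commute)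

lemma gam_gradient': "x : U ==> gam a b x = (SU i. gradient G a x $ i * PD i b x)"
 using gam_sym[of x a b] by (simp add: gam_gradient mult.commute)

lemma G_gradient: "x : U ==> (SU j. G x $ i $ j * gradient G F x $ j) = PD i F x"
proof -
 assume x: "x : U"
 have "(SU j. G x $ i $ j * gradient G F x $ j) = (SU k. (SU j. G x $ i $ j * gi x j k) * PD k F x)"
  unfolding gradient_nth sum_distrib_left sum_distrib_right by (subst sum.swap) (simp add: mult.assoc)
 then show ?thesis by (simp add: inv_right[OF x])
qed

lemma bil_sum: "bil S v w = (SU i j. v $ i * S $ i $ j * w $ j)"
 by (simp add: bil_def inner_vec_def matrix_vector_mult_def sum_distrib_left mult.assoc)

lemma bil_gradient: "x : U ==> bil (G x) (gradient G a x) (gradient G b x) = gam a b x"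
 by (simp add: bil_sum mult.assoc sum_distrib_left[symmetric] G_gradient gam_gradient')

lemma G_christoffel: "x : U ==> (SU k. G x $ l $ k * Ch x k i j) =
 (PD i (%y. G y $ j $ l) x + PD j (%y. G y $ i $ l) x - PD l (%y. G y $ i $ j) x) / 2"
 (is "_ ==> _ = ?c l / 2")
proof -
 assume x: "x : U"
 have "(SU k. G x $ l $ k * Ch x k i j) = (SU m. (SU k. G x $ l $ k * gi x k m) * ?c m) / 2"
  unfolding christoffel_def sum_distrib_left sum_distrib_right sum_divide_distrib times_divide_eq_right
  by (subst sum.swap) (simp add: mult.assoc)
 then show ?thesis by (simp add: inv_right[OF x])
qed

text \<open>Metric compatibility of the Levi-Civita connection. Together with \<open>PD_gi\<close>,
  its form for the inverse metric, it is behind the later cancellations of Christoffel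
  symbols.\<close>

lemma PD_G: "x : U ==> PD k (%y. G y $ i $ j) x =
 (SU m. G x $ j $ m * Ch x m k i) + (SU m. G x $ i $ m * Ch x m k j)"
proof -
 assume x: "x : U"
 have "PD l (%y. G y $ i $ j) x = PD l (%y. G y $ j $ i) x" for l i j
  by (rule pderiv_cong[OF open_U x]) (rule G_symD)
 note s = this[of k j i] this[of j k i] this[of i k j]
 show ?thesis unfolding G_christoffel[OF x] using s by (simp add: field_simps)
qed

lemma PD_gi:
 assumes x: "x : U"
 shows "PD k (%y. gi y i j) x = - (SU l. Ch x i k l * gi x l j) - (SU l. Ch x j k l * gi x i l)"
proof -
 let ?D = "%i j h. SU k. h $ k * PD k (%y. G y $ i $ j) x"
 have Ck: "Ck_on 1 U (%x. G x $ i $ j)" for i j using G_smooth smooth_on_Ck by blast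
 have "((%y. G y $ i $ j) has_derivative ?D i j) (at x within U)" for i j
  using has_derivative_pderiv[OF open_U, of 0 "%y. G y $ i $ j" x] Ck x at_within_open[OF x open_U] by simp
 from matrix_inv_has_derivative[OF Ck det_nonzero x this, of i j]
 have "((%y. gi y i j) has_derivative (%h. - (SU a b. gi x i a * ?D a b h * gi x b j))) (at x)"
  using at_within_open[OF x open_U] by simp
 from pderiv_coord_eq[OF this, of k]
 have "PD k (%y. gi y i j) x = - (SU a b. gi x i a * PD k (%y. G y $ a $ b) x * gi x b j)"
  by (simp add: axis_def)
 also have "... = - (SU a b. gi x i a * (SU m. G x $ b $ m * Ch x m k a) * gi x b j)
  - (SU a b. gi x i a * (SU m. G x $ a $ m * Ch x m k b) * gi x b j)"
  by (simp add: PD_G[OF x] distrib_left distrib_right sum.distrib)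
 also have "(SU a b. gi x i a * (SU m. G x $ b $ m * Ch x m k a) * gi x b j)
  = (SU a. gi x i a * (SU m. Ch x m k a * (SU b. gi x j b * G x $ b $ m)))"
  unfolding sum_distrib_left sum_distrib_right
  by (rule sum.cong[OF refl], subst sum.swap) (simp add: gi_sym[OF x, of j] mult.assoc mult.commute mult.left_commute)
 also have "... = (SU l. Ch x j k l * gi x i l)" by (simp add: inv_left[OF x]) (simp add: mult.commute)
 also have "(SU a b. gi x i a * (SU m. G x $ a $ m * Ch x m k b) * gi x b j)
  = (SU b. gi x b j * (SU m. Ch x m k b * (SU a. gi x i a * G x $ a $ m)))"
  unfolding sum_distrib_left sum_distrib_right
  by (subst sum.swap, rule sum.cong[OF refl], subst sum.swap) (simp add: mult.assoc mult.commute mult.left_commute)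
 also have "... = (SU l. Ch x i k l * gi x l j)" by (simp add: inv_left[OF x]) (simp add: mult.commute)
 finally show ?thesis by simp
qed

lemma hessian_nth: "hessian G F x $ i $ j = PD i (PD j F) x - (SU k. Ch x k i j * PD k F x)"
 by (simp add: hessian_def)

lemma hessian_sym: "x : U ==> smooth_on U F ==> hessian G F x $ i $ j = hessian G F x $ j $ i"
 using pderiv_commute[OF open_U, of x F i j] christoffel_sym[of x _ i j] by (simp add: hessian_nth smooth_on_Ck)

lemma PD_PD: "x : U ==> PD i (PD j F) x = hessian G F x $ i $ j + (SU k. Ch x k i j * PD k F x)"
 by (simp add: hessian_nth)

lemma PD_gradient:
 assumes x: "x : U" and F: "smooth_on U F"
 shows "PD k (%y. gradient G F y $ j) x =
  (SU m. gi x j m * hessian G F x $ k $ m) - (SU m. Ch x j k m * gradient G F x $ m)"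
proof -
 have "PD k (%y. gradient G F y $ j) x = (SU m. gi x j m * PD k (PD m F) x + PD k (%y. gi y j m) x * PD m F x)"
  unfolding gradient_nth
  by (simp add: pderiv_sum pderiv_mult diff x gi_smooth PD_smooth F differentiable_mult)
 also have "... = (SU m. gi x j m * hessian G F x $ k $ m) + (SU m l. gi x j m * (Ch x l k m * PD l F x))
  - (SU m l. Ch x j k l * gi x l m * PD m F x) - (SU m l. Ch x m k l * gi x j l * PD m F x)"
  by (simp add: PD_PD[OF x] PD_gi[OF x] sum.distrib sum_subtractf distrib_left distrib_right left_diff_distrib
    sum_distrib_left sum_distrib_right sum_negf)
 also have "(SU m l. Ch x j k l * gi x l m * PD m F x) = (SU l. Ch x j k l * gradient G F x $ l)"
  unfolding gradient_nth sum_distrib_left by (subst sum.swap) (simp add: mult.assoc)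
 also have "(SU m l. Ch x m k l * gi x j l * PD m F x) = (SU m l. gi x j m * (Ch x l k m * PD l F x))"
  by (subst sum.swap) (simp add: mult.assoc mult.commute mult.left_commute)
 finally show ?thesis by simp
qed

lemma PD_gam:
 assumes x: "x : U" and a: "smooth_on U a" and b: "smooth_on U b"
 shows "PD k (gam a b) x = (SU j. hessian G a x $ k $ j * gradient G b x $ j) +
  (SU j. hessian G b x $ k $ j * gradient G a x $ j)"
proof -
 have "PD k (gam a b) x = PD k (%y. SU i. PD i a y * gradient G b y $ i) x"
  by (simp add: gam_gradient[abs_def])
 also have "... = (SU i. PD i a x * PD k (%y. gradient G b y $ i) x + PD k (PD i a) x * gradient G b x $ i)"
  by (simp add: pderiv_sum pderiv_mult diff x PD_smooth gradient_smooth a b differentiable_mult)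
 also have "... = (SU i m. PD i a x * (gi x i m * hessian G b x $ k $ m))
   - (SU i m. PD i a x * (Ch x i k m * gradient G b x $ m))
   + (SU j. hessian G a x $ k $ j * gradient G b x $ j)
   + (SU i m. Ch x m k i * PD m a x * gradient G b x $ i)"
  by (simp add: PD_gradient[OF x b] PD_PD[OF x] sum.distrib sum_subtractf right_diff_distrib distrib_right
    sum_distrib_left sum_distrib_right)
 also have "(SU i m. Ch x m k i * PD m a x * gradient G b x $ i)
   = (SU i m. PD i a x * (Ch x i k m * gradient G b x $ m))"
  by (subst sum.swap) (simp add: mult.assoc mult.commute mult.left_commute)
 also have "(SU i m. PD i a x * (gi x i m * hessian G b x $ k $ m))
   = (SU j. hessian G b x $ k $ j * gradient G a x $ j)"
  unfolding gradient_nth sum_distrib_left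
  by (subst sum.swap) (simp add: gi_sym[OF x] mult.assoc mult.commute mult.left_commute)
 finally show ?thesis by simp
qed

text \<open>This expresses the Hessian through \<open>gam\<close> alone. As \<open>gam\<close> is
  visibly invariant under changes of charts, so is the Hessian, and second derivatives of transition
  maps never have to be written down. The same identity produces the Hessian of the potential in
  \<open>witten_bochner\<close>.\<close>

lemma hessian_gam:
 assumes x: "x : U" and F: "smooth_on U F" and a: "smooth_on U a" and b: "smooth_on U b"
 shows "2 * bil (hessian G F x) (gradient G a x) (gradient G b x) =
  gam a (gam F b) x + gam b (gam F a) x - gam F (gam a b) x"
proof -
 have H: "(SU i j. gradient G a x $ i * (hessian G f x $ i $ j * gradient G b x $ j)) =
  (SU i j. gradient G b x $ i * (hessian G f x $ i $ j * gradient G a x $ j))"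
  if "smooth_on U f" for f a b
  by (subst sum.swap) (simp add: hessian_sym[OF x that] mult.assoc mult.commute mult.left_commute)
 show ?thesis
  using H[OF F, of a b] H[OF a, of F b] H[OF b, of a F]
  by (simp add: gam_gradient'[OF x, of a "gam F b"] gam_gradient'[OF x, of b "gam F a"] gam_gradient'[OF x, of F "gam a b"]
    PD_gam[OF x] F a b bil_sum distrib_left sum.distrib sum_distrib_left mult.assoc)
qed

text \<open>The segment \<open>M s\<close> joins the identity to \<open>G x\<close> through positive
  definite, hence nonsingular, matrices, so the determinant cannot change sign along it.\<close>

lemma det_pos:
 assumes x: "x : U" shows "det (G x) > 0"
proof (rule ccontr)
 define M where "M s = (\<chi> i j. (1 - s) * mat 1 $ i $ j + s * G x $ i $ j)" for s :: real
 assume "~ det (G x) > 0"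
 moreover have M: "M 0 = mat 1" "M 1 = G x" by (simp_all add: M_def vec_eq_iff)
 moreover have "continuous_on {0..1} (%s. det (M s))"
  by (rule Ck_on_imp_continuous_on[of 0], rule Ck_on_det) (auto simp: M_def intro!: continuous_intros)
 ultimately obtain s where s: "0 <= s" "s <= 1" "det (M s) = 0"
  using IVT2'[of "%s. det (M s)" 1 0 0] by auto
 then obtain v where v: "v ~= 0" "M s *v v = 0"
  using invertible_det_nz[of "M s"] matrix_left_invertible_ker[of "M s"] invertible_left_inverse[of "M s"] by blast
 have "M s = (1 - s) *\<^sub>R mat 1 + s *\<^sub>R G x" by (simp add: M_def vec_eq_iff)
 then have "bil (M s) v v = (1 - s) * (v \<bullet> v) + s * bil (G x) v v"
  by (simp add: bil_def matrix_vector_mult_add_rdistrib scaleR_matrix_vector_assoc[symmetric] inner_add_right)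
 moreover have "v \<bullet> v > 0" "bil (G x) v v > 0" using G_pos[OF x v(1)] v(1) by auto
 ultimately have "bil (M s) v v > 0"
  using s(1,2) by (cases "s = 0") (auto intro!: add_nonneg_pos mult_pos_pos mult_nonneg_nonneg)
 then show False using v(2) by (simp add: bil_def)
qed

lemma laplacian_sum: "laplacian G F x = (SU i j. gi x i j * hessian G F x $ i $ j)"
 by (simp add: laplacian_def tensor_trace_def)

lemma witten_laplacian_eq: "x : U ==> witten_laplacian G \<Phi> F x = laplacian G F x - gam \<Phi> F x"
 by (simp add: witten_laplacian_def bil_gradient)

lemma laplacian_smooth: "smooth_on U F ==> smooth_on U (laplacian G F)"
 unfolding laplacian_sum[abs_def] by (intro smooth_on_intros gi_smooth hessian_smooth)

lemma witten_laplacian_smooth: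
 assumes "smooth_on U F" "smooth_on U \<Phi>"
 shows "smooth_on U (witten_laplacian G \<Phi> F)"
 by (rule smooth_on_cong[of U "%x. laplacian G F x - gam \<Phi> F x"])
  (auto simp: witten_laplacian_eq intro!: smooth_on_diff laplacian_smooth gam_smooth assms)

section \<open>The weighted density and the divergence form of the Witten Laplacian\<close>

definition rho :: "(real^'n => real) => real^'n => real" where
 "rho \<Phi> x = exp (- \<Phi> x) * sqrt (det (G x))"

lemma rho_smooth: "smooth_on U \<Phi> ==> smooth_on U (rho \<Phi>)"
 unfolding rho_def[abs_def] by (intro smooth_on_intros smooth_on_sqrt smooth_on_det G_smooth det_pos)

lemma PD_det:
 assumes x: "x : U"
 shows "PD k (%y. det (G y)) x = det (G x) * (2 * (SU i. Ch x i k i))"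
proof -
 let ?D = "%i j h. SU k. h $ k * PD k (%y. G y $ i $ j) x"
 have Ck: "Ck_on (Suc 0) U (%x. G x $ i $ j)" for i j using G_smooth smooth_on_Ck by blast
 have "((%y. G y $ i $ j) has_derivative ?D i j) (at x)" for i j
  using has_derivative_pderiv[OF open_U Ck x] .
 from pderiv_coord_eq[OF det_has_derivative[OF this det_nonzero[OF x]], of k]
 have "PD k (%y. det (G y)) x = det (G x) * (SU i j. gi x j i * PD k (%y. G y $ i $ j) x)"
  by (simp add: axis_def)
 also have "(SU i j. gi x j i * PD k (%y. G y $ i $ j) x) =
  (SU i j m. gi x i j * G x $ j $ m * Ch x m k i)
  + (SU i j m. gi x j i * G x $ i $ m * Ch x m k j)"
  by (simp add: PD_G[OF x] distrib_left sum.distrib sum_distrib_left mult.assoc gi_sym[OF x, of _ _])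
 also have "(SU i j m. gi x j i * G x $ i $ m * Ch x m k j) =
  (SU i j m. gi x i j * G x $ j $ m * Ch x m k i)"
  by (rule sum.swap)
 also have "(SU i j m. gi x i j * G x $ j $ m * Ch x m k i) = (SU i. Ch x i k i)"
 proof -
  have "(SU j m. gi x i j * G x $ j $ m * Ch x m k i) =
   (SU m. (SU j. gi x i j * G x $ j $ m) * Ch x m k i)" for i
   unfolding sum_distrib_right by (rule sum.swap)
  then show ?thesis by (simp add: inv_left[OF x])
 qed
 finally show ?thesis by simp
qed

lemma PD_rho:
 assumes x: "x : U" and \<Phi>: "smooth_on U \<Phi>"
 shows "PD k (rho \<Phi>) x = rho \<Phi> x * ((SU i. Ch x i k i) - PD k \<Phi> x)"
proof -
 have d: "(%y. det (G y)) differentiable (at x)" by (intro diff smooth_on_det G_smooth x)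
 have "PD k (%y. sqrt (det (G y))) x = inverse (sqrt (det (G x))) / 2 * PD k (%y. det (G y)) x"
  by (rule pderiv_compose[OF d DERIV_real_sqrt[OF det_pos[OF x]]])
 also have "... = sqrt (det (G x)) * (SU i. Ch x i k i)"
  using det_pos[OF x] real_sqrt_mult_self[of "det (G x)"]
  by (simp add: PD_det[OF x] field_simps)
 finally have 1: "PD k (%y. sqrt (det (G y))) x = sqrt (det (G x)) * (SU i. Ch x i k i)" .
 have "PD k (%y. exp (- \<Phi> y)) x = exp (- \<Phi> x) * PD k (%y. - \<Phi> y) x"
  by (rule pderiv_compose[OF diff[OF smooth_on_minus[OF \<Phi>] x]]) (rule DERIV_exp)
 then have 2: "PD k (%y. exp (- \<Phi> y)) x = - (exp (- \<Phi> x) * PD k \<Phi> x)"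
  by (simp add: pderiv_minus diff x \<Phi>)
 show ?thesis unfolding rho_def[abs_def]
  by (subst pderiv_mult)
   (auto simp: 1 2 algebra_simps intro!: diff x smooth_on_intros smooth_on_sqrt smooth_on_det G_smooth det_pos \<Phi>)
qed

text \<open>Differentiating the volume density produces contracted Christoffel symbols that cancel
  those of the gradient, and differentiating the weight produces the drift term. In this form the
  operator is ready for the divergence theorem in a chart.\<close>

lemma divergence_form:
 assumes x: "x : U" and F: "smooth_on U F" and \<Phi>: "smooth_on U \<Phi>"
 shows "(SU i. PD i (%y. rho \<Phi> y * gradient G F y $ i) x) = rho \<Phi> x * witten_laplacian G \<Phi> F x"
proof -
 have "(SU i. PD i (%y. rho \<Phi> y * gradient G F y $ i) x) =
  (SU i. rho \<Phi> x * PD i (%y. gradient G F y $ i) x + PD i (rho \<Phi>) x * gradient G F x $ i)"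
  by (simp add: pderiv_mult diff x rho_smooth gradient_smooth F \<Phi>)
 also have "... = rho \<Phi> x * ((SU i m. gi x i m * hessian G F x $ i $ m)
   - (SU i m. Ch x i i m * gradient G F x $ m)
   + (SU i m. Ch x m i m * gradient G F x $ i)
   - (SU i. PD i \<Phi> x * gradient G F x $ i))"
  by (simp add: PD_gradient[OF x F] PD_rho[OF x \<Phi>] sum.distrib sum_subtractf sum_distrib_left sum_distrib_right
    right_diff_distrib left_diff_distrib distrib_left mult.assoc)
 also have "(SU i m. Ch x m i m * gradient G F x $ i) = (SU i m. Ch x i i m * gradient G F x $ m)"
  by (subst sum.swap) (simp add: christoffel_sym[OF x])
 finally show ?thesis by (simp add: witten_laplacian_eq[OF x] laplacian_sum gam_gradient)
qed

section \<open>Curvature identities and the Bochner formula\<close>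

text \<open>Components of the covariant derivative of the Hessian; \<open>l\<close> is the direction
  of differentiation.\<close>

definition nh :: "(real^'n => real) => real^'n => 'n => 'n => 'n => real" where
 "nh F x l k j = PD l (%y. hessian G F y $ k $ j) x
  - (SU m. Ch x m l k * hessian G F x $ m $ j) - (SU m. Ch x m l j * hessian G F x $ k $ m)"

lemma nh_sym:
 assumes x: "x : U" and F: "smooth_on U F" shows "nh F x l k j = nh F x l j k"
proof -
 have "PD l (%y. hessian G F y $ k $ j) x = PD l (%y. hessian G F y $ j $ k) x"
  by (rule pderiv_cong[OF open_U x]) (rule hessian_sym[OF _ F])
 then show ?thesis by (simp add: nh_def hessian_sym[OF x F])
qed

text \<open>The Ricci identity for the one-form dF. Third derivatives and Hessian terms are
  symmetric in \<open>l\<close> and \<open>j\<close> and cancel; the derivatives and products of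
  Christoffel symbols that remain make up \<open>riemann\<close>.\<close>

lemma nh_commute:
 assumes x: "x : U" and F: "smooth_on U F"
 shows "nh F x l j k - nh F x j l k = - (SU m. riemann G x m k l j * PD m F x)"
proof -
 have P: "PD a (%y. hessian G F y $ b $ k) x = PD a (PD b (PD k F)) x
   - (SU m. Ch x m b k * (hessian G F x $ a $ m + (SU p. Ch x p a m * PD p F x)))
   - (SU m. PD a (%y. Ch y m b k) x * PD m F x)" for a b
  unfolding hessian_nth
  by (simp add: pderiv_diff pderiv_sum pderiv_mult diff x PD_smooth christoffel_smooth F differentiable_mult
    differentiable_sum sum.distrib hessian_nth)
 have Q: "PD l (PD j (PD k F)) x = PD j (PD l (PD k F)) x"
  using pderiv_commute[OF open_U x] PD_smooth[OF F] smooth_on_Ck by blast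
 have S: "(SU m. Ch x m l j * hessian G F x $ m $ k) = (SU m. Ch x m j l * hessian G F x $ m $ k)"
  by (simp add: christoffel_sym[OF x, of _ l j])
 have R: "(SU m. Ch x m b k * (SU p. Ch x p a m * PD p F x)) =
  (SU m. (SU p. Ch x p b k * Ch x m a p) * PD m F x)" for a b
  unfolding sum_distrib_left sum_distrib_right by (subst sum.swap) (simp add: mult.assoc)
 have H: "(SU m. Ch x m b k * hessian G F x $ a $ m) = (SU m. Ch x m b k * hessian G F x $ m $ a)" for a b
  by (simp add: hessian_sym[OF x F])
 show ?thesis
  unfolding nh_def P Q riemann_def
  by (simp add: distrib_left distrib_right left_diff_distrib sum.distrib sum_subtractf R S H
    hessian_sym[OF x F, of j] hessian_sym[OF x F, of l])
qed

definition low :: "real^'n => 'n => 'n => 'n => 'n => real" where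
 "low x p k l j = (SU m. G x $ p $ m * riemann G x m k l j)"

text \<open>With the index lowered, derivatives of Christoffel symbols turn into second derivatives
  of \<open>G\<close>, and the quadratic rest \<open>Q\<close> has evident symmetries. The algebraic
  symmetries of the curvature can be read off from this form.\<close>

lemma low_eq:
 assumes x: "x : U"
 defines "DD == %a b c d. PD a (PD b (%y. G y $ c $ d)) x"
 defines "Q == %a b c d. (SU m q. G x $ m $ q * Ch x q a b * Ch x m c d)"
 shows "low x p k l j = (DD l k j p - DD l p j k - DD j k l p + DD j p l k) / 2 - Q l p j k + Q j p l k"
proof -
 have comm: "DD a b c d = DD b a c d" for a b c d
  unfolding DD_def using pderiv_commute[OF open_U x] G_smooth smooth_on_Ck by blast
 have P: "(SU m. G x $ p $ m * PD a (%y. Ch y m b k) x) =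
   (DD a b k p + DD a k b p - DD a p b k) / 2
   - (SU m q. G x $ m $ q * Ch x q a p * Ch x m b k)
   - (SU m q. G x $ p $ q * Ch x q a m * Ch x m b k)" for a b
 proof -
  have "PD a (%y. SU m. G y $ p $ m * Ch y m b k) x =
    PD a (%y. (PD b (%z. G z $ k $ p) y + PD k (%z. G z $ b $ p) y - PD p (%z. G z $ b $ k) y) * (1/2)) x"
   by (rule pderiv_cong[OF open_U x]) (simp add: G_christoffel)
  also have "... = (DD a b k p + DD a k b p - DD a p b k) / 2"
   unfolding DD_def
   by (subst pderiv_mult)
    (auto simp: pderiv_add pderiv_diff diff x PD_smooth G_smooth smooth_on_add smooth_on_diff)
  also have "PD a (%y. SU m. G y $ p $ m * Ch y m b k) x =
   (SU m. G x $ p $ m * PD a (%y. Ch y m b k) x) + (SU m. PD a (%y. G y $ p $ m) x * Ch x m b k)"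
   by (simp add: pderiv_sum pderiv_mult diff x G_smooth christoffel_smooth differentiable_mult sum.distrib)
  finally have "(DD a b k p + DD a k b p - DD a p b k) / 2 =
   (SU m. G x $ p $ m * PD a (%y. Ch y m b k) x) + (SU m. PD a (%y. G y $ p $ m) x * Ch x m b k)"
   by (rule sym)
  moreover have "(SU m. PD a (%y. G y $ p $ m) x * Ch x m b k) =
   (SU m q. G x $ m $ q * Ch x q a p * Ch x m b k) +
   (SU m q. G x $ p $ q * Ch x q a m * Ch x m b k)"
   by (simp add: PD_G[OF x] sum_distrib_right distrib_right sum.distrib)
  ultimately show ?thesis by linarith
 qed
 have R: "(SU m. G x $ p $ m * (SU q. Ch x q b k * Ch x m a q)) =
  (SU m q. G x $ p $ q * Ch x q a m * Ch x m b k)" for a b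
  unfolding sum_distrib_left by (subst sum.swap) (simp add: mult.assoc mult.commute mult.left_commute)
 have "low x p k l j = (DD l j k p + DD l k j p - DD l p j k) / 2 - (DD j l k p + DD j k l p - DD j p l k) / 2
  - Q l p j k + Q j p l k"
  unfolding low_def riemann_def Q_def
  by (simp add: distrib_left right_diff_distrib sum.distrib sum_subtractf P R)
 then show ?thesis using comm[of l j k p] by (simp add: field_simps)
qed

lemma low_antisym: "x : U ==> low x p k l j = - low x k p l j"
proof -
 assume x: "x : U"
 have comm: "PD a (PD b (%y. G y $ c $ d)) x = PD b (PD a (%y. G y $ c $ d)) x" for a b c d
  using pderiv_commute[OF open_U x] G_smooth smooth_on_Ck by blast
 have Qsym: "(SU m q. G x $ m $ q * Ch x q a b * Ch x m c d) =
  (SU m q. G x $ m $ q * Ch x q c d * Ch x m a b)" for a b c d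
  by (subst sum.swap) (simp add: G_symD[OF x] mult.assoc mult.commute mult.left_commute)
 show ?thesis unfolding low_eq[OF x] using Qsym[of l p j k] Qsym[of j p l k] comm[of l k j p] by (simp add: field_simps)
qed

lemma riemann_low: "x : U ==> riemann G x m k l j = (SU p. gi x m p * low x p k l j)"
proof -
 assume x: "x : U"
 have "(SU p. gi x m p * low x p k l j) = (SU q. (SU p. gi x m p * G x $ p $ q) * riemann G x q k l j)"
  unfolding low_def sum_distrib_left sum_distrib_right by (subst sum.swap) (simp add: mult.assoc)
 then show ?thesis by (simp add: inv_left[OF x])
qed

lemma ricci_low: "x : U ==> ricci G x $ j $ k = (SU i p. gi x i p * low x p k i j)"
 by (simp add: ricci_def riemann_low)

text \<open>Pair symmetry of the lowered curvature tensor, contracted with the symmetric inverse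
  metric. It is what makes the tensor \<open>Sm\<close> symmetric, as the rigidity argument
  requires.\<close>

lemma ricci_sym:
 assumes x: "x : U" shows "ricci G x $ j $ k = ricci G x $ k $ j"
proof -
 have comm: "PD a (PD b (%y. G y $ c $ d)) x = PD b (PD a (%y. G y $ c $ d)) x" for a b c d
  using pderiv_commute[OF open_U x] G_smooth smooth_on_Ck by blast
 have sym: "PD a (PD b (%y. G y $ c $ d)) x = PD a (PD b (%y. G y $ d $ c)) x" for a b c d
  by (rule pderiv_cong[OF open_U x], rule pderiv_cong[OF open_U]) (auto intro: G_symD)
 have Qsym: "(SU m q. G x $ m $ q * Ch x q a b * Ch x m c d) =
  (SU m q. G x $ m $ q * Ch x q c d * Ch x m a b)" for a b c d
  by (subst sum.swap) (simp add: G_symD[OF x] mult.assoc mult.commute mult.left_commute)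
 have Qc: "(SU m q. G x $ m $ q * Ch x q a b * Ch x m c d) =
  (SU m q. G x $ m $ q * Ch x q b a * Ch x m d c)" for a b c d
  using christoffel_sym[OF x, of _ a b] christoffel_sym[OF x, of _ c d] by simp
 have low: "low x p k i j = low x i j p k" for i p
 proof -
  note e = trans[OF comm[of i k j p] sym[of k i j p]] trans[OF comm[of i p j k] sym[of p i j k]] trans[OF comm[of j k i p] sym[of k j i p]]
   trans[OF comm[of j p i k] sym[of p j i k]] Qc[of i p j k] trans[OF Qsym[of j p i k] Qc[of i k j p]]
  show ?thesis by (simp only: low_eq[OF x] e) simp
 qed
 have "ricci G x $ j $ k = (SU i p. gi x p i * low x i j p k)"
  unfolding ricci_low[OF x] using low gi_sym[OF x] by simp
 also have "... = ricci G x $ k $ j" unfolding ricci_low[OF x] by (rule sum.swap)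
 finally show ?thesis .
qed

text \<open>The Ricci identity leaves a contraction over \<open>l\<close> and \<open>k\<close> that
  is not the one defining \<open>ricci\<close>; antisymmetry in the first pair of indices turns it
  into that one and causes the sign.\<close>

lemma riemann_contract:
 assumes x: "x : U"
 shows "(SU l k. gi x l k * (SU m. riemann G x m k l j * PD m F x)) =
  - (SU k. ricci G x $ j $ k * gradient G F x $ k)"
proof -
 have "(SU m. riemann G x m k l j * PD m F x) = - (SU p. gradient G F x $ p * low x k p l j)" for k l
 proof -
  have "(SU m. riemann G x m k l j * PD m F x) = (SU m p. gi x p m * PD m F x * low x p k l j)"
   unfolding riemann_low[OF x] sum_distrib_right
   by (simp add: gi_sym[OF x] mult.assoc mult.commute mult.left_commute)
  also have "... = (SU p. gradient G F x $ p * low x p k l j)"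
   unfolding gradient_nth sum_distrib_right by (rule sum.swap)
  finally show ?thesis by (simp add: low_antisym[OF x, of _ k] sum_negf)
 qed
 then have "(SU l k. gi x l k * (SU m. riemann G x m k l j * PD m F x)) =
  - (SU l k p. gradient G F x $ p * (gi x l k * low x k p l j))"
  by (simp add: sum_negf sum_distrib_left mult.left_commute)
 also have "(SU l k p. gradient G F x $ p * (gi x l k * low x k p l j)) =
  (SU p. gradient G F x $ p * ricci G x $ j $ p)"
  unfolding ricci_low[OF x] sum_distrib_left
  by (rule sum3_rotate)
 finally show ?thesis by (simp add: mult.commute)
qed

lemma PD_laplacian:
 assumes x: "x : U" and F: "smooth_on U F"
 shows "PD j (laplacian G F) x = (SU l k. gi x l k * nh F x j l k)"
proof -
 have "PD j (laplacian G F) x = PD j (%y. SU l k. gi y l k * hessian G F y $ l $ k) x"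
  by (simp add: laplacian_sum[abs_def])
 also have "... = (SU l k. gi x l k * PD j (%y. hessian G F y $ l $ k) x)
   - (SU l k m. Ch x l j m * gi x m k * hessian G F x $ l $ k)
   - (SU l k m. Ch x k j m * gi x l m * hessian G F x $ l $ k)"
  by (simp add: pderiv_sum pderiv_mult diff x gi_smooth hessian_smooth F differentiable_mult differentiable_sum
    PD_gi[OF x] sum.distrib sum_subtractf sum_distrib_right left_diff_distrib distrib_right sum_negf)
 also have "(SU l k m. Ch x k j m * gi x l m * hessian G F x $ l $ k) =
  (SU l k m. gi x l k * (Ch x m j k * hessian G F x $ l $ m))"
  by (rule sum.cong[OF refl], subst sum.swap) (simp add: mult.assoc mult.commute mult.left_commute)
 also have "(SU l k m. Ch x l j m * gi x m k * hessian G F x $ l $ k) =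
  (SU l k m. gi x l k * (Ch x m j l * hessian G F x $ m $ k))"
  by (subst (2) sum.swap, subst sum.swap, subst (2) sum.swap) (simp add: mult.assoc mult.commute mult.left_commute)
 finally show ?thesis by (simp add: nh_def right_diff_distrib sum_subtractf sum_distrib_left)
qed

lemma hessian_gam_self:
 assumes x: "x : U" and F: "smooth_on U F"
 shows "hessian G (gam F F) x $ l $ k = 2 * (SU j. nh F x l k j * gradient G F x $ j)
  + 2 * (SU j m. gi x j m * hessian G F x $ k $ j * hessian G F x $ l $ m)"
proof -
 let ?V = "%j x. gradient G F x $ j" and ?h = "%i j x. hessian G F x $ i $ j"
 have N: "PD k (gam F F) y = 2 * (SU j. ?h k j y * ?V j y)" if "y : U" for y k
  using PD_gam[OF that F F] by simp
 have "PD l (PD k (gam F F)) x = PD l (%y. 2 * (SU j. ?h k j y * ?V j y)) x"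
  by (rule pderiv_cong[OF open_U x N])
 also have "... = 2 * (SU j. ?h k j x * PD l (?V j) x + PD l (?h k j) x * ?V j x)"
  by (simp add: pderiv_cmult pderiv_sum pderiv_mult diff x gradient_smooth hessian_smooth F differentiable_mult differentiable_sum)
 also have "... = 2 * (SU j m. gi x j m * ?h k j x * ?h l m x)
  - 2 * (SU j m. ?h k j x * (Ch x j l m * ?V m x)) + 2 * (SU j. PD l (?h k j) x * ?V j x)"
  by (simp add: PD_gradient[OF x F] sum.distrib sum_subtractf right_diff_distrib distrib_left sum_distrib_left
    mult.assoc mult.left_commute)
 also have "(SU j m. ?h k j x * (Ch x j l m * ?V m x)) =
  (SU j m. Ch x m l j * ?h k m x * ?V j x)"
  by (subst sum.swap) (simp add: mult.assoc mult.commute mult.left_commute)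
 finally have 1: "PD l (PD k (gam F F)) x = 2 * (SU j m. gi x j m * ?h k j x * ?h l m x)
  - 2 * (SU j m. Ch x m l j * ?h k m x * ?V j x) + 2 * (SU j. PD l (?h k j) x * ?V j x)" .
 have 2: "(SU m. Ch x m l k * PD m (gam F F) x) = 2 * (SU j m. Ch x m l k * ?h m j x * ?V j x)"
  unfolding N[OF x] sum_distrib_left by (subst sum.swap) (simp add: mult.assoc mult.left_commute)
 show ?thesis
  unfolding hessian_nth[of "gam F F"] 1 2 nh_def
  by (simp add: left_diff_distrib sum_subtractf sum_distrib_right right_diff_distrib)
qed

text \<open>Tracing \<open>hessian_gam_self\<close> shows the squared Hessian at once. The other
  term traces \<open>nh\<close> over its direction and one slot of the Hessian, while the gradient
  of the Laplacian traces the two slots of the Hessian; by \<open>nh_commute\<close> they differ by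
  the Ricci term.\<close>

lemma bochner:
 assumes x: "x : U" and F: "smooth_on U F"
 shows "laplacian G (gam F F) x - 2 * gam F (laplacian G F) x =
  2 * tensor_norm2 (G x) (hessian G F x) + 2 * bil (ricci G x) (gradient G F x) (gradient G F x)"
proof -
 let ?V = "%j. gradient G F x $ j" and ?h = "%i j. hessian G F x $ i $ j"
 have 1: "laplacian G (gam F F) x = 2 * (SU j. ?V j * (SU l k. gi x l k * nh F x l j k))
  + 2 * (SU l k j m. gi x l k * gi x j m * ?h k j * ?h l m)"
 proof -
  have "laplacian G (gam F F) x = 2 * (SU l k j. gi x l k * (nh F x l k j * ?V j))
  + 2 * (SU l k j m. gi x l k * gi x j m * ?h k j * ?h l m)"
   unfolding laplacian_sum hessian_gam_self[OF x F]
   by (simp add: distrib_left sum.distrib sum_distrib_left mult.assoc mult.left_commute)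
  also have "(SU l k j. gi x l k * (nh F x l k j * ?V j)) =
   (SU j l k. ?V j * (gi x l k * nh F x l j k))"
   by (subst (2) sum.swap, subst sum.swap)
    (simp add: nh_sym[OF x F, of _ _ _] mult.assoc mult.commute mult.left_commute)
  finally show ?thesis by (simp add: sum_distrib_left)
 qed
 have 2: "gam F (laplacian G F) x = (SU j. ?V j * (SU l k. gi x l k * nh F x j l k))"
  by (simp add: gam_gradient'[OF x] PD_laplacian[OF x F])
 have 3: "(SU l k. gi x l k * nh F x l j k) - (SU l k. gi x l k * nh F x j l k) =
  (SU k. ricci G x $ j $ k * ?V k)" for j
  using riemann_contract[OF x, of j F]
  by (simp add: sum_subtractf[symmetric] right_diff_distrib[symmetric] nh_commute[OF x F] sum_negf)
 have 4: "(SU l k j m. gi x l k * gi x j m * ?h k j * ?h l m) = tensor_norm2 (G x) (hessian G F x)"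
  unfolding tensor_norm2_def
  by (subst sum.swap, rule sum.cong[OF refl], subst sum.swap, rule sum.cong[OF refl])
   (simp add: gi_sym[OF x] mult.assoc mult.commute mult.left_commute)
 have "(SU j. ?V j * (SU l k. gi x l k * nh F x l j k)) - gam F (laplacian G F) x =
  bil (ricci G x) (gradient G F x) (gradient G F x)"
 proof -
  have "(SU j. ?V j * A j) - (SU j. ?V j * B j) = (SU j. ?V j * (A j - B j))" for A B
   by (simp add: right_diff_distrib sum_subtractf)
  note D = this
  show ?thesis unfolding 2 by (subst D, simp only: 3) (simp add: bil_sum sum_distrib_left mult.assoc)
 qed
 then show ?thesis unfolding 1 4 by simp
qed

lemma gam_diff_right:
 "smooth_on U a ==> smooth_on U b ==> x : U ==> gam F (%y. a y - b y) x = gam F a x - gam F b x"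
 unfolding gam_def by (simp add: pderiv_diff diff right_diff_distrib sum_subtractf)

text \<open>Compared with \<open>bochner\<close> the drift contributes
  \<open>2 * gam F (gam \<Phi> F) - gam \<Phi> (gam F F)\<close>, and \<open>hessian_gam\<close>
  identifies this with twice the Hessian of \<Phi> on the gradient. That term completes the Ricci
  curvature to that of the Witten Laplacian.\<close>

lemma witten_bochner:
 assumes x: "x : U" and F: "smooth_on U F" and \<Phi>: "smooth_on U \<Phi>"
 shows "witten_laplacian G \<Phi> (gam F F) x - 2 * gam F (witten_laplacian G \<Phi> F) x = Gamma2 G \<Phi> F x"
proof -
 let ?V = "gradient G F x"
 have c: "PD i (witten_laplacian G \<Phi> F) x = PD i (%y. laplacian G F y - gam \<Phi> F y) x" for i
  by (rule pderiv_cong[OF open_U x witten_laplacian_eq])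
 have "gam F (witten_laplacian G \<Phi> F) x = gam F (%y. laplacian G F y - gam \<Phi> F y) x"
  by (simp add: gam_def c)
 also have "... = gam F (laplacian G F) x - gam F (gam \<Phi> F) x"
  by (rule gam_diff_right[OF laplacian_smooth[OF F] gam_smooth[OF \<Phi> F] x])
 finally have 1: "gam F (witten_laplacian G \<Phi> F) x = gam F (laplacian G F) x - gam F (gam \<Phi> F) x" .
 have 2: "gam F (gam \<Phi> F) x = gam F (gam F \<Phi>) x"
 proof -
  have "PD i (gam \<Phi> F) x = PD i (gam F \<Phi>) x" for i by (rule pderiv_cong[OF open_U x]) (rule gam_sym)
  then show ?thesis by (simp add: gam_def[of F "gam \<Phi> F"] gam_def[of F "gam F \<Phi>"])
 qed
 have "2 * bil (hessian G \<Phi> x) ?V ?V = 2 * gam F (gam \<Phi> F) x - gam \<Phi> (gam F F) x"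
  using hessian_gam[OF x \<Phi> F F] by simp
 moreover have "bil (ricci_L G \<Phi> x) ?V ?V = bil (ricci G x) ?V ?V + bil (hessian G \<Phi> x) ?V ?V"
  by (simp add: ricci_L_def bil_sum distrib_left distrib_right sum.distrib)
 ultimately show ?thesis
  using bochner[OF x F] by (simp add: witten_laplacian_eq[OF x] 1 Gamma2_def algebra_simps)
qed

end

subsection \<open>Change of variables for nonnegative functions\<close>

text \<open>The change of variables theorems of the library need a well-ordered index type. A copy of an
 arbitrary finite type carries such an order.\<close>

typedef 'n wo = "UNIV :: 'n set" morphisms of_wo to_wo ..

lemma to_wo_of_wo [simp]: "to_wo (of_wo i) = i" and of_wo_to_wo [simp]: "of_wo (to_wo k) = k"
 by (simp_all add: of_wo_inverse to_wo_inverse)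

lemma bij_of_wo: "bij of_wo"
 by (rule bij_betw_byWitness[where f' = to_wo]) auto

instance wo :: (finite) finite
proof
 have "UNIV = range (to_wo :: 'a => 'a wo)" by (metis surjI to_wo_of_wo)
 then show "finite (UNIV :: 'a wo set)" by (metis finite finite_imageI)
qed

instantiation wo :: (finite) wellorder
begin

definition wo_enum :: "'a wo => nat" where
 "wo_enum = (SOME e. inj e)"

definition less_eq_wo :: "'a wo => 'a wo => bool" where
 "less_eq_wo a b \<longleftrightarrow> wo_enum a <= wo_enum b"

definition less_wo :: "'a wo => 'a wo => bool" where
 "less_wo a b \<longleftrightarrow> wo_enum a < wo_enum b"

instance
proof
 have "EX e :: 'a wo => nat. inj e"
  using finite_imp_inj_to_nat_seg[of "UNIV :: 'a wo set"] by auto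
 then have inj: "inj (wo_enum :: 'a wo => nat)" unfolding wo_enum_def by (rule someI_ex)
 fix a b c :: "'a wo" and P :: "'a wo => bool"
 show "a <= b ==> b <= a ==> a = b"
  using inj by (simp add: less_eq_wo_def injD)
 assume *: "!!x. (!!y. y < x ==> P y) ==> P x"
 show "P a" by (induction a rule: measure_induct_rule[of wo_enum]) (rule *, simp add: less_wo_def)
qed (auto simp: less_eq_wo_def less_wo_def)

end

definition wo_vec :: "real^'n => real^('n wo)" where "wo_vec x = (\<chi> i. x $ of_wo i)"
definition unwo_vec :: "real^('n wo) => real^'n" where "unwo_vec y = (\<chi> k. y $ to_wo k)"

lemma wo_vec_unwo [simp]: "wo_vec (unwo_vec y) = y" and unwo_vec_wo [simp]: "unwo_vec (wo_vec x) = x"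
 by (simp_all add: wo_vec_def unwo_vec_def vec_eq_iff)

lemma bounded_linear_wo_vec: "bounded_linear wo_vec"
 by (intro linear_conv_bounded_linear[THEN iffD1] linearI) (simp_all add: wo_vec_def vec_eq_iff)

lemma bounded_linear_unwo_vec: "bounded_linear unwo_vec"
 by (intro linear_conv_bounded_linear[THEN iffD1] linearI) (simp_all add: unwo_vec_def vec_eq_iff)

lemma wo_vec_borel [measurable]: "wo_vec : borel_measurable borel" "unwo_vec : borel_measurable borel"
 by (auto intro!: borel_measurable_continuous_onI linear_continuous_on bounded_linear_wo_vec bounded_linear_unwo_vec)

lemma prod_Basis_cart: "(PROD b:Basis. (v :: real^'n) \<bullet> b) = (PROD i:UNIV. v $ i)"
proof -
 have "Basis = (%i::'n. axis i (1::real)) ` UNIV" by (auto simp: Basis_vec_def)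
 moreover have "inj (%i::'n. axis i (1::real))" by (auto simp: inj_def axis_eq_axis)
 ultimately have "(PROD b:Basis. v \<bullet> b) = (PROD i:UNIV. v \<bullet> axis i 1)" using prod.reindex[of "%i::'n. axis i (1::real)" UNIV "%b. v \<bullet> b"] by simp
 then show ?thesis by (simp only: inner_axis) simp
qed

lemma distr_wo_vec: "distr lborel borel wo_vec = (lborel :: (real^('n::finite wo)) measure)"
proof (rule lborel_eqI[symmetric])
 fix l u :: "real^('n wo)" assume lu: "!!b. b : Basis ==> l \<bullet> b <= u \<bullet> b"
 have "wo_vec -` box l u = box (unwo_vec l) (unwo_vec u :: real^'n)"
 proof -
  have "(ALL i. l $ i < x $ of_wo i & x $ of_wo i < u $ i) \<longleftrightarrow> (ALL k. l $ to_wo k < x $ k & x $ k < u $ to_wo k)"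
   for x :: "real^'n"
   by (metis of_wo_to_wo to_wo_of_wo)
  then show ?thesis by (auto simp: mem_box_cart wo_vec_def unwo_vec_def)
 qed
 then have "emeasure (distr lborel borel wo_vec) (box l u) = emeasure lborel (box (unwo_vec l) (unwo_vec u :: real^'n))"
  by (subst emeasure_distr) auto
 also have "... = (PROD b:Basis. (unwo_vec u - unwo_vec l :: real^'n) \<bullet> b)"
 proof (rule emeasure_lborel_box)
  fix b :: "real^'n" assume "b : Basis"
  then obtain i where b: "b = axis i 1" by (auto simp: Basis_vec_def)
  have "axis (to_wo i) (1::real) : Basis" by (auto simp: Basis_vec_def)
  from lu[OF this] show "unwo_vec l \<bullet> b <= unwo_vec u \<bullet> b" by (simp add: b inner_axis unwo_vec_def)
 qed
 also have "(PROD b:Basis. (unwo_vec u - unwo_vec l :: real^'n) \<bullet> b) = (PROD b:Basis. (u - l) \<bullet> b)"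
 proof -
  have "bij (to_wo :: 'n => _)" by (rule bij_betw_byWitness[where f' = of_wo]) auto
  from prod.reindex_bij_betw[OF this, of "%i. (u - l) $ i"] show ?thesis
   unfolding prod_Basis_cart by (simp add: unwo_vec_def)
 qed
 finally show "emeasure (distr lborel borel wo_vec) (box l u) = ennreal (PROD b:Basis. (u - l) \<bullet> b)" .
qed simp

lemma det_wo:
 fixes B :: "real^'n^'n"
 shows "det (\<chi> i j. B $ of_wo i $ of_wo j :: real^('n wo)^('n wo)) = det B"
proof -
 have bt: "bij (to_wo :: 'n => _)" by (rule bij_betw_byWitness[where f' = of_wo]) auto
 have mp: "map_permutation UNIV to_wo p = to_wo o p o of_wo" for p :: "'n => 'n"
  using bt inv_into_f_eq[of "to_wo :: 'n => _" UNIV "of_wo _"]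
  by (auto simp: map_permutation_def restrict_id_def fun_eq_iff bij_is_surj bij_is_inj)
 have sign: "sign (to_wo o p o of_wo) = sign p" if "p permutes UNIV" for p :: "'n => 'n"
  using sign_map_permutation[OF bij_is_inj[OF bt] that finite] by (simp add: mp)
 have bij: "bij_betw (%p. to_wo o p o of_wo) {p. p permutes (UNIV :: 'n set)} {q. q permutes (UNIV :: 'n wo set)}"
 proof (rule bij_betwI)
  have "(f o p o h) permutes UNIV" if "bij f" "bij h" "p permutes UNIV" for f :: "'a => 'b" and p h
   by (rule bij_imp_permutes[OF bij_comp[OF that(2) bij_comp[OF permutes_bij[OF that(3)] that(1)]]]) auto
  then show "(%p. to_wo o p o of_wo) : {p. p permutes (UNIV :: 'n set)} \<rightarrow> {q. q permutes UNIV}"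
   "(%q. of_wo o q o to_wo) : {q. q permutes (UNIV :: 'n wo set)} \<rightarrow> {p. p permutes UNIV}"
   using bt bij_of_wo by blast+
 qed (auto simp: fun_eq_iff)
 have "det (\<chi> i j. B $ of_wo i $ of_wo j :: real^('n wo)^('n wo)) =
  (\<Sum>p | p permutes (UNIV :: 'n set). of_int (sign (to_wo o p o of_wo)) *
   (PROD i:UNIV. B $ of_wo i $ of_wo ((to_wo o p o of_wo) i)))"
  unfolding det_def by (subst sum.reindex_bij_betw[OF bij, symmetric]) simp
 also have "... = det B"
  unfolding det_def
  by (rule sum.cong[OF refl]) (use sign prod.reindex_bij_betw[OF bij_of_wo, of "%i. B $ i $ _ i"] in simp)
 finally show ?thesis .
qed

text \<open>An infinite right side is trivial; a finite one makes the integrand gauge integrable, so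
  the bound for integrals over images applies. The inequality asks nothing of the injectivity of
  \<open>g\<close>; equality is recovered later from the inequality for the inverse map.\<close>

lemma nn_integral_image_le_wo:
 fixes f :: "real^'n::{finite,wellorder} => real"
 assumes S: "S : sets borel" and nonneg: "!!x. x : S ==> 0 <= f (g x)"
  and der: "!!x. x : S ==> (g has_derivative g' x) (at x within S)"
  and meas: "(%x. indicator S x * (\<bar>det (matrix (g' x))\<bar> * f (g x))) : borel_measurable borel"
 shows "(\<integral>\<^sup>+y. indicator (g ` S) y * ennreal (f y) \<partial>lborel)
  <= (\<integral>\<^sup>+x. indicator S x * ennreal (\<bar>det (matrix (g' x))\<bar> * f (g x)) \<partial>lborel)" (is "?L <= ?R")
proof (cases "?R < \<infinity>")
 case True
 let ?h = "%x. indicator S x * (\<bar>det (matrix (g' x))\<bar> * f (g x))"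
 have R: "?R = (\<integral>\<^sup>+x. ennreal (?h x) \<partial>lborel)"
  by (intro nn_integral_cong) (simp split: split_indicator)
 have h0: "0 <= ?h x" for x using nonneg by (simp split: split_indicator)
 have fin: "(\<integral>\<^sup>+x. ennreal (?h x) \<partial>lborel) < \<infinity>" using True R by simp
 have int: "?h integrable_on UNIV" by (rule nn_integral_integrable_on[OF meas h0 fin])
 have eq: "(\<integral>\<^sup>+x. ennreal (?h x) \<partial>lborel) = integral UNIV ?h" by (rule nn_integral_lborel_eq_integral[OF meas h0 fin])
 have h: "?h = (%x. if x : S then \<bar>det (matrix (g' x))\<bar> * f (g x) else 0)" by (auto simp: fun_eq_iff)
 have intS: "(%x. \<bar>det (matrix (g' x))\<bar> * f (g x)) integrable_on S"
  using int unfolding h by (simp add: integrable_restrict_UNIV)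
 from integral_on_image_ubound_nonneg[OF nonneg der intS]
 have 1: "f integrable_on (g ` S)" "integral (g ` S) f <= integral S (%x. \<bar>det (matrix (g' x))\<bar> * f (g x))" by auto
 have "?L = (\<integral>\<^sup>+y. ennreal (f y) * indicator (g ` S) y \<partial>lborel)" by (simp add: mult.commute)
 also have "... = ennreal (integral (g ` S) f)"
  by (rule nn_integral_has_integral_lebesgue'[OF _ integrable_integral[OF 1(1)]]) (use nonneg in auto)
 also have "... <= ennreal (integral S (%x. \<bar>det (matrix (g' x))\<bar> * f (g x)))" using 1(2) by (rule ennreal_leI)
 also have "integral S (%x. \<bar>det (matrix (g' x))\<bar> * f (g x)) = integral UNIV ?h"
  unfolding h by (rule integral_restrict_UNIV[symmetric])
 finally show ?thesis using R eq by simp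
qed (simp add: not_less top_unique)

lemma nn_integral_image_le:
 fixes f :: "real^'n => real" and g :: "real^'n => real^'n"
 assumes S: "S : sets borel" and nonneg: "!!x. x : S ==> 0 <= f (g x)"
  and der: "!!x. x : S ==> (g has_derivative g' x) (at x within S)"
  and meas: "(%x. indicator S x * (\<bar>det (matrix (g' x))\<bar> * f (g x))) : borel_measurable borel"
  and meas': "(%y. indicator (g ` S) y * ennreal (f y)) : borel_measurable borel"
 shows "(\<integral>\<^sup>+y. indicator (g ` S) y * ennreal (f y) \<partial>lborel)
  <= (\<integral>\<^sup>+x. indicator S x * ennreal (\<bar>det (matrix (g' x))\<bar> * f (g x)) \<partial>lborel)"
proof -
 define S' where "S' = unwo_vec -` S"
 define G where "G = wo_vec o g o unwo_vec"
 define G' where "G' y = wo_vec o g' (unwo_vec y) o unwo_vec" for y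
 define F where "F = f o unwo_vec"
 have S'im: "S' = wo_vec ` S" unfolding S'_def by (auto simp: image_iff) (metis wo_vec_unwo)
 have GS: "G ` S' = wo_vec ` (g ` S)" unfolding S'im G_def by (auto simp: image_iff)
 have ind1: "indicator S' (wo_vec x) = indicator S x" for x :: "real^'n" by (simp add: S'_def indicator_def)
 have ind2: "indicator (G ` S') (wo_vec y) = indicator (g ` S) y" for y :: "real^'n"
 proof -
  have "wo_vec y : wo_vec ` (g ` S) \<longleftrightarrow> y : g ` S" by (metis (no_types, lifting) image_iff unwo_vec_wo)
  then show ?thesis by (simp add: GS indicator_def)
 qed
 have S'b: "S' : sets borel" using measurable_sets[OF wo_vec_borel(2) S] by (simp add: S'_def)
 have der': "(G has_derivative G' x) (at x within S')" if x: "x : S'" for x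
 proof -
  have 1: "(unwo_vec has_derivative unwo_vec) (at x within S')"
   by (rule bounded_linear_imp_has_derivative[OF bounded_linear_unwo_vec])
  have 2: "(g has_derivative g' (unwo_vec x)) (at (unwo_vec x) within unwo_vec ` S')"
   by (rule has_derivative_subset[OF der]) (use x in \<open>auto simp: S'_def\<close>)
  from diff_chain_within[OF 1 2]
  have "(g o unwo_vec has_derivative g' (unwo_vec x) o unwo_vec) (at x within S')" .
  from bounded_linear.has_derivative[OF bounded_linear_wo_vec this]
  show ?thesis by (simp add: G_def G'_def o_def)
 qed
 have det': "det (matrix (G' (wo_vec x))) = det (matrix (g' x))" for x
 proof -
  have "unwo_vec (axis j 1) = (axis (of_wo j) 1 :: real^'n)" for j
   by (auto simp: unwo_vec_def axis_def vec_eq_iff)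
  then have "matrix (G' (wo_vec x)) = (\<chi> i j. matrix (g' x) $ of_wo i $ of_wo j)"
   unfolding matrix_def G'_def o_def by (simp only: unwo_vec_wo) (simp add: vec_eq_iff wo_vec_def)
  then show ?thesis by (simp add: det_wo)
 qed
 have meas2: "(%x. indicator S' x * (\<bar>det (matrix (G' x))\<bar> * F (G x))) : borel_measurable borel"
 proof -
  have "(%x. indicator S (unwo_vec x) * (\<bar>det (matrix (g' (unwo_vec x)))\<bar> * f (g (unwo_vec x)))) : borel_measurable borel"
   using measurable_compose[OF wo_vec_borel(2) meas] .
  moreover have "indicator S' x * (\<bar>det (matrix (G' x))\<bar> * F (G x)) =
   indicator S (unwo_vec x) * (\<bar>det (matrix (g' (unwo_vec x)))\<bar> * f (g (unwo_vec x)))" for x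
   using det'[of "unwo_vec x"] by (simp add: F_def G_def S'_def indicator_def)
  ultimately show ?thesis by presburger
 qed
 have "(\<integral>\<^sup>+y. indicator (g ` S) y * ennreal (f y) \<partial>lborel) =
  (\<integral>\<^sup>+y. indicator (G ` S') (wo_vec y) * ennreal (F (wo_vec y)) \<partial>lborel)"
  by (simp only: ind2) (simp add: F_def)
 also have "... = (\<integral>\<^sup>+y. indicator (G ` S') y * ennreal (F y) \<partial>lborel)"
 proof -
  have "(%y. indicator (g ` S) (unwo_vec y) * ennreal (f (unwo_vec y))) : borel_measurable borel"
   using measurable_compose[OF wo_vec_borel(2) meas'] .
  moreover have "unwo_vec y : g ` S \<longleftrightarrow> y : G ` S'" for y
   unfolding GS by (metis (no_types, lifting) image_iff unwo_vec_wo wo_vec_unwo)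
  then have "indicator (g ` S) (unwo_vec y) * ennreal (f (unwo_vec y)) = indicator (G ` S') y * ennreal (F y)" for y
   by (simp add: F_def indicator_def)
  ultimately have "(%y. indicator (G ` S') y * ennreal (F y)) : borel_measurable borel" by (simp only:)
  then show ?thesis by (subst distr_wo_vec[symmetric], subst nn_integral_distr) auto
 qed
 also have "... <= (\<integral>\<^sup>+x. indicator S' x * ennreal (\<bar>det (matrix (G' x))\<bar> * F (G x)) \<partial>lborel)"
  by (rule nn_integral_image_le_wo[OF S'b _ der' meas2])
   (use nonneg in \<open>auto simp: S'_def F_def G_def\<close>)
 also have "... = (\<integral>\<^sup>+x. indicator S' (wo_vec x) * ennreal (\<bar>det (matrix (G' (wo_vec x)))\<bar> * F (G (wo_vec x))) \<partial>lborel)"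
 proof -
  have "(%x. indicator S' x * ennreal (\<bar>det (matrix (G' x))\<bar> * F (G x))) = (%x. ennreal (indicator S' x * (\<bar>det (matrix (G' x))\<bar> * F (G x))))"
   by (auto simp: fun_eq_iff split: split_indicator)
  then have "(%x. indicator S' x * ennreal (\<bar>det (matrix (G' x))\<bar> * F (G x))) : borel_measurable borel"
   using meas2 by simp
  then show ?thesis by (subst distr_wo_vec[symmetric], subst nn_integral_distr) auto
 qed
 also have "... = (\<integral>\<^sup>+x. indicator S x * ennreal (\<bar>det (matrix (g' x))\<bar> * f (g x)) \<partial>lborel)"
  by (simp only: ind1 det') (simp add: F_def G_def)
 finally show ?thesis .
qed
subsection \<open>Charts\<close>

lemma continuous_nonneg_zero_lborel:
 fixes f :: "real^'n => real"
 assumes U: "open U" and f: "continuous_on U f" "!!x. x : U ==> 0 <= f x"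
  and zero: "(\<integral>\<^sup>+x. ennreal (indicator U x * f x) \<partial>lborel) = 0" and x: "x : U"
 shows "f x = 0"
proof (rule ccontr)
 assume "f x ~= 0"
 then have pos: "f x > 0" using f(2)[OF x] by simp
 have m: "(%x. indicator U x * f x) : borel_measurable borel"
  using borel_measurable_continuous_on_indicator[of U f] f(1) U by simp
 have "open (U \<inter> f -` {f x / 2<..})"
  by (rule continuous_open_preimage[OF f(1) U open_greaterThan])
 moreover have "x : U \<inter> f -` {f x / 2<..}" using x pos by simp
 ultimately obtain e where e: "e > 0" "ball x e \<subseteq> U \<inter> f -` {f x / 2<..}" using openE by blast
 have "ennreal (f x / 2) * emeasure lborel (ball x e) = (\<integral>\<^sup>+y\<in>ball x e. ennreal (f x / 2) \<partial>lborel)"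
  by (simp add: nn_integral_cmult_indicator)
 also have "... <= (\<integral>\<^sup>+x. ennreal (indicator U x * f x) \<partial>lborel)"
  by (rule nn_integral_mono) (use e(2) in \<open>auto split: split_indicator intro!: ennreal_leI dest!: subsetD\<close>)
 finally have "emeasure lborel (ball x e) = 0" using zero pos by simp
 then show False using content_ball_pos[OF e(1), of x] by (simp add: measure_def)
qed

locale closed_manifold =
 fixes M :: "'a::t2_space set" and A :: "('a, 'n::finite) chart set"
 assumes compact_M: "compact M" and atlas: "smooth_atlas M A"
begin

abbreviation overlap :: "('a, 'n) chart => ('a, 'n) chart => (real^'n) set" where
 "overlap c d == snd c ` (fst c \<inter> fst d)"

abbreviation trans :: "('a, 'n) chart => ('a, 'n) chart => real^'n => real^'n" where
 "trans c d == snd d o chart_inv c"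

abbreviation jac :: "('a, 'n) chart => ('a, 'n) chart => real^'n => real^'n => real^'n" where
 "jac c d x == frechet_derivative (trans c d) (at x)"

lemma chart_union: "(UN c:A. fst c) = M"
 using atlas by (simp add: smooth_atlas_def)

lemma chart_openin: "c : A ==> openin (top_of_set M) (fst c)"
 and open_chart_image: "c : A ==> open (chart_image c)"
 and chart_homeo: "c : A ==> homeomorphism (fst c) (chart_image c) (snd c) (chart_inv c)"
 and trans_smooth: "c : A ==> d : A ==> smooth_on (overlap c d) (trans c d)"
 using atlas by (auto simp: smooth_atlas_def)

lemma chart_subset: "c : A ==> fst c \<subseteq> M"
 using chart_union by blast

lemma chart_inv_snd: "c : A ==> p : fst c ==> chart_inv c (snd c p) = p"
 using chart_homeo by (metis homeomorphism_apply1)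

lemma snd_chart_inv: "c : A ==> x : chart_image c ==> snd c (chart_inv c x) = x"
 using chart_homeo by (metis homeomorphism_apply2)

lemma chart_inv_in: "c : A ==> x : chart_image c ==> chart_inv c x : fst c"
 by (rule inv_into_into)

lemma snd_in: "p : fst c ==> snd c p : chart_image c"
 by blast

lemma chart_continuous: "c : A ==> continuous_on (fst c) (snd c)"
 and chart_inv_continuous: "c : A ==> continuous_on (chart_image c) (chart_inv c)"
 by (rule homeomorphism_cont1[OF chart_homeo], assumption, rule homeomorphism_cont2[OF chart_homeo], assumption)

lemma image_eq_vimage:
 assumes c: "c : A" and B: "B \<subseteq> fst c"
 shows "snd c ` B = chart_image c \<inter> chart_inv c -` B"
proof (rule set_eqI)
 fix x
 show "x : snd c ` B \<longleftrightarrow> x : chart_image c \<inter> chart_inv c -` B"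
 proof
  assume "x : snd c ` B"
  then obtain p where p: "p : B" "x = snd c p" by blast
  then have "p : fst c" using B by blast
  with p show "x : chart_image c \<inter> chart_inv c -` B" using chart_inv_snd[OF c] by simp
 next
  assume "x : chart_image c \<inter> chart_inv c -` B"
  then show "x : snd c ` B" using snd_chart_inv[OF c, of x] by (metis IntD1 IntD2 image_eqI vimageE)
 qed
qed

lemma openin_subchart: "c : A ==> openin (top_of_set M) V ==> open (snd c ` (fst c \<inter> V))"
proof -
 assume c: "c : A" and V: "openin (top_of_set M) V"
 obtain O' where O': "open O'" "V = M \<inter> O'" using V by (auto simp: openin_open)
 have "snd c ` (fst c \<inter> V) = chart_image c \<inter> chart_inv c -` O'"
 proof -
  have "snd c ` (fst c \<inter> V) = chart_image c \<inter> chart_inv c -` (fst c \<inter> V)"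
   by (rule image_eq_vimage[OF c]) simp
  also have "... = chart_image c \<inter> chart_inv c -` O'"
   using chart_subset[OF c] chart_inv_in[OF c] O'(2) by blast
  finally show ?thesis .
 qed
 moreover have "open (chart_inv c -` O' \<inter> chart_image c)"
  using iffD1[OF continuous_on_open_vimage[OF open_chart_image[OF c]] chart_inv_continuous[OF c]] O'(1) by simp
 ultimately show ?thesis by (simp add: Int_commute)
qed

lemma open_overlap: "c : A ==> d : A ==> open (overlap c d)"
 using openin_subchart chart_openin by blast

lemma trans_overlap: "c : A ==> d : A ==> x : overlap c d ==> trans c d x : overlap d c"
 by (auto simp: chart_inv_snd)

lemma trans_trans: "c : A ==> d : A ==> x : overlap c d ==> trans d c (trans c d x) = x"
 by (auto simp: chart_inv_snd)

lemma trans_image: "c : A ==> d : A ==> B \<subseteq> fst c \<inter> fst d ==> trans c d ` (snd c ` B) = snd d ` B"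
 by (force simp: image_iff chart_inv_snd)

lemma trans_has_derivative:
 assumes "c : A" "d : A" "x : overlap c d"
 shows "(trans c d has_derivative jac c d x) (at x)"
proof -
 have "EX D. (trans c d has_derivative D) (at x)"
  by (rule Ck_on_open_has_derivative[OF open_overlap[OF assms(1,2)] smooth_on_Ck[OF trans_smooth[OF assms(1,2)]] assms(3)])
 then show ?thesis using frechet_derivative_works differentiableI by blast
qed

lemma closed_M: "closed M" using compact_imp_closed[OF compact_M] .

lemma M_borel [measurable]: "M : sets borel" using closed_M by auto

lemma chart_borel [measurable]: "c : A ==> fst c : sets borel"
proof -
 assume "c : A"
 then obtain O' where "open O'" "fst c = M \<inter> O'" using chart_openin[of c] by (auto simp: openin_open)
 then show ?thesis using M_borel by simp
qed

lemma chart_inv_measurable: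
 assumes "c : A" shows "chart_inv c : measurable (restrict_space borel (chart_image c)) borel"
 by (rule borel_measurable_continuous_on_restrict[OF chart_inv_continuous[OF assms]])

lemma image_borel:
 assumes c: "c : A" and B: "B : sets borel" "B \<subseteq> fst c"
 shows "snd c ` B : sets borel"
proof -
 have "chart_inv c -` B \<inter> space (restrict_space borel (chart_image c)) : sets (restrict_space borel (chart_image c))"
  by (rule measurable_sets[OF chart_inv_measurable[OF c] B(1)])
 then have "chart_image c \<inter> chart_inv c -` B : sets (restrict_space borel (chart_image c))"
  by (simp add: space_restrict_space Int_commute)
 then show ?thesis
  using image_eq_vimage[OF c B(2)] open_chart_image[OF c] by (simp add: sets_restrict_space_iff)
qed

lemma finite_charts: "\<exists>C\<subseteq>A. finite C & (UN c:C. fst c) = M"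
proof -
 have "ALL c:A. EX O'. open O' & fst c = M \<inter> O'" using chart_openin by (auto simp: openin_open)
 from bchoice[OF this] obtain O' where
  O': "!!c. c : A ==> open (O' c)" "!!c. c : A ==> fst c = M \<inter> O' c" by blast
 have "M \<subseteq> (UN c:A. O' c)" using chart_union O'(2) by blast
 then obtain C where C: "C \<subseteq> A" "finite C" "M \<subseteq> (UN c:C. O' c)"
  using compactE_image[OF compact_M, of A O'] O'(1) by (metis (no_types, lifting))
 have "(UN c:C. fst c) = M" using C O'(2) by blast
 then show ?thesis using C by blast
qed

text \<open>Disjoint Borel pieces, each inside one chart, play the role of a partition of unity for
  measures: additivity over them gives both the uniqueness and the existence of a measure with
  prescribed chart densities.\<close>

lemma borel_partition:
 "EX (m::nat) e E. (ALL k<m. e k : A & E k \<subseteq> fst (e k) & E k : sets borel) &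
  disjoint_family_on E {..<m} & (\<Union>k<m. E k) = M"
proof -
 obtain C where C: "C \<subseteq> A" "finite C" "(UN c:C. fst c) = M" using finite_charts by blast
 obtain e where e: "bij_betw e {0..<card C} C" using ex_bij_betw_nat_finite[OF C(2)] by blast
 have eA: "e k : A" if "k < card C" for k using e C(1) that by (auto simp: bij_betw_def)
 define E where "E k = fst (e k) - (\<Union>j<k. fst (e j))" for k
 have "(\<Union>k<card C. E k) = (\<Union>k<card C. fst (e k))"
 proof -
  have "EX k<card C. p : E k" if "k < card C" "p : fst (e k)" for k p
  proof -
   define j where "j = (LEAST j. p : fst (e j))"
   have "p : fst (e j)" "j <= k" using that LeastI[of "%j. p : fst (e j)" k] Least_le[of "%j. p : fst (e j)" k] by (auto simp: j_def)
   moreover have "p ~: fst (e i)" if "i < j" for i using not_less_Least that unfolding j_def by blast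
   ultimately show ?thesis using that(1) by (intro exI[of _ j]) (auto simp: E_def)
  qed
  then show ?thesis unfolding E_def by (intro equalityI UN_least) (blast, fastforce)
 qed
 also have "... = (UN c:e ` {0..<card C}. fst c)" by (simp add: lessThan_atLeast0)
 also have "... = M" using e C(3) by (simp add: bij_betw_def)
 finally have 1: "(\<Union>k<card C. E k) = M" .
 have 2: "E i \<inter> E j = {}" if "i < j" for i j using that by (auto simp: E_def)
 have "disjoint_family_on E {..<card C}"
  unfolding disjoint_family_on_def using 2 by (metis Int_commute linorder_neqE_nat)
 moreover have "E k : sets borel" if "k < card C" for k
  unfolding E_def using eA that by (intro sets.Diff chart_borel sets.finite_UN) auto
 ultimately show ?thesis using 1 eA by (intro exI[of _ "card C"] exI[of _ e] exI[of _ E]) (auto simp: E_def)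
qed

subsection \<open>Measures with given densities in the charts\<close>

text \<open>The property by which \<open>riemannian_volume\<close> selects its measure, but for an
  arbitrary density, so that the weighted volumes are covered as well.\<close>

definition chart_measure :: "'a measure => (('a, 'n) chart => real^'n => real) => bool" where
 "chart_measure \<nu> r \<longleftrightarrow> sets \<nu> = sets (restrict_space borel M) &
  (ALL c:A. ALL B:sets borel. B \<subseteq> fst c --> emeasure \<nu> B = (\<integral>\<^sup>+x\<in>snd c ` B. ennreal (r c x) \<partial>lborel))"

definition density_law :: "(('a, 'n) chart => real^'n => real) => bool" where
 "density_law r \<longleftrightarrow> (ALL c:A. continuous_on (chart_image c) (r c) & (ALL x:chart_image c. 0 <= r c x)) &
  (ALL c:A. ALL d:A. ALL x:overlap c d. r c x = \<bar>det (matrix (jac c d x))\<bar> * r d (trans c d x))"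

lemma chart_measure_unique:
 assumes 1: "chart_measure \<nu> r" and 2: "chart_measure \<nu>' r'"
  and eq: "!!c x. c : A ==> x : chart_image c ==> r c x = r' c x"
 shows "\<nu> = \<nu>'"
proof (rule measure_eqI)
 show s: "sets \<nu> = sets \<nu>'" using 1 2 by (simp add: chart_measure_def)
 fix B assume B: "B : sets \<nu>"
 then have Bb: "B : sets borel" "B \<subseteq> M" using 1 by (auto simp: chart_measure_def sets_restrict_space_iff)
 obtain m e E where E: "ALL k<(m::nat). e k : A & E k \<subseteq> fst (e k) & E k : sets borel"
  "disjoint_family_on E {..<m}" "(\<Union>k<m. E k) = M" using borel_partition by blast
 have part: "emeasure \<mu> B = (\<Sum>k<m. emeasure \<mu> (B \<inter> E k))" if "sets \<mu> = sets (restrict_space borel M)" for \<mu>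
 proof -
  have "B = (UN k:{..<m}. B \<inter> E k)" using E(3) Bb(2) by blast
  moreover have "(\<Sum>k<m. emeasure \<mu> (B \<inter> E k)) = emeasure \<mu> (UN k:{..<m}. B \<inter> E k)"
  proof (rule sum_emeasure)
   show "(%k. B \<inter> E k) ` {..<m} \<subseteq> sets \<mu>"
   proof safe
    fix k assume "k < m"
    then have "E k : sets borel" using E(1) by blast
    then show "B \<inter> E k : sets \<mu>" using Bb that by (auto simp: sets_restrict_space_iff)
   qed
   show "disjoint_family_on (%k. B \<inter> E k) {..<m}"
    using E(2) unfolding disjoint_family_on_def by blast
  qed simp
  ultimately show ?thesis by simp
 qed
 have "emeasure \<nu> (B \<inter> E k) = emeasure \<nu>' (B \<inter> E k)" if "k < m" for k
 proof -
  have *: "e k : A" "B \<inter> E k \<subseteq> fst (e k)" "B \<inter> E k : sets borel" using E(1) that Bb by auto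
  have "(\<integral>\<^sup>+x\<in>snd (e k) ` (B \<inter> E k). ennreal (r (e k) x) \<partial>lborel) = (\<integral>\<^sup>+x\<in>snd (e k) ` (B \<inter> E k). ennreal (r' (e k) x) \<partial>lborel)"
   by (rule nn_integral_cong) (use eq[OF *(1)] *(2) in \<open>auto split: split_indicator\<close>)
  then show ?thesis using 1 2 * unfolding chart_measure_def by simp
 qed
 then show "emeasure \<nu> B = emeasure \<nu>' B" using part[of \<nu>] part[of \<nu>'] 1 2 by (simp add: chart_measure_def)
qed

lemma density_law_continuous: "density_law r ==> c : A ==> continuous_on (chart_image c) (r c)"
 and density_law_nonneg: "density_law r ==> c : A ==> x : chart_image c ==> 0 <= r c x"
 unfolding density_law_def by blast+

lemma density_borel:
 assumes "density_law r" "c : A"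
 shows "(%x. indicator (chart_image c) x * r c x) : borel_measurable borel"
 using borel_measurable_continuous_on_indicator[of "chart_image c" "r c"] assms open_chart_image[OF assms(2)]
 by (simp add: density_law_def)

lemma density_nn_borel:
 assumes "density_law r" "c : A" "N : sets borel" "N \<subseteq> chart_image c"
 shows "(%x. ennreal (r c x) * indicator N x) : borel_measurable borel"
proof -
 have "(%x. ennreal (indicator (chart_image c) x * r c x) * indicator N x) : borel_measurable borel"
  using density_borel[OF assms(1,2)] assms(3) by measurable
 moreover have "ennreal (indicator (chart_image c) x * r c x) * indicator N x = ennreal (r c x) * indicator N x" for x
  using assms(4) by (auto split: split_indicator)
 ultimately show ?thesis by simp
qed

text \<open>The image inequality for the transition map gives one direction, and for the inverse
  transition the other.\<close>

lemma density_change: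
 assumes r: "density_law r" and c: "c : A" and d: "d : A" and B: "B : sets borel" "B \<subseteq> fst c \<inter> fst d"
 shows "(\<integral>\<^sup>+x\<in>snd c ` B. ennreal (r c x) \<partial>lborel) = (\<integral>\<^sup>+y\<in>snd d ` B. ennreal (r d y) \<partial>lborel)"
proof (rule antisym)
 have le: "(\<integral>\<^sup>+y\<in>snd d ` B. ennreal (r d y) \<partial>lborel) <= (\<integral>\<^sup>+x\<in>snd c ` B. ennreal (r c x) \<partial>lborel)"
  if c: "c : A" and d: "d : A" and B2: "B \<subseteq> fst c \<inter> fst d" for c d
 proof -
  let ?S = "snd c ` B"
  have S: "?S : sets borel" "?S \<subseteq> overlap c d" using image_borel[OF c B(1)] B2 by auto
  have im: "trans c d ` ?S = snd d ` B" by (rule trans_image[OF c d B2])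
  have rel: "\<bar>det (matrix (jac c d x))\<bar> * r d (trans c d x) = r c x" if "x : ?S" for x
  proof -
   have "x : overlap c d" using S(2) that by blast
   then show ?thesis using r c d unfolding density_law_def by metis
  qed
  have "(\<integral>\<^sup>+y. indicator (trans c d ` ?S) y * ennreal (r d y) \<partial>lborel)
   <= (\<integral>\<^sup>+x. indicator ?S x * ennreal (\<bar>det (matrix (jac c d x))\<bar> * r d (trans c d x)) \<partial>lborel)"
  proof (rule nn_integral_image_le[OF S(1)])
   fix x assume x: "x : ?S"
   show "0 <= r d (trans c d x)"
    using trans_overlap[OF c d, of x] S(2) x r d unfolding density_law_def by blast
   show "(trans c d has_derivative jac c d x) (at x within ?S)"
    using trans_has_derivative[OF c d, of x] x S(2) by (auto intro: has_derivative_at_withinI)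
  next
   have "(%x. indicator ?S x * (indicator (chart_image c) x * r c x)) : borel_measurable borel"
    using density_borel[OF r c] S(1) by measurable
   moreover have "indicator ?S x * (\<bar>det (matrix (jac c d x))\<bar> * r d (trans c d x)) = indicator ?S x * (indicator (chart_image c) x * r c x)" for x
    using rel[of x] S(2) by (auto split: split_indicator)
   ultimately show "(%x. indicator ?S x * (\<bar>det (matrix (jac c d x))\<bar> * r d (trans c d x))) : borel_measurable borel"
    by presburger
   show "(%y. indicator (trans c d ` ?S) y * ennreal (r d y)) : borel_measurable borel"
    unfolding im using density_nn_borel[OF r d, of "snd d ` B"] image_borel[OF d B(1)] B2 by (auto simp: mult.commute)
  qed
  also have "... = (\<integral>\<^sup>+x\<in>?S. ennreal (r c x) \<partial>lborel)"
   by (rule nn_integral_cong) (use rel in \<open>auto split: split_indicator\<close>)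
  finally show ?thesis unfolding im by (simp add: mult.commute)
 qed
 show "(\<integral>\<^sup>+x\<in>snd c ` B. ennreal (r c x) \<partial>lborel) <= (\<integral>\<^sup>+y\<in>snd d ` B. ennreal (r d y) \<partial>lborel)"
  using le[OF d c] B by blast
 show "(\<integral>\<^sup>+y\<in>snd d ` B. ennreal (r d y) \<partial>lborel) <= (\<integral>\<^sup>+x\<in>snd c ` B. ennreal (r c x) \<partial>lborel)"
  using le[OF c d] B by blast
qed

text \<open>A set is measured by cutting it along the Borel partition and integrating each piece in
  the chart of that piece. \<open>density_change\<close> shows that any other chart would give the
  same value, which is the required formula for sets inside a chart.\<close>

lemma chart_measure_exists:
 assumes r: "density_law r"
 shows "EX \<nu>. chart_measure \<nu> r"
proof -
 obtain m e E where E: "ALL k<(m::nat). e k : A & E k \<subseteq> fst (e k) & E k : sets borel"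
  "disjoint_family_on E {..<m}" "(\<Union>k<m. E k) = M" using borel_partition by blast
 define S where "S = sets (restrict_space borel M)"
 define \<mu> where "\<mu> B = (\<Sum>k<m. \<integral>\<^sup>+x\<in>snd (e k) ` (B \<inter> E k). ennreal (r (e k) x) \<partial>lborel)" for B
 have SB: "B : S \<longleftrightarrow> B : sets borel & B \<subseteq> M" for B by (simp add: S_def sets_restrict_space_iff conj_commute)
 have sa: "sigma_algebra M S"
  using sets.sigma_algebra_axioms[of "restrict_space borel M"] by (simp add: S_def space_restrict_space)
 have img: "snd (e k) ` (B \<inter> E k) : sets borel" if "k < m" "B : S" for k B
  by (rule image_borel) (use E(1) that SB in auto)
 have ca: "countably_additive S \<mu>"
 proof (rule countably_additiveI)
  fix B :: "nat => 'a set"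
  assume B: "range B \<subseteq> S" "disjoint_family B" "(\<Union>i. B i) : S"
  have "(\<Sum>i. \<integral>\<^sup>+x\<in>snd (e k) ` (B i \<inter> E k). ennreal (r (e k) x) \<partial>lborel) =
    (\<integral>\<^sup>+x\<in>snd (e k) ` ((\<Union>i. B i) \<inter> E k). ennreal (r (e k) x) \<partial>lborel)" if k: "k < m" for k
  proof -
   let ?N = "%i. snd (e k) ` (B i \<inter> E k)"
   have ek: "e k : A" "E k \<subseteq> fst (e k)" using E(1) k by auto
   have N: "?N i : sets borel" "?N i \<subseteq> chart_image (e k)" for i using img[OF k, of "B i"] B(1) ek by auto
   have inj: "inj_on (snd (e k)) (fst (e k))" using chart_inv_snd[OF ek(1)] by (metis inj_onI)
   have disj: "disjoint_family ?N"
   proof (unfold disjoint_family_on_def, intro ballI impI)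
    fix i j :: nat assume "i ~= j"
    then have "B i \<inter> B j = {}" using B(2) by (auto simp: disjoint_family_on_def)
    then show "?N i \<inter> ?N j = {}" using inj ek(2) by (auto dest!: inj_onD)
   qed
   have ind: "indicator (\<Union>i. ?N i) x = (\<Sum>i. indicator (?N i) x :: ennreal)" for x
    using suminf_indicator[OF disj, of x] by simp
   have "(\<Sum>i. \<integral>\<^sup>+x\<in>?N i. ennreal (r (e k) x) \<partial>lborel) = (\<integral>\<^sup>+x. (\<Sum>i. ennreal (r (e k) x) * indicator (?N i) x) \<partial>lborel)"
    by (rule nn_integral_suminf[symmetric]) (use density_nn_borel[OF r ek(1) N] in simp)
   also have "... = (\<integral>\<^sup>+x\<in>(\<Union>i. ?N i). ennreal (r (e k) x) \<partial>lborel)"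
    by (simp only: ind ennreal_suminf_cmult)
   also have "(\<Union>i. ?N i) = snd (e k) ` ((\<Union>i. B i) \<inter> E k)" by blast
   finally show ?thesis .
  qed
  then show "(\<Sum>i. \<mu> (B i)) = \<mu> (\<Union>i. B i)"
   unfolding \<mu>_def by (subst suminf_sum) (auto intro: summableI)
 qed
 define \<nu> where "\<nu> = measure_of M S \<mu>"
 have S: "S \<subseteq> Pow M" using SB by auto
 have sig: "sigma_sets M S = S" using sa by (simp add: sigma_algebra.sigma_sets_eq)
 have sets: "sets \<nu> = S" unfolding \<nu>_def using S sig by simp
 have em: "emeasure \<nu> B = \<mu> B" if "B : S" for B
 proof (rule emeasure_measure_of[OF \<nu>_def S])
  show "positive (sets \<nu>) \<mu>" by (simp add: positive_def \<mu>_def)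
  show "countably_additive (sets \<nu>) \<mu>" using ca sets by simp
 qed (use that sets in simp)
 have "emeasure \<nu> B = (\<integral>\<^sup>+x\<in>snd c ` B. ennreal (r c x) \<partial>lborel)"
  if c: "c : A" and B: "B : sets borel" "B \<subseteq> fst c" for c B
 proof -
  have BS: "B : S" using B chart_subset[OF c] SB by blast
  let ?N = "%k. snd c ` (B \<inter> E k)"
  have N: "?N k : sets borel" "?N k \<subseteq> chart_image c" if "k < m" for k
   using image_borel[OF c, of "B \<inter> E k"] B E(1) that by auto
  have inj: "inj_on (snd c) (fst c)" using chart_inv_snd[OF c] by (metis inj_onI)
  have disj: "disjoint_family_on ?N {..<m}"
  proof (unfold disjoint_family_on_def, intro ballI impI)
   fix i j :: nat assume "i : {..<m}" "j : {..<m}" "i ~= j"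
   then have "E i \<inter> E j = {}" using E(2) by (auto simp: disjoint_family_on_def)
   then show "?N i \<inter> ?N j = {}" using inj B(2) by (auto dest!: inj_onD)
  qed
  have U: "(\<Union>k<m. ?N k) = snd c ` B" using E(3) B(2) chart_subset[OF c] by blast
  have "emeasure \<nu> B = (\<Sum>k<m. \<integral>\<^sup>+x\<in>snd (e k) ` (B \<inter> E k). ennreal (r (e k) x) \<partial>lborel)"
   unfolding em[OF BS] \<mu>_def ..
  also have "... = (\<Sum>k<m. \<integral>\<^sup>+x\<in>?N k. ennreal (r c x) \<partial>lborel)"
   by (rule sum.cong[OF refl], rule density_change[OF r]) (use E(1) c B in auto)
  also have "... = (\<integral>\<^sup>+x. (\<Sum>k<m. ennreal (r c x) * indicator (?N k) x) \<partial>lborel)"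
   by (rule nn_integral_sum[symmetric]) (use density_nn_borel[OF r c N] in simp)
  also have "... = (\<integral>\<^sup>+x\<in>(\<Union>k<m. ?N k). ennreal (r c x) \<partial>lborel)"
   by (rule nn_integral_cong) (simp add: indicator_UN_disjoint[OF _ disj] sum_distrib_left)
  finally show ?thesis unfolding U .
 qed
 then have "chart_measure \<nu> r" unfolding chart_measure_def using sets S_def by blast
 then show ?thesis ..
qed

text \<open>Restricted to a chart, the measure is the image of a measure on coordinate space. The
  map has to be total with values in the manifold; \<open>p0\<close> is a default value outside the
  coordinate domain, where the density vanishes.\<close>

lemma chart_measure_density:
 assumes r: "density_law r" and \<nu>: "chart_measure \<nu> r" and c: "c : A" and p0: "p0 : fst c"
 defines "\<psi> == %x. if x : chart_image c then chart_inv c x else p0"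
 defines "D == density lborel (%x. ennreal (indicator (chart_image c) x * r c x))"
 shows "\<psi> : measurable D \<nu>" "density \<nu> (indicator (fst c)) = distr D \<nu> \<psi>"
proof -
 have sets\<nu>: "sets \<nu> = sets (restrict_space borel M)" using \<nu> by (simp add: chart_measure_def)
 have sp\<nu>: "space \<nu> = M" using sets_eq_imp_space_eq[OF sets\<nu>] by (simp add: space_restrict_space)
 have SB: "B : sets \<nu> \<longleftrightarrow> B : sets borel & B \<subseteq> M" for B
  by (simp add: sets\<nu> sets_restrict_space_iff conj_commute)
 have op: "open (chart_image c)" by (rule open_chart_image[OF c])
 have pre: "\<psi> -` B \<inter> chart_image c = snd c ` (B \<inter> fst c)" for B
 proof -
  have "\<psi> -` B \<inter> chart_image c = chart_image c \<inter> chart_inv c -` (B \<inter> fst c)"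
   using chart_inv_in[OF c] by (auto simp: \<psi>_def)
  then show ?thesis using image_eq_vimage[OF c, of "B \<inter> fst c"] by simp
 qed
 have meas: "\<psi> -` B : sets borel" if "B : sets borel" for B
 proof -
  have "\<psi> -` B = snd c ` (B \<inter> fst c) \<union> (if p0 : B then - chart_image c else {})"
   unfolding pre[symmetric] by (auto simp: \<psi>_def split: if_splits)
  moreover have "snd c ` (B \<inter> fst c) : sets borel" using image_borel[OF c, of "B \<inter> fst c"] that chart_borel[OF c] by simp
  moreover have "- chart_image c : sets borel" using op by (simp add: Compl_eq_Diff_UNIV sets.Diff)
  ultimately show ?thesis by (cases "p0 : B") auto
 qed
 show m: "\<psi> : measurable D \<nu>"
 proof (rule measurableI)
  show "\<psi> x : space \<nu>" for x
   unfolding sp\<nu> using chart_subset[OF c] p0 chart_inv_in[OF c, of x] by (auto simp: \<psi>_def)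
  show "\<psi> -` B \<inter> space D : sets D" if "B : sets \<nu>" for B using meas[of B] that SB by (simp add: D_def)
 qed
 show "density \<nu> (indicator (fst c)) = distr D \<nu> \<psi>"
 proof (rule measure_eqI)
  fix B assume "B : sets (density \<nu> (indicator (fst c)))"
  then have B: "B : sets \<nu>" by simp
  then have Bb: "B : sets borel" using SB by blast
  have fc: "fst c : sets \<nu>" using SB chart_borel[OF c] chart_subset[OF c] by blast
  have "emeasure (density \<nu> (indicator (fst c))) B = emeasure \<nu> (B \<inter> fst c)"
  proof -
   have "emeasure (density \<nu> (indicator (fst c))) B = (\<integral>\<^sup>+p. indicator (fst c) p * indicator B p \<partial>\<nu>)"
    by (rule emeasure_density) (use B fc in auto)
   also have "... = (\<integral>\<^sup>+p. indicator (B \<inter> fst c) p \<partial>\<nu>)"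
    by (rule nn_integral_cong) (auto split: split_indicator)
   finally show ?thesis using B fc by simp
  qed
  also have "... = (\<integral>\<^sup>+x\<in>snd c ` (B \<inter> fst c). ennreal (r c x) \<partial>lborel)"
   using \<nu> c Bb chart_borel[OF c] unfolding chart_measure_def by (meson inf_le2 sets.Int)
  also have "... = (\<integral>\<^sup>+x. ennreal (indicator (chart_image c) x * r c x) * indicator (\<psi> -` B) x \<partial>lborel)"
   unfolding pre[symmetric] by (rule nn_integral_cong) (auto split: split_indicator)
  also have "... = emeasure D (\<psi> -` B)"
   unfolding D_def by (rule emeasure_density[symmetric]) (use density_borel[OF r c] meas[OF Bb] in auto)
  also have "... = emeasure (distr D \<nu> \<psi>) B"
   using m B by (simp add: emeasure_distr D_def)
  finally show "emeasure (density \<nu> (indicator (fst c))) B = emeasure (distr D \<nu> \<psi>) B" .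
 qed simp
qed

lemma chart_measure_space: "chart_measure \<nu> r ==> space \<nu> = M"
 using sets_eq_imp_space_eq[of \<nu> "restrict_space borel M"] by (simp add: chart_measure_def space_restrict_space)

lemma chart_measure_sets: "chart_measure \<nu> r ==> B : sets borel ==> B \<subseteq> M ==> B : sets \<nu>"
 by (simp add: chart_measure_def sets_restrict_space_iff)

lemma continuous_on_measurable:
 "chart_measure \<nu> r ==> continuous_on M F ==> F : borel_measurable \<nu>"
 using borel_measurable_continuous_on_restrict[of M F] measurable_cong_sets[of \<nu> "restrict_space borel M" borel borel]
 by (auto simp: chart_measure_def)

lemma chart_measure_nn_integral:
 assumes r: "density_law r" and \<nu>: "chart_measure \<nu> r" and c: "c : A"
  and F: "F : borel_measurable \<nu>"
 shows "(\<integral>\<^sup>+p. F p * indicator (fst c) p \<partial>\<nu>) =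
  (\<integral>\<^sup>+x. ennreal (indicator (chart_image c) x * r c x) * F (chart_inv c x) \<partial>lborel)"
proof (cases "fst c = {}")
 case False
 then obtain p0 where p0: "p0 : fst c" by blast
 note D = chart_measure_density[OF r \<nu> c p0]
 have fc: "fst c : sets \<nu>" using chart_measure_sets[OF \<nu>] chart_borel[OF c] chart_subset[OF c] by blast
 have "(\<integral>\<^sup>+p. F p * indicator (fst c) p \<partial>\<nu>) = (\<integral>\<^sup>+p. F p \<partial>density \<nu> (indicator (fst c)))"
  using F fc by (subst nn_integral_density) (auto simp: mult.commute)
 also have "... = (\<integral>\<^sup>+x. F (if x : chart_image c then chart_inv c x else p0)
   \<partial>density lborel (%x. ennreal (indicator (chart_image c) x * r c x)))"
  unfolding D(2) by (rule nn_integral_distr[OF D(1)]) (simp add: F)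
 also have "... = (\<integral>\<^sup>+x. ennreal (indicator (chart_image c) x * r c x) * F (if x : chart_image c then chart_inv c x else p0) \<partial>lborel)"
  using density_borel[OF r c] measurable_compose[OF D(1) F]
  by (subst nn_integral_density) (auto cong: measurable_cong_sets)
 also have "... = (\<integral>\<^sup>+x. ennreal (indicator (chart_image c) x * r c x) * F (chart_inv c x) \<partial>lborel)"
  by (rule nn_integral_cong) (auto split: split_indicator)
 finally show ?thesis .
qed simp

lemma chart_measure_integral:
 fixes F :: "'a => real"
 assumes r: "density_law r" and \<nu>: "chart_measure \<nu> r" and c: "c : A"
  and F: "F : borel_measurable \<nu>" and supp: "!!p. p : M ==> p ~: fst c ==> F p = 0"
 shows "(\<integral>p. F p \<partial>\<nu>) = (LINT x|lborel. indicator (chart_image c) x * (r c x * F (chart_inv c x)))"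
proof (cases "fst c = {}")
 case False
 then obtain p0 where p0: "p0 : fst c" by blast
 note D = chart_measure_density[OF r \<nu> c p0]
 have fc: "fst c : sets \<nu>" using chart_measure_sets[OF \<nu>] chart_borel[OF c] chart_subset[OF c] by blast
 have "(\<integral>p. F p \<partial>\<nu>) = (\<integral>p. indicator (fst c) p *\<^sub>R F p \<partial>\<nu>)"
  by (rule LINT_cong)
   (use supp chart_measure_space[OF \<nu>] in \<open>auto split: split_indicator\<close>)
 also have "... = (\<integral>p. F p \<partial>density \<nu> (%p. ennreal (indicator (fst c) p)))"
  using F fc by (subst integral_density) auto
 also have "... = (\<integral>p. F p \<partial>density \<nu> (indicator (fst c)))"
  by (simp add: ennreal_indicator)
 also have "... = (\<integral>x. F (if x : chart_image c then chart_inv c x else p0)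
   \<partial>density lborel (%x. ennreal (indicator (chart_image c) x * r c x)))"
  unfolding D(2) by (rule integral_distr[OF D(1) F])
 also have "... = (LINT x|lborel. (indicator (chart_image c) x * r c x) *\<^sub>R F (if x : chart_image c then chart_inv c x else p0))"
 proof (rule integral_density)
  show "AE x in lborel. 0 <= indicator (chart_image c) x * r c x"
   using r c by (intro AE_I2) (auto simp: density_law_def split: split_indicator)
 qed (use density_borel[OF r c] measurable_compose[OF D(1) F] in \<open>auto cong: measurable_cong_sets\<close>)
 also have "... = (LINT x|lborel. indicator (chart_image c) x * (r c x * F (chart_inv c x)))"
  by (rule LINT_cong) (auto split: split_indicator)
 finally show ?thesis .
next
 case True
 then have "(\<integral>p. F p \<partial>\<nu>) = (\<integral>p. 0 \<partial>\<nu>)"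
  using supp chart_measure_space[OF \<nu>] by (intro LINT_cong) auto
 then show ?thesis using True by simp
qed

lemma chart_ball:
 assumes "p : M"
 obtains c R where "c : A" "p : fst c" "0 < R" "cball (snd c p) R \<subseteq> chart_image c"
proof -
 obtain c where c: "c : A" "p : fst c" using chart_union assms by blast
 moreover obtain R where "0 < R" "cball (snd c p) R \<subseteq> chart_image c"
  using open_contains_cball[of "chart_image c"] open_chart_image[OF c(1)] snd_in[OF c(2)] by blast
 ultimately show ?thesis using that by blast
qed

lemma chart_measure_finite:
 assumes r: "density_law r" and \<nu>: "chart_measure \<nu> r"
 shows "finite_measure \<nu>"
proof
 have "EX O'. open O' & p : O' & emeasure \<nu> (M \<inter> O') < \<infinity>" if p: "p : M" for p
 proof -
  obtain c R where c: "c : A" "p : fst c" and R: "0 < R" "cball (snd c p) R \<subseteq> chart_image c" using chart_ball[OF p] .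
  have "openin (top_of_set (fst c)) (fst c \<inter> snd c -` ball (snd c p) R)"
   by (rule continuous_openin_preimage_gen[OF chart_continuous[OF c(1)] open_ball])
  then have "openin (top_of_set M) (fst c \<inter> snd c -` ball (snd c p) R)"
   using chart_openin[OF c(1)] openin_trans by blast
  then obtain O' where O': "open O'" "M \<inter> O' = fst c \<inter> snd c -` ball (snd c p) R" unfolding openin_open by blast
  have sub: "M \<inter> O' \<subseteq> fst c" using O'(2) by blast
  have N: "snd c ` (M \<inter> O') \<subseteq> cball (snd c p) R" using O'(2) by auto
  have "continuous_on (cball (snd c p) R) (r c)" by (rule continuous_on_subset[OF density_law_continuous[OF r c(1)] R(2)])
  then have "compact (r c ` cball (snd c p) R)" using compact_continuous_image compact_cball by blast
  then obtain b where b: "!!x. x : cball (snd c p) R ==> r c x <= b"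
   using compact_imp_bounded bounded_imp_bdd_above unfolding bdd_above_def by (metis image_eqI)
  have "M \<inter> O' : sets borel" using O'(1) M_borel by simp
  then have "emeasure \<nu> (M \<inter> O') = (\<integral>\<^sup>+x\<in>snd c ` (M \<inter> O'). ennreal (r c x) \<partial>lborel)"
   using \<nu> c(1) sub unfolding chart_measure_def by blast
  also have "... <= (\<integral>\<^sup>+x\<in>cball (snd c p) R. ennreal b \<partial>lborel)"
   by (rule nn_integral_mono) (use N b in \<open>auto split: split_indicator intro: ennreal_leI\<close>)
  also have "... = ennreal b * emeasure lborel (cball (snd c p) R)" by (simp add: nn_integral_cmult_indicator)
  also have "... < \<infinity>" using emeasure_lborel_cball_finite[of "snd c p" R] by (simp add: ennreal_mult_less_top)
  finally show ?thesis using O' p c R(1) by (intro exI[of _ O']) auto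
 qed
 then have "ALL p:M. EX O'. open O' & p : O' & emeasure \<nu> (M \<inter> O') < \<infinity>" by blast
 from bchoice[OF this] obtain O' where O': "ALL p:M. open (O' p) & p : O' p & emeasure \<nu> (M \<inter> O' p) < \<infinity>" ..
 have cov: "M \<subseteq> (UN p:M. O' p)" using O' by blast
 obtain C where C: "C \<subseteq> M" "finite C" "M \<subseteq> (UN p:C. O' p)"
  by (rule compactE_image[OF compact_M _ cov]) (use O' in blast)+
 have "emeasure \<nu> (UN p:C. M \<inter> O' p) <= (SUM p:C. emeasure \<nu> (M \<inter> O' p))"
  by (rule emeasure_subadditive_finite[OF C(2)])
   (use O' C(1) M_borel in \<open>auto intro!: chart_measure_sets[OF \<nu>]\<close>)
 also have "... < \<infinity>" using O' C(1,2) by (auto simp: less_top)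
 also have "(UN p:C. M \<inter> O' p) = space \<nu>" using C(3) chart_measure_space[OF \<nu>] by blast
 finally show "emeasure \<nu> (space \<nu>) ~= \<infinity>" by simp
qed

text \<open>Turns vanishing integrals into pointwise identities: a continuous nonnegative function
  that is zero almost everywhere is zero, because the chart density is positive and nonempty open
  sets have positive Lebesgue measure.\<close>

lemma chart_measure_zero:
 assumes r: "density_law r" and \<nu>: "chart_measure \<nu> r" and c: "c : A"
  and pos: "!!x. x : chart_image c ==> r c x > 0"
  and F: "continuous_on M F" "!!p. p : M ==> 0 <= (F p :: real)" and zero: "(\<integral>p. F p \<partial>\<nu>) = 0" and p: "p : fst c"
 shows "F p = 0"
proof -
 interpret finite_measure \<nu> by (rule chart_measure_finite[OF r \<nu>])
 have Fm: "F : borel_measurable \<nu>" by (rule continuous_on_measurable[OF \<nu> F(1)])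
 have "compact (F ` M)" using compact_continuous_image[OF F(1) compact_M] .
 then obtain b where b: "!!p. p : M ==> norm (F p) <= b" using compact_imp_bounded bounded_iff by (metis imageI)
 have int: "integrable \<nu> F"
  by (rule integrable_const_bound[of _ b]) (use b Fm chart_measure_space[OF \<nu>] in auto)
 have "AE p in \<nu>. 0 <= F p" using F(2) chart_measure_space[OF \<nu>] by (intro AE_I2) simp
 then have "AE p in \<nu>. F p = 0" using integral_nonneg_eq_0_iff_AE[OF int] zero by simp
 then have "(\<integral>\<^sup>+p. ennreal (F p) * indicator (fst c) p \<partial>\<nu>) = (\<integral>\<^sup>+p. 0 \<partial>\<nu>)"
  by (intro nn_integral_cong_AE) (auto elim!: eventually_mono)
 then have 1: "(\<integral>\<^sup>+x. ennreal (indicator (chart_image c) x * r c x) * ennreal (F (chart_inv c x)) \<partial>lborel) = 0"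
  using chart_measure_nn_integral[OF r \<nu> c, of "%p. ennreal (F p)"] Fm by simp
 have inM: "chart_inv c x : M" if "x : chart_image c" for x
  using chart_inv_in[OF c that] chart_subset[OF c] by blast
 have "(\<integral>\<^sup>+x. ennreal (indicator (chart_image c) x * (r c x * F (chart_inv c x))) \<partial>lborel) =
  (\<integral>\<^sup>+x. ennreal (indicator (chart_image c) x * r c x) * ennreal (F (chart_inv c x)) \<partial>lborel)"
  by (rule nn_integral_cong) (use density_law_nonneg[OF r c] F(2) inM in \<open>auto split: split_indicator simp: ennreal_mult\<close>)
 with 1 have 2: "(\<integral>\<^sup>+x. ennreal (indicator (chart_image c) x * (r c x * F (chart_inv c x))) \<partial>lborel) = 0" by simp
 have "r c (snd c p) * F (chart_inv c (snd c p)) = 0"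
 proof (rule continuous_nonneg_zero_lborel[OF open_chart_image[OF c] _ _ 2 snd_in[OF p]])
  show "continuous_on (chart_image c) (%x. r c x * F (chart_inv c x))"
   by (intro continuous_on_mult density_law_continuous[OF r c] continuous_on_compose2[OF F(1) chart_inv_continuous[OF c]])
    (use inM in auto)
  show "0 <= r c x * F (chart_inv c x)" if "x : chart_image c" for x
   using density_law_nonneg[OF r c that] F(2)[OF inM[OF that]] by simp
 qed
 then show ?thesis using pos[OF snd_in[OF p]] chart_inv_snd[OF c p] by simp
qed

end

subsection \<open>Transformation laws\<close>

context closed_manifold
begin

lemma jac_inverse:
 assumes c: "c : A" and d: "d : A" and x: "x : overlap c d"
 shows "jac d c (trans c d x) (jac c d x v) = v" "jac c d x (jac d c (trans c d x) v) = v"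
proof -
 have *: "jac d c (trans c d x) (jac c d x v) = v" if c: "c : A" and d: "d : A" and x: "x : overlap c d" for c d x v
 proof -
  have "((%y. trans d c (trans c d y)) has_derivative (%v. jac d c (trans c d x) (jac c d x v))) (at x)"
   using diff_chain_at[OF trans_has_derivative[OF c d x] trans_has_derivative[OF d c trans_overlap[OF c d x]]]
   by (simp only: o_def)
  then have "((%y. y) has_derivative (%v. jac d c (trans c d x) (jac c d x v))) (at x)"
   by (rule has_derivative_transform_within_open[OF _ open_overlap[OF c d] x]) (rule trans_trans[OF c d])
  then have "(%v. jac d c (trans c d x) (jac c d x v)) = (%v. v)"
   by (rule has_derivative_unique) (rule has_derivative_ident)
  then show ?thesis by (rule fun_cong)
 qed
 show "jac d c (trans c d x) (jac c d x v) = v" by (rule *[OF c d x])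
 show "jac c d x (jac d c (trans c d x) v) = v"
  using *[OF d c trans_overlap[OF c d x], of v] trans_trans[OF c d x] by (simp only:)
qed

lemma linear_jac: "c : A ==> d : A ==> x : overlap c d ==> linear (jac c d x)"
 using has_derivative_linear[OF trans_has_derivative] .

lemma jac_matrix: "c : A ==> d : A ==> x : overlap c d ==> jac c d x v = matrix (jac c d x) *v v"
 using matrix_works[of "jac c d x" v] linear_jac[of c d x] by (simp only: linear_matrix_vector_mul_eq)

lemma det_jac_nonzero:
 assumes c: "c : A" and d: "d : A" and x: "x : overlap c d"
 shows "det (matrix (jac c d x)) ~= 0"
proof -
 let ?J = "matrix (jac c d x)" and ?K = "matrix (jac d c (trans c d x))"
 have "?K *v (?J *v v) = v" for v
  using jac_inverse(1)[OF c d x, of v] jac_matrix[OF c d x] jac_matrix[OF d c trans_overlap[OF c d x]] by metis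
 then have "?K ** ?J = mat 1" by (simp add: matrix_eq matrix_vector_mul_assoc)
 then have "det ?K * det ?J = 1" by (metis det_I det_mul)
 then show ?thesis by auto
qed

lemma pderiv_pullback:
 assumes c: "c : A" and d: "d : A" and x: "x : overlap c d" and F: "F differentiable (at (trans c d x))"
 shows "pderiv_coord i (%y. F (trans c d y)) x = (SU k. pderiv_coord k F (trans c d x) * matrix (jac c d x) $ k $ i)"
proof -
 let ?y = "trans c d x"
 let ?D = "frechet_derivative F (at ?y)"
 have D: "(F has_derivative ?D) (at ?y)" using F frechet_derivative_works by blast
 have "((%y. F (trans c d y)) has_derivative (%v. ?D (jac c d x v))) (at x)"
  using diff_chain_at[OF trans_has_derivative[OF c d x] D] by (simp only: o_def)
 from pderiv_coord_eq[OF this, of i]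
 have 1: "pderiv_coord i (%y. F (trans c d y)) x = ?D (jac c d x (axis i 1))" .
 have "jac c d x (axis i 1) = (SU k. matrix (jac c d x) $ k $ i *\<^sub>R axis k 1)"
  using basis_expansion[of "jac c d x (axis i 1)"] by (simp add: matrix_def scalar_mult_eq_scaleR)
 then have "?D (jac c d x (axis i 1)) = (SU k. matrix (jac c d x) $ k $ i * ?D (axis k 1))"
  unfolding linear_sum[OF has_derivative_linear[OF D]] linear_cmul[OF has_derivative_linear[OF D]]
  by (simp only: linear_sum[OF has_derivative_linear[OF D]] linear_cmul[OF has_derivative_linear[OF D]] real_scaleR_def)
 then show ?thesis unfolding 1 by (simp add: pderiv_coord_def mult.commute)
qed

lemma pullback_differentiable:
 assumes c: "c : A" and d: "d : A" and x: "x : overlap c d" and F: "F differentiable (at (trans c d x))"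
 shows "(%y. F (trans c d y)) differentiable (at x)"
proof -
 have "(F has_derivative frechet_derivative F (at (trans c d x))) (at (trans c d x))" using F frechet_derivative_works by blast
 from diff_chain_at[OF trans_has_derivative[OF c d x] this] show ?thesis
  unfolding differentiable_def o_def by blast
qed

lemma coord_trans:
 assumes "c : A" "d : A" "x : overlap c d"
 shows "coord c u x = coord d u (trans c d x)"
 using assms by (auto simp: coord_def chart_inv_snd)

end

lemma bil_matrix_eqI:
 assumes "!!v w. bil S v w = bil S' v w" shows "S = (S' :: real^'n^'n)"
proof -
 have "S $ i $ j = S' $ i $ j" for i j
  using assms[of "axis i 1" "axis j 1"]
  by (simp add: bil_def inner_axis' matrix_vector_mult_basis column_def)
 then show ?thesis by (simp add: vec_eq_iff)
qed

lemma bil_congruence: "bil S (J *v v) (J *v w) = bil (transpose J ** S ** J) v w"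
 unfolding bil_def by (simp add: matrix_vector_mul_assoc[symmetric] dot_lmul_matrix[symmetric] transpose_matrix_vector
  del: matrix_vector_mul_assoc)
  (metis dot_lmul_matrix transpose_matrix_vector inner_commute)

text \<open>The inverse metric transforms with the inverse Jacobian, opposite to a covariant tensor,
  so the Jacobians cancel under traces.\<close>

lemma trace_conj:
 fixes J :: "real^'n^'n"
 assumes J: "det J ~= 0" and G: "det Gd ~= 0" "Gc = transpose J ** Gd ** J"
 shows "matrix_inv Gc = matrix_inv J ** matrix_inv Gd ** transpose (matrix_inv J)"
proof -
 let ?K = "matrix_inv J"
 have JK: "J ** ?K = mat 1" "?K ** J = mat 1" using matrix_inv_right[OF J] matrix_inv_left[OF J] .
 have tJK: "transpose ?K ** transpose J = mat 1" "transpose J ** transpose ?K = mat 1"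
  using JK by (metis matrix_transpose_mul transpose_mat)+
 have Gi: "Gd ** matrix_inv Gd = mat 1" using matrix_inv_right[OF G(1)] .
 have "det Gc ~= 0" using J G by (simp add: det_mul)
 have "Gc ** (?K ** matrix_inv Gd ** transpose ?K) = transpose J ** (Gd ** ((J ** ?K) ** matrix_inv Gd)) ** transpose ?K"
  unfolding G(2) by (simp add: matrix_mul_assoc)
 also have "... = mat 1" by (simp add: JK Gi tJK)
 finally have 1: "Gc ** (?K ** matrix_inv Gd ** transpose ?K) = mat 1" .
 have "matrix_inv Gc = matrix_inv Gc ** (Gc ** (?K ** matrix_inv Gd ** transpose ?K))" by (simp add: 1)
 also have "... = ?K ** matrix_inv Gd ** transpose ?K"
  using matrix_inv_left[OF \<open>det Gc ~= 0\<close>] by (simp add: matrix_mul_assoc)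
 finally show ?thesis .
qed

lemma tensor_trace_eq_trace: "tensor_trace B S = trace (matrix_inv B ** transpose S)"
 by (simp add: tensor_trace_def trace_def matrix_matrix_mult_def transpose_def)

lemma tensor_trace_conj:
 fixes J :: "real^'n^'n"
 assumes J: "det J ~= 0" and G: "det Gd ~= 0" "Gc = transpose J ** Gd ** J" and S: "Sc = transpose J ** Sd ** J"
 shows "tensor_trace Gc Sc = tensor_trace Gd Sd"
proof -
 let ?K = "matrix_inv J"
 have tJK: "transpose ?K ** transpose J = mat 1" using matrix_inv_right[OF J] by (metis matrix_transpose_mul transpose_mat)
 have "matrix_inv Gc ** transpose Sc = ?K ** (matrix_inv Gd ** ((transpose ?K ** transpose J) ** (transpose Sd ** J)))"
  unfolding trace_conj[OF J G] S by (simp add: matrix_transpose_mul matrix_mul_assoc)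
 also have "... = ?K ** (matrix_inv Gd ** (transpose Sd ** J))" unfolding tJK by simp
 finally have "tensor_trace Gc Sc = trace ((matrix_inv Gd ** (transpose Sd ** J)) ** ?K)"
  unfolding tensor_trace_eq_trace by (simp only: trace_mul_sym[of ?K])
 also have "(matrix_inv Gd ** (transpose Sd ** J)) ** ?K = matrix_inv Gd ** (transpose Sd ** (J ** ?K))"
  by (simp add: matrix_mul_assoc)
 finally show ?thesis using matrix_inv_right[OF J] by (simp add: tensor_trace_eq_trace)
qed

text \<open>Written as a trace of a covariant tensor, the norm inherits its chart independence from
  that of the trace.\<close>

lemma tensor_norm2_eq_trace: "tensor_norm2 B S = tensor_trace B (S ** matrix_inv B ** transpose S)"
proof -
 have "tensor_trace B (S ** matrix_inv B ** transpose S) =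
  (SU i k l j. matrix_inv B $ i $ k * (S $ i $ j * matrix_inv B $ j $ l * S $ k $ l))"
  by (simp add: tensor_trace_def matrix_matrix_mult_def transpose_def sum_distrib_left sum_distrib_right)
 also have "... = (SU i j k l. matrix_inv B $ i $ k * (S $ i $ j * matrix_inv B $ j $ l * S $ k $ l))"
  by (rule sum.cong[OF refl], rule sum3_rotate)
 finally show ?thesis unfolding tensor_norm2_def by (simp add: mult.assoc mult.left_commute)
qed

lemma tensor_norm2_conj:
 fixes J :: "real^'n^'n"
 assumes J: "det J ~= 0" and G: "det Gd ~= 0" "Gc = transpose J ** Gd ** J" and S: "Sc = transpose J ** Sd ** J"
 shows "tensor_norm2 Gc Sc = tensor_norm2 Gd Sd"
proof -
 let ?K = "matrix_inv J"
 have JK: "J ** ?K = mat 1" using matrix_inv_right[OF J] .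
 have tJK: "transpose ?K ** transpose J = mat 1" using JK by (metis matrix_transpose_mul transpose_mat)
 have "Sc ** matrix_inv Gc ** transpose Sc =
  transpose J ** (Sd ** ((J ** ?K) ** (matrix_inv Gd ** ((transpose ?K ** transpose J) ** (transpose Sd ** J)))))"
  unfolding trace_conj[OF J G] S by (simp add: matrix_transpose_mul matrix_mul_assoc)
 also have "... = transpose J ** (Sd ** matrix_inv Gd ** transpose Sd) ** J"
  by (simp add: JK tJK matrix_mul_assoc)
 finally show ?thesis unfolding tensor_norm2_eq_trace by (rule tensor_trace_conj[OF J G])
qed

lemma local_metric_subset:
 assumes "local_metric U G" "open V" "V \<subseteq> U" shows "local_metric V G"
proof -
 interpret local_metric U G by fact
 show ?thesis
  by unfold_locales (use assms G_smooth G_sym G_pos smooth_on_subset in \<open>blast+\<close>)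
qed

subsection \<open>The weighted volume\<close>

locale metric_flow = closed_manifold M A
 for M :: "'a::t2_space set" and A :: "('a, 'n::finite) chart set" +
 fixes T :: real and g :: "real => ('a, 'n) tensor2" and \<phi> :: "real => 'a => real"
 assumes T_pos: "0 < T" and g_smooth: "smooth_metrics A T g"
  and phi_smooth: "smooth_functions A {0..T} \<phi>" and conjugate: "conjugate_potential A T g \<phi>"
begin

lemma g_tensor: "t : {0..T} ==> tensor_law A (g t)"
 and g_sym: "t : {0..T} ==> c : A ==> x : chart_image c ==> transpose (g t c x) = g t c x"
 and g_pos: "t : {0..T} ==> c : A ==> x : chart_image c ==> v ~= 0 ==> bil (g t c x) v v > 0"
 and g_smooth_matrix: "c : A ==> smooth_on ({0..T} \<times> chart_image c) (%(t, x). g t c x)"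
 using g_smooth unfolding smooth_metrics_def riemannian_metric_def by blast+

lemma g_smooth_comp: "c : A ==> smooth_on ({0..T} \<times> chart_image c) (%(t, x). g t c x $ i $ j)"
proof -
 assume c: "c : A"
 have bl: "bounded_linear (%S :: real^'n^'n. S $ i $ j)"
  by (rule bounded_linear_compose[OF bounded_linear_vec_nth bounded_linear_vec_nth])
 have "smooth_on ({0..T} \<times> chart_image c) (%p. (case p of (t, x) => g t c x) $ i $ j)"
  by (rule smooth_on_bounded_linear_compose[OF bl g_smooth_matrix[OF c]])
 then show ?thesis by (simp add: case_prod_unfold)
qed

lemma smooth_on_slice:
 "smooth_on (I \<times> U) (%(t, x). f t x) ==> t : I ==> smooth_on U (f t)"
 unfolding smooth_on_def using Ck_on_spacetime_slice by blast

lemma local_metric_g: "t : {0..T} ==> c : A ==> local_metric (chart_image c) (g t c)"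
proof
 assume t: "t : {0..T}" and c: "c : A"
 show "smooth_on (chart_image c) (%x. g t c x $ i $ j)" for i j
  using smooth_on_slice[OF g_smooth_comp[OF c] t] .
qed (use open_chart_image g_sym g_pos in auto)

lemma phi_chart_smooth: "t : {0..T} ==> c : A ==> smooth_on (chart_image c) (coord c (\<phi> t))"
 using phi_smooth smooth_on_slice[of "{0..T}" "chart_image c" "%t. coord c (\<phi> t)"] unfolding smooth_functions_def by blast

lemma g_congruence:
 assumes t: "t : {0..T}" and c: "c : A" and d: "d : A" and x: "x : overlap c d"
 shows "g t c x = transpose (matrix (jac c d x)) ** g t d (trans c d x) ** matrix (jac c d x)"
proof (rule bil_matrix_eqI)
 fix v w
 obtain p where p: "p : fst c \<inter> fst d" "x = snd c p" using x by blast
 have "bil (g t c (snd c p)) v w = bil (g t d (snd d p)) (jac c d x v) (jac c d x w)"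
  using g_tensor[OF t] c d p unfolding tensor_law_def Let_def by blast
 moreover have "snd d p = trans c d x" using p chart_inv_snd[OF c] by simp
 ultimately have "bil (g t c x) v w = bil (g t d (trans c d x)) (jac c d x v) (jac c d x w)"
  using p(2) by (simp only:)
 also have "... = bil (g t d (trans c d x)) (matrix (jac c d x) *v v) (matrix (jac c d x) *v w)"
  by (simp only: jac_matrix[OF c d x, symmetric])
 finally show "bil (g t c x) v w = bil (transpose (matrix (jac c d x)) ** g t d (trans c d x) ** matrix (jac c d x)) v w"
  by (simp only: bil_congruence)
qed

definition rho :: "real => ('a, 'n) chart => real^'n => real" where
 "rho t c x = exp (- coord c (\<phi> t) x) * sqrt (det (g t c x))"

lemma det_g_pos: "t : {0..T} ==> c : A ==> x : chart_image c ==> det (g t c x) > 0"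
 using local_metric.det_pos[OF local_metric_g] .

lemma rho_pos: "t : {0..T} ==> c : A ==> x : chart_image c ==> rho t c x > 0"
 by (simp add: rho_def det_g_pos)

lemma rho_smooth: "t : {0..T} ==> c : A ==> smooth_on (chart_image c) (rho t c)"
 unfolding rho_def[abs_def] using local_metric.G_smooth[OF local_metric_g]
 by (intro smooth_on_intros smooth_on_sqrt smooth_on_det phi_chart_smooth det_g_pos)

lemma overlap_subset: "overlap c d \<subseteq> chart_image c" by blast

lemma density_law_sqrt:
 assumes t: "t : {0..T}" shows "density_law (%c x. sqrt (det (g t c x)))"
 unfolding density_law_def
proof (intro conjI ballI)
 fix c assume c: "c : A"
 have "smooth_on (chart_image c) (%x. sqrt (det (g t c x)))"
  using local_metric.G_smooth[OF local_metric_g[OF t c]] det_g_pos[OF t c] by (intro smooth_on_sqrt smooth_on_det)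
 then show "continuous_on (chart_image c) (%x. sqrt (det (g t c x)))" by (rule smooth_on_imp_continuous_on)
 show "0 <= sqrt (det (g t c x))" if "x : chart_image c" for x using det_g_pos[OF t c that] by simp
 fix d x assume d: "d : A" and x: "x : overlap c d"
 have "det (g t c x) = (det (matrix (jac c d x)))\<^sup>2 * det (g t d (trans c d x))"
  by (subst g_congruence[OF t c d x]) (simp add: det_mul power2_eq_square)
 then show "sqrt (det (g t c x)) = \<bar>det (matrix (jac c d x))\<bar> * sqrt (det (g t d (trans c d x)))"
  by (simp add: real_sqrt_mult)
qed

lemma density_law_rho:
 assumes t: "t : {0..T}" shows "density_law (rho t)"
 unfolding density_law_def
proof (intro conjI ballI)
 fix c assume c: "c : A"
 show "continuous_on (chart_image c) (rho t c)" by (rule smooth_on_imp_continuous_on[OF rho_smooth[OF t c]])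
 show "0 <= rho t c x" if "x : chart_image c" for x using rho_pos[OF t c that] by simp
 fix d x assume d: "d : A" and x: "x : overlap c d"
 have "sqrt (det (g t c x)) = \<bar>det (matrix (jac c d x))\<bar> * sqrt (det (g t d (trans c d x)))"
  using density_law_sqrt[OF t] c d x unfolding density_law_def by blast
 then show "rho t c x = \<bar>det (matrix (jac c d x))\<bar> * rho t d (trans c d x)"
  unfolding rho_def coord_trans[OF c d x] by simp
qed

lemma continuous_on_charts:
 fixes F :: "'a => 'b::topological_space"
 assumes "!!c. c : A ==> continuous_on (chart_image c) (coord c F)"
 shows "continuous_on M F"
proof -
 have 1: "continuous_on (fst c) F" if c: "c : A" for c
 proof (rule continuous_on_eq)
  show "continuous_on (fst c) (%p. coord c F (snd c p))"
   by (rule continuous_on_compose2[OF assms[OF c] chart_continuous[OF c]]) auto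
  show "coord c F (snd c p) = F p" if "p : fst c" for p using chart_inv_snd[OF c that] by (simp add: coord_def)
 qed
 show ?thesis
  unfolding continuous_on_eq_continuous_within
 proof
  fix p assume "p : M"
  then obtain c where c: "c : A" "p : fst c" using chart_union by blast
  obtain O' where O': "open O'" "fst c = M \<inter> O'" using chart_openin[OF c(1)] unfolding openin_open by blast
  have "at p within fst c = at p within M"
   using O' c(2) by (intro at_within_nhd[of p O']) auto
  then show "continuous (at p within M) F"
   using 1[OF c(1)] c(2) unfolding continuous_on_eq_continuous_within by metis
 qed
qed

lemma phi_continuous: "t : {0..T} ==> continuous_on M (\<phi> t)"
 by (rule continuous_on_charts) (rule smooth_on_imp_continuous_on[OF phi_chart_smooth])

lemma riemannian_volume_chart_measure:
 assumes t: "t : {0..T}"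
 shows "chart_measure (riemannian_volume M A (g t)) (%c x. sqrt (det (g t c x)))"
proof -
 have "EX! \<nu>. chart_measure \<nu> (%c x. sqrt (det (g t c x)))"
  using chart_measure_exists[OF density_law_sqrt[OF t]] chart_measure_unique by blast
 from theI'[OF this] show ?thesis
  unfolding riemannian_volume_def chart_measure_def .
qed

lemma weighted_volume_chart_measure:
 assumes t: "t : {0..T}"
 shows "chart_measure (weighted_volume M A g \<phi> t) (rho t)"
 unfolding chart_measure_def
proof (intro conjI ballI impI)
 let ?\<nu> = "riemannian_volume M A (g t)"
 note \<nu> = riemannian_volume_chart_measure[OF t]
 show "sets (weighted_volume M A g \<phi> t) = sets (restrict_space borel M)"
  using \<nu> by (simp add: weighted_volume_def chart_measure_def)
 fix c B assume c: "c : A" and B: "B : sets borel" "B \<subseteq> fst c"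
 have Bs: "B : sets ?\<nu>" using chart_measure_sets[OF \<nu> B(1)] B(2) chart_subset[OF c] by blast
 have phim: "\<phi> t : borel_measurable ?\<nu>" by (rule continuous_on_measurable[OF \<nu> phi_continuous[OF t]])
 have Fm: "(%p. ennreal (exp (- \<phi> t p)) * indicator B p) : borel_measurable ?\<nu>"
  using phim Bs by measurable
 have "emeasure (weighted_volume M A g \<phi> t) B = (\<integral>\<^sup>+p. ennreal (exp (- \<phi> t p)) * indicator B p \<partial>?\<nu>)"
  unfolding weighted_volume_def by (rule emeasure_density) (use phim Bs in auto)
 also have "... = (\<integral>\<^sup>+p. (ennreal (exp (- \<phi> t p)) * indicator B p) * indicator (fst c) p \<partial>?\<nu>)"
  by (rule nn_integral_cong) (use B(2) in \<open>auto split: split_indicator\<close>)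
 also have "... = (\<integral>\<^sup>+x. ennreal (indicator (chart_image c) x * sqrt (det (g t c x))) *
   (ennreal (exp (- \<phi> t (chart_inv c x))) * indicator B (chart_inv c x)) \<partial>lborel)"
  by (rule chart_measure_nn_integral[OF density_law_sqrt[OF t] \<nu> c Fm])
 also have "... = (\<integral>\<^sup>+x\<in>snd c ` B. ennreal (rho t c x) \<partial>lborel)"
  unfolding image_eq_vimage[OF c B(2)]
  by (rule nn_integral_cong)
   (use det_g_pos[OF t c] in \<open>auto simp: rho_def coord_def ennreal_mult[symmetric] mult.commute less_imp_le split: split_indicator\<close>)
 finally show "emeasure (weighted_volume M A g \<phi> t) B = (\<integral>\<^sup>+x\<in>snd c ` B. ennreal (rho t c x) \<partial>lborel)" .
qed

lemma T_interval: "time_interval T {0..T}" "time_interval T {0<..T}"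
 using T_pos by (auto simp: time_interval_def)

lemma g_comp_time_deriv:
 assumes t: "t : {0..T}" and c: "c : A" and x: "x : chart_image c"
 shows "((%s. g s c x $ i $ j) has_real_derivative metric_deriv T g t c x $ i $ j) (at t within {0..T})"
proof -
 have "((%s. g s c x) has_vector_derivative metric_deriv T g t c x) (at t within {0..T})"
  unfolding metric_deriv_def
  by (rule has_time_deriv[OF T_interval(1) open_chart_image[OF c] smooth_on_Ck[OF g_smooth_matrix[OF c]] t x])
 then have "((%s. g s c x $ i $ j) has_vector_derivative metric_deriv T g t c x $ i $ j) (at t within {0..T})"
  by (intro bounded_linear.has_vector_derivative[OF bounded_linear_vec_nth])
 then show ?thesis by (simp add: has_real_derivative_iff_has_vector_derivative)
qed

lemma phi_time_deriv:
 assumes t: "t : {0..T}" and c: "c : A" and x: "x : chart_image c"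
 shows "((%s. coord c (\<phi> s) x) has_real_derivative 1/2 * tensor_trace (g t c x) (metric_deriv T g t c x)) (at t within {0..T})"
proof -
 have "((%s. coord c (\<phi> s) x) has_vector_derivative time_deriv T (%s. coord c (\<phi> s) x) t) (at t within {0..T})"
  using phi_smooth c unfolding smooth_functions_def
  by (intro has_time_deriv[OF T_interval(1) open_chart_image[OF c] smooth_on_Ck t x, of "%s. coord c (\<phi> s)"]) blast
 moreover have "time_deriv T (%s. coord c (\<phi> s) x) t = 1/2 * tensor_trace (g t c x) (metric_deriv T g t c x)"
  using conjugate t c x unfolding conjugate_potential_def by blast
 ultimately show ?thesis by (simp add: has_real_derivative_iff_has_vector_derivative)
qed

text \<open>By Jacobi's formula the logarithmic derivative of the volume density is half the trace
  of the derivative of the metric, exactly what the equation for the potential subtracts.\<close>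

lemma rho_constant:
 assumes t: "t : {0..T}" and c: "c : A" and x: "x : chart_image c"
 shows "rho t c x = rho 0 c x"
proof -
 have "((%s. rho s c x) has_real_derivative 0) (at s within {0..T})" if s: "s : {0..T}" for s
 proof -
  let ?tr = "tensor_trace (g s c x) (metric_deriv T g s c x)"
  have pos: "det (g s c x) > 0" by (rule det_g_pos[OF s c x])
  have d: "((%s. det (g s c x)) has_real_derivative det (g s c x) * ?tr) (at s within {0..T})"
  proof -
   have "((%s. g s c x $ i $ j) has_derivative (%h. metric_deriv T g s c x $ i $ j * h)) (at s within {0..T})" for i j
    using g_comp_time_deriv[OF s c x] by (simp add: has_field_derivative_def)
   from det_has_derivative[OF this] pos
   have "((%s. det (g s c x)) has_derivative (%h. det (g s c x) *
    (SU i j. matrix_inv (g s c x) $ j $ i * (metric_deriv T g s c x $ i $ j * h)))) (at s within {0..T})"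
    by simp
   moreover have "det (g s c x) * (SU i j. matrix_inv (g s c x) $ j $ i * (metric_deriv T g s c x $ i $ j * h)) =
    det (g s c x) * ?tr * h" for h
    unfolding tensor_trace_def
    by (simp add: sum_distrib_left sum_distrib_right mult.assoc local_metric.gi_sym[OF local_metric_g[OF s c] x])
   ultimately show ?thesis unfolding has_field_derivative_def by (simp only:)
  qed
  have "((%s. sqrt (det (g s c x))) has_real_derivative inverse (sqrt (det (g s c x))) / 2 * (det (g s c x) * ?tr)) (at s within {0..T})"
   by (rule DERIV_chain2[OF DERIV_real_sqrt[OF pos] d])
  moreover have "((%s. exp (- coord c (\<phi> s) x)) has_real_derivative exp (- coord c (\<phi> s) x) * (- (1/2 * ?tr))) (at s within {0..T})"
   by (rule DERIV_chain2[OF DERIV_exp DERIV_minus[OF phi_time_deriv[OF s c x]]])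
  ultimately have "((%s. rho s c x) has_real_derivative
    exp (- coord c (\<phi> s) x) * (- (1/2 * ?tr)) * sqrt (det (g s c x)) +
    inverse (sqrt (det (g s c x))) / 2 * (det (g s c x) * ?tr) * exp (- coord c (\<phi> s) x)) (at s within {0..T})"
   unfolding rho_def[abs_def] by (intro DERIV_mult)
  moreover have e: "inverse (sqrt (det (g s c x))) / 2 * (det (g s c x) * ?tr) = sqrt (det (g s c x)) * ?tr / 2"
   using pos real_sqrt_mult_self[of "det (g s c x)"] by (simp add: field_simps)
  have "exp (- coord c (\<phi> s) x) * (- (1/2 * ?tr)) * sqrt (det (g s c x)) +
    inverse (sqrt (det (g s c x))) / 2 * (det (g s c x) * ?tr) * exp (- coord c (\<phi> s) x) = 0"
   unfolding e by simp
  ultimately show ?thesis by (simp only:)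
 qed
 then show ?thesis
  using has_field_derivative_zero_constant[of "{0..T}" "%s. rho s c x"] t T_pos
  by (metis atLeastAtMost_iff convex_real_interval(5) less_imp_le order_refl)
qed

text \<open>All integrals are taken against this one measure; by \<open>rho_constant\<close> it is
  the weighted volume at every time, so differentiating an integral in time never touches the
  measure.\<close>

definition mu :: "'a measure" where "mu = weighted_volume M A g \<phi> 0"

abbreviation "r0 == rho 0"

lemma weighted_volume_mu: "t : {0..T} ==> weighted_volume M A g \<phi> t = mu"
 unfolding mu_def
 by (rule chart_measure_unique[OF weighted_volume_chart_measure weighted_volume_chart_measure rho_constant])
  (use T_pos in auto)

lemma zero_time: "0 : {0..T}" using T_pos by simp

lemma mu_chart: "chart_measure mu r0" and r0_law: "density_law r0"
 unfolding mu_def using weighted_volume_chart_measure[OF zero_time] density_law_rho[OF zero_time] .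

lemma space_mu [simp]: "space mu = M"
 by (rule chart_measure_space[OF mu_chart])

lemma mu_measurable: "continuous_on M F ==> F : borel_measurable mu"
 by (rule continuous_on_measurable[OF mu_chart])

lemma mu_finite: "finite_measure mu"
 by (rule chart_measure_finite[OF r0_law mu_chart])

lemma mu_integrable:
 fixes F :: "'a => real"
 assumes F: "continuous_on M F" shows "integrable mu F"
proof -
 interpret finite_measure mu by (rule mu_finite)
 have "compact (F ` M)" using compact_continuous_image[OF F compact_M] .
 then obtain b where "!!p. p : M ==> norm (F p) <= b" using compact_imp_bounded bounded_iff by (metis imageI)
 then show ?thesis by (intro integrable_const_bound[of _ b] mu_measurable F AE_I2) auto
qed

lemma mu_integral_chart:
 fixes F :: "'a => real"
 assumes c: "c : A" and F: "continuous_on M F" and supp: "!!p. p : M ==> p ~: fst c ==> F p = 0"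
 shows "(LINT p|mu. F p) = (LINT x|lborel. indicator (chart_image c) x * (r0 c x * coord c F x))"
 unfolding coord_def by (rule chart_measure_integral[OF r0_law mu_chart c mu_measurable[OF F] supp])

lemma mu_zero:
 assumes "continuous_on M F" "!!p. p : M ==> 0 <= (F p :: real)" "(LINT p|mu. F p) = 0" "p : M"
 shows "F p = 0"
proof -
 obtain c where c: "c : A" "p : fst c" using chart_union assms(4) by blast
 show ?thesis
  by (rule chart_measure_zero[OF r0_law mu_chart c(1) rho_pos[OF zero_time c(1)] assms(1,2,3) c(2)])
qed

end

subsection \<open>Invariance under changes of charts\<close>

lemma matrix_inv_cancel:
 fixes B :: "real^'n^'n"
 assumes "det B ~= 0" shows "matrix_inv B *v (B *v w) = w"
 unfolding matrix_vector_mul_assoc matrix_inv_left[OF assms] by simp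

context metric_flow
begin

abbreviation gm :: "real => ('a, 'n) chart => (real^'n => real) => (real^'n => real) => real^'n => real" where
 "gm t c == local_metric.gam (g t c)"

lemma g_gradient:
 assumes t: "t : {0..T}" and c: "c : A" and x: "x : chart_image c"
 shows "g t c x *v gradient (g t c) F x = (\<chi> i. pderiv_coord i F x)"
 unfolding gradient_def matrix_vector_mul_assoc
 using matrix_inv_right det_g_pos[OF t c x] by (metis less_irrefl matrix_vector_mul_lid)

lemma gradient_pullback:
 assumes t: "t : {0..T}" and c: "c : A" and d: "d : A" and x: "x : overlap c d"
  and F: "F differentiable (at (trans c d x))"
 shows "matrix (jac c d x) *v gradient (g t c) (%y. F (trans c d y)) x = gradient (g t d) F (trans c d x)"
proof -
 let ?J = "matrix (jac c d x)" and ?y = "trans c d x"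
 let ?V = "gradient (g t c) (%y. F (trans c d y)) x"
 have xc: "x : chart_image c" and yd: "?y : chart_image d" using x trans_overlap[OF c d x] by auto
 have dJ: "det (transpose ?J) ~= 0" using det_jac_nonzero[OF c d x] by (simp add: det_transpose)
 have "(\<chi> i. pderiv_coord i (%y. F (trans c d y)) x) = transpose ?J *v (\<chi> k. pderiv_coord k F ?y)"
  unfolding pderiv_pullback[OF c d x F]
  by (simp add: vec_eq_iff matrix_vector_mult_def transpose_def mult.commute)
 note 1 = this
 have "transpose ?J *v (g t d ?y *v (?J *v ?V)) = (transpose ?J ** g t d ?y ** ?J) *v ?V"
  by (simp only: matrix_vector_mul_assoc matrix_mul_assoc)
 also have "... = g t c x *v ?V" by (rule arg_cong[where f="%S. S *v ?V"]) (rule g_congruence[OF t c d x, symmetric])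
 also have "... = transpose ?J *v (\<chi> k. pderiv_coord k F ?y)" by (rule trans[OF g_gradient[OF t c xc] 1])
 finally have "transpose ?J *v (g t d ?y *v (?J *v ?V)) = transpose ?J *v (\<chi> k. pderiv_coord k F ?y)" .
 then have "g t d ?y *v (?J *v ?V) = (\<chi> k. pderiv_coord k F ?y)"
  by (rule injD[OF inj_matrix_vector_mult, rotated]) (use dJ invertible_det_nz[of "transpose ?J"] in blast)
 then have "matrix_inv (g t d ?y) *v (g t d ?y *v (?J *v ?V)) = gradient (g t d) F ?y"
  by (simp only: gradient_def)
 moreover have "matrix_inv (g t d ?y) *v (g t d ?y *v (?J *v ?V)) = ?J *v ?V"
  by (rule matrix_inv_cancel) (use det_g_pos[OF t d yd] in simp)
 ultimately show ?thesis by (simp only:)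
qed

lemma gam_pullback:
 assumes t: "t : {0..T}" and c: "c : A" and d: "d : A" and x: "x : overlap c d"
  and F: "F differentiable (at (trans c d x))" and H: "H differentiable (at (trans c d x))"
 shows "gm t c (%y. F (trans c d y)) (%y. H (trans c d y)) x = gm t d F H (trans c d x)"
proof -
 have xc: "x : chart_image c" and yd: "trans c d x : chart_image d" using x trans_overlap[OF c d x] by auto
 have "gm t c (%y. F (trans c d y)) (%y. H (trans c d y)) x =
  bil (g t c x) (gradient (g t c) (%y. F (trans c d y)) x) (gradient (g t c) (%y. H (trans c d y)) x)"
  by (rule local_metric.bil_gradient[OF local_metric_g[OF t c] xc, symmetric])
 also have "... = bil (g t d (trans c d x)) (gradient (g t d) F (trans c d x)) (gradient (g t d) H (trans c d x))"
  unfolding gradient_pullback[OF t c d x F, symmetric] gradient_pullback[OF t c d x H, symmetric] bil_congruence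
  by (simp only: g_congruence[OF t c d x, symmetric])
 also have "... = gm t d F H (trans c d x)"
  by (rule local_metric.bil_gradient[OF local_metric_g[OF t d] yd])
 finally show ?thesis .
qed

lemma gam_cong:
 assumes "open U" "x : U" "!!y. y : U ==> F y = F' y" "!!y. y : U ==> H y = H' y" and t: "t : {0..T}" and c: "c : A"
 shows "gm t c F H x = gm t c F' H' x"
 unfolding local_metric.gam_def[OF local_metric_g[OF t c]]
 using pderiv_cong[OF assms(1,2), of F F'] pderiv_cong[OF assms(1,2), of H H'] assms(3,4) by simp

text \<open>By \<open>hessian_gam\<close> the Hessian on two gradients is a combination of iterated
  \<open>gam\<close>, each of which is known to pull back. It remains to realise arbitrary vectors
  as gradients.\<close>

lemma hessian_pullback:
 assumes t: "t : {0..T}" and c: "c : A" and d: "d : A" and x: "x : overlap c d"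
  and F: "smooth_on (overlap d c) F" and F': "smooth_on (overlap c d) (%y. F (trans c d y))"
 shows "hessian (g t c) (%y. F (trans c d y)) x =
  transpose (matrix (jac c d x)) ** hessian (g t d) F (trans c d x) ** matrix (jac c d x)"
proof (rule bil_matrix_eqI)
 fix v w
 let ?J = "matrix (jac c d x)" and ?y = "trans c d x"
 have oc: "open (overlap c d)" and od: "open (overlap d c)" using open_overlap c d by auto
 interpret C: local_metric "overlap c d" "g t c"
  by (rule local_metric_subset[OF local_metric_g[OF t c] oc overlap_subset])
 interpret D: local_metric "overlap d c" "g t d"
  by (rule local_metric_subset[OF local_metric_g[OF t d] od overlap_subset])
 have y: "?y : overlap d c" by (rule trans_overlap[OF c d x])
 have yd: "?y : chart_image d" using y by blast
 \<comment> \<open>A linear function whose gradient at \<open>?y\<close> is \<open>?J *v v\<close>;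
   its pullback therefore has gradient \<open>v\<close> at \<open>x\<close>.\<close>
 define lin where "lin v z = (g t d ?y *v (?J *v v)) \<bullet> z" for v z :: "real^'n"
 have lin_bl: "bounded_linear (lin v)" for v unfolding lin_def by (rule bounded_linear_inner_right)
 have lin_smooth: "smooth_on S (lin v)" for S v by (rule smooth_on_bounded_linear[OF lin_bl])
 have linp_smooth: "smooth_on (overlap c d) (%z. lin v (trans c d z))" for v
  by (rule smooth_on_bounded_linear_compose[OF lin_bl trans_smooth[OF c d]])
 have grad_d: "gradient (g t d) (lin v) ?y = ?J *v v" for v
 proof -
  have "pderiv_coord i (lin v) ?y = (g t d ?y *v (?J *v v)) $ i" for i
   using pderiv_coord_eq[OF bounded_linear_imp_has_derivative[OF lin_bl], of i v ?y]
   by (simp add: lin_def inner_axis)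
  then have "gradient (g t d) (lin v) ?y = matrix_inv (g t d ?y) *v (g t d ?y *v (?J *v v))"
   unfolding gradient_def by (simp add: vec_nth_inverse)
  also have "... = ?J *v v" by (rule matrix_inv_cancel) (use det_g_pos[OF t d yd] in simp)
  finally show ?thesis .
 qed
 have diff: "f differentiable (at (trans c d z))" if "smooth_on (overlap d c) f" "z : overlap c d" for f z
  by (rule smooth_on_differentiable[OF od that(1) trans_overlap[OF c d that(2)]])
 have grad_c: "gradient (g t c) (%z. lin v (trans c d z)) x = v" for v
 proof -
  have "?J *v gradient (g t c) (%z. lin v (trans c d z)) x = ?J *v v"
   using gradient_pullback[OF t c d x diff[OF lin_smooth x], of v] grad_d by metis
  then show ?thesis
   by (rule injD[OF inj_matrix_vector_mult, rotated]) (use det_jac_nonzero[OF c d x] invertible_det_nz[of ?J] in blast)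
 qed
 have gam2: "gm t c (%z. a (trans c d z)) (gm t c (%z. b (trans c d z)) (%z. f (trans c d z))) x = gm t d a (gm t d b f) ?y"
  if a: "smooth_on (overlap d c) a" and b: "smooth_on (overlap d c) b" and f: "smooth_on (overlap d c) f" for a b f
 proof -
  have "gm t c (%z. a (trans c d z)) (gm t c (%z. b (trans c d z)) (%z. f (trans c d z))) x =
   gm t c (%z. a (trans c d z)) (%z. gm t d b f (trans c d z)) x"
   by (rule gam_cong[OF oc x refl _ t c]) (rule gam_pullback[OF t c d _ diff[OF b] diff[OF f]])
  also have "... = gm t d a (gm t d b f) ?y"
   by (rule gam_pullback[OF t c d x diff[OF a x] diff[OF D.gam_smooth[OF b f] x]])
  finally show ?thesis .
 qed
 let ?a = "lin v" and ?b = "lin w"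
 let ?a' = "%z. lin v (trans c d z)" and ?b' = "%z. lin w (trans c d z)" and ?F' = "%y. F (trans c d y)"
 have "2 * bil (hessian (g t c) ?F' x) v w =
  gm t c ?a' (gm t c ?F' ?b') x + gm t c ?b' (gm t c ?F' ?a') x - gm t c ?F' (gm t c ?a' ?b') x"
  using C.hessian_gam[OF x F' linp_smooth linp_smooth, of v w] unfolding grad_c .
 also have "... = gm t d ?a (gm t d F ?b) ?y + gm t d ?b (gm t d F ?a) ?y - gm t d F (gm t d ?a ?b) ?y"
  by (simp only: gam2 F lin_smooth)
 also have "... = 2 * bil (hessian (g t d) F ?y) (?J *v v) (?J *v w)"
  using D.hessian_gam[OF y F lin_smooth lin_smooth, of v w] unfolding grad_d by simp
 finally show "bil (hessian (g t c) ?F' x) v w = bil (transpose ?J ** hessian (g t d) F ?y ** ?J) v w"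
  unfolding bil_congruence by simp
qed

subsection \<open>Functions on the manifold\<close>

text \<open>Two classes of functions are kept apart: bumps and test functions are only C^1, while
  functions to which \<open>Lap\<close> is applied are smooth (\<open>SM\<close>).\<close>

definition C1M :: "('a => real) => bool" where
 "C1M a \<longleftrightarrow> (ALL c:A. Ck_on 1 (chart_image c) (coord c a))"

definition SM :: "('a => real) => bool" where
 "SM a \<longleftrightarrow> (ALL c:A. smooth_on (chart_image c) (coord c a))"

lemma SM_C1M: "SM a ==> C1M a"
 unfolding SM_def C1M_def using smooth_on_Ck by blast

lemma C1M_chart: "C1M a ==> c : A ==> Ck_on (Suc 0) (chart_image c) (coord c a)"
 by (simp add: C1M_def del: Ck_on.simps)

lemma C1M_diff: "C1M a ==> c : A ==> x : chart_image c ==> coord c a differentiable (at x)"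
 by (rule Ck_on_open_differentiable[OF open_chart_image C1M_chart])

lemma SM_chart: "SM a ==> c : A ==> smooth_on (chart_image c) (coord c a)"
 by (simp add: SM_def)

lemma C1M_continuous: "C1M a ==> continuous_on M a"
 by (rule continuous_on_charts) (rule Ck_on_imp_continuous_on[OF C1M_chart])

lemma coord_arith:
 "coord c (%p. k) = (%x. k)" "coord c (%p. a p + b p) = (%x. coord c a x + coord c b x)"
 "coord c (%p. a p * b p) = (%x. coord c a x * coord c b x)" "coord c (%p. a p - b p) = (%x. coord c a x - coord c b x)"
 "coord c (%p. a p / b p) = (%x. coord c a x / coord c b x)" "coord c (%p. ln (a p)) = (%x. ln (coord c a x))"
 "coord c (%p. SUM i:I. F i p) = (%x. SUM i:I. coord c (F i) x)"
 for a b :: "'a => real"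
 by (simp_all add: coord_def fun_eq_iff)

lemma coord_apply: "c : A ==> p : fst c ==> coord c u (snd c p) = u p"
 by (simp add: coord_def chart_inv_snd)

lemma chart_inv_M: "c : A ==> x : chart_image c ==> chart_inv c x : M"
 using chart_inv_in chart_subset by blast

lemma C1M_add: "C1M a ==> C1M b ==> C1M (%p. a p + b p)"
 and C1M_mult: "C1M a ==> C1M b ==> C1M (%p. a p * b p)"
 and C1M_diff2: "C1M a ==> C1M b ==> C1M (%p. a p - b p)"
 and C1M_const: "C1M (%p. k)"
 unfolding C1M_def coord_arith by (blast intro: Ck_on_add Ck_on_mult Ck_on_diff Ck_on_const)+

lemma C1M_sum: "(!!i. i : I ==> C1M (F i)) ==> C1M (%p. SUM i:I. F i p)"
 by (induction I rule: infinite_finite_induct) (simp_all add: C1M_add C1M_const)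

lemma C1M_divide: "C1M a ==> C1M b ==> (!!p. p : M ==> b p ~= 0) ==> C1M (%p. a p / b p)"
 unfolding C1M_def coord_arith using chart_inv_M by (auto intro!: Ck_on_divide simp: coord_def simp del: Ck_on.simps One_nat_def)

lemma SM_ln: "SM a ==> (!!p. p : M ==> a p > 0) ==> SM (%p. ln (a p))"
 unfolding SM_def coord_arith using chart_inv_M by (auto intro!: smooth_on_ln simp: coord_def)

lemma chart_at: "p : M ==> chart_at A p : A & p : fst (chart_at A p)"
 unfolding chart_at_def by (rule someI_ex) (use chart_union in blast)

definition Gam :: "real => ('a => real) => ('a => real) => 'a => real" where
 "Gam t a b p = (let c = chart_at A p in gm t c (coord c a) (coord c b) (snd c p))"

definition Lap :: "real => ('a => real) => 'a => real" where
 "Lap t b p = (let c = chart_at A p in witten_laplacian (g t c) (coord c (\<phi> t)) (coord c b) (snd c p))"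

text \<open>To prove chart independence, a point of the chart \<open>c\<close> is looked at in the chart \<open>d\<close>.\<close>

lemma two_charts:
 assumes "c : A" "d : A" "p : fst c" "p : fst d"
 shows "snd c p : overlap c d" "trans c d (snd c p) = snd d p"
  "!!u. y : overlap c d ==> coord c u y = (%y. coord d u (trans c d y)) y"
 using assms coord_trans[OF assms(1,2)] by (auto simp: chart_inv_snd simp del: comp_apply) (simp add: chart_inv_snd)

lemma Gam_chart:
 assumes t: "t : {0..T}" and a: "C1M a" and b: "C1M b" and c: "c : A" and p: "p : fst c"
 shows "Gam t a b p = gm t c (coord c a) (coord c b) (snd c p)"
proof -
 define d where "d = chart_at A p"
 have d: "d : A" "p : fst d" using chart_at[of p] p chart_subset[OF c] unfolding d_def by auto
 note tc = two_charts[OF c d(1) p d(2)]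
 have y: "trans c d (snd c p) : chart_image d" unfolding tc(2) using d(2) by blast
 have "gm t c (coord c a) (coord c b) (snd c p) =
  gm t c (%y. coord d a (trans c d y)) (%y. coord d b (trans c d y)) (snd c p)"
  by (rule gam_cong[OF open_overlap[OF c d(1)] tc(1) coord_trans[OF c d(1)] coord_trans[OF c d(1)] t c])
 also have "... = gm t d (coord d a) (coord d b) (snd d p)"
  using gam_pullback[OF t c d(1) tc(1) C1M_diff[OF a d(1) y] C1M_diff[OF b d(1) y]] unfolding tc(2) .
 finally show ?thesis by (simp add: Gam_def d_def Let_def)
qed

lemma coord_Gam:
 assumes t: "t : {0..T}" and a: "C1M a" and b: "C1M b" and c: "c : A" and x: "x : chart_image c"
 shows "coord c (Gam t a b) x = gm t c (coord c a) (coord c b) x"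
 using Gam_chart[OF t a b c chart_inv_in[OF c x]] snd_chart_inv[OF c x] by (simp add: coord_def)

lemma hessian_cong:
 assumes "open U" "x : U" "!!y. y : U ==> F y = F' y"
 shows "hessian G F x = hessian G F' x"
proof -
 have 1: "pderiv_coord j F y = pderiv_coord j F' y" if "y : U" for j y by (rule pderiv_cong[OF assms(1) that assms(3)])
 have "pderiv_coord i (pderiv_coord j F) x = pderiv_coord i (pderiv_coord j F') x" for i j
  by (rule pderiv_cong[OF assms(1,2) 1])
 then show ?thesis using 1[OF assms(2)] by (simp add: hessian_def)
qed

lemma hessian_chart:
 assumes t: "t : {0..T}" and b: "SM b" and c: "c : A" and d: "d : A" and p: "p : fst c" "p : fst d"
 shows "hessian (g t c) (coord c b) (snd c p) =
  transpose (matrix (jac c d (snd c p))) ** hessian (g t d) (coord d b) (snd d p) ** matrix (jac c d (snd c p))"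
proof -
 note tc = two_charts[OF c d p]
 have 1: "hessian (g t c) (coord c b) (snd c p) = hessian (g t c) (%y. coord d b (trans c d y)) (snd c p)"
  by (rule hessian_cong[OF open_overlap[OF c d] tc(1) coord_trans[OF c d]])
 have 2: "smooth_on (overlap d c) (coord d b)" by (rule smooth_on_subset[OF SM_chart[OF b d]]) blast
 have 3: "smooth_on (overlap c d) (%y. coord d b (trans c d y))"
  by (rule smooth_on_cong[OF smooth_on_subset[OF SM_chart[OF b c] overlap_subset] coord_trans[OF c d]])
 show ?thesis unfolding 1 hessian_pullback[OF t c d tc(1) 2 3] unfolding tc(2) ..
qed

lemma g_congruence_point:
 assumes t: "t : {0..T}" and c: "c : A" and d: "d : A" and p: "p : fst c" "p : fst d"
 shows "g t c (snd c p) = transpose (matrix (jac c d (snd c p))) ** g t d (snd d p) ** matrix (jac c d (snd c p))"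
 using g_congruence[OF t c d two_charts(1)[OF c d p]] unfolding two_charts(2)[OF c d p] .

lemma laplacian_chart:
 assumes t: "t : {0..T}" and b: "SM b" and c: "c : A" and d: "d : A" and p: "p : fst c" "p : fst d"
 shows "laplacian (g t c) (coord c b) (snd c p) = laplacian (g t d) (coord d b) (snd d p)"
 unfolding laplacian_def
 by (rule tensor_trace_conj[OF det_jac_nonzero[OF c d two_charts(1)[OF c d p]] _ g_congruence_point[OF t c d p] hessian_chart[OF t b c d p]])
  (use det_g_pos[OF t d] p in \<open>force\<close>)

lemma hessian_norm2_chart:
 assumes t: "t : {0..T}" and b: "SM b" and c: "c : A" and p: "p : fst c"
 shows "hessian_norm2 A (g t) b p = tensor_norm2 (g t c (snd c p)) (hessian (g t c) (coord c b) (snd c p))"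
proof -
 define d where "d = chart_at A p"
 have d: "d : A" "p : fst d" using chart_at[of p] p chart_subset[OF c] unfolding d_def by auto
 have "tensor_norm2 (g t c (snd c p)) (hessian (g t c) (coord c b) (snd c p)) =
  tensor_norm2 (g t d (snd d p)) (hessian (g t d) (coord d b) (snd d p))"
  by (rule tensor_norm2_conj[OF det_jac_nonzero[OF c d(1) two_charts(1)[OF c d(1) p d(2)]] _
    g_congruence_point[OF t c d(1) p d(2)] hessian_chart[OF t b c d(1) p d(2)]])
   (use det_g_pos[OF t d(1)] d(2) in \<open>force\<close>)
 then show ?thesis by (simp add: hessian_norm2_def d_def Let_def)
qed

lemma SM_phi: "t : {0..T} ==> SM (\<phi> t)"
 unfolding SM_def using phi_chart_smooth by blast

lemma Lap_chart:
 assumes t: "t : {0..T}" and b: "SM b" and c: "c : A" and p: "p : fst c"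
 shows "Lap t b p = witten_laplacian (g t c) (coord c (\<phi> t)) (coord c b) (snd c p)"
proof -
 have w: "witten_laplacian (g t d) (coord d (\<phi> t)) (coord d b) (snd d p) =
  laplacian (g t d) (coord d b) (snd d p) - Gam t (\<phi> t) b p" if d: "d : A" "p : fst d" for d
  using local_metric.witten_laplacian_eq[OF local_metric_g[OF t d(1)] snd_in[OF d(2)]]
   Gam_chart[OF t SM_C1M[OF SM_phi[OF t]] SM_C1M[OF b] d] by simp
 define d where "d = chart_at A p"
 have d: "d : A" "p : fst d" using chart_at[of p] p chart_subset[OF c] unfolding d_def by auto
 show ?thesis
  unfolding w[OF c p] laplacian_chart[OF t b c d(1) p d(2)] using w[OF d] by (simp add: Lap_def d_def Let_def)
qed

lemma coord_Lap:
 assumes t: "t : {0..T}" and b: "SM b" and c: "c : A" and x: "x : chart_image c"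
 shows "coord c (Lap t b) x = witten_laplacian (g t c) (coord c (\<phi> t)) (coord c b) x"
 using Lap_chart[OF t b c chart_inv_in[OF c x]] snd_chart_inv[OF c x] by (simp add: coord_def)

lemma SM_Gam: "t : {0..T} ==> SM a ==> SM b ==> SM (Gam t a b)"
 unfolding SM_def
 by (intro ballI, rule smooth_on_cong[OF local_metric.gam_smooth[OF local_metric_g]])
  (auto simp: coord_Gam SM_C1M SM_def)

lemma SM_Lap: "t : {0..T} ==> SM b ==> SM (Lap t b)"
 unfolding SM_def
 by (intro ballI, rule smooth_on_cong[OF local_metric.witten_laplacian_smooth[OF local_metric_g]])
  (auto simp: coord_Lap SM_def phi_chart_smooth)

lemma Gam_continuous:
 assumes t: "t : {0..T}" and a: "C1M a" and b: "C1M b"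
 shows "continuous_on M (Gam t a b)"
proof (rule continuous_on_charts)
 fix c assume c: "c : A"
 have PD: "continuous_on (chart_image c) (pderiv_coord i (coord c a))" if "C1M a" for i a
  using Ck_on_pderiv[OF open_chart_image[OF c] C1M_chart[OF that c]] by simp
 have "continuous_on (chart_image c) (gm t c (coord c a) (coord c b))"
  unfolding local_metric.gam_def[OF local_metric_g[OF t c], abs_def]
  by (intro continuous_on_sum continuous_on_mult PD a b
    smooth_on_imp_continuous_on[OF local_metric.gi_smooth[OF local_metric_g[OF t c]]])
 then show "continuous_on (chart_image c) (coord c (Gam t a b))"
  by (rule continuous_on_eq) (rule coord_Gam[OF t a b c, symmetric])
qed

lemma Gam_cong:
 assumes "!!q. q : M ==> a q = a' q" "!!q. q : M ==> b q = b' q" and t: "t : {0..T}" and p: "p : M"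
 shows "Gam t a b p = Gam t a' b' p"
proof -
 define d where "d = chart_at A p"
 have d: "d : A" "p : fst d" using chart_at[OF p] by (auto simp: d_def)
 show ?thesis
  unfolding Gam_def Let_def d_def[symmetric]
  by (rule gam_cong[OF open_chart_image[OF d(1)] snd_in[OF d(2)] _ _ t d(1)]) (simp_all add: coord_def assms(1,2) chart_inv_M[OF d(1)])
qed

lemma Gam_sym: "t : {0..T} ==> C1M a ==> C1M b ==> p : M ==> Gam t a b p = Gam t b a p"
 using Gam_chart[of t _ _ "chart_at A p" p] chart_at[of p]
  local_metric.gam_sym[OF local_metric_g] by (metis snd_in)

lemma Gam_add:
 "t : {0..T} ==> C1M a ==> C1M a' ==> C1M b ==> p : M ==> Gam t (%q. a q + a' q) b p = Gam t a b p + Gam t a' b p"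
 using chart_at[of p] C1M_diff[of _ "chart_at A p" "snd (chart_at A p) p"]
 by (simp add: Gam_def Let_def coord_arith local_metric.gam_def[OF local_metric_g] pderiv_add snd_in
   distrib_left distrib_right sum.distrib)

lemma Gam_mult:
 "t : {0..T} ==> C1M a ==> C1M a' ==> C1M b ==> p : M ==>
  Gam t (%q. a q * a' q) b p = a p * Gam t a' b p + a' p * Gam t a b p"
 using chart_at[of p] C1M_diff[of _ "chart_at A p" "snd (chart_at A p) p"]
 by (simp add: Gam_def Let_def coord_arith local_metric.gam_def[OF local_metric_g] pderiv_mult snd_in coord_apply
   distrib_left distrib_right sum.distrib sum_distrib_left mult.assoc mult.commute mult.left_commute)

lemma Gam_const: "t : {0..T} ==> p : M ==> Gam t (%q. k) b p = 0"
 using chart_at[of p] by (simp add: Gam_def Let_def coord_arith local_metric.gam_def[OF local_metric_g])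

lemma Gam_sum:
 assumes "t : {0..T}" "finite I" "!!i. i : I ==> C1M (F i)" "C1M b" "p : M"
 shows "Gam t (%q. SUM i:I. F i q) b p = (SUM i:I. Gam t (F i) b p)"
 using assms(2,3)
proof (induction I rule: finite_induct)
 case empty
 then show ?case using Gam_const[OF assms(1,5)] by simp
next
 case (insert i I)
 then show ?case using Gam_add[OF assms(1) _ C1M_sum assms(4,5), of "F i" I F] by simp
qed

lemma Gam_nonneg:
 assumes t: "t : {0..T}" and a: "C1M a" and p: "p : M"
 shows "0 <= Gam t a a p"
proof -
 define c where "c = chart_at A p"
 have c: "c : A" "p : fst c" using chart_at[OF p] by (auto simp: c_def)
 have "Gam t a a p = bil (g t c (snd c p)) (gradient (g t c) (coord c a) (snd c p)) (gradient (g t c) (coord c a) (snd c p))"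
  using Gam_chart[OF t a a c] local_metric.bil_gradient[OF local_metric_g[OF t c(1)] snd_in[OF c(2)]] by simp
 also have "... >= 0" using g_pos[OF t c(1) snd_in[OF c(2)]] by (metis bil_def inner_zero_left less_imp_le order_refl)
 finally show ?thesis .
qed

end

subsection \<open>Space-time regularity\<close>

context metric_flow
begin

lemma smooth_functions_iff:
 "smooth_functions A I u \<longleftrightarrow> (ALL c:A. smooth_on (I \<times> chart_image c) (%q. coord c (u (fst q)) (snd q)))"
 by (simp add: smooth_functions_def case_prod_unfold)

lemma spacetime_pderiv:
 assumes I: "time_interval T I" and U: "open U" and f: "smooth_on (I \<times> U) (%q. f (fst q) (snd q))"
 shows "smooth_on (I \<times> U) (%q. pderiv_coord i (f (fst q)) (snd q))"
 using Ck_on_spacetime_pderiv[OF I U, of _ f i] f unfolding smooth_on_def case_prod_unfold by blast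

lemma g_spacetime:
 assumes I: "time_interval T I" and c: "c : A"
 shows "smooth_on (I \<times> chart_image c) (%q. g (fst q) c (snd q) $ i $ j)"
 by (rule smooth_on_subset[of "{0..T} \<times> chart_image c"])
  (use g_smooth_comp[OF c] time_interval_subset[OF I] in \<open>auto simp: case_prod_unfold\<close>)

lemma gi_spacetime:
 assumes I: "time_interval T I" and c: "c : A"
 shows "smooth_on (I \<times> chart_image c) (%q. matrix_inv (g (fst q) c (snd q)) $ i $ j)"
 by (rule smooth_on_matrix_inv[OF g_spacetime[OF I c]])
  (use det_g_pos[OF _ c] time_interval_subset[OF I] in \<open>force\<close>)

lemma gm_spacetime:
 assumes I: "time_interval T I" and c: "c : A"
  and a: "smooth_on (I \<times> chart_image c) (%q. a (fst q) (snd q))"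
  and b: "smooth_on (I \<times> chart_image c) (%q. b (fst q) (snd q))"
 shows "smooth_on (I \<times> chart_image c) (%q. gm (fst q) c (a (fst q)) (b (fst q)) (snd q))"
proof -
 have "smooth_on (I \<times> chart_image c) (%q. SU i j. matrix_inv (g (fst q) c (snd q)) $ i $ j *
   pderiv_coord i (a (fst q)) (snd q) * pderiv_coord j (b (fst q)) (snd q))"
  by (intro smooth_on_intros gi_spacetime[OF I c] spacetime_pderiv[OF I open_chart_image[OF c]] a b)
 then show ?thesis
  by (rule smooth_on_cong) (use time_interval_subset[OF I] in \<open>auto simp: local_metric.gam_def[OF local_metric_g[OF _ c]] subset_iff\<close>)
qed

lemma christoffel_spacetime:
 assumes I: "time_interval T I" and c: "c : A"
 shows "smooth_on (I \<times> chart_image c) (%q. christoffel (g (fst q) c) (snd q) k i j)"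
proof -
 have G: "smooth_on (I \<times> chart_image c) (%q. pderiv_coord k (%y. g (fst q) c y $ i $ j) (snd q))" for i j k
  by (rule spacetime_pderiv[OF I open_chart_image[OF c], of "%t y. g t c y $ i $ j"]) (rule g_spacetime[OF I c])
 show ?thesis
  unfolding christoffel_def
  by (intro smooth_on_divide smooth_on_intros gi_spacetime[OF I c] G) auto
qed

lemma hessian_spacetime:
 assumes I: "time_interval T I" and c: "c : A"
  and a: "smooth_on (I \<times> chart_image c) (%q. a (fst q) (snd q))"
 shows "smooth_on (I \<times> chart_image c) (%q. hessian (g (fst q) c) (a (fst q)) (snd q) $ i $ j)"
proof -
 note PD = spacetime_pderiv[OF I open_chart_image[OF c]]
 show ?thesis
  unfolding hessian_def
  by (simp, intro smooth_on_intros christoffel_spacetime[OF I c] PD[of "%t. pderiv_coord j (a t)"] PD a)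
qed

lemma wl_spacetime:
 assumes I: "time_interval T I" and c: "c : A"
  and a: "smooth_on (I \<times> chart_image c) (%q. a (fst q) (snd q))"
 shows "smooth_on (I \<times> chart_image c) (%q. witten_laplacian (g (fst q) c) (coord c (\<phi> (fst q))) (a (fst q)) (snd q))"
proof -
 have phi: "smooth_on (I \<times> chart_image c) (%q. coord c (\<phi> (fst q)) (snd q))"
  using phi_smooth c smooth_on_subset[of "{0..T} \<times> chart_image c" _ "I \<times> chart_image c"] time_interval_subset[OF I]
  unfolding smooth_functions_iff by blast
 have "smooth_on (I \<times> chart_image c) (%q. (SU i j. matrix_inv (g (fst q) c (snd q)) $ i $ j *
   hessian (g (fst q) c) (a (fst q)) (snd q) $ i $ j) - gm (fst q) c (coord c (\<phi> (fst q))) (a (fst q)) (snd q))"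
  by (intro smooth_on_intros gi_spacetime[OF I c] hessian_spacetime[OF I c] gm_spacetime[OF I c] phi a)
 then show ?thesis
  by (rule smooth_on_cong) (use time_interval_subset[OF I] in
   \<open>auto simp: local_metric.witten_laplacian_eq[OF local_metric_g[OF _ c]] local_metric.laplacian_sum[OF local_metric_g[OF _ c]] subset_iff\<close>)
qed

lemma smooth_functions_slice: "smooth_functions A I u ==> t : I ==> SM (u t)"
 unfolding SM_def smooth_functions_def using smooth_on_slice[of I _ "%t. coord _ (u t)" t] by blast

lemma smooth_functions_Gam:
 assumes I: "time_interval T I" and u: "smooth_functions A I u" and w: "smooth_functions A I w"
 shows "smooth_functions A I (%t. Gam t (u t) (w t))"
 unfolding smooth_functions_iff
proof
 fix c assume c: "c : A"
 have "smooth_on (I \<times> chart_image c) (%q. gm (fst q) c (coord c (u (fst q))) (coord c (w (fst q))) (snd q))"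
  using u w c by (intro gm_spacetime[OF I c]) (auto simp: smooth_functions_iff)
 then show "smooth_on (I \<times> chart_image c) (%q. coord c (Gam (fst q) (u (fst q)) (w (fst q))) (snd q))"
  by (rule smooth_on_cong) (use time_interval_subset[OF I] c smooth_functions_slice[OF u] smooth_functions_slice[OF w] in
   \<open>auto simp: coord_Gam SM_C1M subset_iff\<close>)
qed

lemma smooth_functions_Lap:
 assumes I: "time_interval T I" and u: "smooth_functions A I u"
 shows "smooth_functions A I (%t. Lap t (u t))"
 unfolding smooth_functions_iff
proof
 fix c assume c: "c : A"
 have "smooth_on (I \<times> chart_image c) (%q. witten_laplacian (g (fst q) c) (coord c (\<phi> (fst q))) (coord c (u (fst q))) (snd q))"
  using u c by (intro wl_spacetime[OF I c]) (auto simp: smooth_functions_iff)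
 then show "smooth_on (I \<times> chart_image c) (%q. coord c (Lap (fst q) (u (fst q))) (snd q))"
  by (rule smooth_on_cong) (use time_interval_subset[OF I] c smooth_functions_slice[OF u] in
   \<open>auto simp: coord_Lap subset_iff\<close>)
qed

lemma smooth_functions_ln:
 assumes u: "smooth_functions A I u" and pos: "!!t p. t : I ==> p : M ==> u t p > 0"
 shows "smooth_functions A I (%t p. ln (u t p))"
 unfolding smooth_functions_iff coord_arith
 using u pos chart_inv_M by (auto intro!: smooth_on_ln simp: smooth_functions_iff) (simp add: coord_def)

lemma smooth_functions_mult:
 "smooth_functions A I u ==> smooth_functions A I w ==> smooth_functions A I (%t p. u t p * w t p)"
 and smooth_functions_add:
 "smooth_functions A I u ==> smooth_functions A I w ==> smooth_functions A I (%t p. u t p + w t p)"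
 and smooth_functions_diff:
 "smooth_functions A I u ==> smooth_functions A I w ==> smooth_functions A I (%t p. u t p - w t p)"
 and smooth_functions_const: "smooth_functions A I (%t p. k)"
 unfolding smooth_functions_iff coord_arith
 by (simp_all add: smooth_on_mult smooth_on_add smooth_on_diff smooth_on_const)

definition dt :: "(real => 'a => real) => real => 'a => real" where
 "dt u t p = time_deriv T (%s. u s p) t"

lemma coord_dt: "coord c (dt u t) x = time_deriv T (%s. coord c (u s) x) t"
 by (simp add: coord_def dt_def)

lemma smooth_functions_dt:
 assumes I: "time_interval T I" and u: "smooth_functions A I u"
 shows "smooth_functions A I (dt u)"
 using u Ck_on_spacetime_time_deriv[OF I open_chart_image, of _ _ "%s. coord _ (u s)"]
 unfolding smooth_functions_def smooth_on_def coord_dt by blast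

lemma dt_deriv:
 assumes I: "time_interval T I" and u: "smooth_functions A I u" and t: "t : I" and p: "p : M"
 shows "((%s. u s p) has_real_derivative dt u t p) (at t within {0..T})"
proof -
 obtain c where c: "c : A" "p : fst c" using chart_union p by blast
 have "((%s. coord c (u s) (snd c p)) has_vector_derivative time_deriv T (%s. coord c (u s) (snd c p)) t) (at t within {0..T})"
  using u c(1) unfolding smooth_functions_def
  by (intro has_time_deriv[OF I open_chart_image[OF c(1)] smooth_on_Ck t snd_in[OF c(2)], of "%s. coord c (u s)"]) blast
 then show ?thesis
  by (simp add: coord_apply[OF c] dt_def has_real_derivative_iff_has_vector_derivative)
qed

lemma time_deriv_DERIV:
 "t : {0..T} ==> (F has_real_derivative d) (at t within {0..T}) ==> time_deriv T F t = d"
 using time_deriv_eq[OF T_pos] by (simp add: has_real_derivative_iff_has_vector_derivative)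

lemma continuous_on_spacetime_charts:
 fixes F :: "real => 'a => real"
 assumes "!!c. c : A ==> continuous_on (I \<times> chart_image c) (%q. coord c (F (fst q)) (snd q))"
 shows "continuous_on (I \<times> M) (%q. F (fst q) (snd q))"
 unfolding continuous_on_eq_continuous_within
proof
 fix q assume q: "q : I \<times> M"
 then obtain c where c: "c : A" "snd q : fst c" using chart_union by auto
 obtain O' where O': "open O'" "fst c = M \<inter> O'" using chart_openin[OF c(1)] unfolding openin_open by blast
 have 1: "continuous_on (I \<times> fst c) (%q. F (fst q) (snd q))"
 proof (rule continuous_on_eq)
  have c2: "continuous_on (I \<times> fst c) (%q. (fst q, snd c (snd q)))"
   by (intro continuous_on_Pair continuous_on_fst continuous_on_id
     continuous_on_compose2[OF chart_continuous[OF c(1)] continuous_on_snd[OF continuous_on_id]]) auto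
  have "continuous_on (I \<times> fst c) (%q. (%q. coord c (F (fst q)) (snd q)) (fst q, snd c (snd q)))"
   by (rule continuous_on_compose2[OF assms[OF c(1)] c2]) auto
  then show "continuous_on (I \<times> fst c) (%q. coord c (F (fst q)) (snd c (snd q)))" by simp
  show "coord c (F (fst q)) (snd c (snd q)) = F (fst q) (snd q)" if "q : I \<times> fst c" for q
   using coord_apply[OF c(1), of "snd q"] that by auto
 qed
 have eq: "at q within I \<times> fst c = at q within I \<times> M"
 proof (rule at_within_nhd[of q "UNIV \<times> O'"])
  show "q : UNIV \<times> O'" using O'(2) c(2) by (cases q) simp
  show "open (UNIV \<times> O')" using O'(1) by (intro open_Times open_UNIV)
  show "I \<times> fst c \<inter> (UNIV \<times> O') - {q} = I \<times> M \<inter> (UNIV \<times> O') - {q}" using O'(2) by blast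
 qed
 have "q : I \<times> fst c" using q c(2) by (cases q) simp
 with 1 have "continuous (at q within I \<times> fst c) (%q. F (fst q) (snd q))"
  by (simp only: continuous_on_eq_continuous_within)
 then show "continuous (at q within I \<times> M) (%q. F (fst q) (snd q))" unfolding eq .
qed

lemma smooth_functions_continuous:
 "smooth_functions A I u ==> continuous_on (I \<times> M) (%q. u (fst q) (snd q))"
 by (rule continuous_on_spacetime_charts) (auto simp: smooth_functions_iff intro: smooth_on_imp_continuous_on)

subsection \<open>Time derivatives of the carre du champ\<close>

lemma gi_time_deriv:
 assumes t: "t : {0..T}" and c: "c : A" and x: "x : chart_image c"
 shows "((%s. matrix_inv (g s c x) $ i $ j) has_real_derivative
  - (SU a b. matrix_inv (g t c x) $ i $ a * metric_deriv T g t c x $ a $ b * matrix_inv (g t c x) $ b $ j))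
  (at t within {0..T})"
proof -
 have bl: "bounded_linear (%s::real. (s, 0 :: real^'n))" by (intro bounded_linear_Pair bounded_linear_zero bounded_linear_ident)
 have Ck: "Ck_on 1 {0..T} (%s. g s c x $ i $ j)" for i j
  using Ck_on_affine[OF bl smooth_on_Ck[OF g_smooth_comp[OF c, of i j], of 1], of "{0..T}" "(0, x)"] x by simp
 have "((%s. g s c x $ i $ j) has_derivative (%h. metric_deriv T g t c x $ i $ j * h)) (at t within {0..T})" for i j
  using g_comp_time_deriv[OF t c x] by (simp add: has_field_derivative_def)
 from matrix_inv_has_derivative[OF Ck _ t this, of i j] det_g_pos[OF _ c x]
 have "((%s. matrix_inv (g s c x) $ i $ j) has_derivative (%h. - (SU a b.
  matrix_inv (g t c x) $ i $ a * (metric_deriv T g t c x $ a $ b * h) * matrix_inv (g t c x) $ b $ j))) (at t within {0..T})"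
  by (simp add: less_imp_neq[symmetric])
 then show ?thesis unfolding has_field_derivative_def
  by (rule has_derivative_eq_rhs) (simp add: fun_eq_iff sum_distrib_left sum_distrib_right mult.assoc mult.left_commute mult.commute)
qed

lemma gm_time_deriv:
 assumes t: "t : {0..T}" and c: "c : A" and x: "x : chart_image c"
  and a: "!!i. ((%s. pderiv_coord i (a s) x) has_real_derivative a' i) (at t within {0..T})"
  and b: "!!i. ((%s. pderiv_coord i (b s) x) has_real_derivative b' i) (at t within {0..T})"
 shows "((%s. gm s c (a s) (b s) x) has_real_derivative
  - bil (metric_deriv T g t c x) (gradient (g t c) (a t) x) (gradient (g t c) (b t) x)
  + (SU i j. matrix_inv (g t c x) $ i $ j * a' i * pderiv_coord j (b t) x)
  + (SU i j. matrix_inv (g t c x) $ i $ j * pderiv_coord i (a t) x * b' j)) (at t within {0..T})"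
proof -
 interpret L: local_metric "chart_image c" "g t c" by (rule local_metric_g[OF t c])
 let ?gi = "%i j. matrix_inv (g t c x) $ i $ j" and ?gd = "%i j. metric_deriv T g t c x $ i $ j"
 let ?a = "%i. pderiv_coord i (a t) x" and ?b = "%i. pderiv_coord i (b t) x"
 have D: "((%s. SU i j. matrix_inv (g s c x) $ i $ j * pderiv_coord i (a s) x * pderiv_coord j (b s) x)
  has_real_derivative (SU i j.
   ((- (SU k l. ?gi i k * ?gd k l * ?gi l j)) * ?a i + a' i * ?gi i j) * ?b j + b' j * (?gi i j * ?a i)))
  (at t within {0..T})"
  by (intro DERIV_sum DERIV_mult gi_time_deriv t c x a b)
 have E: "(SU i j.
   ((- (SU k l. ?gi i k * ?gd k l * ?gi l j)) * ?a i + a' i * ?gi i j) * ?b j + b' j * (?gi i j * ?a i))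
  = - bil (metric_deriv T g t c x) (gradient (g t c) (a t) x) (gradient (g t c) (b t) x)
  + (SU i j. ?gi i j * a' i * ?b j) + (SU i j. ?gi i j * ?a i * b' j)"
 proof -
  have "bil (metric_deriv T g t c x) (gradient (g t c) (a t) x) (gradient (g t c) (b t) x) =
   (SU k l i j. ?gi i k * ?gd k l * ?gi l j * ?a i * ?b j)"
   unfolding L.bil_sum L.gradient_nth sum_distrib_left sum_distrib_right
   by (rule sum.cong[OF refl], rule sum.cong[OF refl], subst sum.swap)
    (simp add: L.gi_sym[OF x] mult.assoc mult.commute mult.left_commute)
  also have "... = (SU i k l j. ?gi i k * ?gd k l * ?gi l j * ?a i * ?b j)"
   by (rule sum3_rotate)
  also have "... = (SU i j k l. ?gi i k * ?gd k l * ?gi l j * ?a i * ?b j)"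
   by (rule sum.cong[OF refl]) (rule sum3_rotate)
  finally have 1: "(SU i j. (SU k l. ?gi i k * ?gd k l * ?gi l j) * ?a i * ?b j) =
   bil (metric_deriv T g t c x) (gradient (g t c) (a t) x) (gradient (g t c) (b t) x)"
   by (simp add: sum_distrib_right)
  show ?thesis unfolding 1[symmetric]
   by (simp add: distrib_right left_diff_distrib right_diff_distrib sum.distrib sum_negf sum_subtractf mult.commute mult.left_commute)
 qed
 show ?thesis
  by (rule DERIV_cong_on[OF t _ D[unfolded E]]) (rule local_metric.gam_def[OF local_metric_g[OF _ c]])
qed

text \<open>The time derivative of \<open>Gam\<close> has the opposite sign, because the metric enters inverted.\<close>

definition Gdot :: "real => ('a => real) => ('a => real) => 'a => real" where
 "Gdot t a b p = - time_deriv T (%s. Gam s a b p) t"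

lemma Gam_time_deriv_fixed:
 assumes t: "t : {0..T}" and a: "C1M a" and b: "C1M b" and c: "c : A" and p: "p : fst c"
 shows "((%s. Gam s a b p) has_real_derivative
  - bil (metric_deriv T g t c (snd c p)) (gradient (g t c) (coord c a) (snd c p)) (gradient (g t c) (coord c b) (snd c p)))
  (at t within {0..T})"
proof -
 have "((%s. gm s c (coord c a) (coord c b) (snd c p)) has_real_derivative
  - bil (metric_deriv T g t c (snd c p)) (gradient (g t c) (coord c a) (snd c p)) (gradient (g t c) (coord c b) (snd c p))) (at t within {0..T})"
  using gm_time_deriv[OF t c snd_in[OF p] DERIV_const DERIV_const] by simp
 then show ?thesis
  by (rule DERIV_cong_on[OF t, rotated]) (rule Gam_chart[OF _ a b c p])
qed

lemma Gdot_chart: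
 assumes t: "t : {0..T}" and a: "C1M a" and b: "C1M b" and c: "c : A" and p: "p : fst c"
 shows "Gdot t a b p = bil (metric_deriv T g t c (snd c p)) (gradient (g t c) (coord c a) (snd c p)) (gradient (g t c) (coord c b) (snd c p))"
 unfolding Gdot_def time_deriv_DERIV[OF t Gam_time_deriv_fixed[OF assms]] by simp

lemma Gam_time_deriv_const:
 assumes t: "t : {0..T}" and a: "C1M a" and b: "C1M b" and p: "p : M"
 shows "((%s. Gam s a b p) has_real_derivative - Gdot t a b p) (at t within {0..T})"
proof -
 obtain c where c: "c : A" "p : fst c" using chart_union p by blast
 show ?thesis using Gam_time_deriv_fixed[OF t a b c] Gdot_chart[OF t a b c] by simp
qed

text \<open>The moving metric contributes \<open>- Gdot\<close>, and each slot contributes the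
  product of \<open>w t\<close> with its time derivative, once time and space derivatives have been
  exchanged.\<close>

lemma Gam_time_deriv:
 assumes I: "time_interval T I" and w: "smooth_functions A I w" and t: "t : I" and p: "p : M"
 shows "((%s. Gam s (w s) (w s) p) has_real_derivative - Gdot t (w t) (w t) p + 2 * Gam t (w t) (dt w t) p) (at t within {0..T})"
proof -
 obtain c where c: "c : A" "p : fst c" using chart_union p by blast
 have t': "t : {0..T}" using t time_interval_subset[OF I] by blast
 let ?x = "snd c p"
 have x: "?x : chart_image c" using c(2) by blast
 interpret L: local_metric "chart_image c" "g t c" by (rule local_metric_g[OF t' c(1)])
 have sm: "smooth_on (I \<times> chart_image c) (%(t, x). coord c (w t) x)" using w c(1) by (simp add: smooth_functions_def)
 have "Ck_on (Suc 0) (I \<times> chart_image c) (%(t, x). pderiv_coord i (coord c (w t)) x)" for i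
  by (rule Ck_on_spacetime_pderiv[OF I open_chart_image[OF c(1)] smooth_on_Ck[OF sm]])
 from has_time_deriv[OF I open_chart_image[OF c(1)] this t x]
 have "((%s. pderiv_coord i (coord c (w s)) ?x) has_vector_derivative
   time_deriv T (%s. pderiv_coord i (coord c (w s)) ?x) t) (at t within {0..T})" for i .
 moreover have cdt: "coord c (dt w t) = (%y. time_deriv T (%s. coord c (w s) y) t)" by (rule ext) (rule coord_dt)
 have "time_deriv T (%s. pderiv_coord i (coord c (w s)) ?x) t = pderiv_coord i (coord c (dt w t)) ?x" for i
  unfolding cdt
  by (rule time_deriv_pderiv_commute[OF I open_chart_image[OF c(1)] smooth_on_Ck[OF sm] t x])
 ultimately have P: "((%s. pderiv_coord i (coord c (w s)) ?x) has_real_derivative pderiv_coord i (coord c (dt w t)) ?x) (at t within {0..T})" for i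
  unfolding has_real_derivative_iff_has_vector_derivative by (simp only:)
 note wC = SM_C1M[OF smooth_functions_slice[OF w]]
 note wt = wC[OF t]
 have wdC: "C1M (dt w t)" by (rule SM_C1M[OF smooth_functions_slice[OF smooth_functions_dt[OF I w] t]])
 have D: "((%s. gm s c (coord c (w s)) (coord c (w s)) ?x) has_real_derivative
  - Gdot t (w t) (w t) p + 2 * Gam t (w t) (dt w t) p) (at t within I)"
  using gm_time_deriv[OF t' c(1) x P P] Gam_sym[OF t' wt wdC] c chart_subset[OF c(1)]
  unfolding at_within_time_interval[OF I t] L.gam_def[symmetric] Gam_chart[OF t' wdC wt c, symmetric]
   Gam_chart[OF t' wt wdC c, symmetric] Gdot_chart[OF t' wt wt c, symmetric] by (simp add: p)
 have "((%s. Gam s (w s) (w s) p) has_real_derivative - Gdot t (w t) (w t) p + 2 * Gam t (w t) (dt w t) p) (at t within I)"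
 proof (rule DERIV_cong_on[OF t _ D])
  fix s assume s: "s : I"
  then have "s : {0..T}" using time_interval_subset[OF I] by (rule subsetD[rotated])
  then show "Gam s (w s) (w s) p = gm s c (coord c (w s)) (coord c (w s)) ?x"
   by (rule Gam_chart[OF _ wC[OF s] wC[OF s] c])
 qed
 then show ?thesis unfolding at_within_time_interval[OF I t] .
qed

lemma metric_deriv_spacetime:
 assumes c: "c : A"
 shows "smooth_on ({0..T} \<times> chart_image c) (%q. metric_deriv T g (fst q) c (snd q) $ i $ j)"
 unfolding smooth_on_def
proof
 fix k
 have "Ck_on k ({0..T} \<times> chart_image c) (%(t, x). time_deriv T (%s. g s c x) t)"
  by (rule Ck_on_spacetime_time_deriv[OF T_interval(1) open_chart_image[OF c] smooth_on_Ck[OF g_smooth_matrix[OF c]]])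
 then show "Ck_on k ({0..T} \<times> chart_image c) (%q. metric_deriv T g (fst q) c (snd q) $ i $ j)"
  unfolding metric_deriv_def case_prod_unfold
  by (intro Ck_on_bounded_linear_compose[OF bounded_linear_vec_nth])
qed

lemmas metric_deriv_continuous = smooth_on_imp_continuous_on[OF metric_deriv_spacetime]

lemma Gdot_continuous:
 assumes a: "C1M a" and b: "C1M b"
 shows "continuous_on ({0..T} \<times> M) (%q. Gdot (fst q) a b (snd q))"
proof (rule continuous_on_spacetime_charts)
 fix c assume c: "c : A"
 let ?S = "{0..T} \<times> chart_image c"
 have PD: "continuous_on ?S (%q. pderiv_coord i (coord c a) (snd q))" if "C1M a" for i a
 proof (rule continuous_on_compose2[OF _ continuous_on_snd[OF continuous_on_id]])
  show "continuous_on (chart_image c) (pderiv_coord i (coord c a))"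
   by (rule Ck_on_imp_continuous_on[OF Ck_on_pderiv[OF open_chart_image[OF c] C1M_chart[OF that c]]])
 qed auto
 have gi: "continuous_on ?S (%q. matrix_inv (g (fst q) c (snd q)) $ i $ j)" for i j
  by (rule smooth_on_imp_continuous_on[OF gi_spacetime[OF T_interval(1) c]])
 note gd = metric_deriv_continuous[OF c]
 have "continuous_on ?S (%q. SU i j.
  (SU k. matrix_inv (g (fst q) c (snd q)) $ i $ k * pderiv_coord k (coord c a) (snd q)) *
  metric_deriv T g (fst q) c (snd q) $ i $ j *
  (SU k. matrix_inv (g (fst q) c (snd q)) $ j $ k * pderiv_coord k (coord c b) (snd q)))"
  by (intro continuous_on_sum continuous_on_mult PD a b gi gd)
 then show "continuous_on ?S (%q. coord c (Gdot (fst q) a b) (snd q))"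
 proof (rule continuous_on_eq)
  fix q assume q: "q : ?S"
  then have t: "fst q : {0..T}" and x: "snd q : chart_image c" by auto
  note L = local_metric_g[OF t c]
  show "(SU i j.
  (SU k. matrix_inv (g (fst q) c (snd q)) $ i $ k * pderiv_coord k (coord c a) (snd q)) *
  metric_deriv T g (fst q) c (snd q) $ i $ j *
  (SU k. matrix_inv (g (fst q) c (snd q)) $ j $ k * pderiv_coord k (coord c b) (snd q))) = coord c (Gdot (fst q) a b) (snd q)"
   unfolding coord_def[of c "Gdot (fst q) a b"] Gdot_chart[OF t a b c chart_inv_in[OF c x]] snd_chart_inv[OF c x]
    local_metric.bil_sum[OF L] local_metric.gradient_nth[OF L] ..
 qed
qed

end

subsection \<open>Integration on the manifold\<close>

lemma frechet_derivative_sum: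
 fixes F :: "real^'n => real"
 assumes "F differentiable (at x)"
 shows "frechet_derivative F (at x) h = (SU i. h $ i * pderiv_coord i F x)"
proof -
 note lin = has_derivative_linear[OF frechet_derivative_works[THEN iffD1, OF assms]]
 have "frechet_derivative F (at x) h = frechet_derivative F (at x) (SU i. h $ i *s axis i 1)" by (simp only: basis_expansion)
 also have "... = (SU i. h $ i * frechet_derivative F (at x) (axis i 1))"
  by (simp only: linear_sum[OF lin] scalar_mult_eq_scaleR linear_cmul[OF lin] real_scaleR_def)
 finally show ?thesis by (simp only: pderiv_coord_def)
qed

lemma Ck1_iff:
 fixes F :: "real^'n => real"
 assumes U: "open U"
 shows "Ck_on 1 U F \<longleftrightarrow> (ALL x:U. F differentiable (at x)) & (ALL i. continuous_on U (pderiv_coord i F))"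
proof
 assume "Ck_on 1 U F"
 then have F: "Ck_on (Suc 0) U F" by (simp only: One_nat_def)
 show "(ALL x:U. F differentiable (at x)) & (ALL i. continuous_on U (pderiv_coord i F))"
  using Ck_on_open_differentiable[OF U F] Ck_on_imp_continuous_on[OF Ck_on_pderiv[OF U F]] by blast
next
 assume R: "(ALL x:U. F differentiable (at x)) & (ALL i. continuous_on U (pderiv_coord i F))"
 have D: "(F has_derivative frechet_derivative F (at x)) (at x)" if "x : U" for x
  using R that frechet_derivative_works by blast
 note eq = frechet_derivative_sum[OF R[THEN conjunct1, rule_format]]
 have "continuous_on U (%x. frechet_derivative F (at x) h)" for h
 proof (rule continuous_on_eq)
  show "continuous_on U (%x. SU i. h $ i * pderiv_coord i F x)"
   using R by (intro continuous_on_sum continuous_on_mult continuous_on_const) blast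
 qed (rule eq[symmetric])
 then have "Ck_on (Suc 0) U F"
  by (intro Ck_on_SucI[of U F "%x. frechet_derivative F (at x)"]) (auto intro: has_derivative_at_withinI[OF D])
 then show "Ck_on 1 U F" by (simp only: One_nat_def)
qed

text \<open>\<open>U\<close> and the complement of \<open>K\<close> are open, cover the space, and
  the two descriptions of the function agree where they overlap; differentiability and continuity
  are checked on each.\<close>

lemma zero_extension:
 fixes F :: "real^'n => real"
 assumes U: "open U" and F: "Ck_on 1 U F" and K: "compact K" "K \<subseteq> U" and zero: "!!x. x : U ==> x ~: K ==> F x = 0"
 defines "F0 == %x. if x : U then F x else 0"
 shows "Ck_on 1 UNIV F0" "!!i x. pderiv_coord i F0 x = indicator U x * pderiv_coord i F x"
  "!!i x. x ~: K ==> pderiv_coord i F0 x = 0"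
proof -
 have oK: "open (- K)" using K(1) by (simp add: compact_imp_closed open_Compl)
 have F0U: "F0 x = F x" if "x : U" for x using that by (simp add: F0_def)
 have F0K: "F0 x = 0" if "x : - K" for x using that zero by (simp add: F0_def)
 have pU: "pderiv_coord i F0 x = pderiv_coord i F x" if "x : U" for i x
  by (rule pderiv_cong[OF U that F0U])
 have pK: "pderiv_coord i F0 x = 0" if "x : - K" for i x
  using pderiv_cong[OF oK that, of F0 "%_. 0" i] F0K by simp
 show p: "pderiv_coord i F0 x = indicator U x * pderiv_coord i F x" for i x
  using pU[where x=x and i=i] pK[where x=x and i=i] K(2) by (cases "x : U") auto
 show "pderiv_coord i F0 x = 0" if "x ~: K" for i x using pK that by simp
 have FU: "ALL x:U. F differentiable (at x)" "continuous_on U (pderiv_coord i F)" for i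
  using F Ck1_iff[OF U] by blast+
 have "F0 differentiable (at x)" for x
 proof (cases "x : U")
  case True
  then have "(F has_derivative frechet_derivative F (at x)) (at x)" using FU(1) frechet_derivative_works by blast
  then have "(F0 has_derivative frechet_derivative F (at x)) (at x)"
   by (rule has_derivative_transform_within_open[OF _ U True]) (rule F0U[symmetric])
  then show ?thesis by (rule differentiableI)
 next
  case False
  then have x: "x : - K" using K(2) by blast
  have "((%x. 0) has_derivative (%h. 0)) (at x)" by (rule has_derivative_const)
  then have "(F0 has_derivative (%h. 0)) (at x)"
   by (rule has_derivative_transform_within_open[OF _ oK x]) (rule F0K[symmetric])
  then show ?thesis by (rule differentiableI)
 qed
 moreover have "continuous_on UNIV (pderiv_coord i F0)" for i
 proof -
  have "continuous_on U (pderiv_coord i F0)" by (rule continuous_on_eq[OF FU(2)]) (rule pU[symmetric])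
  moreover have "continuous_on (- K) (pderiv_coord i F0)"
   by (rule continuous_on_eq[OF continuous_on_const]) (rule pK[symmetric])
  ultimately have "continuous_on (U \<union> - K) (pderiv_coord i F0)" by (rule continuous_on_open_Un[OF U oK])
  moreover have "U \<union> - K = UNIV" using K(2) by blast
  ultimately show ?thesis by simp
 qed
 ultimately show "Ck_on 1 UNIV F0" by (simp only: Ck1_iff[OF open_UNIV]) blast
qed

lemma continuous_compact_support:
 fixes F :: "real^'n => real"
 assumes F: "continuous_on UNIV F" and K: "compact K" and zero: "!!x. x ~: K ==> F x = 0"
 shows "integrable lborel F" "EX b>=0. ALL x. \<bar>F x\<bar> <= b"
proof -
 have "compact (F ` K)" using compact_continuous_image[OF continuous_on_subset[OF F] K] by blast
 then obtain b where b: "ALL y:F ` K. norm y <= b" using compact_imp_bounded bounded_iff by metis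
 have b': "\<bar>F x\<bar> <= \<bar>b\<bar>" for x using b zero[of x] by (cases "x : K") auto
 then show "EX b>=0. ALL x. \<bar>F x\<bar> <= b" by (intro exI[of _ "\<bar>b\<bar>"]) auto
 have Fm: "F : borel_measurable borel" by (rule borel_measurable_continuous_onI[OF F])
 have "integrable lborel (%x. indicator K x * \<bar>b\<bar>)"
  using emeasure_compact_finite[OF K] compact_imp_closed[OF K] by (intro integrable_mult_left) simp
 then show "integrable lborel F"
  by (rule Bochner_Integration.integrable_bound)
   (use Fm b' zero in \<open>auto intro!: AE_I2 split: split_indicator\<close>)
qed

lemma integral_translate:
 fixes F :: "real^'n => real"
 assumes "F : borel_measurable borel"
 shows "(LINT x|lborel. F (h + x)) = (LINT x|lborel. F x)"
 by (subst lborel_distr_plus[symmetric, of h], subst integral_distr) (use assms in auto)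

text \<open>The difference quotients of \<open>F\<close> have integral zero by translation invariance.\<close>

lemma integral_pderiv_zero:
 fixes F :: "real^'n => real"
 assumes F: "Ck_on 1 UNIV F" and K: "compact K" and zero: "!!x. x ~: K ==> F x = 0"
 shows "(LINT x|lborel. pderiv_coord i F x) = 0"
proof -
 let ?e = "axis i 1 :: real^'n"
 have F1: "Ck_on (Suc 0) UNIV F" using F by (simp only: One_nat_def)
 have Fc: "continuous_on UNIV F" by (rule Ck_on_imp_continuous_on[OF F])
 have Fm: "F : borel_measurable borel" by (rule borel_measurable_continuous_onI[OF Fc])
 have dc: "continuous_on UNIV (pderiv_coord i F)" using F Ck1_iff[OF open_UNIV] by blast
 have oK: "open (- K)" using K by (simp add: compact_imp_closed open_Compl)
 have dz: "pderiv_coord i F x = 0" if "x ~: K" for x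
  using pderiv_cong[OF oK, of x F "%_. 0" i] zero that by simp
 obtain b where b: "b >= 0" "!!x. \<bar>pderiv_coord i F x\<bar> <= b"
  using continuous_compact_support(2)[OF dc K dz] by blast
 have der: "((%s. F (x + s *\<^sub>R ?e)) has_real_derivative pderiv_coord i F (x + s *\<^sub>R ?e)) (at s)" for x s
  using DERIV_along_line[OF has_derivative_pderiv[OF open_UNIV F1 UNIV_I], where p=x and s=s and a="?e"]
  by (simp add: axis_def if_distrib[of "%c. c * _"] cong: if_cong)
 define h where "h n = 1 / (real n + 1)" for n
 have h: "h n > 0" "h n <= 1" for n by (auto simp: h_def)
 have h0: "h \<longlonglongrightarrow> 0"
  using LIMSEQ_ignore_initial_segment[OF lim_1_over_n, of 1] by (simp add: h_def[abs_def] add.commute)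
 \<comment> \<open>\<open>K\<close> swept back along the unit step: it carries the difference
   quotients of all steps of length at most 1, so a single integrable function dominates
   them.\<close>
 define K' where "K' = (%(x, s). x - s *\<^sub>R ?e) ` (K \<times> {0..1})"
 have K': "compact K'" unfolding K'_def case_prod_unfold
  by (intro compact_continuous_image compact_Times K compact_Icc continuous_intros)
 have inK': "x : K'" if "x + s *\<^sub>R ?e : K" "0 <= s" "s <= 1" for x s
  unfolding K'_def by (rule image_eqI[of _ _ "(x + s *\<^sub>R ?e, s)"]) (use that in auto)
 let ?q = "%n x. (F (h n *\<^sub>R ?e + x) - F x) / h n"
 have bound: "\<bar>?q n x\<bar> <= indicator K' x * b" for n x
 proof -
  obtain s where s: "0 < s" "s < h n" "F (x + h n *\<^sub>R ?e) - F (x + 0 *\<^sub>R ?e) = (h n - 0) * pderiv_coord i F (x + s *\<^sub>R ?e)"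
   using MVT2[OF h(1)[of n] der[where x=x]] by blast
  then have q: "?q n x = pderiv_coord i F (x + s *\<^sub>R ?e)" using h(1)[of n] by (simp add: add.commute)
  show ?thesis
  proof (cases "x + s *\<^sub>R ?e : K")
   case True
   then have "x : K'" using inK' s h(2)[of n] by auto
   then show ?thesis using q b(2) by simp
  next
   case False
   then have "?q n x = 0" unfolding q by (rule dz)
   then show ?thesis using b(1) by (simp only: abs_zero) simp
  qed
 qed
 have lim: "(%n. ?q n x) \<longlonglongrightarrow> pderiv_coord i F x" for x
 proof -
  have "((%s. (F (x + s *\<^sub>R ?e) - F x) / s) \<longlongrightarrow> pderiv_coord i F x) (at 0)"
   using der[where x=x and s=0] by (simp add: has_field_derivative_iff)
  moreover have "filterlim h (at 0) sequentially"
   using h0 h(1) unfolding filterlim_at by (intro conjI always_eventually allI) (auto simp: less_imp_neq[symmetric])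
  ultimately have "(%n. (F (x + h n *\<^sub>R ?e) - F x) / h n) \<longlonglongrightarrow> pderiv_coord i F x"
   by (rule filterlim_compose)
  then show ?thesis by (simp add: add.commute)
 qed
 have "(%n. \<integral>x. ?q n x \<partial>lborel) \<longlonglongrightarrow> (LINT x|lborel. pderiv_coord i F x)"
 proof (rule integral_dominated_convergence[where w = "%x. indicator K' x * b"])
  show "integrable lborel (%x. indicator K' x * b)"
   using emeasure_compact_finite[OF K'] compact_imp_closed[OF K'] by (intro integrable_mult_left) simp
  show "?q n : borel_measurable lborel" for n
   using Fm by measurable
  show "pderiv_coord i F : borel_measurable lborel"
   using borel_measurable_continuous_onI[OF dc] by simp
 qed (use bound lim in auto)
 moreover have "(LINT x|lborel. ?q n x) = 0" for n
 proof -
  have int: "integrable lborel F" by (rule continuous_compact_support(1)[OF Fc K zero])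
  have Fh: "continuous_on UNIV (%x. F (h n *\<^sub>R ?e + x))"
   by (intro continuous_on_compose2[OF Fc] continuous_intros) auto
  have int': "integrable lborel (%x. F (h n *\<^sub>R ?e + x))"
   by (rule continuous_compact_support(1)[OF Fh K'])
    (use zero inK' h(1,2)[of n] in \<open>metis add.commute less_imp_le\<close>)
  show ?thesis
   using int int' integral_translate[OF Fm, of "h n *\<^sub>R ?e"] by simp
 qed
 ultimately have "(%n. 0) \<longlonglongrightarrow> (LINT x|lborel. pderiv_coord i F x)" by (simp only:)
 then show ?thesis by (rule LIMSEQ_unique[OF _ tendsto_const])
qed

lemma divergence_zero:
 fixes F :: "'n => real^'n => real"
 assumes U: "open U" and K: "compact K" "K \<subseteq> U" and F: "!!i. Ck_on 1 U (F i)"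
  and zero: "!!i x. x : U ==> x ~: K ==> F i x = 0"
 shows "(LINT x|lborel. indicator U x * (SU i. pderiv_coord i (F i) x)) = 0"
proof -
 let ?F0 = "%i x. if x : U then F i x else 0"
 note Z = zero_extension[OF U F K zero]
 have int: "integrable lborel (pderiv_coord i (?F0 i))" for i
  using Z(1)[of i] Z(3) Ck1_iff[OF open_UNIV] by (intro continuous_compact_support(1)[OF _ K(1)]) blast+
 have Z2: "pderiv_coord j (?F0 i) x = indicator U x * pderiv_coord j (F i) x" for i j x
  by (rule zero_extension(2)[OF U F K zero])
 have 1: "indicator U x * (SU i. pderiv_coord i (F i) x) = (SU i. pderiv_coord i (?F0 i) x)" for x
  unfolding Z2 by (rule sum_distrib_left)
 have "(LINT x|lborel. pderiv_coord i (?F0 i) x) = 0" for i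
  by (rule integral_pderiv_zero[OF Z(1) K(1)]) (use K(2) zero in auto)
 then show ?thesis unfolding 1 using int by simp
qed

context metric_flow
begin

text \<open>Seen in another chart, the coordinate domain is the union of two open sets: the overlap,
  where the chain rule applies, and the part off the compact support, where the function is zero.
  C^1 is checked on each.\<close>

lemma bump_C1M:
 assumes c: "c : A" and K: "compact K" "K \<subseteq> chart_image c" and h: "Ck_on 1 (chart_image c) h"
  and zero: "!!x. x : chart_image c ==> x ~: K ==> h x = 0"
 shows "C1M (%p. if p : fst c then h (snd c p) else 0)" (is "C1M ?F")
 unfolding C1M_def
proof
 fix d assume d: "d : A"
 define K' where "K' = chart_inv c ` K"
 have K': "compact K'" unfolding K'_def
  by (rule compact_continuous_image[OF continuous_on_subset[OF chart_inv_continuous[OF c] K(2)] K(1)])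
 define V1 where "V1 = overlap d c"
 define V2 where "V2 = snd d ` (fst d \<inter> (M - K'))"
 have o1: "open V1" unfolding V1_def by (rule open_overlap[OF d c])
 have o2: "open V2" unfolding V2_def
  by (rule openin_subchart[OF d]) (use compact_imp_closed[OF K'] in \<open>auto intro: openin_diff simp: closedin_closed_Int openin_open_Int Diff_eq open_Compl\<close>)
 have K'c: "K' \<subseteq> fst c" unfolding K'_def using chart_inv_in[OF c] K(2) by blast
 have U: "chart_image d = V1 \<union> V2" unfolding V1_def V2_def using K'c chart_subset[OF d] by blast
 have F1: "coord d ?F y = h (trans d c y)" if "y : V1" for y
  using that chart_inv_snd[OF d] unfolding V1_def by (auto simp: coord_def)
 have F2: "coord d ?F y = 0" if y: "y : V2" for y
 proof -
  obtain p where p: "p : fst d" "p ~: K'" "y = snd d p" using y unfolding V2_def by blast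
  have "coord d ?F y = ?F p" using p chart_inv_snd[OF d] by (simp add: coord_def)
  moreover have "?F p = 0"
  proof (cases "p : fst c")
   case True
   have "snd c p ~: K" using p(2) chart_inv_snd[OF c True] unfolding K'_def by force
   then show ?thesis using zero[of "snd c p"] True by simp
  qed simp
  ultimately show ?thesis by simp
 qed
 have hd: "h differentiable (at x)" "continuous_on (chart_image c) (pderiv_coord k h)" if "x : chart_image c" for x k
  using h Ck1_iff[OF open_chart_image[OF c]] that by blast+
 have hc: "continuous_on (chart_image c) (pderiv_coord k h)" for k
  using h Ck1_iff[OF open_chart_image[OF c]] by blast
 have tr: "trans d c y : chart_image c" if "y : V1" for y
  using trans_overlap[OF d c] that unfolding V1_def by blast
 have tcont: "continuous_on V1 (trans d c)"
  unfolding V1_def by (rule smooth_on_imp_continuous_on[OF trans_smooth[OF d c]])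
 have jac_cont: "continuous_on V1 (%y. matrix (jac d c y) $ k $ i)" for k i
 proof -
  have bl: "bounded_linear (%v :: real^'n. v $ k)" by (rule bounded_linear_vec_nth)
  have "smooth_on V1 (%y. trans d c y $ k)"
   unfolding V1_def by (rule smooth_on_bounded_linear_compose[OF bl trans_smooth[OF d c]])
  then have "continuous_on V1 (pderiv_coord i (%y. trans d c y $ k))"
   by (intro smooth_on_imp_continuous_on smooth_on_pderiv o1)
  then show ?thesis
  proof (rule continuous_on_eq)
   fix y assume "y : V1"
   then have "(trans d c has_derivative jac d c y) (at y)" using trans_has_derivative[OF d c] unfolding V1_def by blast
   from pderiv_coord_eq[OF bounded_linear.has_derivative[OF bl this], of i]
   show "pderiv_coord i (%y. trans d c y $ k) y = matrix (jac d c y) $ k $ i" by (simp add: matrix_def)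
  qed
 qed
 have p1: "pderiv_coord i (coord d ?F) y = (SU k. pderiv_coord k h (trans d c y) * matrix (jac d c y) $ k $ i)"
  if y: "y : V1" for y i
 proof -
  have "pderiv_coord i (coord d ?F) y = pderiv_coord i (%y. h (trans d c y)) y"
   by (rule pderiv_cong[OF o1 y F1])
  also have "... = (SU k. pderiv_coord k h (trans d c y) * matrix (jac d c y) $ k $ i)"
   by (rule pderiv_pullback[OF d c y[unfolded V1_def] hd(1)[OF tr[OF y]]])
  finally show ?thesis .
 qed
 have p2: "pderiv_coord i (coord d ?F) y = 0" if "y : V2" for y i
  using pderiv_cong[OF o2 that, of "coord d ?F" "%_. 0" i] F2 by simp
 have "continuous_on V1 (pderiv_coord i (coord d ?F))" for i
 proof (rule continuous_on_eq)
  show "continuous_on V1 (%y. SU k. pderiv_coord k h (trans d c y) * matrix (jac d c y) $ k $ i)"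
   by (intro continuous_on_sum continuous_on_mult jac_cont continuous_on_compose2[OF hc tcont]) (use tr in auto)
 qed (rule p1[symmetric])
 moreover have "continuous_on V2 (pderiv_coord i (coord d ?F))" for i
  by (rule continuous_on_eq[OF continuous_on_const]) (rule p2[symmetric])
 ultimately have c: "continuous_on (V1 \<union> V2) (pderiv_coord i (coord d ?F))" for i
  by (intro continuous_on_open_Un o1 o2)
 have "coord d ?F differentiable (at y)" if "y : V1 \<union> V2" for y
 proof (cases "y : V1")
  case True
  have "(%y. h (trans d c y)) differentiable (at y)"
   by (rule pullback_differentiable[OF d \<open>c : A\<close> True[unfolded V1_def] hd(1)[OF tr[OF True]]])
  then have "((%y. h (trans d c y)) has_derivative frechet_derivative (%y. h (trans d c y)) (at y)) (at y)"
   using frechet_derivative_works by blast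
  then have "(coord d ?F has_derivative frechet_derivative (%y. h (trans d c y)) (at y)) (at y)"
   by (rule has_derivative_transform_within_open[OF _ o1 True]) (rule F1[symmetric])
  then show ?thesis by (rule differentiableI)
 next
  case False
  then have y: "y : V2" using that by blast
  have "((%y. 0) has_derivative (%h. 0)) (at y)" by (rule has_derivative_const)
  then have "(coord d ?F has_derivative (%h. 0)) (at y)"
   by (rule has_derivative_transform_within_open[OF _ o2 y]) (rule F2[symmetric])
  then show ?thesis by (rule differentiableI)
 qed
 then show "Ck_on 1 (chart_image d) (coord d ?F)"
  unfolding Ck1_iff[OF open_chart_image[OF d]] unfolding U using c by blast
qed

lemma positive_cover:
 fixes \<beta> :: "'a => 'a => real"
 assumes \<beta>: "!!p. p : M ==> continuous_on M (\<beta> p)" "!!p q. p : M ==> 0 <= \<beta> p q" "!!p. p : M ==> 0 < \<beta> p p"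
 obtains N where "N \<subseteq> M" "finite N" "!!q. q : M ==> 0 < (SUM p:N. \<beta> p q)"
proof -
 have "ALL p:M. EX O'. open O' & M \<inter> \<beta> p -` {0<..} = M \<inter> O'"
  using continuous_openin_preimage_gen[OF \<beta>(1) open_greaterThan] by (simp add: openin_open)
 from bchoice[OF this] obtain O' where O': "ALL p:M. open (O' p) & M \<inter> \<beta> p -` {0<..} = M \<inter> O' p" ..
 have O: "q : O' p \<longleftrightarrow> 0 < \<beta> p q" if "p : M" "q : M" for p q
 proof -
  have "q : M \<inter> O' p \<longleftrightarrow> q : M \<inter> \<beta> p -` {0<..}" using O' that(1) by simp
  then show ?thesis using that(2) by simp
 qed
 obtain N where N: "N \<subseteq> M" "finite N" "M \<subseteq> (UN p:N. O' p)"
  by (rule compactE_image[OF compact_M, of M O']) (use O' O \<beta>(3) in auto)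
 show ?thesis
 proof (rule that[OF N(1,2)])
  fix q assume q: "q : M"
  then obtain p where p: "p : N" "q : O' p" using N(3) by blast
  then have "0 < \<beta> p q" using O q N(1) by blast
  then show "0 < (SUM p:N. \<beta> p q)" by (rule sum_pos2[OF N(2) p(1)]) (use \<beta>(2) N(1) in blast)
 qed
qed

text \<open>Replaces a partition of unity. Only the sum has to be positive; dividing by it is left
  to the place of use.\<close>

lemma bump_cover:
 obtains C :: "'a set" and B where "finite C" "!!k. k : C ==> C1M (B k)" "!!p. p : M ==> (SUM k:C. B k p) > 0"
  "!!k. k : C ==> EX c K. c : A & compact K & K \<subseteq> chart_image c & (ALL p:M. B k p ~= 0 --> p : fst c & snd c p : K)"
proof -
 have "ALL p:M. EX B. C1M B & (ALL q. B q >= 0) & 0 < B p &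
  (EX c K. c : A & compact K & K \<subseteq> chart_image c & (ALL q:M. B q ~= 0 --> q : fst c & snd c q : K))"
 proof
  fix p assume "p : M"
  then obtain c R where c: "c : A" "p : fst c" and R: "0 < R" "cball (snd c p) R \<subseteq> chart_image c" using chart_ball by blast
  let ?x0 = "snd c p"
  \<comment> \<open>The square, \<open>Suc 1\<close>, is the least truncated power that is C^1; the
    base is negative outside the ball.\<close>
  define h where "h x = max 0 (R\<^sup>2 - (x - ?x0) \<bullet> (x - ?x0)) ^ Suc 1" for x
  have hC: "Ck_on 1 (chart_image c) h" unfolding h_def inner_vec_def
   by (intro Ck_on_max_zero_power Ck_on_diff Ck_on_const Ck_on_sum)
    (simp only: inner_real_def vector_minus_component, intro Ck_on_mult Ck_on_diff Ck_on_bounded_linear bounded_linear_vec_nth Ck_on_const)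
  have hz: "h x = 0" if "x ~: cball ?x0 R" for x
  proof -
   have "R\<^sup>2 <= (dist ?x0 x)\<^sup>2" using that R(1) by (intro power_mono) auto
   then show ?thesis by (simp add: h_def dist_norm norm_minus_commute[of ?x0] power2_norm_eq_inner)
  qed
  define b where "b q = (if q : fst c then h (snd c q) else 0)" for q
  have 1: "C1M b" unfolding b_def[abs_def] by (rule bump_C1M[OF c(1) compact_cball R(2) hC hz])
  have 2: "ALL q. b q >= 0" by (simp add: b_def h_def)
  have 3: "0 < b p" using c(2) R(1) by (simp add: b_def h_def)
  have 4: "ALL q:M. b q ~= 0 --> q : fst c & snd c q : cball ?x0 R" using hz by (auto simp: b_def simp del: mem_cball)
  show "EX B. C1M B & (ALL q. B q >= 0) & 0 < B p &
   (EX c K. c : A & compact K & K \<subseteq> chart_image c & (ALL q:M. B q ~= 0 --> q : fst c & snd c q : K))"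
   by (intro exI[of _ b] conjI exI[of _ c] exI[of _ "cball ?x0 R"]) (fact 1 2 3 c(1) compact_cball R(2) 4)+
 qed
 from bchoice[OF this] obtain B where BB: "ALL p:M. C1M (B p) & (ALL q. B p q >= 0) & 0 < B p p &
  (EX c K. c : A & compact K & K \<subseteq> chart_image c & (ALL q:M. B p q ~= 0 --> q : fst c & snd c q : K))" ..
 note B = bspec[OF BB]
 obtain N where N: "N \<subseteq> M" "finite N" "!!q. q : M ==> 0 < (SUM p:N. B p q)"
  by (rule positive_cover[of B]) (use B C1M_continuous in \<open>simp_all\<close>)
 show ?thesis by (rule that[OF N(2), where B=B]) (use BB N(1,3) in blast)+
qed

text \<open>In the chart, density times integrand is by \<open>divergence_form\<close> the
  divergence of \<open>a\<close> times the weighted gradient of \<open>b\<close>, and this field has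
  compact support in the coordinate domain.\<close>

lemma integration_by_parts_local:
 assumes t: "t : {0..T}" and a: "C1M a" and b: "SM b" and c: "c : A" and K: "compact K" "K \<subseteq> chart_image c"
  and supp: "!!p. p : M ==> a p ~= 0 ==> p : fst c & snd c p : K"
 shows "(LINT p|mu. Gam t a b p) = - (LINT p|mu. a p * Lap t b p)"
proof -
 let ?U = "chart_image c" and ?a = "coord c a" and ?b = "coord c b"
 interpret L: local_metric ?U "g t c" by (rule local_metric_g[OF t c])
 have oU: "open ?U" by (rule open_chart_image[OF c])
 have az: "?a x = 0" if "x : ?U" "x ~: K" for x
  using supp[OF chart_inv_M[OF c that(1)]] snd_chart_inv[OF c that(1)] that(2) by (auto simp: coord_def)
 have bs: "smooth_on ?U ?b" by (rule SM_chart[OF b c])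
 let ?F = "%p. Gam t a b p + a p * Lap t b p"
 have Gc: "continuous_on M (Gam t a b)" by (rule Gam_continuous[OF t a SM_C1M[OF b]])
 have ac: "continuous_on M a" by (rule C1M_continuous[OF a])
 have Lc: "continuous_on M (Lap t b)" by (rule C1M_continuous[OF SM_C1M[OF SM_Lap[OF t b]]])
 have Fc: "continuous_on M ?F" by (intro continuous_on_add continuous_on_mult Gc ac Lc)
 define K' where "K' = chart_inv c ` K"
 have K': "compact K'" "K' \<subseteq> fst c" unfolding K'_def using chart_inv_in[OF c] K
  by (auto intro!: compact_continuous_image continuous_on_subset[OF chart_inv_continuous[OF c]])
 \<comment> \<open>Outside the chart the derivatives of \<open>a\<close> vanish too, since
   \<open>a\<close> is zero on the open set off the compact set \<open>K'\<close>; this is seen in a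
   chart \<open>d\<close> around the point.\<close>
 have F0: "?F p = 0" if p: "p : M" "p ~: fst c" for p
 proof -
  define d where "d = chart_at A p"
  have d: "d : A" "p : fst d" using chart_at[OF p(1)] by (auto simp: d_def)
  have "open (snd d ` (fst d \<inter> (M - K')))"
   by (rule openin_subchart[OF d(1)]) (use compact_imp_closed[OF K'(1)] in \<open>auto simp: Diff_eq open_Compl openin_open_Int\<close>)
  moreover have "snd d p : snd d ` (fst d \<inter> (M - K'))" using d p K'(2) by blast
  moreover have "coord d a y = 0" if "y : snd d ` (fst d \<inter> (M - K'))" for y
  proof -
   obtain q where q: "q : fst d" "q : M" "q ~: K'" "y = snd d q" using \<open>y : _\<close> by blast
   have "a q = 0"
   proof (rule ccontr)
    assume "a q ~= 0"
    then have "q : fst c" "snd c q : K" using supp q(2) by auto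
    then show False using q(3) chart_inv_snd[OF c] unfolding K'_def by (metis image_eqI)
   qed
   then show ?thesis using coord_apply[OF d(1) q(1), of a] q(4) by simp
  qed
  ultimately have "pderiv_coord i (coord d a) (snd d p) = 0" for i
   using pderiv_cong[of "snd d ` (fst d \<inter> (M - K'))" "snd d p" "coord d a" "%_. 0" i] by simp
  then have "Gam t a b p = 0"
   unfolding Gam_def Let_def d_def[symmetric] local_metric.gam_def[OF local_metric_g[OF t d(1)]] by simp
  moreover have "a p = 0" using supp[OF p(1)] p(2) by blast
  ultimately show ?thesis by simp
 qed
 have "(LINT p|mu. ?F p) = (LINT x|lborel. indicator ?U x * (r0 c x * coord c ?F x))"
  by (rule mu_integral_chart[OF c Fc F0])
 also have "... = (LINT x|lborel. indicator ?U x * (SU i. pderiv_coord i (%y. ?a y * (L.rho (coord c (\<phi> t)) y * gradient (g t c) ?b y $ i)) x))"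
 proof (rule LINT_cong[OF refl])
  fix x
  show "indicator ?U x * (r0 c x * coord c ?F x) =
   indicator ?U x * (SU i. pderiv_coord i (%y. ?a y * (L.rho (coord c (\<phi> t)) y * gradient (g t c) ?b y $ i)) x)"
  proof (cases "x : ?U")
   case x: True
   have phi: "smooth_on ?U (coord c (\<phi> t))" by (rule phi_chart_smooth[OF t c])
   have rho: "L.rho (coord c (\<phi> t)) x = r0 c x"
    using rho_constant[OF t c x] by (simp add: L.rho_def rho_def)
   have "(SU i. pderiv_coord i (%y. ?a y * (L.rho (coord c (\<phi> t)) y * gradient (g t c) ?b y $ i)) x) =
    (SU i. ?a x * pderiv_coord i (%y. L.rho (coord c (\<phi> t)) y * gradient (g t c) ?b y $ i) x
     + pderiv_coord i ?a x * (L.rho (coord c (\<phi> t)) x * gradient (g t c) ?b x $ i))"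
    by (intro sum.cong[OF refl] pderiv_mult C1M_diff[OF a c x] L.diff[OF _ x] smooth_on_mult L.rho_smooth phi L.gradient_smooth bs)
   also have "... = ?a x * (r0 c x * witten_laplacian (g t c) (coord c (\<phi> t)) ?b x) + r0 c x * gm t c ?a ?b x"
    unfolding sum.distrib sum_distrib_left[symmetric] L.divergence_form[OF x bs phi] rho L.gam_gradient
    by (simp add: sum_distrib_left mult.left_commute)
   also have "... = r0 c x * coord c ?F x"
    using coord_Gam[OF t a SM_C1M[OF b] c x] coord_Lap[OF t b c x] by (simp add: coord_def distrib_left mult.left_commute)
   finally show ?thesis by simp
  qed simp
 qed
 also have "... = 0"
 proof (rule divergence_zero[OF oU K])
  show "Ck_on 1 ?U (%y. ?a y * (L.rho (coord c (\<phi> t)) y * gradient (g t c) ?b y $ i))" for i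
  proof (rule Ck_on_mult)
   show "Ck_on 1 ?U ?a" using C1M_chart[OF a c] by (simp only: One_nat_def)
   show "Ck_on 1 ?U (%y. L.rho (coord c (\<phi> t)) y * gradient (g t c) ?b y $ i)"
    by (intro smooth_on_Ck smooth_on_mult L.rho_smooth phi_chart_smooth t c L.gradient_smooth bs)
  qed
 qed (use az in simp)
 finally show ?thesis
  using mu_integrable[OF Gc] mu_integrable[OF continuous_on_mult[OF ac Lc]] by simp
qed

text \<open>Dividing by the positive sum of the bumps splits \<open>a\<close> into finitely many C^1
  pieces, each with compact support in one chart.\<close>

theorem integration_by_parts:
 assumes t: "t : {0..T}" and a: "C1M a" and b: "SM b"
 shows "(LINT p|mu. Gam t a b p) = - (LINT p|mu. a p * Lap t b p)"
proof -
 obtain C :: "'a set" and B where C: "finite C" and B: "!!k. k : C ==> C1M (B k)" "!!p. p : M ==> (SUM k:C. B k p) > 0"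
  "!!k. k : C ==> EX c K. c : A & compact K & K \<subseteq> chart_image c & (ALL p:M. B k p ~= 0 --> p : fst c & snd c p : K)"
  using bump_cover by blast
 define a' where "a' p = a p / (SUM k:C. B k p)" for p
 have a': "C1M a'" unfolding a'_def
  by (intro C1M_divide a C1M_sum B(1)) (use B(2) in force)+
 have ak: "C1M (%p. B k p * a' p)" if "k : C" for k by (rule C1M_mult[OF B(1)[OF that] a'])
 have dec: "a p = (SUM k:C. B k p * a' p)" if "p : M" for p
 proof -
  have "(SUM k:C. B k p * a' p) = (SUM k:C. B k p) * a' p" by (rule sum_distrib_right[symmetric])
  then show ?thesis using B(2)[OF that] by (simp add: a'_def)
 qed
 have loc: "(LINT p|mu. Gam t (%p. B k p * a' p) b p) = - (LINT p|mu. (B k p * a' p) * Lap t b p)" if k: "k : C" for k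
 proof -
  obtain c K where cK: "c : A" "compact K" "K \<subseteq> chart_image c" "ALL p:M. B k p ~= 0 --> p : fst c & snd c p : K"
   using B(3)[OF k] by blast
  show ?thesis by (rule integration_by_parts_local[OF t ak[OF k] b cK(1-3)]) (use cK(4) in auto)
 qed
 have Lc: "continuous_on M (Lap t b)" by (rule C1M_continuous[OF SM_C1M[OF SM_Lap[OF t b]]])
 have eqG: "Gam t a b p = (SUM k:C. Gam t (%p. B k p * a' p) b p)" if p: "p : M" for p
 proof -
  have "Gam t a b p = Gam t (%p. SUM k:C. B k p * a' p) b p" by (rule Gam_cong[OF dec refl t p])
  then show ?thesis using Gam_sum[OF t C ak SM_C1M[OF b] p] by simp
 qed
 have "(LINT p|mu. Gam t a b p) = (LINT p|mu. (SUM k:C. Gam t (%p. B k p * a' p) b p))"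
  by (rule LINT_cong[OF refl]) (simp add: eqG)
 also have "... = (SUM k:C. \<integral>p. Gam t (%p. B k p * a' p) b p \<partial>mu)"
  by (rule LINT_sum) (intro mu_integrable Gam_continuous t ak SM_C1M[OF b])
 also have "... = (SUM k:C. - (LINT p|mu. (B k p * a' p) * Lap t b p))"
  by (rule sum.cong[OF refl loc])
 also have "... = - (LINT p|mu. (SUM k:C. (B k p * a' p) * Lap t b p))"
  unfolding sum_negf
  by (subst LINT_sum) (intro mu_integrable continuous_on_mult C1M_continuous[OF ak] Lc, auto)
 also have "(LINT p|mu. (SUM k:C. (B k p * a' p) * Lap t b p)) = (LINT p|mu. a p * Lap t b p)"
  by (rule LINT_cong[OF refl]) (simp add: dec sum_distrib_right)
 finally show ?thesis .
qed

end

subsection \<open>Entropy derivatives\<close>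

lemma D_coeff_derivative:
 assumes "0 < t"
 shows "(D_coeff K has_real_derivative - (D_coeff K t)\<^sup>2 * exp (- 2 * K * t)) (at t within S)"
proof (cases "K = 0")
 case True
 then have "D_coeff K = (%t. 1 / t)" by (simp add: D_coeff_def fun_eq_iff)
 then show ?thesis using assms True
  by (auto intro!: derivative_eq_intros simp: power2_eq_square divide_simps D_coeff_def)
next
 case False
 then have D: "D_coeff K = (%t. 2 * K / (1 - exp (- 2 * K * t)))" by (simp add: D_coeff_def fun_eq_iff)
 have "exp (- 2 * K * t) ~= 1" using False assms by simp
 then show ?thesis unfolding D
  by (auto intro!: derivative_eq_intros simp: power2_eq_square divide_simps)
qed

text \<open>These identities explain the factor in \<open>W_entropy\<close>: the derivative of
  \<open>D_coeff\<close> is absorbed so that the entropy keeps the constant coefficient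
  \<open>K\<close>, and its derivative, the Fisher information, gets
  \<open>(1 + exp (2 * K * t)) / 2\<close>.\<close>

lemma sinh_coeff_D_coeff:
 assumes "0 < t"
 shows "sinh_coeff K t * D_coeff K t = (1 + exp (2 * K * t)) / 2"
  "D_coeff K t + sinh_coeff K t * (- (D_coeff K t)\<^sup>2 * exp (- 2 * K * t)) = K"
proof -
 define y where "y = exp (- 2 * K * t)"
 have y: "y > 0" "exp (2 * K * t) = 1 / y" unfolding y_def by (simp_all add: exp_minus divide_simps)
 have "sinh_coeff K t * D_coeff K t = (1 + 1 / y) / 2 & D_coeff K t * (1 - y) = 2 * K"
 proof (cases "K = 0")
  case True
  then show ?thesis using assms by (simp add: sinh_coeff_def D_coeff_def y_def)
 next
  case False
  then have y1: "y ~= 1" using assms by (simp add: y_def)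
  have "sinh (2 * K * t) = (1 / y - y) / 2" using y(2) by (simp add: sinh_def y_def exp_minus field_simps)
  moreover have "D_coeff K t = 2 * K / (1 - y)" using False by (simp add: D_coeff_def y_def)
  moreover have "(a / 2) / (2 * K) * (2 * K / b) = a / (2 * b)" for a b using False by simp
  ultimately have "sinh_coeff K t * D_coeff K t = (1 / y - y) / (2 * (1 - y)) & D_coeff K t * (1 - y) = 2 * K"
   using False y1 unfolding sinh_coeff_def by (simp only: if_False) simp
  moreover have "(1 / y - y) / (2 * (1 - y)) = (1 + 1 / y) / 2"
  proof -
   have "(1 / y - y) * 2 = (1 + 1 / y) * (2 * (1 - y))" using y(1) by (simp add: field_simps)
   then show ?thesis using y1 by (subst frac_eq_eq) auto
  qed
  ultimately show ?thesis by simp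
 qed
 then have 1: "sinh_coeff K t * D_coeff K t = (1 + 1 / y) / 2" and 2: "D_coeff K t * (1 - y) = 2 * K" by simp_all
 show "sinh_coeff K t * D_coeff K t = (1 + exp (2 * K * t)) / 2" using 1 y(2) by simp
 have "D_coeff K t + sinh_coeff K t * (- (D_coeff K t)\<^sup>2 * y) = D_coeff K t - (sinh_coeff K t * D_coeff K t) * D_coeff K t * y"
  by (simp add: power2_eq_square algebra_simps)
 also have "... = D_coeff K t * (1 - y) / 2" unfolding 1 using y(1) by (simp add: field_simps)
 finally show "D_coeff K t + sinh_coeff K t * (- (D_coeff K t)\<^sup>2 * exp (- 2 * K * t)) = K"
  using 2 by (simp add: y_def)
qed

context metric_flow
begin

lemma spacetime_uniform:
 fixes F :: "real => 'a => real"
 assumes F: "continuous_on (I \<times> M) (%q. F (fst q) (snd q))" and t: "t : I" and e: "0 < e"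
 obtains d where "0 < d" "!!s p. s : I ==> \<bar>s - t\<bar> < d ==> p : M ==> \<bar>F s p - F t p\<bar> <= e"
proof -
 obtain X0 where X: "t : X0" "open X0" "ALL x:X0 \<inter> I. ALL p:M. dist (F x p) (F t p) <= e"
  using continuous_on_prod_compactE[OF F compact_M t e] by auto
 obtain d where d: "d > 0" "ball t d \<subseteq> X0" using openE[OF X(2,1)] .
 show ?thesis
 proof (rule that[OF d(1)])
  fix s p assume s: "s : I" "\<bar>s - t\<bar> < d" and p: "p : M"
  then have "s : X0 \<inter> I" using d(2) by (auto simp: dist_real_def)
  then show "\<bar>F s p - F t p\<bar> <= e" using X(3) p by (auto simp: dist_real_def)
 qed
qed

lemma spacetime_slice:
 "continuous_on (I \<times> M) (%q. F (fst q) (snd q)) ==> t : I ==> continuous_on M (F t)"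
 using continuous_on_compose2[of "I \<times> M" "%q. F (fst q) (snd q)" M "%p. (t, p)",
   OF _ continuous_on_Pair[OF continuous_on_const continuous_on_id]]
 by auto

lemma mu_abs_bound:
 fixes F :: "'a => real"
 assumes F: "continuous_on M F" and B: "!!p. p : M ==> \<bar>F p\<bar> <= B"
 shows "\<bar>\<integral>p. F p \<partial>mu\<bar> <= B * measure mu M"
proof -
 interpret finite_measure mu by (rule mu_finite)
 have "\<bar>\<integral>p. F p \<partial>mu\<bar> <= (LINT p|mu. \<bar>F p\<bar>)" by (rule integral_abs_bound)
 also have "... <= (LINT p|mu. B)"
  by (rule integral_mono[OF mu_integrable[OF continuous_on_rabs[OF F]]]) (use B in auto)
 finally show ?thesis by (simp add: mult.commute)
qed

lemma mu_integral_continuous: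
 fixes F :: "real => 'a => real"
 assumes F: "continuous_on (I \<times> M) (%q. F (fst q) (snd q))"
 shows "continuous_on I (%t. \<integral>p. F t p \<partial>mu)"
 unfolding continuous_on_iff
proof (intro ballI allI impI)
 fix t and e :: real assume t: "t : I" and e: "0 < e"
 define m where "m = measure mu M + 1"
 have m: "0 < m" "measure mu M < m" by (simp_all add: m_def add_nonneg_pos)
 obtain d where d: "0 < d" "!!s p. s : I ==> \<bar>s - t\<bar> < d ==> p : M ==> \<bar>F s p - F t p\<bar> <= e / m"
  by (rule spacetime_uniform[OF F t, of "e / m"]) (use e m in auto)
 show "EX d>0. ALL s:I. dist s t < d --> dist (LINT p|mu. F s p) (LINT p|mu. F t p) < e"
 proof (intro exI[of _ d] conjI d(1) ballI impI)
  fix s assume s: "s : I" "dist s t < d"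
  note c = spacetime_slice[OF F s(1)] spacetime_slice[OF F t]
  have "\<bar>\<integral>p. F s p - F t p \<partial>mu\<bar> <= e / m * measure mu M"
   by (rule mu_abs_bound[OF continuous_on_diff[OF c]]) (use d(2)[OF s(1)] s(2) in \<open>simp add: dist_real_def\<close>)
  also have "... < e" using m e by (simp add: field_simps)
  finally show "dist (LINT p|mu. F s p) (LINT p|mu. F t p) < e"
   by (simp add: dist_real_def LINT_diff[OF c[THEN mu_integrable]])
 qed
qed

text \<open>The error of the linearisation at \<open>t\<close> is controlled pointwise by the
  oscillation of \<open>F'\<close> on the segment from \<open>t\<close> to \<open>s\<close>.
  Compactness of the manifold makes this uniform in the point, and finite mass carries it to the
  integral.\<close>

lemma mu_integral_derivative:
 fixes F F' :: "real => 'a => real"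
 assumes I: "time_interval T I" and t: "t : I" and c: "!!s. s : I ==> continuous_on M (F s)"
  and F': "continuous_on (I \<times> M) (%q. F' (fst q) (snd q))"
  and D: "!!s p. s : I ==> p : M ==> ((%s. F s p) has_real_derivative F' s p) (at s within {0..T})"
 shows "((%s. \<integral>p. F s p \<partial>mu) has_real_derivative (LINT p|mu. F' t p)) (at t within {0..T})"
proof -
 have sub: "I \<subseteq> {0..T}" by (rule time_interval_subset[OF I])
 have cI: "closed_segment t s \<subseteq> I" if "s : I" for s
  using that t I by (auto simp: time_interval_def closed_segment_eq_real_ivl split: if_splits)
 \<comment> \<open>The summand 1 keeps the divisor positive even when the measure is zero.\<close>
 define m where "m = measure mu M + 1"
 have m: "0 < m" "measure mu M <= m" by (simp_all add: m_def add_nonneg_pos)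
 have c': "continuous_on M (F' t)" by (rule spacetime_slice[OF F' t])
 have "((%s. \<integral>p. F s p \<partial>mu) has_derivative (*) (LINT p|mu. F' t p)) (at t within I)"
  unfolding has_derivative_within_alt
 proof (intro conjI allI impI bounded_linear_mult_right)
  fix e :: real assume e: "0 < e"
  obtain d where d: "0 < d" "!!s p. s : I ==> \<bar>s - t\<bar> < d ==> p : M ==> \<bar>F' s p - F' t p\<bar> <= e / m"
   by (rule spacetime_uniform[OF F' t, of "e / m"]) (use e m in auto)
  show "EX d>0. ALL s:I. norm (s - t) < d -->
   norm ((LINT p|mu. F s p) - (LINT p|mu. F t p) - (LINT p|mu. F' t p) * (s - t)) <= e * norm (s - t)"
  proof (intro exI[of _ d] conjI d(1) ballI impI)
   fix s assume s: "s : I" "norm (s - t) < d"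
   have ptw: "\<bar>F s p - F t p - F' t p * (s - t)\<bar> <= e / m * \<bar>s - t\<bar>" if p: "p : M" for p
   proof -
    let ?S = "I \<inter> ball t d"
    have "norm (F s p - F t p - (s - t) *\<^sub>R F' t p) <= norm (s - t) * (e / m)"
    proof (rule vector_differentiable_bound_linearization[of ?S "%s. F s p" "%s. F' s p"])
     fix x assume x: "x : ?S"
     have "((%s. F s p) has_real_derivative F' x p) (at x within ?S)"
      by (rule DERIV_subset[OF D]) (use x p sub in auto)
     then show "((%s. F s p) has_vector_derivative F' x p) (at x within ?S)"
      by (simp add: has_real_derivative_iff_has_vector_derivative)
     show "norm (F' x p - F' t p) <= e / m" using d(2)[of x p] x p by (auto simp: dist_real_def abs_minus_commute)
    next
     have "s : ball t d" using s(2) by (simp add: dist_real_def abs_minus_commute)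
     then have "closed_segment t s \<subseteq> ball t d" using d(1) by (intro closed_segment_subset convex_ball) auto
     then show "closed_segment t s \<subseteq> ?S" using cI[OF s(1)] by blast
    qed (use t d(1) in auto)
    then show ?thesis by (simp add: mult.commute)
   qed
   note ii = c[OF s(1), THEN mu_integrable] c[OF t, THEN mu_integrable] c'[THEN mu_integrable]
   have "(LINT p|mu. F s p) - (LINT p|mu. F t p) - (LINT p|mu. F' t p) * (s - t) = (LINT p|mu. F s p - F t p - F' t p * (s - t))"
    using ii by simp
   also have "\<bar>...\<bar> <= e / m * \<bar>s - t\<bar> * measure mu M"
    by (rule mu_abs_bound[OF _ ptw]) (intro continuous_on_diff continuous_on_mult continuous_on_const c c' s t)
   also have "... = (e * \<bar>s - t\<bar>) * (measure mu M / m)" by simp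
   also have "... <= (e * \<bar>s - t\<bar>) * 1" using m e by (intro mult_left_mono) auto
   finally show "norm ((LINT p|mu. F s p) - (LINT p|mu. F t p) - (LINT p|mu. F' t p) * (s - t)) <= e * norm (s - t)" by simp
  qed
 qed
 then show ?thesis unfolding has_field_derivative_def at_within_time_interval[OF I t] .
qed

lemma Gam_ln:
 assumes t: "t : {0..T}" and a: "C1M a" and pos: "!!p. p : M ==> 0 < a p" and p: "p : M"
 shows "Gam t (%q. ln (a q)) b p = Gam t a b p / a p"
proof -
 define c where "c = chart_at A p"
 have c: "c : A" "p : fst c" using chart_at[OF p] by (auto simp: c_def)
 have P: "pderiv_coord i (%y. ln (coord c a y)) (snd c p) = inverse (a p) * pderiv_coord i (coord c a) (snd c p)" for i
 proof (rule pderiv_compose[OF C1M_diff[OF a c(1) snd_in[OF c(2)]]])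
  show "(ln has_real_derivative inverse (a p)) (at (coord c a (snd c p)))"
   unfolding coord_apply[OF c] by (rule DERIV_ln[OF pos[OF p]])
 qed
 show ?thesis
  unfolding Gam_def Let_def c_def[symmetric] coord_arith local_metric.gam_def[OF local_metric_g[OF t c(1)]] P
   divide_inverse sum_distrib_right
  by (intro sum.cong refl) simp
qed

lemma integration_by_parts':
 assumes "t : {0..T}" "SM a" "SM b"
 shows "(LINT p|mu. a p * Lap t b p) = (LINT p|mu. b p * Lap t a p)"
proof -
 have "(LINT p|mu. Gam t a b p) = (LINT p|mu. Gam t b a p)"
  by (rule LINT_cong[OF refl]) (use Gam_sym[OF assms(1) assms(2,3)[THEN SM_C1M]] in simp)
 then show ?thesis using integration_by_parts[OF assms(1) SM_C1M[OF assms(2)] assms(3)]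
   integration_by_parts[OF assms(1) SM_C1M[OF assms(3)] assms(2)] by simp
qed

text \<open>The chain rule for the Laplacian is obtained by testing against the difference of both sides.\<close>

lemma Lap_ln:
 assumes t: "t : {0..T}" and a: "SM a" and pos: "!!p. p : M ==> 0 < a p" and p: "p : M"
 shows "Lap t a p = a p * (Lap t (%q. ln (a q)) p + Gam t (%q. ln (a q)) (%q. ln (a q)) p)"
proof -
 let ?w = "%q. ln (a q)"
 have w: "SM ?w" by (rule SM_ln[OF a pos])
 note C = a[THEN SM_C1M] w[THEN SM_C1M]
 note S = SM_Lap[OF t a, THEN SM_C1M] SM_Lap[OF t w, THEN SM_C1M] SM_Gam[OF t w w, THEN SM_C1M]
 define h where "h q = Lap t a q - a q * (Lap t ?w q + Gam t ?w ?w q)" for q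
 have h: "C1M h" unfolding h_def by (intro C1M_diff2 C1M_mult C1M_add C S)
 note cont = C1M_continuous[OF C(1)] C1M_continuous[OF C(2)] C1M_continuous[OF h] S[THEN C1M_continuous]
 have "Gam t h a q = Gam t (%q. a q * h q) ?w q - h q * a q * Gam t ?w ?w q" if q: "q : M" for q
  using Gam_mult[OF t C(1) h C(2) q] Gam_ln[OF t C(1) pos q, of h] Gam_ln[OF t C(1) pos q, of ?w]
   Gam_sym[OF t C(2) h q] Gam_sym[OF t C(1) h q] Gam_sym[OF t C(1) C(2) q] pos[OF q]
  by (simp add: field_simps)
 then have "(LINT q|mu. Gam t h a q) = (LINT q|mu. Gam t (%q. a q * h q) ?w q - h q * a q * Gam t ?w ?w q)"
  by (intro LINT_cong) auto
 also have "... = (LINT q|mu. Gam t (%q. a q * h q) ?w q) - (LINT q|mu. h q * a q * Gam t ?w ?w q)"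
  by (intro LINT_diff mu_integrable Gam_continuous t C1M_mult C h continuous_on_mult cont)
 also have "... = - (LINT q|mu. a q * h q * Lap t ?w q) - (LINT q|mu. h q * a q * Gam t ?w ?w q)"
  by (subst integration_by_parts[OF t C1M_mult[OF C(1) h] w]) (rule refl)
 also have "... = - (LINT q|mu. h q * (a q * (Lap t ?w q + Gam t ?w ?w q)))"
 proof -
  have "(LINT q|mu. h q * (a q * (Lap t ?w q + Gam t ?w ?w q))) = (LINT q|mu. a q * h q * Lap t ?w q + h q * a q * Gam t ?w ?w q)"
   by (rule LINT_cong[OF refl]) (simp add: algebra_simps)
  also have "... = (LINT q|mu. a q * h q * Lap t ?w q) + (LINT q|mu. h q * a q * Gam t ?w ?w q)"
   by (intro LINT_add mu_integrable continuous_on_mult cont)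
  finally show ?thesis by simp
 qed
 finally have "(LINT q|mu. h q * Lap t a q) = (LINT q|mu. h q * (a q * (Lap t ?w q + Gam t ?w ?w q)))"
  unfolding integration_by_parts[OF t h a] by simp
 moreover have "(LINT q|mu. h q * Lap t a q - h q * (a q * (Lap t ?w q + Gam t ?w ?w q))) =
  (LINT q|mu. h q * Lap t a q) - (LINT q|mu. h q * (a q * (Lap t ?w q + Gam t ?w ?w q)))"
  by (intro LINT_diff mu_integrable continuous_on_mult continuous_on_add cont)
 ultimately have "(LINT q|mu. h q * Lap t a q - h q * (a q * (Lap t ?w q + Gam t ?w ?w q))) = 0" by linarith
 moreover have "h q * Lap t a q - h q * (a q * (Lap t ?w q + Gam t ?w ?w q)) = h q * h q" for q
  unfolding h_def by (simp only: right_diff_distrib)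
 ultimately have "(LINT q|mu. h q * h q) = 0" by simp
 then have "h p * h p = 0" by (intro mu_zero[of "%q. h q * h q"] continuous_on_mult cont p) auto
 then have "h p = 0" by simp
 then show ?thesis unfolding h_def by linarith
qed

text \<open>The iterated carre du champ of Bakry and Emery, without their factor 1/2, to match the
  normalisation of \<open>Gamma2\<close>.\<close>

definition Gamma2M :: "real => ('a => real) => 'a => real" where
 "Gamma2M t w p = Lap t (Gam t w w) p - 2 * Gam t w (Lap t w) p"

lemma Gamma2M_chart:
 assumes t: "t : {0..T}" and w: "SM w" and c: "c : A" and p: "p : fst c"
 shows "Gamma2M t w p = Gamma2 (g t c) (coord c (\<phi> t)) (coord c w) (snd c p)"
proof -
 note x = snd_in[OF p] and oU = open_chart_image[OF c] and W = SM_C1M[OF w]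
 interpret L: local_metric "chart_image c" "g t c" by (rule local_metric_g[OF t c])
 have h: "hessian (g t c) (coord c (Gam t w w)) (snd c p) = hessian (g t c) (gm t c (coord c w) (coord c w)) (snd c p)"
  by (rule hessian_cong[OF oU x coord_Gam[OF t W W c]])
 have k: "gm t c (coord c (\<phi> t)) (coord c (Gam t w w)) (snd c p) = gm t c (coord c (\<phi> t)) (gm t c (coord c w) (coord c w)) (snd c p)"
  by (rule gam_cong[OF oU x refl coord_Gam[OF t W W c] t c])
 have 1: "Lap t (Gam t w w) p = witten_laplacian (g t c) (coord c (\<phi> t)) (gm t c (coord c w) (coord c w)) (snd c p)"
  unfolding Lap_chart[OF t SM_Gam[OF t w w] c p] L.witten_laplacian_eq[OF x] L.laplacian_sum h k ..
 have 2: "Gam t w (Lap t w) p = gm t c (coord c w) (coord c (Lap t w)) (snd c p)"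
  by (rule Gam_chart[OF t W SM_C1M[OF SM_Lap[OF t w]] c p])
 have 3: "... = gm t c (coord c w) (witten_laplacian (g t c) (coord c (\<phi> t)) (coord c w)) (snd c p)"
  by (rule gam_cong[OF oU x refl coord_Lap[OF t w c] t c])
 show ?thesis
  unfolding Gamma2M_def 1 2 3 by (rule L.witten_bochner[OF x SM_chart[OF w c] phi_chart_smooth[OF t c]])
qed

lemma W_integrand_eq:
 assumes t: "t : {0..T}" and w: "SM w" and p: "p : M"
 shows "W_integrand A T K g \<phi> t w p = 1/2 * (Gdot t w w p + Gamma2M t w p) - K * Gam t w w p"
proof -
 define c where "c = chart_at A p"
 have c: "c : A" "p : fst c" using chart_at[OF p] by (auto simp: c_def)
 note W = SM_C1M[OF w]
 show ?thesis
  unfolding Gdot_chart[OF t W W c] Gamma2M_chart[OF t w c] Gam_chart[OF t W W c]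
   local_metric.bil_gradient[OF local_metric_g[OF t c(1)] snd_in[OF c(2)], symmetric]
  by (simp add: W_integrand_def Let_def c_def[symmetric])
qed

end

section \<open>Entropy and Fisher information along a heat solution\<close>

locale heat_flow = metric_flow M A T g \<phi>
 for M :: "'a::t2_space set" and A :: "('a, 'n::finite) chart set" and T g \<phi> +
 fixes f :: "'a => real" and u :: "real => 'a => real"
 assumes f_pos: "pos_continuous M f" and heat: "heat_solution M A T g \<phi> f u"
begin

abbreviation "I == {0<..T}"
abbreviation "w == %t p. ln (u t p)"

lemma I_subset: "t : I ==> t : {0..T}" by simp

lemma u_smooth: "smooth_functions A I u" using heat by (simp add: heat_solution_def)

lemma u_pos: "t : {0..T} ==> p : M ==> 0 < u t p" using heat by (simp add: heat_solution_def)

lemma u_0: "p : M ==> u 0 p = f p" using heat by (simp add: heat_solution_def)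

lemma u_continuous: "continuous_on ({0..T} \<times> M) (%q. u (fst q) (snd q))"
 using heat by (simp add: heat_solution_def case_prod_unfold)

lemma w_smooth: "smooth_functions A I w"
 by (rule smooth_functions_ln[OF u_smooth]) (simp add: u_pos)

lemma SM_u: "t : I ==> SM (u t)" and SM_w: "t : I ==> SM (w t)"
 by (rule smooth_functions_slice[OF u_smooth] smooth_functions_slice[OF w_smooth], assumption)+

lemmas Lap_u_smooth = smooth_functions_Lap[OF T_interval(2) u_smooth]
lemmas Gam_w_smooth = smooth_functions_Gam[OF T_interval(2) w_smooth w_smooth]

lemma dt_u:
 assumes t: "t : I" and p: "p : M"
 shows "dt u t p = Lap t (u t) p"
proof -
 obtain c where c: "c : A" "p : fst c" using chart_union p by blast
 have "coord c (dt u t) (snd c p) = witten_laplacian (g t c) (coord c (\<phi> t)) (coord c (u t)) (snd c p)"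
  using heat t c(1) snd_in[OF c(2)] unfolding heat_solution_def coord_dt[symmetric] by blast
 then show ?thesis
  by (simp add: Lap_chart[OF I_subset[OF t] SM_u[OF t] c] coord_apply[OF c])
qed

lemma u_deriv:
 "t : I ==> p : M ==> ((%s. u s p) has_real_derivative Lap t (u t) p) (at t within {0..T})"
 using dt_deriv[OF T_interval(2) u_smooth] dt_u by metis

lemma Lap_u: "t : I ==> p : M ==> Lap t (u t) p = u t p * (Lap t (w t) p + Gam t (w t) (w t) p)"
 by (rule Lap_ln) (simp_all add: SM_u u_pos)

lemma dt_w:
 assumes t: "t : I" and p: "p : M"
 shows "dt w t p = Lap t (w t) p + Gam t (w t) (w t) p"
proof -
 have "((%s. ln (u s p)) has_real_derivative inverse (u t p) * Lap t (u t) p) (at t within {0..T})"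
  by (rule DERIV_chain'[OF u_deriv[OF t p] DERIV_ln[OF u_pos[OF I_subset[OF t] p]]])
 from time_deriv_DERIV[OF I_subset[OF t] this] show ?thesis
  unfolding dt_def Lap_u[OF t p] using u_pos[OF I_subset[OF t] p] by simp
qed

lemma Gam_w:
 assumes t: "t : I" and b: "C1M b" and p: "p : M"
 shows "Gam t (u t) b p = u t p * Gam t (w t) b p"
 using Gam_ln[OF I_subset[OF t] SM_C1M[OF SM_u[OF t]] u_pos[OF I_subset[OF t]] p, of b] u_pos[OF I_subset[OF t] p] by simp

definition "fisher t = (LINT p|mu. Gam t (w t) (w t) p * u t p)"

lemma integral_Lap_0: "t : {0..T} ==> SM a ==> (LINT p|mu. Lap t a p) = 0"
 using integration_by_parts[of t "%_. 1" a] C1M_const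
  LINT_cong[OF refl, of mu "Gam t (%_. 1) a" "%_. 0"] Gam_const[of t _ 1 a] by simp

text \<open>The time derivative of u log u is (w + 1) Lu. The integral of Lu vanishes, and
  integration by parts turns the rest into the carre du champ of w and u, where u = exp w brings out
  the factor u.\<close>

lemma entropy_derivative:
 assumes t: "t : I"
 shows "((%s. \<integral>p. u s p * w s p \<partial>mu) has_real_derivative - fisher t) (at t within {0..T})"
proof -
 note t' = I_subset[OF t] and u = SM_u[OF t] and w = SM_w[OF t]
 note c = u[THEN SM_C1M] w[THEN SM_C1M]
 have smD: "smooth_functions A I (%t p. w t p * Lap t (u t) p + Lap t (u t) p)"
  by (intro smooth_functions_add smooth_functions_mult w_smooth Lap_u_smooth)
 have Lc: "continuous_on M (Lap t (u t))" by (rule C1M_continuous[OF SM_C1M[OF SM_Lap[OF t' u]]])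
 have D: "((%s. \<integral>p. u s p * w s p \<partial>mu) has_real_derivative (LINT p|mu. w t p * Lap t (u t) p + Lap t (u t) p)) (at t within {0..T})"
 proof (rule mu_integral_derivative[OF T_interval(2) t _ smooth_functions_continuous[OF smD]])
  show "continuous_on M (%p. u s p * w s p)" if "s : I" for s
   by (intro continuous_on_mult C1M_continuous SM_C1M SM_u SM_w that)
  show "((%s. u s p * w s p) has_real_derivative w s p * Lap s (u s) p + Lap s (u s) p) (at s within {0..T})"
   if s: "s : I" and p: "p : M" for s p
  proof -
   have "((%x. x * ln x) has_real_derivative w s p + 1) (at (u s p))"
    using u_pos[OF I_subset[OF s] p] by (auto intro!: derivative_eq_intros)
   from DERIV_chain'[OF u_deriv[OF s p] this] show ?thesis by (simp add: distrib_right)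
  qed
 qed
 have "(LINT p|mu. w t p * Lap t (u t) p + Lap t (u t) p) = (LINT p|mu. w t p * Lap t (u t) p) + (LINT p|mu. Lap t (u t) p)"
  by (intro LINT_add mu_integrable continuous_on_mult C1M_continuous c Lc)
 moreover have "(LINT p|mu. Gam t (w t) (u t) p) = fisher t"
  unfolding fisher_def
  by (rule LINT_cong[OF refl]) (use Gam_w[OF t c(2)] Gam_sym[OF t' c(2,1)] in \<open>simp add: mult.commute\<close>)
 ultimately have "(LINT p|mu. w t p * Lap t (u t) p + Lap t (u t) p) = - fisher t"
  using integration_by_parts[OF t' c(2) u] integral_Lap_0[OF t' u] by linarith
 with D show ?thesis by simp
qed

text \<open>With the time derivative of w equal to Lw + \<Gamma>(w, w), the integrand is minus the
  claimed one plus L(u \<Gamma>(w, w)) written out by the product rule, and that integrates to zero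
  by two integrations by parts.\<close>

lemma fisher_derivative:
 assumes t: "t : I"
 shows "(fisher has_real_derivative - (LINT p|mu. (Gdot t (w t) (w t) p + Gamma2M t (w t) p) * u t p)) (at t within {0..T})"
proof -
 note t' = I_subset[OF t] and u = SM_u[OF t] and w = SM_w[OF t]
 note c = u[THEN SM_C1M] w[THEN SM_C1M]
 let ?G = "%s. Gam s (w s) (w s)" and ?L = "%s. Lap s (w s)"
 define D where "D s p = dt (%s. Gam s (w s) (w s)) s p * u s p + ?G s p * Lap s (u s) p" for s p
 have G: "SM (?G t)" and L: "SM (?L t)" by (rule SM_Gam[OF t' w w] SM_Lap[OF t' w])+
 note gl = G[THEN SM_C1M] L[THEN SM_C1M]
 have smD: "smooth_functions A I D"
  unfolding D_def by (intro smooth_functions_add smooth_functions_mult smooth_functions_dt T_interval(2) Gam_w_smooth u_smooth Lap_u_smooth)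
 have "(fisher has_real_derivative (LINT p|mu. D t p)) (at t within {0..T})"
  unfolding fisher_def[abs_def]
 proof (rule mu_integral_derivative[OF T_interval(2) t _ smooth_functions_continuous[OF smD]])
  show "continuous_on M (%p. ?G s p * u s p)" if "s : I" for s
   by (intro continuous_on_mult C1M_continuous SM_C1M SM_u SM_w SM_Gam I_subset that)
  show "((%s. ?G s p * u s p) has_real_derivative D s p) (at s within {0..T})" if s: "s : I" and p: "p : M" for s p
   unfolding D_def using DERIV_mult[OF dt_deriv[OF T_interval(2) Gam_w_smooth s p] u_deriv[OF s p]]
   by (simp add: algebra_simps)
 qed
 moreover have "(LINT p|mu. D t p) = - (LINT p|mu. (Gdot t (w t) (w t) p + Gamma2M t (w t) p) * u t p)"
 proof -
  have gd: "continuous_on M (Gdot t (w t) (w t))" by (rule spacetime_slice[OF Gdot_continuous[OF c(2,2)] t'])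
  note LG = SM_Lap[OF t' G, THEN SM_C1M] and Lu = SM_Lap[OF t' u, THEN SM_C1M]
  have wt: "Gam t (w t) (dt w t) p = Gam t (w t) (?L t) p + Gam t (w t) (?G t) p" if p: "p : M" for p
  proof -
   have "Gam t (w t) (dt w t) p = Gam t (w t) (%p. ?L t p + ?G t p) p" by (rule Gam_cong[OF refl dt_w[OF t] t' p])
   also have "... = Gam t (%p. ?L t p + ?G t p) (w t) p"
    by (rule Gam_sym[OF t' c(2) C1M_add[OF gl(2,1)] p])
   also have "... = Gam t (?L t) (w t) p + Gam t (?G t) (w t) p"
    by (rule Gam_add[OF t' gl(2,1) c(2) p])
   finally show ?thesis using Gam_sym[OF t' c(2) gl(1) p] Gam_sym[OF t' c(2) gl(2) p] by simp
  qed
  have D: "D t p = - ((Gdot t (w t) (w t) p + Gamma2M t (w t) p) * u t p)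
    + (u t p * Lap t (?G t) p + (2 * Gam t (u t) (?G t) p + ?G t p * Lap t (u t) p))" if p: "p : M" for p
  proof -
   have e: "dt (%s. Gam s (w s) (w s)) t p = - Gdot t (w t) (w t) p + 2 * Gam t (w t) (dt w t) p"
    unfolding dt_def[of "%s. Gam s (w s) (w s)"] by (rule time_deriv_DERIV[OF t' Gam_time_deriv[OF T_interval(2) w_smooth t p]])
   show ?thesis unfolding D_def e wt[OF p] Gam_w[OF t gl(1) p] Gamma2M_def by (simp add: algebra_simps)
  qed
  have i1: "integrable mu (%p. (Gdot t (w t) (w t) p + Gamma2M t (w t) p) * u t p)"
   unfolding Gamma2M_def
   by (intro mu_integrable continuous_on_mult continuous_on_add continuous_on_diff continuous_on_const gd
     C1M_continuous LG c Gam_continuous t' gl)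
  have i2: "integrable mu (%p. u t p * Lap t (?G t) p)" "integrable mu (Gam t (u t) (?G t))" "integrable mu (%p. ?G t p * Lap t (u t) p)"
   by (intro mu_integrable continuous_on_mult C1M_continuous LG Lu c gl Gam_continuous t')+
  have "(LINT p|mu. D t p) = (LINT p|mu. - ((Gdot t (w t) (w t) p + Gamma2M t (w t) p) * u t p)
    + (u t p * Lap t (?G t) p + (2 * Gam t (u t) (?G t) p + ?G t p * Lap t (u t) p)))"
   by (rule LINT_cong[OF refl]) (simp add: D)
  also have "... = - (LINT p|mu. (Gdot t (w t) (w t) p + Gamma2M t (w t) p) * u t p)
   + ((LINT p|mu. u t p * Lap t (?G t) p) + (2 * (LINT p|mu. Gam t (u t) (?G t) p) + (LINT p|mu. ?G t p * Lap t (u t) p)))"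
   using i1 i2 by simp
  finally show ?thesis
   using integration_by_parts[OF t' c(1) G] integration_by_parts'[OF t' u G] by simp
 qed
 ultimately show ?thesis by simp
qed

end

section \<open>The defect tensor of the flow equation\<close>

context metric_flow
begin

definition Sm :: "real => real => ('a, 'n) chart => real^'n => real^'n^'n" where
 "Sm K t c x = (1/2) *\<^sub>R metric_deriv T g t c x + ricci_L (g t c) (coord c (\<phi> t)) x - K *\<^sub>R g t c x"

lemma bil_Sm: "bil (Sm K t c x) v w = 1/2 * bil (metric_deriv T g t c x) v w
  + bil (ricci_L (g t c) (coord c (\<phi> t)) x) v w - K * bil (g t c x) v w"
 by (simp add: Sm_def bil_def matrix_vector_mult_add_rdistrib matrix_vector_mult_diff_rdistrib
   scaleR_matrix_vector_assoc[symmetric] inner_add_right inner_diff_right)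

lemma W_integrand_Sm:
 assumes t: "t : {0..T}" and w: "SM w" and c: "c : A" and p: "p : fst c"
 defines "v == gradient (g t c) (coord c w) (snd c p)"
 shows "W_integrand A T K g \<phi> t w p = hessian_norm2 A (g t) w p + bil (Sm K t c (snd c p)) v v"
proof -
 note W = SM_C1M[OF w]
 have pM: "p : M" using p chart_subset[OF c] by blast
 show ?thesis
  unfolding W_integrand_eq[OF t w pM] Gdot_chart[OF t W W c p] Gamma2M_chart[OF t w c p] Gam_chart[OF t W W c p]
   local_metric.bil_gradient[OF local_metric_g[OF t c] snd_in[OF p], symmetric] hessian_norm2_chart[OF t w c p]
   Gamma2_def v_def[symmetric] bil_Sm by simp
qed

lemma hessian_norm2_continuous:
 assumes t: "t : {0..T}" and w: "SM w"
 shows "continuous_on M (hessian_norm2 A (g t) w)"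
proof (rule continuous_on_charts)
 fix c assume c: "c : A"
 note L = local_metric_g[OF t c]
 have "continuous_on (chart_image c) (%x. tensor_norm2 (g t c x) (hessian (g t c) (coord c w) x))"
  unfolding tensor_norm2_def
  by (intro continuous_on_sum continuous_on_mult smooth_on_imp_continuous_on[OF local_metric.gi_smooth[OF L]]
    smooth_on_imp_continuous_on[OF local_metric.hessian_smooth[OF L SM_chart[OF w c]]])
 then show "continuous_on (chart_image c) (coord c (hessian_norm2 A (g t) w))"
  by (rule continuous_on_eq)
   (simp add: coord_def[of c "hessian_norm2 A (g t) w"] hessian_norm2_chart[OF t w c chart_inv_in[OF c]] snd_chart_inv[OF c])
qed

lemma W_integrand_continuous:
 assumes t: "t : {0..T}" and w: "SM w"
 shows "continuous_on M (W_integrand A T K g \<phi> t w)"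
proof (rule continuous_on_eq)
 note C = SM_C1M[OF w]
 show "continuous_on M (%p. 1/2 * (Gdot t w w p + Gamma2M t w p) - K * Gam t w w p)"
  unfolding Gamma2M_def
  by (intro continuous_on_mult continuous_on_add continuous_on_diff continuous_on_const
    spacetime_slice[OF Gdot_continuous[OF C C] t] C1M_continuous SM_C1M SM_Lap SM_Gam t w)
qed (simp add: W_integrand_eq[OF t w])

end

context heat_flow
begin

definition "entropy t = (LINT p|mu. f p * ln (f p) - u t p * w t p)"

lemma entropy_DERIV:
 assumes t: "t : I"
 shows "(entropy has_real_derivative fisher t) (at t within {0..T})"
proof -
 have cf: "continuous_on M (%p. f p * ln (f p))"
  using f_pos unfolding pos_continuous_def by (intro continuous_on_mult continuous_on_ln) auto
 have "((%s. (LINT p|mu. f p * ln (f p)) - (LINT p|mu. u s p * w s p)) has_real_derivative 0 - - fisher t) (at t within {0..T})"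
  by (intro DERIV_diff DERIV_const entropy_derivative t)
 then have "((%s. (LINT p|mu. f p * ln (f p)) - (LINT p|mu. u s p * w s p)) has_real_derivative fisher t) (at t within I)"
  unfolding at_within_time_interval[OF T_interval(2) t] by simp
 then have "(entropy has_real_derivative fisher t) (at t within I)"
 proof (rule DERIV_cong_on[OF t, rotated])
  fix s assume s: "s : I"
  show "entropy s = (LINT p|mu. f p * ln (f p)) - (LINT p|mu. u s p * w s p)"
   unfolding entropy_def
   by (intro LINT_diff mu_integrable cf continuous_on_mult C1M_continuous SM_C1M SM_u SM_w s)
 qed
 then show ?thesis unfolding at_within_time_interval[OF T_interval(2) t] .
qed

context
 fixes P :: "real => ('a => real) => 'a => real" and K :: real
 assumes P_eq: "!!t. P t f = u t"
begin

lemma H_eq: "t : {0..T} ==> H_entropy M A g \<phi> P K f t = D_coeff K t * entropy t"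
 by (simp add: H_entropy_def entropy_def weighted_volume_mu P_eq)

lemma H_DERIV:
 assumes t: "t : I"
 shows "(H_entropy M A g \<phi> P K f has_real_derivative
  - (D_coeff K t)\<^sup>2 * exp (- 2 * K * t) * entropy t + fisher t * D_coeff K t) (at t within {0..T})"
proof (rule DERIV_cong_on[OF I_subset[OF t] H_eq])
 show "((%s. D_coeff K s * entropy s) has_real_derivative
  - (D_coeff K t)\<^sup>2 * exp (- 2 * K * t) * entropy t + fisher t * D_coeff K t) (at t within {0..T})"
  using t by (intro DERIV_mult D_coeff_derivative entropy_DERIV) simp_all
qed

lemma W_eq:
 assumes t: "t : I"
 shows "W_entropy M A T g \<phi> P K f t = K * entropy t + (1 + exp (2 * K * t)) / 2 * fisher t"
proof -
 have "0 < t" using t by simp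
 note C = sinh_coeff_D_coeff[OF this]
 have "W_entropy M A T g \<phi> P K f t = (D_coeff K t + sinh_coeff K t * (- (D_coeff K t)\<^sup>2 * exp (- 2 * K * t))) * entropy t
   + (sinh_coeff K t * D_coeff K t) * fisher t"
  unfolding W_entropy_def H_eq[OF I_subset[OF t]] time_deriv_DERIV[OF I_subset[OF t] H_DERIV[OF t]] by (simp add: algebra_simps)
 then show ?thesis unfolding C .
qed

text \<open>In \<open>W_eq\<close> the entropy contributes \<open>K * fisher t\<close> and the
  coefficient of the Fisher information contributes \<open>K * exp (2 * K * t) * fisher t\<close>;
  together they share the factor \<open>1 + exp (2 * K * t)\<close> with the derivative of the
  Fisher information and supply the \<open>- K g\<close> of the integrand.\<close>

lemma W_DERIV:
 assumes t: "t : I"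
 shows "(W_entropy M A T g \<phi> P K f has_real_derivative
  - (1 + exp (2 * K * t)) * (LINT p|mu. W_integrand A T K g \<phi> t (w t) p * u t p)) (at t within {0..T})"
proof -
 note t' = I_subset[OF t] and w = SM_w[OF t] and u = SM_u[OF t]
 note C = w[THEN SM_C1M] u[THEN SM_C1M]
 let ?F = "\<integral>p. (Gdot t (w t) (w t) p + Gamma2M t (w t) p) * u t p \<partial>mu"
 have "((%s. K * entropy s + (1 + exp (2 * K * s)) / 2 * fisher s) has_real_derivative
  K * fisher t + (K * exp (2 * K * t) * fisher t + (- ?F) * ((1 + exp (2 * K * t)) / 2))) (at t within {0..T})"
  by (intro DERIV_add DERIV_mult DERIV_cmult entropy_DERIV fisher_derivative t)
   (auto intro!: derivative_eq_intros)
 then have D: "((%s. K * entropy s + (1 + exp (2 * K * s)) / 2 * fisher s) has_real_derivative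
  (1 + exp (2 * K * t)) * (K * fisher t - ?F / 2)) (at t within I)"
  unfolding at_within_time_interval[OF T_interval(2) t] by (simp add: algebra_simps add_divide_distrib)
 have "(W_entropy M A T g \<phi> P K f has_real_derivative (1 + exp (2 * K * t)) * (K * fisher t - ?F / 2)) (at t within I)"
  by (rule DERIV_cong_on[OF t W_eq]) (assumption, rule D)
 moreover have "(LINT p|mu. W_integrand A T K g \<phi> t (w t) p * u t p) = ?F / 2 - K * fisher t"
 proof -
  have i1: "integrable mu (%p. (Gdot t (w t) (w t) p + Gamma2M t (w t) p) * u t p)"
   unfolding Gamma2M_def
   by (intro mu_integrable continuous_on_mult continuous_on_add continuous_on_diff continuous_on_const
    spacetime_slice[OF Gdot_continuous[OF C(1,1)] t'] C1M_continuous SM_C1M SM_Lap SM_Gam t' w u)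
  have i2: "integrable mu (%p. Gam t (w t) (w t) p * u t p)"
   by (intro mu_integrable continuous_on_mult C1M_continuous SM_C1M SM_Gam t' w u)
  have "(LINT p|mu. W_integrand A T K g \<phi> t (w t) p * u t p) =
   (LINT p|mu. 1/2 * ((Gdot t (w t) (w t) p + Gamma2M t (w t) p) * u t p) - K * (Gam t (w t) (w t) p * u t p))"
   by (rule LINT_cong[OF refl]) (simp add: W_integrand_eq[OF t' w] left_diff_distrib)
  then show ?thesis unfolding fisher_def using i1 i2 by simp
 qed
 moreover have "(1 + exp (2 * K * t)) * (K * fisher t - ?F / 2) = - (1 + exp (2 * K * t)) * (?F / 2 - K * fisher t)"
  by (simp only: minus_mult_left[symmetric] minus_mult_right minus_diff_eq)
 ultimately show ?thesis unfolding at_within_time_interval[OF T_interval(2) t] by simp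
qed

lemma W_integrand_split:
 assumes t: "t : I"
 shows "(LINT p|mu. W_integrand A T K g \<phi> t (w t) p * u t p) = (LINT p|mu. hessian_norm2 A (g t) (w t) p * u t p) +
  (LINT p|mu. (W_integrand A T K g \<phi> t (w t) p - hessian_norm2 A (g t) (w t) p) * u t p)"
proof -
 have "integrable mu (%p. W_integrand A T K g \<phi> t (w t) p * u t p)" "integrable mu (%p. hessian_norm2 A (g t) (w t) p * u t p)"
  by (intro mu_integrable continuous_on_mult W_integrand_continuous hessian_norm2_continuous I_subset C1M_continuous SM_C1M SM_w SM_u t)+
 then show ?thesis by (simp add: left_diff_distrib)
qed

lemma W_defect:
 assumes t: "t : I"
 shows "time_deriv T (W_entropy M A T g \<phi> P K f) t
  + (1 + exp (2 * K * t)) * (LINT p|mu. hessian_norm2 A (g t) (w t) p * u t p) =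
  - (1 + exp (2 * K * t)) * (LINT p|mu. (W_integrand A T K g \<phi> t (w t) p - hessian_norm2 A (g t) (w t) p) * u t p)"
 unfolding time_deriv_DERIV[OF I_subset[OF t] W_DERIV[OF t]] W_integrand_split[OF t] by (simp add: algebra_simps)

end

end

context metric_flow
begin

lemma Sm_nonneg:
 assumes "super_Perelman_Ricci_flow A T K g \<phi>" "t : {0..T}" "c : A" "x : chart_image c"
 shows "0 <= bil (Sm K t c x) v v"
proof -
 have "bil (K *\<^sub>R g t c x) v v <= bil ((1/2) *\<^sub>R metric_deriv T g t c x + ricci_L (g t c) (coord c (\<phi> t)) x) v v"
  using assms unfolding super_Perelman_Ricci_flow_def by blast
 then show ?thesis unfolding Sm_def by (simp add: bil_def matrix_vector_mult_diff_rdistrib inner_diff_right)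
qed

lemma W_integrand_ge:
 assumes "super_Perelman_Ricci_flow A T K g \<phi>" and t: "t : {0..T}" and w: "SM w" and p: "p : M"
 shows "hessian_norm2 A (g t) w p <= W_integrand A T K g \<phi> t w p"
proof -
 obtain c where c: "c : A" "p : fst c" using chart_union p by blast
 show ?thesis using W_integrand_Sm[OF t w c] Sm_nonneg[OF assms(1) t c(1) snd_in[OF c(2)]] by simp
qed

lemma tensor_trace_self:
 assumes t: "t : {0..T}" and c: "c : A" and x: "x : chart_image c"
 shows "tensor_trace (g t c x) (g t c x) = real CARD('n)"
proof -
 have "transpose (g t c x) = g t c x"
  using g_smooth t c x unfolding smooth_metrics_def riemannian_metric_def by blast
 then show ?thesis
  unfolding tensor_trace_eq_trace using det_g_pos[OF t c x] by (simp add: matrix_inv_left trace_I)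
qed

text \<open>The equation for the potential is the trace of the tensor equation: the conjugate
  condition makes its time derivative half the trace of that of the metric, and the metric has trace
  n.\<close>

lemma Perelman_iff:
 "Perelman_Ricci_flow A T K g \<phi> \<longleftrightarrow> (ALL t:{0..T}. ALL c:A. ALL x:chart_image c. Sm K t c x = 0)"
proof -
 have "time_deriv T (%s. coord c (\<phi> s) x) t = - scalar_curvature (g t c) x - laplacian (g t c) (coord c (\<phi> t)) x + real CARD('n) * K"
  if S: "Sm K t c x = 0" and t: "t : {0..T}" and c: "c : A" and x: "x : chart_image c" for t c x
 proof -
  have e: "(1/2) *\<^sub>R metric_deriv T g t c x = K *\<^sub>R g t c x - (ricci (g t c) x + hessian (g t c) (coord c (\<phi> t)) x)"
   using S unfolding Sm_def ricci_L_def by (simp add: algebra_simps)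
  have tt: "tensor_trace B (a *\<^sub>R X) = a * tensor_trace B X" "tensor_trace B (X + Y) = tensor_trace B X + tensor_trace B Y"
   "tensor_trace B (X - Y) = tensor_trace B X - tensor_trace B Y" for a B X Y
   by (simp_all add: tensor_trace_def sum_distrib_left distrib_left right_diff_distrib sum.distrib sum_subtractf mult.left_commute)
  have "time_deriv T (%s. coord c (\<phi> s) x) t = tensor_trace (g t c x) ((1/2) *\<^sub>R metric_deriv T g t c x)"
   using conjugate t c x unfolding conjugate_potential_def tt by blast
  then show ?thesis unfolding e tt tensor_trace_self[OF t c x] scalar_curvature_def laplacian_def by simp
 qed
 moreover have "Sm K t c x = 0 \<longleftrightarrow> (1/2) *\<^sub>R metric_deriv T g t c x + ricci_L (g t c) (coord c (\<phi> t)) x = K *\<^sub>R g t c x" for t c x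
  by (simp add: Sm_def)
 ultimately show ?thesis unfolding Perelman_Ricci_flow_def by blast
qed

end

subsection \<open>Detecting the \<open>L\<^sup>2\<close> norm by finitely many functionals\<close>

text \<open>Nonnegativity of the variance for the probability density \<open>k\<close>. It is used
  for the uniform density on a segment or ball and for averaging kernels.\<close>

lemma square_integral_le:
 fixes k f :: "'b => real"
 assumes k: "integrable N k" "!!x. 0 <= k x" "(LINT x|N. k x) = 1"
  and f: "integrable N (%x. k x * f x)" "integrable N (%x. k x * (f x)\<^sup>2)"
 shows "(LINT x|N. k x * f x)\<^sup>2 <= (LINT x|N. k x * (f x)\<^sup>2)"
proof -
 define c where "c = (LINT x|N. k x * f x)"
 have "0 <= (LINT x|N. k x * (f x - c)\<^sup>2)" by (rule integral_nonneg_AE) (use k(2) in simp)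
 also have "(LINT x|N. k x * (f x - c)\<^sup>2) = (LINT x|N. k x * (f x)\<^sup>2 - 2 * c * (k x * f x) + c\<^sup>2 * k x)"
  by (rule LINT_cong[OF refl]) (simp add: power2_eq_square algebra_simps)
 also have "... = (LINT x|N. k x * (f x)\<^sup>2) - 2 * c * c + c\<^sup>2"
  using k(1,3) f by (simp add: c_def)
 finally show ?thesis by (simp add: c_def[symmetric] power2_eq_square)
qed

lemma nn_integral_translate:
 fixes F :: "real^'n => ennreal"
 assumes [measurable]: "F : borel_measurable borel"
 shows "(\<integral>\<^sup>+x. F (h + x) \<partial>lborel) = (\<integral>\<^sup>+x. F x \<partial>lborel)"
 by (subst lborel_distr_plus[symmetric, of h], subst nn_integral_distr) auto

lemma borel_cutoff:
 fixes W :: "real^'n => real"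
 assumes "compact K" "continuous_on K W"
 shows "(%x. indicator K x * W x) : borel_measurable borel" "EX B>=0. ALL x. \<bar>indicator K x * W x\<bar> <= B"
  "integrable lborel (%x. indicator K x * W x)"
proof -
 show "(%x. indicator K x * W x) : borel_measurable borel"
  using borel_measurable_continuous_on_indicator[OF borel_compact[OF assms(1)] assms(2)] by simp
 obtain b where "ALL y:W ` K. norm y <= b"
  using compact_imp_bounded[OF compact_continuous_image[OF assms(2,1)]] bounded_iff by metis
 then show "EX B>=0. ALL x. \<bar>indicator K x * W x\<bar> <= B"
  by (intro exI[of _ "\<bar>b\<bar>"]) (auto simp: indicator_def intro: order_trans[OF _ abs_ge_self])
 show "integrable lborel (%x. indicator K x * W x)"
  using borel_integrable_compact[OF assms] by simp
qed

definition pgrad2 :: "(real^'n => real) => real^'n => real" where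
 "pgrad2 W x = (norm (\<chi> i. pderiv_coord i W x))\<^sup>2"

text \<open>Functions are estimated on the ball \<open>K\<close>, while the doubled ball leaves room
  for translations by at most \<open>R\<close>. Cutting \<open>W\<close> and its squared gradient
  off at \<open>K2\<close> makes all translates globally defined and measurable.\<close>

locale cutoff_C1 =
 fixes U :: "(real^'n) set" and W :: "real^'n => real" and x0 :: "real^'n" and R :: real
 assumes U: "open U" and W: "Ck_on 1 U W" and R: "0 < R" and KU: "cball x0 (2 * R) \<subseteq> U"
begin

abbreviation "K == cball x0 R"
abbreviation "K2 == cball x0 (2 * R)"
definition "W0 x = indicator K2 x * W x"
definition "G0 x = indicator K2 x * pgrad2 W x"

lemma W_diff: "x : U ==> W differentiable (at x)" and PD_cont: "continuous_on U (pderiv_coord i W)"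
 using Ck1_iff[OF U] W by blast+

lemma W_cont: "continuous_on U W" by (rule Ck_on_imp_continuous_on[OF W])

lemma pgrad2_cont: "continuous_on U (pgrad2 W)"
 unfolding pgrad2_def[abs_def] by (intro continuous_on_power continuous_on_norm continuous_on_vec_lambda PD_cont)

lemma W0_borel [measurable]: "W0 : borel_measurable borel" and W0_bounded: "EX B>=0. ALL x. \<bar>W0 x\<bar> <= B"
 and W0_integrable: "integrable lborel W0"
 unfolding W0_def[abs_def] by (rule borel_cutoff[OF compact_cball continuous_on_subset[OF W_cont KU]])+

lemma G0_borel [measurable]: "G0 : borel_measurable borel" and G0_integrable: "integrable lborel G0"
 unfolding G0_def[abs_def] by (rule borel_cutoff[OF compact_cball continuous_on_subset[OF pgrad2_cont KU]])+

lemma G0_nonneg: "0 <= G0 x" by (simp add: G0_def pgrad2_def)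

lemma W0_sq_integrable: "integrable lborel (%x. (W0 x)\<^sup>2)"
proof -
 have "(%x. (W0 x)\<^sup>2) = (%x. indicator K2 x * (W x)\<^sup>2)" by (auto simp: W0_def indicator_def fun_eq_iff)
 then show ?thesis
  using borel_cutoff(3)[OF compact_cball continuous_on_power[OF continuous_on_subset[OF W_cont KU]]] by simp
qed

lemma segment_bound:
 assumes x: "x : K" and h: "norm h <= R"
 shows "ennreal ((W0 (h + x) - W0 x)\<^sup>2) <= (\<integral>\<^sup>+s. ennreal (indicator {0..1} s * ((norm h)\<^sup>2 * G0 (s *\<^sub>R h + x))) \<partial>lborel)"
proof -
 have in2: "s *\<^sub>R h + x : K2" if "0 <= s" "s <= 1" for s
 proof -
  have "dist x0 (s *\<^sub>R h + x) <= dist x0 x + norm (s *\<^sub>R h)" by (metis add.commute dist_norm dist_triangle add_diff_cancel norm_minus_commute dist_commute)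
  also have "norm (s *\<^sub>R h) <= 1 * R" using mult_mono[of s 1 "norm h" R] that h by simp
  finally show ?thesis using x by simp
 qed
 define q where "q s = h \<bullet> (\<chi> i. pderiv_coord i W (x + s *\<^sub>R h))" for s
 have seg: "x + s *\<^sub>R h : U" if "s : {0..1}" for s using in2[of s] that KU by (auto simp: add.commute)
 have D: "((%s. W (x + s *\<^sub>R h)) has_vector_derivative q s) (at s within {0..1})" if "0 <= s" "s <= 1" for s
 proof -
  have "((%s. W (x + s *\<^sub>R h)) has_real_derivative frechet_derivative W (at (x + s *\<^sub>R h)) h) (at s)"
   by (rule DERIV_along_line[OF frechet_derivative_works[THEN iffD1, OF W_diff]]) (use seg that in simp)
  moreover have "frechet_derivative W (at (x + s *\<^sub>R h)) h = q s"
   using frechet_derivative_sum[OF W_diff[OF seg[of s]]] that by (simp add: q_def inner_vec_def)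
  ultimately show ?thesis
   by (simp add: has_real_derivative_iff_has_vector_derivative has_vector_derivative_at_within)
 qed
 have qc: "continuous_on {0..1} q"
  unfolding q_def
  by (intro continuous_on_inner continuous_on_const continuous_on_vec_lambda continuous_on_compose2[OF PD_cont] continuous_intros)
   (use seg in auto)
 have qi: "integrable lborel (%s. indicator {0..1} s * q s)" "integrable lborel (%s. indicator {0..1} s * (q s)\<^sup>2)"
  using borel_integrable_compact[OF compact_Icc qc] borel_integrable_compact[OF compact_Icc continuous_on_power[OF qc]] by simp_all
 have "(W (h + x) - W x) = (LINT s|lborel. indicator {0..1} s * q s)"
  using integral_FTC_atLeastAtMost[OF _ D qc] by (simp add: add.commute)
 also have "...\<^sup>2 <= (LINT s|lborel. indicator {0..1} s * (q s)\<^sup>2)"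
  using square_integral_le[of lborel "indicator {0..1}" q] qi by simp
 finally have "ennreal ((W (h + x) - W x)\<^sup>2) <= ennreal (LINT s|lborel. indicator {0..1} s * (q s)\<^sup>2)" by simp
 also have "... = (\<integral>\<^sup>+s. ennreal (indicator {0..1} s * (q s)\<^sup>2) \<partial>lborel)"
  by (rule nn_integral_eq_integral[symmetric, OF qi(2)]) simp
 also have "... <= (\<integral>\<^sup>+s. ennreal (indicator {0..1} s * ((norm h)\<^sup>2 * G0 (s *\<^sub>R h + x))) \<partial>lborel)"
 proof (rule nn_integral_mono, rule ennreal_leI)
  fix s :: real
  show "indicator {0..1} s * (q s)\<^sup>2 <= indicator {0..1} s * ((norm h)\<^sup>2 * G0 (s *\<^sub>R h + x))"
   using in2[of s] Cauchy_Schwarz_ineq[of h "\<chi> i. pderiv_coord i W (x + s *\<^sub>R h)"]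
   by (cases "s : {0..1}") (simp_all add: q_def G0_def pgrad2_def power2_norm_eq_inner add.commute)
 qed
 finally show ?thesis using in2[of 0] in2[of 1] by (simp add: W0_def)
qed

text \<open>Integrating \<open>segment_bound\<close> over \<open>x\<close> and exchanging the
  integrals, translation invariance removes the shift by \<open>s *\<^sub>R h\<close>, so every
  \<open>s\<close> contributes the same total gradient energy.\<close>

lemma translation_bound:
 assumes h: "norm h <= R"
 shows "(\<integral>\<^sup>+x. ennreal (indicator K x * (W0 (h + x) - W0 x)\<^sup>2) \<partial>lborel) <= ennreal ((norm h)\<^sup>2 * (LINT x|lborel. G0 x))"
proof -
 have "(\<integral>\<^sup>+x. ennreal (indicator K x * (W0 (h + x) - W0 x)\<^sup>2) \<partial>lborel) <=
  (\<integral>\<^sup>+x. (\<integral>\<^sup>+s. ennreal (indicator {0..1} s * ((norm h)\<^sup>2 * G0 (s *\<^sub>R h + x))) \<partial>lborel) \<partial>lborel)"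
  by (rule nn_integral_mono) (use segment_bound[OF _ h] in \<open>auto simp: indicator_def\<close>)
 also have "... = (\<integral>\<^sup>+s. (\<integral>\<^sup>+x. ennreal (indicator {0..1::real} s * ((norm h)\<^sup>2 * G0 (s *\<^sub>R h + x))) \<partial>lborel) \<partial>lborel)"
  by (rule lborel_pair.Fubini') measurable
 also have "... = (\<integral>\<^sup>+s. ennreal (indicator {0..1::real} s) * ennreal ((norm h)\<^sup>2 * (LINT x|lborel. G0 x)) \<partial>lborel)"
 proof (rule nn_integral_cong)
  fix s :: real
  have "(\<integral>\<^sup>+x. ennreal (indicator {0..1::real} s * ((norm h)\<^sup>2 * G0 (s *\<^sub>R h + x))) \<partial>lborel) =
   ennreal (indicator {0..1} s * (norm h)\<^sup>2) * (\<integral>\<^sup>+x. ennreal (G0 (s *\<^sub>R h + x)) \<partial>lborel)"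
   by (subst nn_integral_cmult[symmetric]) (auto simp: ennreal_mult' G0_nonneg mult.assoc)
  also have "(\<integral>\<^sup>+x. ennreal (G0 (s *\<^sub>R h + x)) \<partial>lborel) = ennreal (LINT x|lborel. G0 x)"
   using nn_integral_translate[of "%x. ennreal (G0 x)" "s *\<^sub>R h"]
    nn_integral_eq_integral[OF G0_integrable] by (simp add: G0_nonneg)
  finally show "(\<integral>\<^sup>+x. ennreal (indicator {0..1::real} s * ((norm h)\<^sup>2 * G0 (s *\<^sub>R h + x))) \<partial>lborel) =
   ennreal (indicator {0..1::real} s) * ennreal ((norm h)\<^sup>2 * (LINT x|lborel. G0 x))"
   by (simp add: ennreal_mult' mult.assoc)
 qed
 also have "... = ennreal ((norm h)\<^sup>2 * (LINT x|lborel. G0 x))"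
  by (subst nn_integral_multc) (auto simp: ennreal_indicator)
 finally show ?thesis .
qed

definition "conv k x = (LINT h|lborel. k h * W0 (h + x))"

lemma conv_integrable:
 assumes k: "integrable lborel k"
 shows "integrable lborel (%h. k h * W0 (h + x))" "integrable lborel (%h. k h * (W0 (h + x) - a)\<^sup>2)"
proof -
 have [measurable]: "k : borel_measurable borel" using borel_measurable_integrable[OF k] by simp
 obtain B where B: "!!x. \<bar>W0 x\<bar> <= B" using W0_bounded by blast
 show "integrable lborel (%h. k h * W0 (h + x))"
 proof (rule Bochner_Integration.integrable_bound[OF integrable_mult_right[OF k, of B]])
  show "AE h in lborel. norm (k h * W0 (h + x)) <= norm (B * k h)"
   using B by (intro AE_I2) (simp add: abs_mult mult_right_mono mult.commute[of "\<bar>k _\<bar>"] order_trans[OF B abs_ge_self])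
 qed simp
 show "integrable lborel (%h. k h * (W0 (h + x) - a)\<^sup>2)"
 proof (rule Bochner_Integration.integrable_bound[OF integrable_mult_right[OF k, of "(B + \<bar>a\<bar>)\<^sup>2"]])
  have "(W0 (h + x) - a)\<^sup>2 <= (B + \<bar>a\<bar>)\<^sup>2" for h
   using B[of "h + x"] by (intro abs_le_square_iff[THEN iffD1]) linarith
  then show "AE h in lborel. norm (k h * (W0 (h + x) - a)\<^sup>2) <= norm ((B + \<bar>a\<bar>)\<^sup>2 * k h)"
   by (intro AE_I2) (simp add: abs_mult mult_right_mono mult.commute[of "\<bar>k _\<bar>"])
 qed simp
qed

lemma conv_diff:
 assumes k: "integrable lborel k" "!!h. 0 <= k h" "(LINT h|lborel. k h) = 1"
 shows "(conv k x - W0 x)\<^sup>2 <= (LINT h|lborel. k h * (W0 (h + x) - W0 x)\<^sup>2)"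
proof -
 have "conv k x - W0 x = (LINT h|lborel. k h * (W0 (h + x) - W0 x))"
  using conv_integrable(1)[OF k(1)] k by (simp add: conv_def right_diff_distrib)
 moreover have "integrable lborel (%h. k h * (W0 (h + x) - W0 x))"
  using conv_integrable(1)[OF k(1)] k by (simp add: right_diff_distrib)
 ultimately show ?thesis using square_integral_le[OF k, of "%h. W0 (h + x) - W0 x"] conv_integrable(2)[OF k(1)] by simp
qed

lemma conv_translate: "k : borel_measurable borel ==> conv k x = (LINT y|lborel. k (y - x) * W0 y)"
 using integral_translate[of "%y. k (y - x) * W0 y" x] by (simp add: conv_def add.commute)

lemma W0_L1: "(LINT x|lborel. \<bar>W0 x\<bar>)\<^sup>2 <= measure lborel K2 * (LINT x|lborel. (W0 x)\<^sup>2)"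
proof -
 let ?V = "measure lborel K2"
 have V: "0 < ?V" using content_cball_pos[of "2 * R" x0] R by simp
 have i: "integrable lborel (indicator K2 :: real^'n => real)"
  using borel_cutoff(3)[OF compact_cball continuous_on_const[of _ 1]] by simp
 have eq: "indicator K2 x / ?V * \<bar>W0 x\<bar> = \<bar>W0 x\<bar> / ?V" "indicator K2 x / ?V * \<bar>W0 x\<bar>\<^sup>2 = (W0 x)\<^sup>2 / ?V" for x
  by (simp_all add: W0_def indicator_def)
 have "(LINT x|lborel. \<bar>W0 x\<bar> / ?V)\<^sup>2 <= (LINT x|lborel. (W0 x)\<^sup>2 / ?V)"
  using square_integral_le[of lborel "%x. indicator K2 x / ?V" "%x. \<bar>W0 x\<bar>"] V i W0_integrable W0_sq_integrable
  unfolding eq by simp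
 then show ?thesis using V by (simp add: power_divide power2_eq_square field_simps)
qed

text \<open>W^2 is at most twice the square of the averaging error plus twice the square of the
  average. By Fubini and \<open>translation_bound\<close> the error costs r^2 times the gradient
  energy. The average is Lipschitz in its centre, with a constant proportional to the L^1 norm of
  \<open>W0\<close>, so it is determined up to a small error by its values at the finitely many
  centres \<open>N\<close>.\<close>

lemma conv_bound:
 assumes k: "integrable lborel k" "!!h. 0 <= k h" "(LINT h|lborel. k h) = 1" "!!h. r <= norm h ==> k h = 0"
  and Lip: "!!h h'. \<bar>k h - k h'\<bar> <= L * norm (h - h')" "0 <= L" and r: "r <= R" "0 <= r"
  and N: "finite N" "K \<subseteq> (UN a:N. ball a e)" and e: "0 <= e"
 shows "(LINT x|lborel. indicator K x * (W0 x)\<^sup>2) <= 2 * r\<^sup>2 * (LINT x|lborel. G0 x) +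
  4 * measure lborel K * ((SUM a:N. (LINT y|lborel. k (y - a) * W0 y)\<^sup>2) + (L * e)\<^sup>2 * measure lborel K2 * (LINT x|lborel. (W0 x)\<^sup>2))"
proof -
 have km [measurable]: "k : borel_measurable borel" using borel_measurable_integrable[OF k(1)] by simp
 define c where "c = (SUM a:N. (LINT y|lborel. k (y - a) * W0 y)\<^sup>2) + (L * e)\<^sup>2 * measure lborel K2 * (LINT x|lborel. (W0 x)\<^sup>2)"
 have c0: "0 <= c" unfolding c_def by (intro add_nonneg_nonneg sum_nonneg mult_nonneg_nonneg integral_nonneg_AE) auto
 have kxi: "integrable lborel (%y. k (y - x) * W0 y)" for x
  using conv_integrable(1)[OF k(1), of x] lborel_integrable_real_affine_iff
  by (subst lborel_distr_plus[symmetric, of x], subst integrable_distr_eq) (auto simp: add.commute)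
 have 1: "(conv k x)\<^sup>2 <= 2 * c" if x: "x : K" for x
 proof -
  obtain a where a: "a : N" "dist a x < e" using N(2) x by auto
  have "\<bar>conv k x - conv k a\<bar> = \<bar>\<integral>y. (k (y - x) - k (y - a)) * W0 y \<partial>lborel\<bar>"
   using kxi by (simp add: conv_translate left_diff_distrib)
  also have "... <= (LINT y|lborel. \<bar>(k (y - x) - k (y - a)) * W0 y\<bar>)" by (rule integral_abs_bound)
  also have "... <= (LINT y|lborel. L * e * \<bar>W0 y\<bar>)"
  proof (rule integral_mono)
   show "integrable lborel (%y. \<bar>(k (y - x) - k (y - a)) * W0 y\<bar>)" using kxi by (simp add: left_diff_distrib)
   show "integrable lborel (%y. L * e * \<bar>W0 y\<bar>)" using W0_integrable by simp
   fix y
   have "\<bar>k (y - x) - k (y - a)\<bar> <= L * norm ((y - x) - (y - a))" by (rule Lip)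
   also have "... <= L * e" using a(2) Lip(2) by (intro mult_left_mono) (simp_all add: dist_norm)
   finally show "\<bar>(k (y - x) - k (y - a)) * W0 y\<bar> <= L * e * \<bar>W0 y\<bar>" by (simp add: abs_mult mult_right_mono)
  qed
  also have "... = L * e * (LINT y|lborel. \<bar>W0 y\<bar>)" by simp
  finally have "\<bar>conv k x - conv k a\<bar>\<^sup>2 <= (L * e * (LINT y|lborel. \<bar>W0 y\<bar>))\<^sup>2" by (intro power_mono) auto
  also have "... <= (L * e)\<^sup>2 * (measure lborel K2 * (LINT x|lborel. (W0 x)\<^sup>2))"
   unfolding power_mult_distrib[of "L * e"] by (intro mult_left_mono W0_L1) simp
  finally have d: "(conv k x - conv k a)\<^sup>2 <= (L * e)\<^sup>2 * measure lborel K2 * (LINT x|lborel. (W0 x)\<^sup>2)" by (simp add: mult.assoc)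
  have "(conv k a)\<^sup>2 <= (SUM a:N. (LINT y|lborel. k (y - a) * W0 y)\<^sup>2)"
   unfolding conv_translate[OF km] by (rule member_le_sum[OF a(1) _ N(1)]) simp
  with d have "(conv k a)\<^sup>2 + (conv k x - conv k a)\<^sup>2 <= c" by (simp add: c_def)
  then have "2 * ((conv k a)\<^sup>2 + (conv k x - conv k a)\<^sup>2) <= 2 * c" by (rule mult_left_mono) simp
  moreover have "(conv k x)\<^sup>2 <= 2 * ((conv k a)\<^sup>2 + (conv k x - conv k a)\<^sup>2)"
   using zero_le_power2[of "2 * conv k a - conv k x"] by (simp add: power2_eq_square algebra_simps)
  ultimately show ?thesis by (rule order_trans[rotated])
 qed
 define Q where "Q x h = ennreal (k h * (indicator K x * (W0 (h + x) - W0 x)\<^sup>2))" for x h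
 have [measurable]: "K : sets borel" by simp
 have [measurable]: "case_prod Q : borel_measurable (lborel \<Otimes>\<^sub>M lborel)" unfolding Q_def case_prod_unfold by measurable
 have "(\<integral>\<^sup>+x. (\<integral>\<^sup>+h. Q x h \<partial>lborel) \<partial>lborel) = (\<integral>\<^sup>+h. (\<integral>\<^sup>+x. Q x h \<partial>lborel) \<partial>lborel)"
  by (rule lborel_pair.Fubini'[symmetric, of "%x h. Q x h"]) measurable
 also have "... <= (\<integral>\<^sup>+h. ennreal (k h) * ennreal (r\<^sup>2 * (LINT x|lborel. G0 x)) \<partial>lborel)"
 proof (rule nn_integral_mono)
  fix h
  show "(\<integral>\<^sup>+x. Q x h \<partial>lborel) <= ennreal (k h) * ennreal (r\<^sup>2 * (LINT x|lborel. G0 x))"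
  proof (cases "norm h < r")
   case True
   have "(\<integral>\<^sup>+x. Q x h \<partial>lborel) = ennreal (k h) * (\<integral>\<^sup>+x. ennreal (indicator K x * (W0 (h + x) - W0 x)\<^sup>2) \<partial>lborel)"
    unfolding Q_def using k(2) by (subst nn_integral_cmult[symmetric]) (auto simp: ennreal_mult')
   also have "... <= ennreal (k h) * ennreal ((norm h)\<^sup>2 * (LINT x|lborel. G0 x))"
    by (intro mult_left_mono translation_bound) (use True r in auto)
   also have "... <= ennreal (k h) * ennreal (r\<^sup>2 * (LINT x|lborel. G0 x))"
    by (intro mult_left_mono ennreal_leI mult_right_mono power_mono integral_nonneg_AE) (use True G0_nonneg in auto)
   finally show ?thesis .
  next
   case False
   then show ?thesis using k(4)[of h] by (simp add: Q_def)
  qed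
 qed
 also have "... = ennreal (r\<^sup>2 * (LINT x|lborel. G0 x))"
  using nn_integral_eq_integral[OF k(1)] k(2,3) by (subst nn_integral_multc) auto
 finally have H: "(\<integral>\<^sup>+x. (\<integral>\<^sup>+h. Q x h \<partial>lborel) \<partial>lborel) <= ennreal (r\<^sup>2 * (LINT x|lborel. G0 x))" .
 have fK: "emeasure lborel K < \<infinity>" by (rule emeasure_bounded_finite[OF bounded_cball])
 have "ennreal (LINT x|lborel. indicator K x * (W0 x)\<^sup>2) = (\<integral>\<^sup>+x. ennreal (indicator K x * (W0 x)\<^sup>2) \<partial>lborel)"
  by (rule nn_integral_eq_integral[symmetric])
   (auto intro!: Bochner_Integration.integrable_bound[OF W0_sq_integrable] simp: indicator_def)
 also have "... <= (\<integral>\<^sup>+x. 2 * (\<integral>\<^sup>+h. Q x h \<partial>lborel) + ennreal (4 * c) * indicator K x \<partial>lborel)"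
 proof (rule nn_integral_mono)
  fix x
  show "ennreal (indicator K x * (W0 x)\<^sup>2) <= 2 * (\<integral>\<^sup>+h. Q x h \<partial>lborel) + ennreal (4 * c) * indicator K x"
  proof (cases "x : K")
   case True
   have "(W0 x)\<^sup>2 <= 2 * (conv k x - W0 x)\<^sup>2 + 2 * (conv k x)\<^sup>2"
    using zero_le_power2[of "2 * conv k x - W0 x"] by (simp add: power2_eq_square algebra_simps)
   also have "... <= 2 * (LINT h|lborel. k h * (W0 (h + x) - W0 x)\<^sup>2) + 4 * c"
    using conv_diff[OF k(1-3), of x] 1[OF True] by linarith
   finally have "ennreal ((W0 x)\<^sup>2) <= ennreal (2 * (LINT h|lborel. k h * (W0 (h + x) - W0 x)\<^sup>2) + 4 * c)" by (rule ennreal_leI)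
   also have "... = 2 * ennreal (LINT h|lborel. k h * (W0 (h + x) - W0 x)\<^sup>2) + ennreal (4 * c)"
    using c0 k(2) by (simp add: ennreal_plus ennreal_mult' integral_nonneg_AE)
   also have "ennreal (LINT h|lborel. k h * (W0 (h + x) - W0 x)\<^sup>2) = (\<integral>\<^sup>+h. Q x h \<partial>lborel)"
    using True k(2) by (simp add: Q_def nn_integral_eq_integral[OF conv_integrable(2)[OF k(1)]])
   finally show ?thesis using True by simp
  qed simp
 qed
 also have "... = 2 * (\<integral>\<^sup>+x. (\<integral>\<^sup>+h. Q x h \<partial>lborel) \<partial>lborel) + ennreal (4 * c) * emeasure lborel K"
  by (simp add: nn_integral_add nn_integral_cmult)
 also have "... <= 2 * ennreal (r\<^sup>2 * (LINT x|lborel. G0 x)) + ennreal (4 * c) * emeasure lborel K"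
  by (intro add_mono mult_left_mono H) simp_all
 also have "2 * ennreal (r\<^sup>2 * (LINT x|lborel. G0 x)) + ennreal (4 * c) * emeasure lborel K =
  ennreal (2 * r\<^sup>2 * (LINT x|lborel. G0 x) + 4 * measure lborel K * c)"
 proof -
  have a0: "0 <= r\<^sup>2 * (LINT x|lborel. G0 x)" using G0_nonneg by (intro mult_nonneg_nonneg integral_nonneg_AE) auto
  have K: "emeasure lborel K = ennreal (measure lborel K)" using fK by (intro emeasure_eq_ennreal_measure) auto
  have "2 * ennreal a + ennreal (4 * c) * ennreal v = ennreal (2 * a + 4 * v * c)" if "0 <= a" "0 <= v" for a v
  proof -
   have "2 * ennreal a = ennreal (2 * a)" by (simp add: ennreal_mult')
   moreover have "ennreal (4 * c) * ennreal v = ennreal (4 * v * c)"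
    using that(2) by (subst ennreal_mult''[symmetric]) (simp_all add: mult.commute mult.left_commute)
   ultimately show ?thesis using that c0 by (simp add: ennreal_plus[symmetric] del: ennreal_plus)
  qed
  from this[OF a0 measure_nonneg] show ?thesis unfolding K by (simp only: mult.assoc)
 qed
 finally show ?thesis
  using c0 G0_nonneg unfolding c_def[symmetric]
  by (subst (asm) ennreal_le_iff) (auto intro!: add_nonneg_nonneg mult_nonneg_nonneg integral_nonneg_AE)
qed

end

text \<open>The size of the Lipschitz constant \<open>L\<close> does not matter: the mesh of centres
  is chosen after it.\<close>

lemma tent_kernel:
 assumes "0 < r"
 obtains k :: "real^'n => real" and L where "continuous_on UNIV k" "integrable lborel k" "!!h. 0 <= k h"
  "(LINT h|lborel. k h) = 1" "!!h. r <= norm h ==> k h = 0" "0 <= L" "!!h h'. \<bar>k h - k h'\<bar> <= L * norm (h - h')"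
proof -
 define q :: "real^'n => real" where "q h = max 0 (r - norm h)" for h
 have qc: "continuous_on UNIV q" unfolding q_def by (intro continuous_intros)
 have z: "q x = 0" if "x ~: cball 0 r" for x using that by (simp add: q_def)
 have qi: "integrable lborel q" by (rule continuous_compact_support(1)[OF qc compact_cball z])
 define Z where "Z = (LINT h|lborel. q h)"
 have q0: "0 <= q h" for h by (simp add: q_def)
 have "Z ~= 0"
 proof
  assume "Z = 0"
  then have "(\<integral>\<^sup>+x. ennreal (indicator UNIV x * q x) \<partial>lborel) = 0" using nn_integral_eq_integral[OF qi] q0 by (simp add: Z_def)
  from continuous_nonneg_zero_lborel[OF open_UNIV qc q0 this, of 0] show False using assms by (simp add: q_def)
 qed
 then have Z: "0 < Z" using integral_nonneg_AE[of q lborel] q0 unfolding Z_def by (simp add: less_le)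
 show ?thesis
 proof (rule that[of "%h. q h / Z" "1 / Z"])
  show "\<bar>q h / Z - q h' / Z\<bar> <= 1 / Z * norm (h - h')" for h h'
  proof -
   have "\<bar>q h - q h'\<bar> <= norm (h - h')" using norm_triangle_ineq3[of h h'] unfolding q_def by linarith
   then show ?thesis using Z by (simp add: diff_divide_distrib[symmetric] divide_right_mono)
  qed
  show "q h / Z = 0" if "r <= norm h" for h using that by (simp add: q_def)
  show "continuous_on UNIV (%h. q h / Z)" using Z by (intro continuous_on_divide qc continuous_on_const) auto
 qed (use Z qi q0 in \<open>auto simp: Z_def[symmetric]\<close>)
qed

text \<open>A quantitative form of Rellich compactness. The finitely many functionals and the
  constant are fixed by the balls and \<open>d\<close> alone, before any function \<open>W\<close>
  is given; this uniformity is what the density argument lives on.\<close>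

lemma local_detection:
 fixes x0 :: "real^'n"
 assumes R: "0 < R" and d: "0 < d"
 obtains X C where "finite X" "0 <= C"
  "!!k. k : X ==> continuous_on UNIV k & (ALL x. 0 <= k x) & (ALL x. x ~: cball x0 (2 * R) --> k x = 0)"
  "!!U W. open U ==> Ck_on 1 U W ==> cball x0 (2 * R) \<subseteq> U ==>
   (LINT x|lborel. indicator (cball x0 R) x * (W x)\<^sup>2) <=
   d * (LINT x|lborel. indicator (cball x0 (2 * R)) x * (pgrad2 W x + (W x)\<^sup>2)) + C * (SUM k:X. (LINT y|lborel. k y * W y)\<^sup>2)"
proof -
 let ?K = "cball x0 R" and ?K2 = "cball x0 (2 * R)"
 let ?V1 = "measure lborel ?K" and ?V2 = "measure lborel ?K2"
 \<comment> \<open>The averaging radius is so small that the coefficient 2 r^2 of the gradient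
   energy is at most d.\<close>
 define r where "r = min R (sqrt (d / 2))"
 have r: "0 < r" "r <= R" "2 * r\<^sup>2 <= d"
 proof -
  show "0 < r" "r <= R" using R d by (simp_all add: r_def)
  have "r\<^sup>2 <= (sqrt (d / 2))\<^sup>2" using R d by (intro power_mono) (simp_all add: r_def)
  then show "2 * r\<^sup>2 <= d" using d by simp
 qed
 obtain k :: "real^'n => real" and L where k: "continuous_on UNIV k" "integrable lborel k" "!!h. 0 <= k h"
  "(LINT h|lborel. k h) = 1" "!!h. r <= norm h ==> k h = 0" "0 <= L" "!!h h'. \<bar>k h - k h'\<bar> <= L * norm (h - h')"
  by (rule tent_kernel[OF r(1)]) (rule that, assumption+)
 \<comment> \<open>The mesh \<open>e\<close> of the centres is fitted so that the coefficient of the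
   L^2 norm, \<open>(B - 1) * e\<^sup>2\<close>, is at most d as well; the summand 1 keeps
   \<open>B\<close> positive.\<close>
 define B where "B = 4 * ?V1 * ?V2 * L\<^sup>2 + 1"
 have B: "0 < B" unfolding B_def by (intro add_nonneg_pos mult_nonneg_nonneg) auto
 define e where "e = sqrt (d / B)"
 have e: "0 < e" "B * e\<^sup>2 = d" using d B by (simp_all add: e_def)
 obtain N where N: "N \<subseteq> ?K" "finite N" "?K \<subseteq> (UN a:N. ball a e)"
  by (rule compactE_image[OF compact_cball, of ?K "%a. ball a e" x0 R]) (use e in auto)
 show ?thesis
 proof (rule that[of "(%a y. k (y - a)) ` N" "4 * ?V1 * real (card N)"])
  show "finite ((%a y. k (y - a)) ` N)" using N(2) by simp
  show "0 <= 4 * ?V1 * real (card N)" by simp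
  have far: "k (y - a) = 0" if "a : N" "y ~: ?K2" for a y
  proof (rule k(5))
   have "dist x0 y <= dist x0 a + dist a y" by (rule dist_triangle)
   then show "r <= norm (y - a)" using that N(1) r(2) by (auto simp: dist_norm norm_minus_commute)
  qed
  fix q assume "q : (%a y. k (y - a)) ` N"
  then show "continuous_on UNIV q & (ALL x. 0 <= q x) & (ALL x. x ~: ?K2 --> q x = 0)"
   using far k(3) by (auto intro!: continuous_on_compose2[OF k(1)] continuous_intros)
 next
  fix U and W :: "real^'n => real" assume U: "open U" "Ck_on 1 U W" "?K2 \<subseteq> U"
  interpret cutoff_C1 U W x0 R by unfold_locales (fact U R)+
  have kk: "(LINT y|lborel. k (y - a) * W0 y) = (LINT y|lborel. k (y - a) * W y)" if "a : N" for a
  proof (rule LINT_cong[OF refl])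
   fix y
   have "dist x0 y <= dist x0 a + dist a y" by (rule dist_triangle)
   then show "k (y - a) * W0 y = k (y - a) * W y"
    using that N(1) r(2) k(5)[of "y - a"] by (cases "y : ?K2") (auto simp: W0_def dist_norm norm_minus_commute)
  qed
  let ?S = "SUM a:N. (LINT y|lborel. k (y - a) * W y)\<^sup>2" and ?J = "\<integral>x. (W0 x)\<^sup>2 \<partial>lborel" and ?G = "\<integral>x. G0 x \<partial>lborel"
  have J: "0 <= ?J" and G: "0 <= ?G" using G0_nonneg by (auto intro!: integral_nonneg_AE)
  have "(LINT x|lborel. indicator ?K x * (W x)\<^sup>2) = (LINT x|lborel. indicator ?K x * (W0 x)\<^sup>2)"
   by (rule LINT_cong[OF refl]) (use R in \<open>auto simp: W0_def indicator_def\<close>)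
  also have "... <= 2 * r\<^sup>2 * ?G + 4 * ?V1 * ((SUM a:N. (LINT y|lborel. k (y - a) * W0 y)\<^sup>2) + (L * e)\<^sup>2 * ?V2 * ?J)"
   by (rule conv_bound[OF k(2-5,7,6) r(2) less_imp_le[OF r(1)] N(2,3) less_imp_le[OF e(1)]])
  also have "... = 2 * r\<^sup>2 * ?G + (B - 1) * e\<^sup>2 * ?J + 4 * ?V1 * ?S"
   using kk by (simp add: B_def algebra_simps power_mult_distrib)
  also have "... <= d * ?G + d * ?J + 4 * ?V1 * ?S"
  proof -
   have "(B - 1) * e\<^sup>2 <= d" using e(2) by (simp add: left_diff_distrib)
   from mult_right_mono[OF this J] mult_right_mono[OF r(3) G] show ?thesis by linarith
  qed
  also have "d * ?G + d * ?J = d * (LINT x|lborel. indicator ?K2 x * (pgrad2 W x + (W x)\<^sup>2))"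
  proof -
   have "(LINT x|lborel. indicator ?K2 x * (pgrad2 W x + (W x)\<^sup>2)) = (LINT x|lborel. G0 x + (W0 x)\<^sup>2)"
    by (rule LINT_cong[OF refl]) (auto simp: G0_def W0_def indicator_def)
   then show ?thesis using G0_integrable W0_sq_integrable by (simp add: distrib_left)
  qed
  finally have "(LINT x|lborel. indicator ?K x * (W x)\<^sup>2) <= d * (LINT x|lborel. indicator ?K2 x * (pgrad2 W x + (W x)\<^sup>2)) + 4 * ?V1 * ?S" .
  moreover have S: "?S <= real (card N) * (SUM k:(%a y. k (y - a)) ` N. (LINT y|lborel. k y * W y)\<^sup>2)"
   using N(2) by (intro sum_bounded_above member_le_sum[of "%y. k (y - _)" _ "%k. (LINT y|lborel. k y * W y)\<^sup>2"]) auto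
  from mult_left_mono[OF this, of "4 * ?V1"] have "4 * ?V1 * ?S <= 4 * ?V1 * real (card N) * (SUM k:(%a y. k (y - a)) ` N. (LINT y|lborel. k y * W y)\<^sup>2)"
   by (simp add: mult.assoc)
  ultimately show "(LINT x|lborel. indicator ?K x * (W x)\<^sup>2) <= d * (LINT x|lborel. indicator ?K2 x * (pgrad2 W x + (W x)\<^sup>2))
   + 4 * ?V1 * real (card N) * (SUM k:(%a y. k (y - a)) ` N. (LINT y|lborel. k y * W y)\<^sup>2)" by linarith
 qed
qed

text \<open>Both forms are homogeneous of degree two in \<open>v\<close>, so it suffices to bound
  their quotient on the compact product of \<open>Z\<close> with the unit sphere.\<close>

lemma form_bound:
 fixes P Q :: "'b::topological_space => real^'n^'n"
 assumes Z: "compact Z" and c: "!!i j. continuous_on Z (%z. P z $ i $ j)" "!!i j. continuous_on Z (%z. Q z $ i $ j)"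
  and pos: "!!z v. z : Z ==> v ~= 0 ==> 0 < bil (P z) v v"
 obtains C where "0 <= C" "!!z v. z : Z ==> \<bar>bil (Q z) v v\<bar> <= C * bil (P z) v v"
proof -
 have bs: "bil S v v = (SU i j. v $ i * S $ i $ j * v $ j)" for S :: "real^'n^'n" and v
  by (simp add: bil_def inner_vec_def matrix_vector_mult_def sum_distrib_left mult.assoc)
 let ?S = "Z \<times> sphere (0 :: real^'n) 1"
 have bc: "continuous_on ?S (%q. bil (S (fst q)) (snd q) (snd q))" if "!!i j. continuous_on Z (%z. S z $ i $ j)" for S
  unfolding bs
  by (intro continuous_on_sum continuous_on_mult continuous_on_compose2[OF that continuous_on_fst[OF continuous_on_id]]
    continuous_on_component continuous_on_snd continuous_on_id) auto
 have "continuous_on ?S (%q. \<bar>bil (Q (fst q)) (snd q) (snd q)\<bar> / bil (P (fst q)) (snd q) (snd q))"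
 proof (intro continuous_on_divide continuous_on_rabs bc c ballI)
  fix q assume q: "q : ?S"
  then have "snd q ~= 0" by auto
  then show "bil (P (fst q)) (snd q) (snd q) ~= 0" using pos[of "fst q" "snd q"] q by auto
 qed
 from compact_continuous_image[OF this compact_Times[OF Z compact_sphere]]
 obtain b where b: "!!q. q : ?S ==> norm (\<bar>bil (Q (fst q)) (snd q) (snd q)\<bar> / bil (P (fst q)) (snd q) (snd q)) <= b"
  using compact_imp_bounded bounded_iff by (metis (no_types, lifting) imageI)
 show ?thesis
 proof (rule that[of "\<bar>b\<bar>"])
  fix z and v :: "real^'n" assume z: "z : Z"
  show "\<bar>bil (Q z) v v\<bar> <= \<bar>b\<bar> * bil (P z) v v"
  proof (cases "v = 0")
   case False
   define e where "e = (1 / norm v) *\<^sub>R v"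
   have e: "v = norm v *\<^sub>R e" "norm e = 1" "e ~= 0" using False by (auto simp: e_def)
   have h: "bil S v v = (norm v)\<^sup>2 * bil S e e" for S
    by (subst (1 2) e(1)) (simp add: bil_def matrix_vector_mult_scaleR power2_eq_square)
   have "\<bar>bil (Q z) e e\<bar> / bil (P z) e e <= \<bar>b\<bar>" using b[of "(z, e)"] z e(2) pos[OF z e(3)] by simp
   then have "\<bar>bil (Q z) e e\<bar> <= \<bar>b\<bar> * bil (P z) e e" using pos[OF z e(3)] by (simp add: divide_le_eq)
   then have "(norm v)\<^sup>2 * \<bar>bil (Q z) e e\<bar> <= (norm v)\<^sup>2 * (\<bar>b\<bar> * bil (P z) e e)" by (rule mult_left_mono) simp
   then show ?thesis unfolding h by (simp add: abs_mult mult.left_commute)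
  qed (simp add: bil_def)
 qed simp
qed

section \<open>Uniform bounds and detection on the manifold\<close>

context metric_flow
begin

lemma ellipticity:
 assumes c: "c : A" and Z: "compact Z" "Z \<subseteq> chart_image c"
 obtains k where "0 <= k" "!!s x W. s : {0..T} ==> x : Z ==> pgrad2 W x <= k * gm s c W W x"
proof -
 have pos: "0 < bil (matrix_inv (g (fst q) c (snd q))) v v" if q: "q : {0..T} \<times> Z" and v: "v ~= 0" for q v
 proof -
  have t: "fst q : {0..T}" and x: "snd q : chart_image c" using q Z(2) by auto
  let ?G = "g (fst q) c (snd q)"
  have inv: "?G ** matrix_inv ?G = mat 1" using matrix_inv_right det_g_pos[OF t c x] by (metis less_irrefl)
  have Gv: "?G *v (matrix_inv ?G *v v) = v" unfolding matrix_vector_mul_assoc inv by simp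
  then have "matrix_inv ?G *v v ~= 0" using v by auto
  then have "0 < bil ?G (matrix_inv ?G *v v) (matrix_inv ?G *v v)" by (rule g_pos[OF t c x])
  then show ?thesis unfolding bil_def Gv by (simp add: inner_commute)
 qed
 have cP: "continuous_on ({0..T} \<times> Z) (%q. matrix_inv (g (fst q) c (snd q)) $ i $ j)" for i j
  by (rule continuous_on_subset[OF smooth_on_imp_continuous_on[OF gi_spacetime[OF T_interval(1) c]]]) (use Z(2) in auto)
 obtain k where k: "0 <= k" "!!q v. q : {0..T} \<times> Z ==> \<bar>bil (mat 1) v v\<bar> <= k * bil (matrix_inv (g (fst q) c (snd q))) v v"
  by (rule form_bound[where Q="%_. mat 1", OF compact_Times[OF compact_Icc Z(1)] cP continuous_on_const]) (rule pos, assumption, assumption, rule that, assumption+)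
 show ?thesis
 proof (rule that[OF k(1)])
  fix s x W assume s: "s : {0..T}" and x: "x : Z"
  let ?v = "\<chi> i. pderiv_coord i W x"
  note L = local_metric_g[OF s c]
  have "gm s c W W x = bil (matrix_inv (g s c x)) ?v ?v"
   by (simp add: local_metric.gam_def[OF L] local_metric.bil_sum[OF L] mult.commute mult.left_commute)
  then show "pgrad2 W x <= k * gm s c W W x"
   using k(2)[of "(s, x)" ?v] s x by (simp add: pgrad2_def power2_norm_eq_inner bil_def)
 qed
qed

text \<open>Gives a constant by which the time derivative of the Dirichlet form is controlled by the
  form itself, uniformly in time and function. It is the price, in the monotonicity of the
  frequency, for the moving metric.\<close>

lemma Gdot_bound:
 obtains C where "0 <= C" "!!s a p. s : {0..T} ==> C1M a ==> p : M ==> \<bar>Gdot s a a p\<bar> <= C * Gam s a a p"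
proof -
 obtain N :: "'a set" and B where N: "finite N" "!!k. k : N ==> C1M (B k)" "!!p. p : M ==> (SUM k:N. B k p) > 0"
  and supp: "!!k. k : N ==> EX c K. c : A & compact K & K \<subseteq> chart_image c & (ALL p:M. B k p ~= 0 --> p : fst c & snd c p : K)"
  using bump_cover by blast
 let ?G = "%k C. 0 <= C & (ALL s:{0..T}. ALL q:M. ALL a. B k q ~= 0 --> C1M a --> \<bar>Gdot s a a q\<bar> <= C * Gam s a a q)"
 have "ALL k:N. EX C. ?G k C"
 proof
  fix k assume "k : N"
  from supp[OF this] obtain c Z where c: "c : A" and Z: "compact Z" "Z \<subseteq> chart_image c"
   and B: "ALL p:M. B k p ~= 0 --> p : fst c & snd c p : Z" by (elim exE conjE) (rule that)
  have sub: "{0..T} \<times> Z \<subseteq> {0..T} \<times> chart_image c" using Z(2) by auto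
  have cP: "continuous_on ({0..T} \<times> Z) (%q. g (fst q) c (snd q) $ i $ j)" for i j
   by (rule continuous_on_subset[OF smooth_on_imp_continuous_on[OF g_spacetime[OF T_interval(1) c]] sub])
  have cQ: "continuous_on ({0..T} \<times> Z) (%q. metric_deriv T g (fst q) c (snd q) $ i $ j)" for i j
   by (rule continuous_on_subset[OF metric_deriv_continuous[OF c] sub])
  have pos: "0 < bil (g (fst q) c (snd q)) v v" if "q : {0..T} \<times> Z" "v ~= 0" for q v
   using g_pos[OF _ c _ that(2)] that(1) Z(2) by auto
  obtain C where C: "0 <= C" "!!q v. q : {0..T} \<times> Z ==> \<bar>bil (metric_deriv T g (fst q) c (snd q)) v v\<bar> <= C * bil (g (fst q) c (snd q)) v v"
   by (rule form_bound[OF compact_Times[OF compact_Icc Z(1)] cP cQ]) (rule pos, assumption, assumption, rule that, assumption+)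
  have "\<bar>Gdot s a a q\<bar> <= C * Gam s a a q" if s: "s : {0..T}" and q: "q : M" "B k q ~= 0" and a: "C1M a" for s q a
  proof -
   have qc: "q : fst c" "snd c q : Z" using B q by simp_all
   show ?thesis
    unfolding Gdot_chart[OF s a a c qc(1)] Gam_chart[OF s a a c qc(1)]
     local_metric.bil_gradient[OF local_metric_g[OF s c] snd_in[OF qc(1)], symmetric]
    using C(2)[of "(s, snd c q)"] s qc(2) by simp
  qed
  then show "EX C. ?G k C" using C(1) by (intro exI[of _ C]) simp
 qed
 from bchoice[OF this] obtain C where C: "ALL k:N. ?G k (C k)" ..
 show ?thesis
 proof (rule that[of "SUM k:N. C k"])
  show "0 <= (SUM k:N. C k)" using C by (simp add: sum_nonneg)
  fix s a q assume s: "s : {0..T}" and a: "C1M a" and q: "q : M"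
  have "EX k:N. B k q ~= 0" using N(3)[OF q] by (rule contrapos_pp) simp
  then obtain k where k: "k : N" "B k q ~= 0" ..
  have "\<bar>Gdot s a a q\<bar> <= C k * Gam s a a q" using C k s a q by simp
  also have "... <= (SUM k:N. C k) * Gam s a a q"
   by (intro mult_right_mono Gam_nonneg[OF s a q] member_le_sum N(1) k(1)) (use C in auto)
  finally show "\<bar>Gdot s a a q\<bar> <= (SUM k:N. C k) * Gam s a a q" .
 qed
qed

lemma continuous_on_coord: "c : A ==> continuous_on M F ==> continuous_on (chart_image c) (coord c F)"
 for F :: "'a => real"
 unfolding coord_def by (rule continuous_on_compose2[OF _ chart_inv_continuous]) (auto intro: chart_inv_M)

definition lift :: "('a, 'n) chart => (real^'n => real) => 'a => real" where
 "lift c h q = (if q : fst c then h (snd c q) else 0)"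

context
 fixes c :: "('a, 'n) chart" and K :: "(real^'n) set" and h :: "real^'n => real"
 assumes c: "c : A" and K: "compact K" "K \<subseteq> chart_image c" and h: "continuous_on (chart_image c) h"
  and zero: "!!x. x : chart_image c ==> x ~: K ==> h x = 0"
begin

lemma lift_continuous: "continuous_on M (lift c h)"
proof -
 define K' where "K' = chart_inv c ` K"
 have K': "compact K'" unfolding K'_def
  by (rule compact_continuous_image[OF continuous_on_subset[OF chart_inv_continuous[OF c] K(2)] K(1)])
 have sub: "K' \<subseteq> fst c" unfolding K'_def using chart_inv_in[OF c] K(2) by blast
 have M: "M = fst c \<union> (M - K')" using sub chart_subset[OF c] by blast
 have "continuous_on (fst c) (lift c h)"
 proof (rule continuous_on_eq)
  show "continuous_on (fst c) (%q. h (snd c q))"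
   by (rule continuous_on_compose2[OF h chart_continuous[OF c]]) auto
 qed (simp add: lift_def)
 moreover have "continuous_on (M - K') (lift c h)"
 proof (rule continuous_on_eq[OF continuous_on_const[of _ 0]])
  fix q assume q: "q : M - K'"
  show "0 = lift c h q"
  proof (cases "q : fst c")
   case True
   then have "snd c q ~: K" using q chart_inv_snd[OF c True] unfolding K'_def by force
   then show ?thesis using zero[OF snd_in[OF True]] by (simp add: lift_def)
  qed (simp add: lift_def)
 qed
 moreover have "openin (top_of_set M) (M - K')"
  using compact_imp_closed[OF K'] by (auto simp: openin_open Diff_eq open_Compl)
 ultimately have "continuous_on (fst c \<union> (M - K')) (lift c h)"
  using chart_openin[OF c] by (intro continuous_on_Un_local_open) (simp_all add: M[symmetric])
 then show ?thesis by (simp add: M[symmetric])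
qed

lemma lift_integral:
 assumes F: "continuous_on M F"
 shows "(LINT q|mu. lift c h q * F q) = (LINT x|lborel. indicator K x * (r0 c x * (h x * coord c F x)))"
proof -
 have "(LINT q|mu. lift c h q * F q) = (LINT x|lborel. indicator (chart_image c) x * (r0 c x * coord c (%q. lift c h q * F q) x))"
  by (rule mu_integral_chart[OF c continuous_on_mult[OF lift_continuous F]]) (simp add: lift_def)
 also have "... = (LINT x|lborel. indicator K x * (r0 c x * (h x * coord c F x)))"
 proof (rule LINT_cong[OF refl])
  fix x
  show "indicator (chart_image c) x * (r0 c x * coord c (%q. lift c h q * F q) x) = indicator K x * (r0 c x * (h x * coord c F x))"
   using K(2) zero[of x] chart_inv_in[OF c, of x] snd_chart_inv[OF c, of x]
   by (cases "x : chart_image c"; cases "x : K") (auto simp: coord_def lift_def)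
 qed
 finally show ?thesis .
qed

end

text \<open>The point is the order of quantifiers: \<open>X\<close> and \<open>C\<close> serve all
  functions \<open>w\<close> and all times \<open>s\<close>. The weight \<open>\<beta>\<close>
  localises the left side.\<close>

definition detects :: "('a => real) => real => ('a => real) set => real => bool" where
 "detects \<beta> d X C \<longleftrightarrow> finite X & 0 <= C & (ALL b:X. continuous_on M b & (ALL q. 0 <= b q)) &
  (ALL w s. C1M w --> s : {0..T} -->
   (LINT q|mu. \<beta> q * (w q)\<^sup>2) <= d * (LINT q|mu. Gam s w w q + (w q)\<^sup>2) + C * (SUM b:X. (LINT q|mu. b q * w q)\<^sup>2))"

text \<open>Carries \<open>local_detection\<close> from a coordinate ball to the manifold. Density
  and metric are comparable to the Euclidean ones on the compact ball, uniformly in time, and the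
  loss is compensated by a smaller parameter.\<close>

lemma bump_detects:
 assumes p: "p : M"
 obtains \<beta> where "continuous_on M \<beta>" "!!q. 0 <= \<beta> q" "0 < \<beta> p" "!!d. 0 < d ==> EX X C. detects \<beta> d X C"
proof -
 obtain c R0 where c: "c : A" "p : fst c" and R0: "0 < R0" "cball (snd c p) R0 \<subseteq> chart_image c" using chart_ball[OF p] by blast
 define R where "R = R0 / 3"
 let ?x0 = "snd c p" and ?U = "chart_image c"
 let ?K = "cball ?x0 R" and ?K2 = "cball ?x0 (2 * R)" and ?K3 = "cball ?x0 (3 * R)"
 have R: "0 < R" and K3: "?K3 \<subseteq> ?U" and K2: "?K2 \<subseteq> ?U" and K1: "?K \<subseteq> ?U" and sub: "?K \<subseteq> ?K3" "?K2 \<subseteq> ?K3" using R0 by (auto simp: R_def)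
 have oU: "open ?U" by (rule open_chart_image[OF c(1)])
 have r0c: "continuous_on ?U (r0 c)" by (rule smooth_on_imp_continuous_on[OF rho_smooth[OF zero_time c(1)]])
 have r0p: "0 < r0 c x" if "x : ?U" for x by (rule rho_pos[OF zero_time c(1) that])
 have bd: "EX B>=0. ALL x:?K3. \<bar>F x\<bar> <= B" if F: "continuous_on ?U F" for F :: "real^'n => real"
 proof -
  obtain B where B: "0 <= B" "ALL x. \<bar>indicator ?K3 x * F x\<bar> <= B" using borel_cutoff(2)[OF compact_cball continuous_on_subset[OF F K3]] by blast
  have "\<bar>F x\<bar> <= B" if "x : ?K3" for x using B(2)[rule_format, of x] by (simp only: indicator_simps(1)[OF that] mult_1)
  then show ?thesis using B(1) by blast
 qed
 have ir0c: "continuous_on ?U (%x. 1 / r0 c x)" using r0p by (intro continuous_on_divide continuous_on_const r0c) force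
 obtain B where B: "0 <= B" "!!x. x : ?K3 ==> r0 c x <= B" using bd[OF r0c] abs_le_D1 by blast
 obtain B' where B': "0 <= B'" "!!x. x : ?K3 ==> 1 / r0 c x <= B'" using bd[OF ir0c] abs_le_D1 by blast
 obtain k0 where k0: "0 <= k0" "!!s x W. s : {0..T} ==> x : ?K3 ==> pgrad2 W x <= k0 * gm s c W W x"
  by (rule ellipticity[OF c(1) compact_cball K3]) (rule that, assumption+)
 \<comment> \<open>\<open>\<beta>1\<close> lives on the inner ball, where the norm is detected;
   \<open>\<beta>2\<close> is 1 on the doubled ball, where the energy is collected, and falls to
   zero inside the tripled one, so that the energy integral extends to the manifold.\<close>
 define \<beta>1 :: "real^'n => real" where "\<beta>1 x = max 0 (R - norm (x - ?x0))" for x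
 define \<beta>2 :: "real^'n => real" where "\<beta>2 x = max 0 (min 1 (3 - norm (x - ?x0) / R))" for x
 have b1: "continuous_on S \<beta>1" "0 <= \<beta>1 x" "\<beta>1 x <= R" "x ~: ?K ==> \<beta>1 x = 0" for S x
 proof -
  show "continuous_on S \<beta>1" unfolding \<beta>1_def by (intro continuous_intros)
 qed (use R in \<open>auto simp: \<beta>1_def dist_norm norm_minus_commute\<close>)
 have b2: "continuous_on S \<beta>2" "0 <= \<beta>2 x" "\<beta>2 x <= 1" "x : ?K2 ==> \<beta>2 x = 1" "x ~: ?K3 ==> \<beta>2 x = 0" for S x
 proof -
  show "continuous_on S \<beta>2" unfolding \<beta>2_def using R by (intro continuous_intros) auto
 qed (use R in \<open>auto simp: \<beta>2_def dist_norm norm_minus_commute field_simps min_def max_def\<close>)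
 note L1 = lift_continuous[OF c(1) compact_cball K3 b1(1)] lift_integral[OF c(1) compact_cball K3 b1(1)]
 note L2 = lift_continuous[OF c(1) compact_cball K3 b2(1)] lift_integral[OF c(1) compact_cball K3 b2(1)]
 have z1: "\<beta>1 x = 0" if "x ~: ?K3" for x using b1(4) that sub by blast
 show ?thesis
 proof (rule that[of "lift c \<beta>1"])
  show "continuous_on M (lift c \<beta>1)" by (rule L1(1)) (rule z1)
  show "0 <= lift c \<beta>1 q" for q using b1(2) by (simp add: lift_def)
  show "0 < lift c \<beta>1 p" using c(2) R by (simp add: lift_def \<beta>1_def)
  fix d :: real assume d: "0 < d"
  \<comment> \<open>All losses of the transfer: \<open>B * R\<close> bounds density times
    \<open>\<beta>1\<close>, \<open>B'\<close> the inverse density, and \<open>k0 + 1\<close> is the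
    ellipticity. The summand 1 makes \<open>Q\<close> positive.\<close>
  define Q where "Q = B * R * (B' * (k0 + 1)) + 1"
  have Q: "0 < Q" unfolding Q_def using B(1) B'(1) k0(1) R by (intro add_nonneg_pos mult_nonneg_nonneg) auto
  have dQ: "0 < d / Q" using d Q by simp
  obtain X C where X: "finite X" "0 <= C"
   and Xk: "!!k. k : X ==> continuous_on UNIV k & (ALL x. 0 <= k x) & (ALL x. x ~: ?K2 --> k x = 0)"
   and XD: "!!U W. open U ==> Ck_on 1 U W ==> ?K2 \<subseteq> U ==>
    (LINT x|lborel. indicator ?K x * (W x)\<^sup>2) <=
    d / Q * (LINT x|lborel. indicator ?K2 x * (pgrad2 W x + (W x)\<^sup>2)) + C * (SUM k:X. (LINT y|lborel. k y * W y)\<^sup>2)"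
   by (rule local_detection[OF R dQ, of ?x0]) (rule that, assumption+)
  \<comment> \<open>Division by the density turns the pairing on the manifold into the Lebesgue
    pairing with \<open>k\<close> in the chart.\<close>
  let ?b = "%k. lift c (%x. k x / r0 c x)"
  have kz: "k x / r0 c x = 0" if "k : X" "x ~: ?K3" for k x
  proof -
   have "x ~: ?K2" using that(2) sub(2) by (rule contra_subsetD[rotated])
   then show ?thesis using Xk[OF that(1)] by simp
  qed
  have kc: "continuous_on ?U (%x. k x / r0 c x)" if "k : X" for k
  proof (intro continuous_on_divide r0c ballI)
   show "continuous_on ?U k" using Xk[OF that] continuous_on_subset[of UNIV k ?U] by simp
   show "r0 c x ~= 0" if "x : ?U" for x using r0p[OF that] by simp
  qed
  have bpair: "(LINT q|mu. ?b k q * w q) = (LINT y|lborel. k y * coord c w y)" if k: "k : X" and w: "continuous_on M w" for k w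
  proof (rule trans[OF lift_integral[OF c(1) compact_cball K3 kc[OF k] kz[OF k] w] LINT_cong[OF refl]])
   fix x
   show "indicator ?K3 x * (r0 c x * (k x / r0 c x * coord c w x)) = k x * coord c w x"
    using r0p[of x] K3 kz[OF k, of x] Xk[OF k] sub(2) by (cases "x : ?K3") (auto simp: indicator_def subset_iff)
  qed
  have "(LINT q|mu. lift c \<beta>1 q * (w q)\<^sup>2) <= d * (LINT q|mu. Gam s w w q + (w q)\<^sup>2)
    + (B * R * C * real (card X)) * (SUM b:?b ` X. (LINT q|mu. b q * w q)\<^sup>2)" if w: "C1M w" and s: "s : {0..T}" for w s
  proof -
   let ?W = "coord c w"
   have W: "Ck_on 1 ?U ?W" using w c(1) by (simp add: C1M_def)
   have Wc: "continuous_on ?U ?W" by (rule Ck_on_imp_continuous_on[OF W])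
   interpret C: cutoff_C1 ?U ?W ?x0 R by unfold_locales (fact oU W R K2)+
   have wc: "continuous_on M w" by (rule C1M_continuous[OF w])
   have Gc: "continuous_on M (%q. Gam s w w q + (w q)\<^sup>2)"
    by (intro continuous_on_add Gam_continuous s w continuous_on_power wc)
   have Gn: "0 <= Gam s w w q + (w q)\<^sup>2" if "q : M" for q using Gam_nonneg[OF s w that] by simp
   have cG: "coord c (%q. Gam s w w q + (w q)\<^sup>2) x = gm s c ?W ?W x + (?W x)\<^sup>2" if "x : ?U" for x
    using coord_Gam[OF s w w c(1) that] by (simp add: coord_def)
   have i1: "integrable lborel (%x. indicator ?K x * (?W x)\<^sup>2)"
    by (intro borel_cutoff(3) compact_cball continuous_on_power continuous_on_subset[OF Wc K1])
   have i3: "integrable lborel (%x. indicator ?K3 x * (r0 c x * (h x * coord c F x)))"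
    if "continuous_on ?U h" "continuous_on M F" for h F
    by (rule borel_cutoff(3)[OF compact_cball continuous_on_subset[OF _ K3]])
     (intro continuous_on_mult r0c that(1) continuous_on_coord[OF c(1) that(2)])
   have "(LINT q|mu. lift c \<beta>1 q * (w q)\<^sup>2) = (LINT x|lborel. indicator ?K3 x * (r0 c x * (\<beta>1 x * coord c (%q. (w q)\<^sup>2) x)))"
    by (rule L1(2)[OF z1 continuous_on_power[OF wc]])
   also have "... <= (LINT x|lborel. (B * R) * (indicator ?K x * (?W x)\<^sup>2))"
   proof (rule integral_mono[OF i3[OF b1(1) continuous_on_power[OF wc]] integrable_mult_right[OF i1]])
    fix x
    show "indicator ?K3 x * (r0 c x * (\<beta>1 x * coord c (%q. (w q)\<^sup>2) x)) <= (B * R) * (indicator ?K x * (?W x)\<^sup>2)"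
    proof (cases "x : ?K")
     case True
     then have x: "x : ?K3" using sub by blast
     have "r0 c x * \<beta>1 x <= B * R" by (intro mult_mono B x b1 B(1))
     then have "(r0 c x * \<beta>1 x) * (?W x)\<^sup>2 <= (B * R) * (?W x)\<^sup>2" by (rule mult_right_mono) simp
     then show ?thesis using True x by (simp add: coord_def mult.assoc)
    next
     case False
     then show ?thesis using b1(4)[OF False] by simp
    qed
   qed
   also have "... = (B * R) * (LINT x|lborel. indicator ?K x * (?W x)\<^sup>2)" by simp
   also have "... <= (B * R) * (d / Q * (LINT x|lborel. indicator ?K2 x * (pgrad2 ?W x + (?W x)\<^sup>2)) + C * (SUM k:X. (LINT y|lborel. k y * ?W y)\<^sup>2))"
    using B(1) R by (intro mult_left_mono[OF XD[OF oU W K2]]) simp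
   finally have 1: "(LINT q|mu. lift c \<beta>1 q * (w q)\<^sup>2) <=
    (B * R) * (d / Q * (LINT x|lborel. indicator ?K2 x * (pgrad2 ?W x + (?W x)\<^sup>2)) + C * (SUM k:X. (LINT y|lborel. k y * ?W y)\<^sup>2))" .
   have "(LINT x|lborel. indicator ?K2 x * (pgrad2 ?W x + (?W x)\<^sup>2)) <=
    (LINT x|lborel. B' * (k0 + 1) * (indicator ?K3 x * (r0 c x * (\<beta>2 x * coord c (%q. Gam s w w q + (w q)\<^sup>2) x))))"
   proof (rule integral_mono[OF _ integrable_mult_right[OF i3[OF b2(1) Gc]]])
    show "integrable lborel (%x. indicator ?K2 x * (pgrad2 ?W x + (?W x)\<^sup>2))"
     by (intro borel_cutoff(3) compact_cball continuous_on_add continuous_on_power continuous_on_subset[OF Wc K2] continuous_on_subset[OF C.pgrad2_cont K2])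
    fix x
    have nn: "0 <= coord c (%q. Gam s w w q + (w q)\<^sup>2) x" if "x : ?U" using Gn[OF chart_inv_M[OF c(1) that]] by (simp add: coord_def)
    show "indicator ?K2 x * (pgrad2 ?W x + (?W x)\<^sup>2) <=
     B' * (k0 + 1) * (indicator ?K3 x * (r0 c x * (\<beta>2 x * coord c (%q. Gam s w w q + (w q)\<^sup>2) x)))"
    proof (cases "x : ?K2")
     case True
     then have x: "x : ?K3" "x : ?U" using sub K2 by blast+
     have g0: "0 <= gm s c ?W ?W x"
      using Gam_nonneg[OF s w chart_inv_M[OF c(1) x(2)]] coord_Gam[OF s w w c(1) x(2)] by (simp add: coord_def)
     have r: "1 <= B' * r0 c x" using B'(2)[OF x(1)] r0p[OF x(2)] by (simp add: divide_le_eq)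
     have "pgrad2 ?W x + (?W x)\<^sup>2 <= k0 * gm s c ?W ?W x + (?W x)\<^sup>2" using k0(2)[OF s x(1)] by simp
     also have "... <= (k0 + 1) * (gm s c ?W ?W x + (?W x)\<^sup>2)" using g0 k0(1) by (simp add: algebra_simps)
     also have "... <= (B' * r0 c x) * ((k0 + 1) * (gm s c ?W ?W x + (?W x)\<^sup>2))"
      using mult_right_mono[OF r, of "(k0 + 1) * (gm s c ?W ?W x + (?W x)\<^sup>2)"] g0 k0(1) by simp
     finally show ?thesis using True x b2(4)[OF True] by (simp add: cG[OF x(2)] mult.assoc mult.left_commute)
    next
     case False
     have "0 <= indicator ?K3 x * (r0 c x * (\<beta>2 x * coord c (%q. Gam s w w q + (w q)\<^sup>2) x))"
      using r0p[of x] nn K3 b2(2)[of x] by (cases "x : ?K3") (auto simp: subset_iff intro!: mult_nonneg_nonneg less_imp_le)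
     then show ?thesis using False B'(1) k0(1) by simp
    qed
   qed
   also have "... = B' * (k0 + 1) * (LINT q|mu. lift c \<beta>2 q * (Gam s w w q + (w q)\<^sup>2))"
    using L2(2)[OF b2(5) Gc] by simp
   also have "... <= B' * (k0 + 1) * (LINT q|mu. Gam s w w q + (w q)\<^sup>2)"
   proof (rule mult_left_mono[OF integral_mono])
    show "integrable mu (%q. lift c \<beta>2 q * (Gam s w w q + (w q)\<^sup>2))"
     by (intro mu_integrable continuous_on_mult Gc L2(1)) (rule b2(5))
    show "lift c \<beta>2 q * (Gam s w w q + (w q)\<^sup>2) <= Gam s w w q + (w q)\<^sup>2" if "q : space mu" for q
     using mult_right_mono[of "lift c \<beta>2 q" 1 "Gam s w w q + (w q)\<^sup>2"] Gn[of q] that b2(3) by (simp add: lift_def)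
   qed (use B'(1) k0(1) mu_integrable[OF Gc] in auto)
   finally have 2: "(LINT x|lborel. indicator ?K2 x * (pgrad2 ?W x + (?W x)\<^sup>2)) <= B' * (k0 + 1) * (LINT q|mu. Gam s w w q + (w q)\<^sup>2)" .
   have I: "0 <= (LINT q|mu. Gam s w w q + (w q)\<^sup>2)" by (rule LINT_nonneg) (use Gn in auto)
   have "(B * R) * (d / Q * (LINT x|lborel. indicator ?K2 x * (pgrad2 ?W x + (?W x)\<^sup>2))) <= (B * R) * (d / Q * (B' * (k0 + 1) * (LINT q|mu. Gam s w w q + (w q)\<^sup>2)))"
    using B(1) R dQ 2 by (intro mult_left_mono) auto
   also have "... = d * ((Q - 1) / Q) * (LINT q|mu. Gam s w w q + (w q)\<^sup>2)" by (simp add: Q_def)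
   also have "... <= d * 1 * (LINT q|mu. Gam s w w q + (w q)\<^sup>2)"
    using d Q I by (intro mult_right_mono mult_left_mono) auto
   finally have 3: "(B * R) * (d / Q * (LINT x|lborel. indicator ?K2 x * (pgrad2 ?W x + (?W x)\<^sup>2))) <= d * (LINT q|mu. Gam s w w q + (w q)\<^sup>2)" by simp
   have "(SUM k:X. (LINT y|lborel. k y * ?W y)\<^sup>2) = (SUM k:X. (LINT q|mu. ?b k q * w q)\<^sup>2)"
    by (rule sum.cong[OF refl]) (simp add: bpair wc)
   also have "... <= real (card X) * (SUM b:?b ` X. (LINT q|mu. b q * w q)\<^sup>2)"
    using X(1) by (intro sum_bounded_above member_le_sum[of "?b _" _ "%b. (LINT q|mu. b q * w q)\<^sup>2"]) auto
   finally have "(B * R * C) * (SUM k:X. (LINT y|lborel. k y * ?W y)\<^sup>2) <= (B * R * C) * (real (card X) * (SUM b:?b ` X. (LINT q|mu. b q * w q)\<^sup>2))"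
    using B(1) R X(2) by (intro mult_left_mono) auto
   with 1 3 show ?thesis by (simp add: distrib_left mult.assoc)
  qed
  moreover have "ALL b:?b ` X. continuous_on M b & (ALL q. 0 <= b q)"
  proof
   fix b assume "b : ?b ` X"
   then obtain k where k: "k : X" "b = ?b k" by blast
   have "continuous_on M b" unfolding k(2) by (rule lift_continuous[OF c(1) compact_cball K3 kc[OF k(1)] kz[OF k(1)]])
   moreover have "0 <= b q" for q
    using Xk[OF k(1)] r0p[OF snd_in[of q c]] by (auto simp: k(2) lift_def intro: divide_nonneg_nonneg less_imp_le)
   ultimately show "continuous_on M b & (ALL q. 0 <= b q)" by blast
  qed
  ultimately show "EX X C. detects (lift c \<beta>1) d X C"
   unfolding detects_def using X B(1) R by (intro exI[of _ "?b ` X"] exI[of _ "B * R * C * real (card X)"]) simp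
 qed
qed

abbreviation "admissible f == pos_continuous M f & ~ f constant_on M"

lemma admissible_exists:
 assumes "M ~= {}"
 obtains f where "admissible f"
proof -
 obtain p where p: "p : M" using assms by blast
 obtain c R where c: "c : A" "p : fst c" and R: "0 < R" "cball (snd c p) R \<subseteq> chart_image c" using chart_ball[OF p] by blast
 let ?x = "snd c p" and ?h = "%x. max 0 (R - norm (x - snd c p))"
 obtain e :: "real^'n" where e: "norm e = R" using vector_choose_size[of R] R(1) by auto
 have y: "?x + e : chart_image c" using R(2) e by (auto simp: dist_norm)
 have hc: "continuous_on (chart_image c) ?h" by (intro continuous_intros)
 have "continuous_on M (lift c ?h)"
  by (rule lift_continuous[OF c(1) compact_cball R(2) hc]) (simp add: dist_norm norm_minus_commute)
 then have "pos_continuous M (%q. 1 + lift c ?h q)"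
  by (auto simp: pos_continuous_def lift_def intro!: continuous_intros add_pos_nonneg)
 moreover have "~ (%q. 1 + lift c ?h q) constant_on M"
 proof
  assume "(%q. 1 + lift c ?h q) constant_on M"
  then obtain k where k: "!!q. q : M ==> 1 + lift c ?h q = k" unfolding constant_on_def by blast
  have "1 + lift c ?h p = 1 + lift c ?h (chart_inv c (?x + e))"
   unfolding k[OF p] k[OF chart_inv_M[OF c(1) y]] ..
  then show False using c R(1) e chart_inv_in[OF c(1) y] snd_chart_inv[OF c(1) y] by (simp add: lift_def)
 qed
 ultimately show ?thesis by (rule that[OF conjI])
qed

text \<open>Detecting functions are merely nonnegative, while equality is given for positive
  non-constant initial values. Adding \<open>f0\<close> makes \<open>b\<close> positive; if
  \<open>b + f0\<close> happens to be constant then \<open>b + 2 f0\<close> is not, because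
  \<open>f0\<close> is not.\<close>

lemma admissible_split:
 assumes f0: "admissible f0" and b: "continuous_on M b" "!!q. 0 <= b q"
 shows "EX f1 f2. admissible f1 & admissible f2 & (ALL q:M. b q = f1 q - f2 q)"
proof -
 have adm: "pos_continuous M (%q. b q + k * f0 q)" if "0 < k" for k
  using f0 b that unfolding pos_continuous_def by (auto intro!: continuous_intros add_nonneg_pos)
 have f02: "admissible (%q. 2 * f0 q)"
  using f0 unfolding pos_continuous_def constant_on_def
  by (auto intro!: continuous_intros) (metis field_sum_of_halves mult_2 mult_cancel_left zero_neq_numeral)
 show ?thesis
 proof (cases "(%q. b q + 1 * f0 q) constant_on M")
  case False
  then show ?thesis using adm[of 1] f0 by (intro exI[of _ "%q. b q + 1 * f0 q"] exI[of _ f0]) simp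
 next
  case True
  then obtain k where k: "!!q. q : M ==> b q + 1 * f0 q = k" unfolding constant_on_def by blast
  have "~ (%q. b q + 2 * f0 q) constant_on M"
  proof
   assume "(%q. b q + 2 * f0 q) constant_on M"
   then obtain k' where k': "!!q. q : M ==> b q + 2 * f0 q = k'" unfolding constant_on_def by blast
   have "f0 q = k' - k" if "q : M" for q using k[OF that] k'[OF that] by simp
   then show False using f0 unfolding constant_on_def by blast
  qed
  then show ?thesis using adm[of 2] f02 by (intro exI[of _ "%q. b q + 2 * f0 q"] exI[of _ "%q. 2 * f0 q"]) simp
 qed
qed

text \<open>The local estimates are summed over a finite cover, the L^2 norm on the right is
  absorbed on the left, and each detecting function is replaced by a difference of two admissible
  ones.\<close>

lemma detection:
 assumes d: "0 < d"
 obtains X C where "finite X" "0 <= C" "!!f. f : X ==> admissible f"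
  "!!w s. C1M w ==> s : {0..T} ==>
   (LINT q|mu. (w q)\<^sup>2) <= d * (LINT q|mu. Gam s w w q) + C * (SUM f:X. (LINT q|mu. f q * w q)\<^sup>2)"
proof (cases "M = {}")
 \<comment> \<open>On the empty manifold every function is constant, so there is no admissible
   function to start from; but all integrals vanish.\<close>
 case True
 have "integral\<^sup>L mu F = 0" for F :: "'a => real"
 proof -
  have e: "space mu = {}" by (rule trans[OF space_mu True])
  have "integral\<^sup>L mu F = (LINT q|mu. 0)"
   by (rule LINT_cong[OF refl]) (simp only: e empty_iff)
  then show ?thesis by simp
 qed
 then show ?thesis by (intro that[of "{}" 0]) simp_all
next
 case False
 then obtain f0 where f0: "admissible f0" by (rule admissible_exists)
 have "ALL p:M. EX \<beta>. continuous_on M \<beta> & (ALL q. 0 <= \<beta> q) & 0 < \<beta> p & (ALL d>0. EX X C. detects \<beta> d X C)"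
 proof
  fix p assume "p : M"
  from bump_detects[OF this] show "EX \<beta>. continuous_on M \<beta> & (ALL q. 0 <= \<beta> q) & 0 < \<beta> p & (ALL d>0. EX X C. detects \<beta> d X C)" by metis
 qed
 from bchoice[OF this] obtain \<beta> where \<beta>: "ALL p:M. continuous_on M (\<beta> p) & (ALL q. 0 <= \<beta> p q) & 0 < \<beta> p p & (ALL d>0. EX X C. detects (\<beta> p) d X C)" ..
 obtain N where N: "N \<subseteq> M" "finite N" "!!q. q : M ==> 0 < (SUM p:N. \<beta> p q)"
  by (rule positive_cover[of \<beta>]) (use bspec[OF \<beta>] in simp_all)
 define S where "S q = (SUM p:N. \<beta> p q)" for q
 have \<beta>N: "continuous_on M (\<beta> p)" "0 <= \<beta> p q" "0 < e ==> EX X C. detects (\<beta> p) e X C" if "p : N" for p q e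
  using \<beta> N(1) that by auto
 have Sc: "continuous_on M S" unfolding S_def using \<beta>N(1) by (intro continuous_on_sum)
 obtain m where m: "0 < m" "!!q. q : M ==> m <= S q"
 proof -
  obtain q0 where q0: "q0 : M" "!!q. q : M ==> S q0 <= S q" using continuous_attains_inf[OF compact_M False Sc] by blast
  have "0 < S q0" unfolding S_def by (rule N(3)[OF q0(1)])
  then show ?thesis using q0(2) by (rule that)
 qed
 define n where "n = real (card N) + 1"
 \<comment> \<open>Summed over the cover, the L^2 part is then at most half of the lower bound
   \<open>m\<close> and can be absorbed, and the energy part is at most \<open>d\<close> after
   multiplication by 2 / m.\<close>
 define d' where "d' = min (m / 2) (d * m / 2) / n"
 have n: "0 < n" "real (card N) <= n" by (simp_all add: n_def add_nonneg_pos)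
 have d': "0 < d'" "n * d' <= m / 2" "n * d' <= d * m / 2" using n d m(1) by (simp_all add: d'_def)
 have "ALL p:N. EX Y. detects (\<beta> p) d' (fst Y) (snd Y)" using \<beta>N(3)[OF _ d'(1)] by simp
 from bchoice[OF this] obtain Y where Y: "ALL p:N. detects (\<beta> p) d' (fst (Y p)) (snd (Y p))" ..
 define B where "B = (UN p:N. fst (Y p))"
 define D where "D = (SUM p:N. snd (Y p))"
 have Bf: "finite B" using N(2) Y unfolding B_def detects_def by blast
 have D0: "0 <= D" unfolding D_def using Y by (intro sum_nonneg) (simp add: detects_def)
 have Bb: "continuous_on M b" "0 <= b q" if "b : B" for b q using that Y unfolding B_def detects_def by blast+
 have "ALL b:B. EX F. admissible (fst F) & admissible (snd F) & (ALL q:M. b q = fst F q - snd F q)"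
 proof
  fix b assume "b : B"
  from admissible_split[OF f0 Bb[OF this]] show "EX F. admissible (fst F) & admissible (snd F) & (ALL q:M. b q = fst F q - snd F q)" by simp
 qed
 from bchoice[OF this] obtain F where F: "ALL b:B. admissible (fst (F b)) & admissible (snd (F b)) & (ALL q:M. b q = fst (F b) q - snd (F b) q)" ..
 define X where "X = (fst o F) ` B \<union> (snd o F) ` B"
 have Xf: "finite X" using Bf by (simp add: X_def)
 show ?thesis
 proof (rule that[OF Xf])
  show "0 <= 2 / m * D * (real (card B) * 4)" using m(1) D0 by simp
  show "admissible f" if "f : X" for f using that F unfolding X_def by auto
  fix w s assume w: "C1M w" and s: "s : {0..T}"
  have wc: "continuous_on M w" by (rule C1M_continuous[OF w])
  let ?J = "\<integral>q. (w q)\<^sup>2 \<partial>mu" and ?G = "\<integral>q. Gam s w w q \<partial>mu"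
  let ?V = "%f. (LINT q|mu. f q * w q)\<^sup>2"
  have J: "0 <= ?J" by (rule LINT_nonneg) simp
  have G: "0 <= ?G" by (rule LINT_nonneg) (simp add: Gam_nonneg[OF s w])
  have JG: "(LINT q|mu. Gam s w w q + (w q)\<^sup>2) = ?G + ?J"
   by (intro LINT_add mu_integrable Gam_continuous s w continuous_on_power wc)
  have VB: "?V b <= 4 * sum ?V X" if b: "b : B" for b
  proof -
   let ?f = "fst (F b)" and ?g = "snd (F b)"
   have Fb: "continuous_on M ?f" "continuous_on M ?g" "!!q. q : M ==> b q = ?f q - ?g q"
    using F b by (auto simp: pos_continuous_def)
   have "(LINT q|mu. b q * w q) = (LINT q|mu. ?f q * w q - ?g q * w q)"
    by (rule LINT_cong[OF refl]) (simp add: Fb(3) left_diff_distrib)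
   also have "... = (LINT q|mu. ?f q * w q) - (LINT q|mu. ?g q * w q)"
    by (intro LINT_diff mu_integrable continuous_on_mult Fb wc)
   finally have e: "(LINT q|mu. b q * w q) = (LINT q|mu. ?f q * w q) - (LINT q|mu. ?g q * w q)" .
   have "(x - y)\<^sup>2 <= 2 * x\<^sup>2 + 2 * y\<^sup>2" for x y :: real
    using zero_le_power2[of "x + y"] by (simp add: power2_eq_square algebra_simps)
   then have "?V b <= 2 * ?V ?f + 2 * ?V ?g" unfolding e .
   moreover have "?V ?f <= sum ?V X" "?V ?g <= sum ?V X"
    using b by (intro member_le_sum Xf; force simp: X_def)+
   ultimately show ?thesis by linarith
  qed
  have "m * ?J = (LINT q|mu. m * (w q)\<^sup>2)" by simp
  also have "... <= (LINT q|mu. S q * (w q)\<^sup>2)"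
   by (intro integral_mono mu_integrable continuous_on_mult continuous_on_const continuous_on_power wc Sc mult_right_mono) (use m(2) in auto)
  also have "... = (SUM p:N. \<integral>q. \<beta> p q * (w q)\<^sup>2 \<partial>mu)"
   unfolding S_def sum_distrib_right
   by (intro LINT_sum mu_integrable continuous_on_mult \<beta>N(1) continuous_on_power wc)
  also have "... <= (SUM p:N. d' * (?G + ?J) + snd (Y p) * (real (card B) * (4 * sum ?V X)))"
  proof (rule sum_mono)
   fix p assume p: "p : N"
   then have Yp: "detects (\<beta> p) d' (fst (Y p)) (snd (Y p))" and sub: "fst (Y p) \<subseteq> B" using Y by (auto simp: B_def)
   have "sum ?V (fst (Y p)) <= sum ?V B" by (rule sum_mono2[OF Bf sub]) simp
   also have "... <= real (card B) * (4 * sum ?V X)" by (rule sum_bounded_above) (rule VB)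
   finally have "snd (Y p) * sum ?V (fst (Y p)) <= snd (Y p) * (real (card B) * (4 * sum ?V X))"
    by (rule mult_left_mono) (use Yp in \<open>simp add: detects_def\<close>)
   moreover have "(LINT q|mu. \<beta> p q * (w q)\<^sup>2) <= d' * (?G + ?J) + snd (Y p) * sum ?V (fst (Y p))"
    using Yp w s unfolding detects_def JG[symmetric] by blast
   ultimately show "(LINT q|mu. \<beta> p q * (w q)\<^sup>2) <= d' * (?G + ?J) + snd (Y p) * (real (card B) * (4 * sum ?V X))" by linarith
  qed
  also have "... = real (card N) * d' * (?G + ?J) + D * (real (card B) * (4 * sum ?V X))"
   by (simp add: sum.distrib sum_distrib_right D_def)
  also have "... <= n * d' * (?G + ?J) + D * (real (card B) * (4 * sum ?V X))"
   using n d'(1) G J by (intro add_right_mono mult_right_mono) auto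
  also have "n * d' * (?G + ?J) <= d * m / 2 * ?G + m / 2 * ?J"
   using mult_right_mono[OF d'(3) G] mult_right_mono[OF d'(2) J] by (simp add: distrib_left)
  finally have "m / 2 * ?J <= d * m / 2 * ?G + D * (real (card B) * (4 * sum ?V X))" by simp
  from mult_left_mono[OF this, of "2 / m"]
  show "?J <= d * ?G + 2 / m * D * (real (card B) * 4) * sum ?V X" using m(1) by (simp add: distrib_left)
 qed
qed

end

subsection \<open>Linear systems of ordinary differential equations\<close>

text \<open>The differential inequalities below are integrated in this form, with the comparison
  function or exponential weight built into \<open>F\<close>.\<close>

lemma DERIV_within_nondecreasing:
 fixes F :: "real => real"
 assumes D: "!!s. s : {a..b} ==> (F has_real_derivative F' s) (at s within {a..b})"
  and F': "!!s. s : {a..b} ==> 0 <= F' s" and xy: "a <= x" "x <= y" "y <= b"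
 shows "F x <= F y"
proof (cases "x = y")
 case False
 have "EX s:{x<..<y}. F y - F x = (*) (F' s) (y - x)"
  using xy False
  by (intro mvt_simple has_derivative_subset[OF D[unfolded has_field_derivative_def]]) auto
 then obtain s where "s : {x<..<y}" "F y - F x = F' s * (y - x)" by auto
 moreover from this have "0 <= F' s * (y - x)" using xy by (intro mult_nonneg_nonneg F') auto
 ultimately show ?thesis by linarith
qed simp

text \<open>These are the increments of Picard iteration, so the solution is their sum: the first is
  the constant terminal value, and each further one is the antiderivative, vanishing at \<tau>, of
  the system applied to the one before.\<close>

definition picard :: "nat => real => (real => nat => nat => real) => (nat => real) => nat => nat => real => real" where
 "picard m \<tau> a z n = rec_nat (%k s. z k) (%_ p k. SOME G. G \<tau> = 0 &
  (ALL s:{0..\<tau>}. (G has_real_derivative (\<Sum>j<m. a s j k * p j s)) (at s within {0..\<tau>}))) n"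

text \<open>The weight \<open>exp (2 * L * (\<tau> - s))\<close> in \<open>?E\<close> makes each
  integration gain a factor 1/2 on the whole interval, however long. The increments are thus
  dominated by a geometric series and may be summed and differentiated term by term.\<close>

lemma linear_ode:
 fixes a :: "real => nat => nat => real"
 assumes \<tau>: "0 < \<tau>" and a: "!!j k. continuous_on {0..\<tau>} (%s. a s j k)"
 obtains c where "!!k. k < m ==> c k \<tau> = z k"
  "!!s k. s : {0..\<tau>} ==> k < m ==> (c k has_real_derivative (\<Sum>j<m. a s j k * c j s)) (at s within {0..\<tau>})"
proof -
 let ?I = "{0..\<tau>}" and ?p = "picard m \<tau> a z"
 have step: "?p (Suc n) k \<tau> = 0 & (ALL s:?I. (?p (Suc n) k has_real_derivative (\<Sum>j<m. a s j k * ?p n j s)) (at s within ?I))"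
  if c: "!!j. continuous_on ?I (?p n j)" for n k
 proof -
  have "continuous_on ?I (%s. \<Sum>j<m. a s j k * ?p n j s)" by (intro continuous_on_sum continuous_on_mult a c)
  from antiderivative_continuous[OF this] obtain G where
   G: "!!s. s : ?I ==> (G has_real_derivative (\<Sum>j<m. a s j k * ?p n j s)) (at s within ?I)"
   unfolding has_real_derivative_iff_has_vector_derivative by blast
  have G': "((%s. G s - G \<tau>) has_real_derivative (\<Sum>j<m. a s j k * ?p n j s)) (at s within ?I)" if "s : ?I" for s
   using DERIV_diff[OF G[OF that] DERIV_const[of "G \<tau>"]] by simp
  have "EX G. G \<tau> = 0 & (ALL s:?I. (G has_real_derivative (\<Sum>j<m. a s j k * ?p n j s)) (at s within ?I))"
   by (rule exI[of _ "%s. G s - G \<tau>"]) (simp add: G')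
  from someI_ex[OF this] show ?thesis unfolding picard_def by simp
 qed
 have cont: "continuous_on ?I (?p n k)" for n k
 proof (induction n arbitrary: k)
  case (Suc n)
  show ?case by (rule DERIV_continuous_on) (use step[OF Suc, of k] in blast)
 qed (simp add: picard_def)
 note D = step[OF cont, THEN conjunct2, rule_format] and Z = step[OF cont, THEN conjunct1]
 have "EX b. ALL s:?I. \<bar>a s j k\<bar> <= b" for j k
  using compact_imp_bounded[OF compact_continuous_image[OF a compact_Icc]] unfolding bounded_iff by (metis imageI real_norm_def)
 then obtain b where b: "!!s j k. s : ?I ==> \<bar>a s j k\<bar> <= b j k" by metis
 define L where "L = (\<Sum>j<m. \<Sum>k<m. \<bar>b j k\<bar>) + 1"
 have L: "0 < L" unfolding L_def by (intro add_nonneg_pos sum_nonneg) auto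
 define B where "B = (\<Sum>k<m. \<bar>z k\<bar>)"
 have B: "0 <= B" unfolding B_def by (intro sum_nonneg) auto
 let ?E = "%n s. B / 2 ^ n * exp (2 * L * (\<tau> - s))"
 have L_le: "\<bar>\<Sum>j<m. a s j k * x j\<bar> <= L * e" if s: "s : ?I" and k: "k < m" and x: "!!j. j < m ==> \<bar>x j\<bar> <= e" and e: "0 <= e" for s k x e
 proof -
  have "\<bar>\<Sum>j<m. a s j k * x j\<bar> <= (\<Sum>j<m. \<bar>a s j k * x j\<bar>)" by (rule sum_abs)
  also have "... <= (\<Sum>j<m. \<bar>b j k\<bar> * e)"
   using x e unfolding abs_mult by (intro sum_mono mult_mono) (auto intro: order_trans[OF b[OF s] abs_ge_self])
  also have "... = (\<Sum>j<m. \<bar>b j k\<bar>) * e" by (rule sum_distrib_right[symmetric])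
  also have "... <= L * e"
  proof (rule mult_right_mono[OF _ e])
   have "(\<Sum>j<m. \<bar>b j k\<bar>) <= (\<Sum>j<m. \<Sum>k<m. \<bar>b j k\<bar>)"
    using k by (intro sum_mono member_le_sum[of k "{..<m}" "%k. \<bar>b _ k\<bar>"]) auto
   then show "(\<Sum>j<m. \<bar>b j k\<bar>) <= L" by (simp add: L_def)
  qed
  finally show ?thesis .
 qed
 have E: "0 <= ?E n s" for n s using B by simp
 have bound: "\<bar>?p n k s\<bar> <= ?E n s" if "s : ?I" "k < m" for n k s
  using that
 proof (induction n arbitrary: k s)
  case 0
  have "\<bar>z k\<bar> <= B" unfolding B_def using 0(2) by (intro member_le_sum) auto
  also have "... * 1 <= B * exp (2 * L * (\<tau> - s))" using B L 0(1) by (intro mult_left_mono) auto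
  finally show ?case by (simp add: picard_def)
 next
  case (Suc n)
  have DE: "(?E (Suc n) has_real_derivative - (L * ?E n r)) (at r within ?I)" for r
   by (auto intro!: derivative_eq_intros)
  have *: "\<bar>\<Sum>j<m. a r j k * ?p n j r\<bar> <= L * ?E n r" if "r : ?I" for r
   using Suc.IH[OF that] by (intro L_le[OF that Suc.prems(2) _ E])
  have "?p (Suc n) k s - ?E (Suc n) s <= ?p (Suc n) k \<tau> - ?E (Suc n) \<tau>"
  proof (rule DERIV_within_nondecreasing[of 0 \<tau> "%s. ?p (Suc n) k s - ?E (Suc n) s"])
   show "((%s. ?p (Suc n) k s - ?E (Suc n) s) has_real_derivative (\<Sum>j<m. a r j k * ?p n j r) - - (L * ?E n r)) (at r within ?I)"
    if "r : ?I" for r by (rule DERIV_diff[OF D[OF that] DE])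
   show "0 <= (\<Sum>j<m. a r j k * ?p n j r) - - (L * ?E n r)" if "r : ?I" for r using *[OF that] by linarith
  qed (use Suc.prems in auto)
  moreover have "- ?p (Suc n) k s - ?E (Suc n) s <= - ?p (Suc n) k \<tau> - ?E (Suc n) \<tau>"
  proof (rule DERIV_within_nondecreasing[of 0 \<tau> "%s. - ?p (Suc n) k s - ?E (Suc n) s"])
   show "((%s. - ?p (Suc n) k s - ?E (Suc n) s) has_real_derivative - (\<Sum>j<m. a r j k * ?p n j r) - - (L * ?E n r)) (at r within ?I)"
    if "r : ?I" for r by (rule DERIV_diff[OF DERIV_minus[OF D[OF that]] DE])
   show "0 <= - (\<Sum>j<m. a r j k * ?p n j r) - - (L * ?E n r)" if "r : ?I" for r using *[OF that] by linarith
  qed (use Suc.prems in auto)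
  ultimately show ?case using Z[of n k] E[of "Suc n" \<tau>] by linarith
 qed
 define e where "e = B * exp (2 * L * \<tau>)"
 have be: "\<bar>?p n k s\<bar> <= e * (1 / 2) ^ n" if "s : ?I" "k < m" for n k s
 proof -
  have "exp (2 * L * (\<tau> - s)) <= exp (2 * L * \<tau>)" using L that(1) by simp
  from mult_left_mono[OF this, of "B / 2 ^ n"] bound[OF that, of n] B show ?thesis by (simp add: e_def power_divide)
 qed
 have e0: "0 <= e" using B by (simp add: e_def)
 have sp: "summable (%n. ?p n k s)" if "s : ?I" "k < m" for k s
  by (rule summable_comparison_test'[of "%n. e * (1 / 2) ^ n" 0])
   (use be[OF that] in \<open>auto intro!: summable_mult summable_geometric\<close>)
 define c where "c k s = z k + (\<Sum>n. ?p (Suc n) k s)" for k s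
 have cs: "c k s = (\<Sum>n. ?p n k s)" if "s : ?I" "k < m" for k s
  using suminf_split_head[OF sp[OF that]] by (simp add: c_def picard_def)
 show ?thesis
 proof (rule that[of c])
  fix k assume k: "k < m"
  show "c k \<tau> = z k" by (simp add: c_def Z)
  let ?f' = "%n s. \<Sum>j<m. a s j k * ?p n j s"
  have "uniform_limit ?I (%n s. \<Sum>i<n. ?f' i s) (%s. \<Sum>i. ?f' i s) sequentially"
  proof (rule Weierstrass_m_test)
   show "norm (?f' n s) <= L * (e * (1 / 2) ^ n)" if "s : ?I" for n s
    using L_le[OF that k be[OF that]] e0 by simp
   show "summable (%n. L * (e * (1 / 2) ^ n))" by (intro summable_mult summable_geometric) simp
  qed
  from has_field_derivative_series[OF _ D this, of \<tau>]
  have "EX h. ALL s:?I. (%n. ?p (Suc n) k s) sums h s & (h has_real_derivative (\<Sum>i. ?f' i s)) (at s within ?I)"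
   using Z \<tau> by simp
  then obtain h where "ALL s:?I. (%n. ?p (Suc n) k s) sums h s & (h has_real_derivative (\<Sum>i. ?f' i s)) (at s within ?I)" ..
  note h = bspec[OF this]
  fix s assume s: "s : ?I"
  have "((%s. z k + h s) has_real_derivative 0 + (\<Sum>i. ?f' i s)) (at s within ?I)"
   by (intro DERIV_add DERIV_const) (use h[OF s] in blast)
  then have "(c k has_real_derivative 0 + (\<Sum>i. ?f' i s)) (at s within ?I)"
   by (rule DERIV_cong_on[OF s, rotated]) (simp add: c_def sums_unique[OF h[THEN conjunct1], symmetric])
  moreover have "(\<Sum>i. ?f' i s) = (\<Sum>j<m. a s j k * c j s)"
  proof -
   have "(\<Sum>i. ?f' i s) = (\<Sum>j<m. \<Sum>i. a s j k * ?p i j s)"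
    by (rule suminf_sum) (use sp[OF s] in \<open>auto intro: summable_mult\<close>)
   also have "... = (\<Sum>j<m. a s j k * c j s)"
    by (rule sum.cong[OF refl]) (use sp[OF s] cs[OF s] in \<open>simp add: suminf_mult\<close>)
   finally show ?thesis .
  qed
  ultimately show "(c k has_real_derivative (\<Sum>j<m. a s j k * c j s)) (at s within ?I)" by simp
 qed
qed

text \<open>A backward gradient flow of a time dependent quadratic form \<open>q\<close>. The frequency \<open>D / N\<close> is almost
 nondecreasing, which bounds the decay of \<open>N\<close> independently of the dimension \<open>m\<close>.\<close>

locale gradient_flow =
 fixes m :: nat and \<tau> C :: real and a a' :: "real => nat => nat => real" and c :: "nat => real => real"
 assumes \<tau>: "0 < \<tau>" and C: "0 <= C" and a_sym: "s : {0..\<tau>} ==> a s j k = a s k j"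
  and a_deriv: "s : {0..\<tau>} ==> ((%s. a s j k) has_real_derivative a' s j k) (at s within {0..\<tau>})"
  and form: "s : {0..\<tau>} ==> 0 <= (\<Sum>k<m. x k * (\<Sum>j<m. a s j k * x j))"
  and form': "s : {0..\<tau>} ==> - C * (\<Sum>k<m. x k * (\<Sum>j<m. a s j k * x j)) <= (\<Sum>k<m. x k * (\<Sum>j<m. a' s j k * x j))"
  and ode: "s : {0..\<tau>} ==> k < m ==> (c k has_real_derivative (\<Sum>j<m. a s j k * c j s)) (at s within {0..\<tau>})"
begin

definition "c' k s = (\<Sum>j<m. a s j k * c j s)"
definition "N s = (\<Sum>k<m. (c k s)\<^sup>2)"
definition "D s = (\<Sum>k<m. c k s * c' k s)"
definition "V s = (\<Sum>k<m. (c' k s)\<^sup>2)"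
definition "D' s = 2 * V s + (\<Sum>k<m. c k s * (\<Sum>j<m. a' s j k * c j s))"

lemma N_nonneg: "0 <= N s" and V_nonneg: "0 <= V s" by (simp_all add: N_def V_def sum_nonneg)

lemma D_nonneg: "s : {0..\<tau>} ==> 0 <= D s"
 using form[of s "%k. c k s"] by (simp add: D_def c'_def)

lemma D'_ge: "s : {0..\<tau>} ==> 2 * V s - C * D s <= D' s"
 using form'[of s "%k. c k s"] by (simp add: D_def D'_def c'_def)

lemma N_DERIV: "s : {0..\<tau>} ==> (N has_real_derivative 2 * D s) (at s within {0..\<tau>})"
 unfolding N_def[abs_def] D_def sum_distrib_left
 by (intro DERIV_sum) (auto intro!: derivative_eq_intros ode simp: c'_def)

lemma D_DERIV:
 assumes s: "s : {0..\<tau>}"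
 shows "(D has_real_derivative D' s) (at s within {0..\<tau>})"
proof -
 have "(D has_real_derivative (\<Sum>k<m. c' k s * c' k s + (\<Sum>j<m. a' s j k * c j s + c' j s * a s j k) * c k s)) (at s within {0..\<tau>})"
  unfolding D_def[abs_def]
  by (intro DERIV_sum DERIV_mult) (auto intro!: DERIV_sum DERIV_mult a_deriv ode s simp: c'_def[abs_def])
 moreover have "(\<Sum>k<m. c' k s * c' k s + (\<Sum>j<m. a' s j k * c j s + c' j s * a s j k) * c k s) = D' s"
 proof -
  have "(\<Sum>k<m. (\<Sum>j<m. c' j s * a s j k) * c k s) = (\<Sum>j<m. \<Sum>k<m. c' j s * (a s k j * c k s))"
   unfolding sum_distrib_right by (subst sum.swap) (simp add: a_sym[OF s] mult.assoc)
  also have "... = V s" unfolding V_def c'_def[of _ s] by (simp add: sum_distrib_left[symmetric] power2_eq_square)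
  finally show ?thesis
   by (simp add: D'_def sum.distrib distrib_right V_def power2_eq_square mult.commute[of "sum _ _" "c _ s"])
 qed
 ultimately show ?thesis by simp
qed

lemma D_sq: "(D s)\<^sup>2 <= N s * V s"
 unfolding D_def N_def V_def by (rule Cauchy_Schwarz_ineq_sum)

text \<open>By \<open>D'_ge\<close> and V >= 0, the weighted quantity
  \<open>exp (C * s) * D s\<close> is nondecreasing.\<close>

lemma D_le:
 assumes "s : {0..\<tau>}" shows "D s <= exp (C * \<tau>) * D \<tau>"
proof -
 have "exp (C * s) * D s <= exp (C * \<tau>) * D \<tau>"
 proof (rule DERIV_within_nondecreasing[of 0 \<tau> "%s. exp (C * s) * D s"])
  show "((%s. exp (C * s) * D s) has_real_derivative exp (C * r) * C * D r + D' r * exp (C * r)) (at r within {0..\<tau>})"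
   if "r : {0..\<tau>}" for r by (rule DERIV_mult[OF _ D_DERIV[OF that]]) (auto intro!: derivative_eq_intros)
  show "0 <= exp (C * r) * C * D r + D' r * exp (C * r)" if "r : {0..\<tau>}" for r
   using mult_nonneg_nonneg[of "exp (C * r)" "C * D r + D' r"] D'_ge[OF that] V_nonneg[of r] by (simp add: algebra_simps)
 qed (use assms in auto)
 moreover have "1 * D s <= exp (C * s) * D s" using D_nonneg[OF assms] C assms by (intro mult_right_mono) auto
 ultimately show ?thesis by simp
qed

text \<open>Up to the factor exp (C s), the frequency has derivative at least 2 (V N - D^2) / N^2,
  which is nonnegative by Cauchy-Schwarz. Its bound \<open>Q\<close> at the terminal time therefore
  holds earlier, and N' = 2 D <= 2 Q N limits the decay of N towards time 0.\<close>

lemma frequency: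
 assumes N: "0 < N \<tau>" and s: "s : {0..\<tau>}"
 defines "Q == exp (C * \<tau>) * D \<tau> / N \<tau>"
 shows "D s <= Q * N s" "exp (- 2 * Q * \<tau>) * N \<tau> <= N s"
proof -
 have DQ: "D s <= Q * N s" if s: "s : {0..\<tau>}" for s
 proof (rule field_le_epsilon)
  fix e0 :: real assume e0: "0 < e0"
  have Q0: "0 <= Q" unfolding Q_def using N D_nonneg[of \<tau>] \<tau> by (intro divide_nonneg_nonneg mult_nonneg_nonneg) auto
  \<comment> \<open>That N stays positive is part of what is being proved, so the quotient is formed
    with \<open>N s + e\<close>; this value of \<open>e\<close> makes the loss \<open>Q * e\<close>
    at most \<open>e0\<close>.\<close>
  define e where "e = e0 / (Q + 1)"
  have e: "0 < e" "Q * e <= e0" using e0 Q0 by (auto simp: e_def field_simps)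
  have pos: "0 < N r + e" for r using N_nonneg[of r] e by simp
  have "exp (C * s) * D s / (N s + e) <= exp (C * \<tau>) * D \<tau> / (N \<tau> + e)"
  proof (rule DERIV_within_nondecreasing[of 0 \<tau> "%s. exp (C * s) * D s / (N s + e)"])
   fix r assume r: "r : {0..\<tau>}"
   have 1: "((%s. exp (C * s) * D s) has_real_derivative exp (C * r) * C * D r + D' r * exp (C * r)) (at r within {0..\<tau>})"
    by (rule DERIV_mult[OF _ D_DERIV[OF r]]) (auto intro!: derivative_eq_intros)
   have 2: "((%s. N s + e) has_real_derivative 2 * D r) (at r within {0..\<tau>})" using DERIV_add[OF N_DERIV[OF r] DERIV_const[of e]] by simp
   show "((%s. exp (C * s) * D s / (N s + e)) has_real_derivative
    ((exp (C * r) * C * D r + D' r * exp (C * r)) * (N r + e) - exp (C * r) * D r * (2 * D r)) / ((N r + e) * (N r + e))) (at r within {0..\<tau>})"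
    by (rule DERIV_divide[OF 1 2]) (use pos[of r] in simp)
   have "(D r)\<^sup>2 <= V r * (N r + e)" using D_sq[of r] V_nonneg[of r] mult_nonneg_nonneg[OF less_imp_le[OF e(1)] V_nonneg[of r]] by (simp add: algebra_simps)
   also have "2 * V r <= C * D r + D' r" using D'_ge[OF r] by simp
   then have "2 * (V r * (N r + e)) <= (C * D r + D' r) * (N r + e)" using pos[of r] mult_right_mono by fastforce
   finally have "0 <= exp (C * r) * ((C * D r + D' r) * (N r + e) - 2 * (D r)\<^sup>2)" by simp
   then show "0 <= ((exp (C * r) * C * D r + D' r * exp (C * r)) * (N r + e) - exp (C * r) * D r * (2 * D r)) / ((N r + e) * (N r + e))"
    by (intro divide_nonneg_nonneg zero_le_square) (simp add: algebra_simps power2_eq_square)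
  qed (use s in auto)
  also have "... <= Q" unfolding Q_def using N e(1) D_nonneg[of \<tau>] \<tau> by (intro divide_left_mono) auto
  finally have "exp (C * s) * D s <= Q * (N s + e)" using pos[of s] by (simp add: divide_le_eq)
  moreover have "1 * D s <= exp (C * s) * D s" using D_nonneg[OF s] C s by (intro mult_right_mono) auto
  ultimately show "D s <= Q * N s + e0" using e(2) by (simp add: distrib_left)
 qed
 then show "D s <= Q * N s" using s .
 have "- (exp (- 2 * Q * s) * N s) <= - (exp (- 2 * Q * \<tau>) * N \<tau>)"
 proof (rule DERIV_within_nondecreasing[of 0 \<tau> "%s. - (exp (- 2 * Q * s) * N s)"])
  show "((%s. - (exp (- 2 * Q * s) * N s)) has_real_derivative - (exp (- 2 * Q * r) * (- 2 * Q) * N r + 2 * D r * exp (- 2 * Q * r))) (at r within {0..\<tau>})"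
   if "r : {0..\<tau>}" for r
   by (intro DERIV_minus DERIV_mult N_DERIV that) (auto intro!: derivative_eq_intros)
  show "0 <= - (exp (- 2 * Q * r) * (- 2 * Q) * N r + 2 * D r * exp (- 2 * Q * r))" if "r : {0..\<tau>}" for r
   using mult_left_mono[OF DQ[OF that], of "2 * exp (- 2 * Q * r)"] by (simp add: algebra_simps)
 qed (use s in auto)
 moreover have "exp (- 2 * Q * s) * N s <= 1 * N s"
  using s N D_nonneg[of \<tau>] \<tau> N_nonneg[of s] unfolding Q_def by (intro mult_right_mono) auto
 ultimately show "exp (- 2 * Q * \<tau>) * N \<tau> <= N s" by simp
qed

text \<open>V has no pointwise bound independent of the dimension, but 2 V <= D' + C D, so its
  integral is controlled by D at the terminal time. The comparison function
  \<open>\<eta> * (k * s + D s / 2)\<close> integrates the bound on the derivative of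
  \<open>\<psi>\<close>.\<close>

lemma pairing_bound:
 assumes \<psi>: "!!s. s : {\<epsilon>..\<tau>} ==> (\<psi> has_real_derivative \<psi>' s) (at s within {\<epsilon>..\<tau>})"
  and \<psi>': "!!s. s : {\<epsilon>..\<tau>} ==> \<bar>\<psi>' s\<bar> <= \<eta> * (1 + V s + D s)" and \<epsilon>: "0 <= \<epsilon>" "\<epsilon> <= \<tau>" and \<eta>: "0 <= \<eta>"
 shows "\<bar>\<psi> \<epsilon>\<bar> <= \<bar>\<psi> \<tau>\<bar> + \<eta> * ((1 + (1 + C / 2) * (exp (C * \<tau>) * D \<tau>)) * \<tau> + D \<tau> / 2)"
proof -
 define k where "k = 1 + (1 + C / 2) * (exp (C * \<tau>) * D \<tau>)"
 have sub: "{\<epsilon>..\<tau>} \<subseteq> {0..\<tau>}" using \<epsilon> by auto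
 have H: "((%s. \<eta> * (k * s + D s / 2)) has_real_derivative \<eta> * (k + D' s / 2)) (at s within {\<epsilon>..\<tau>})" if "s : {\<epsilon>..\<tau>}" for s
  by (intro DERIV_cmult DERIV_add DERIV_cdivide DERIV_subset[OF D_DERIV sub]) (use that sub in \<open>auto intro!: derivative_eq_intros\<close>)
 have le: "\<bar>\<psi>' s\<bar> <= \<eta> * (k + D' s / 2)" if s: "s : {\<epsilon>..\<tau>}" for s
 proof -
  have s0: "s : {0..\<tau>}" using s sub by blast
  have "(1 + C / 2) * D s <= (1 + C / 2) * (exp (C * \<tau>) * D \<tau>)" using C by (intro mult_left_mono D_le s0) auto
  then have "1 + V s + D s <= k + D' s / 2" using D'_ge[OF s0] by (simp add: k_def algebra_simps)
  then show ?thesis using \<psi>'[OF s] \<eta> mult_left_mono order_trans by blast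
 qed
 have "\<psi> \<epsilon> + \<eta> * (k * \<epsilon> + D \<epsilon> / 2) <= \<psi> \<tau> + \<eta> * (k * \<tau> + D \<tau> / 2)"
  by (rule DERIV_within_nondecreasing[of \<epsilon> \<tau>, OF DERIV_add[OF \<psi> H]]) (use le \<epsilon> in \<open>force simp: abs_le_iff\<close>)+
 moreover have "- \<psi> \<epsilon> + \<eta> * (k * \<epsilon> + D \<epsilon> / 2) <= - \<psi> \<tau> + \<eta> * (k * \<tau> + D \<tau> / 2)"
  by (rule DERIV_within_nondecreasing[of \<epsilon> \<tau>, OF DERIV_add[OF DERIV_minus[OF \<psi>] H]]) (use le \<epsilon> in \<open>force simp: abs_le_iff\<close>)+
 moreover have "0 <= \<eta> * (k * \<epsilon> + D \<epsilon> / 2)"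
  unfolding k_def using \<eta> C \<epsilon> \<tau> D_nonneg[of \<epsilon>] D_nonneg[of \<tau>] by (intro mult_nonneg_nonneg add_nonneg_nonneg) auto
 ultimately show ?thesis unfolding k_def[symmetric] by linarith
qed

end

subsection \<open>Density of the range of the heat semigroup\<close>

context metric_flow
begin

section \<open>The Dirichlet form and orthonormal systems\<close>

definition "energy t a b = (LINT p|mu. Gam t a b p)"

lemma Gam_cmult: "t : {0..T} ==> C1M a ==> C1M b ==> p : M ==> Gam t (%q. k * a q) b p = k * Gam t a b p"
 using Gam_mult[OF _ C1M_const[of k]] Gam_const by simp

lemma energy_sym: "t : {0..T} ==> C1M a ==> C1M b ==> energy t a b = energy t b a"
 unfolding energy_def by (rule LINT_cong[OF refl]) (metis Gam_sym space_mu)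

lemma energy_add: "t : {0..T} ==> C1M a ==> C1M a' ==> C1M b ==> energy t (%q. a q + a' q) b = energy t a b + energy t a' b"
 unfolding energy_def
 by (subst LINT_add[symmetric]) (auto intro!: mu_integrable Gam_continuous LINT_cong Gam_add simp: energy_def)

lemma energy_cmult: "t : {0..T} ==> C1M a ==> C1M b ==> energy t (%q. k * a q) b = k * energy t a b"
 using LINT_cong[OF refl, of mu "Gam t (%q. k * a q) b" "%p. k * Gam t a b p"] Gam_cmult[of t a b]
 unfolding energy_def by simp

lemma energy_sum:
 assumes t: "t : {0..T}" and F: "finite J" "!!i. i : J ==> C1M (F i)" and b: "C1M b"
 shows "energy t (%q. SUM i:J. F i q) b = (SUM i:J. energy t (F i) b)"
proof -
 have "energy t (%q. SUM i:J. F i q) b = (LINT p|mu. (SUM i:J. Gam t (F i) b p))"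
  unfolding energy_def by (rule LINT_cong[OF refl]) (simp add: Gam_sum[OF t F b])
 then show ?thesis unfolding energy_def
  using LINT_sum[of J mu "%i. Gam t (F i) b"] F b t by (simp add: mu_integrable Gam_continuous)
qed

lemma energy_nonneg: "t : {0..T} ==> C1M a ==> 0 <= energy t a a"
 unfolding energy_def by (rule LINT_nonneg) (simp add: Gam_nonneg)

lemma energy_DERIV:
 assumes t: "t : {0..T}" and a: "C1M a" and b: "C1M b"
 shows "((%t. energy t a b) has_real_derivative - (LINT p|mu. Gdot t a b p)) (at t within {0..T})"
 using mu_integral_derivative[OF T_interval(1) t Gam_continuous[OF _ a b] continuous_on_minus[OF Gdot_continuous[OF a b]] Gam_time_deriv_const[OF _ a b]]
 unfolding energy_def by simp

lemma C1M_cmult: "C1M a ==> C1M (%p. k * a p)"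
 by (rule C1M_mult[OF C1M_const])

text \<open>Young's inequality with weight \<open>e\<close>: the smallness of \<open>b\<close>
  becomes a factor in front of a quantity that need not be small. \<open>energy_bound\<close> is the
  same for the Dirichlet form.\<close>

lemma product_bound:
 fixes a b :: "'a => real"
 assumes a: "continuous_on M a" and b: "continuous_on M b" and e: "0 < e" and be: "(LINT p|mu. (b p)\<^sup>2) <= e\<^sup>2"
 shows "\<bar>\<integral>p. a p * b p \<partial>mu\<bar> <= e * (LINT p|mu. (a p)\<^sup>2) / 2 + e / 2"
proof -
 have "\<bar>\<integral>p. a p * b p \<partial>mu\<bar> <= (LINT p|mu. \<bar>a p * b p\<bar>)" by (rule integral_abs_bound)
 also have "... <= (LINT p|mu. e / 2 * (a p)\<^sup>2 + 1 / (2 * e) * (b p)\<^sup>2)"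
 proof (rule integral_mono)
  show "integrable mu (%p. \<bar>a p * b p\<bar>)" "integrable mu (%p. e / 2 * (a p)\<^sup>2 + 1 / (2 * e) * (b p)\<^sup>2)"
   using e by (auto intro!: mu_integrable continuous_intros a b)
  show "\<bar>a p * b p\<bar> <= e / 2 * (a p)\<^sup>2 + 1 / (2 * e) * (b p)\<^sup>2" for p
  proof -
   have "0 <= (e * \<bar>a p\<bar> - \<bar>b p\<bar>)\<^sup>2" by simp
   then have "2 * e * \<bar>a p * b p\<bar> <= e\<^sup>2 * (a p)\<^sup>2 + (b p)\<^sup>2" by (simp add: power2_eq_square algebra_simps abs_mult)
   then show ?thesis using e by (simp add: field_simps power2_eq_square)
  qed
 qed
 also have "... = e / 2 * (LINT p|mu. (a p)\<^sup>2) + 1 / (2 * e) * (LINT p|mu. (b p)\<^sup>2)"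
  using e by (subst LINT_add) (auto intro!: mu_integrable continuous_intros a b)
 also have "... <= e / 2 * (LINT p|mu. (a p)\<^sup>2) + 1 / (2 * e) * e\<^sup>2"
  using e be by (intro add_left_mono mult_left_mono) auto
 finally show ?thesis using e by (simp add: power2_eq_square)
qed

lemma energy_bound:
 assumes t: "t : {0..T}" and a: "C1M a" and b: "C1M b" and e: "0 < e" and be: "energy t b b <= e\<^sup>2"
 shows "\<bar>energy t a b\<bar> <= e * energy t a a / 2 + e / 2"
proof -
 have *: "energy t (%q. k * a q + b q) (%q. k * a q + b q) = k\<^sup>2 * energy t a a + 2 * k * energy t a b + energy t b b" for k
 proof -
  note ka = C1M_cmult[OF a, of k]
  note kab = C1M_add[OF ka b]
  have "energy t a (%q. k * a q + b q) = k * energy t a a + energy t a b"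
   unfolding energy_sym[OF t a kab] energy_add[OF t ka b a] energy_cmult[OF t a a] energy_sym[OF t b a] ..
  moreover have "energy t b (%q. k * a q + b q) = k * energy t a b + energy t b b"
   unfolding energy_sym[OF t b kab] energy_add[OF t ka b b] energy_cmult[OF t a b] ..
  ultimately show ?thesis unfolding energy_add[OF t ka b kab] energy_cmult[OF t a kab]
   by (simp add: power2_eq_square algebra_simps)
 qed
 have nn: "0 <= k\<^sup>2 * energy t a a + 2 * k * energy t a b + energy t b b" for k
  unfolding *[symmetric] by (intro energy_nonneg t C1M_add C1M_cmult a b)
 have "2 * e * \<bar>energy t a b\<bar> <= e\<^sup>2 * energy t a a + energy t b b" using nn[of e] nn[of "- e"] by (auto simp: abs_if)
 also have "... <= 2 * e * (e * energy t a a / 2 + e / 2)" using be by (simp add: power2_eq_square algebra_simps)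
 finally show ?thesis using e by simp
qed

definition orthonormal :: "nat => (nat => 'a => real) => bool" where
 "orthonormal m e \<longleftrightarrow> (ALL k. C1M (e k)) & (ALL j<m. ALL k<m. (LINT p|mu. e j p * e k p) = of_bool (j = k))"

lemma inner_sum:
 fixes F :: "'a => real"
 assumes F: "continuous_on M F" and e: "!!k. C1M (e k)"
 shows "(LINT p|mu. F p * (\<Sum>k<m. x k * e k p)) = (\<Sum>k<m. x k * (LINT p|mu. F p * e k p))"
proof -
 have "(LINT p|mu. F p * (\<Sum>k<m. x k * e k p)) = (LINT p|mu. (\<Sum>k<m. x k * (F p * e k p)))"
  by (rule LINT_cong[OF refl]) (simp add: sum_distrib_left mult.left_commute)
 also have "... = (\<Sum>k<m. \<integral>p. x k * (F p * e k p) \<partial>mu)"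
  by (rule LINT_sum) (intro mu_integrable continuous_on_mult continuous_on_const F C1M_continuous e)
 finally show ?thesis by simp
qed

lemma C1M_lincomb: "(!!k. C1M (e k)) ==> C1M (%p. \<Sum>k<m. x k * e k p)" for m :: nat
 by (intro C1M_sum C1M_cmult)

lemma orthonormal_coeff:
 assumes e: "orthonormal m e" and k: "k < m"
 shows "(LINT p|mu. (\<Sum>j<m. x j * e j p) * e k p) = x k"
proof -
 have eC: "!!k. C1M (e k)" using e by (simp add: orthonormal_def)
 have "(LINT p|mu. (\<Sum>j<m. x j * e j p) * e k p) = (\<Sum>j<m. x j * (LINT p|mu. e k p * e j p))"
  using inner_sum[OF C1M_continuous[OF eC[of k]] eC, where m=m and x=x] by (simp add: mult.commute)
 also have "... = (\<Sum>j<m. if j = k then x j else 0)" using e k by (intro sum.cong) (auto simp: orthonormal_def)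
 finally show ?thesis using k by simp
qed

text \<open>Only finitely many functions are ever needed, so dependent ones are simply skipped; the
  span is meant pointwise on \<open>M\<close>, so that values and gradients can be substituted
  exactly.\<close>

lemma gram_schmidt:
 assumes "finite F" "!!f. f : F ==> C1M f"
 shows "EX m e. orthonormal m e & (ALL f:F. EX x. ALL p:M. f p = (\<Sum>k<m. x k * e k p))"
 using assms
proof (induction F rule: finite_induct)
 case empty
 show ?case by (intro exI[of _ 0] exI[of _ "%_ _. 0"]) (simp add: orthonormal_def C1M_const)
next
 case (insert f F)
 then obtain m e where e: "orthonormal m e" and F: "ALL f:F. EX x. ALL p:M. f p = (\<Sum>k<m. x k * e k p)" by auto
 have eC: "!!k. C1M (e k)" using e by (simp add: orthonormal_def)
 have f: "C1M f" using insert.prems by simp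
 define x where "x k = (LINT p|mu. f p * e k p)" for k
 define r where "r p = f p - (\<Sum>k<m. x k * e k p)" for p
 have r: "C1M r" unfolding r_def by (intro C1M_diff2 f C1M_lincomb eC)
 note rc = C1M_continuous[OF r]
 have re: "(LINT p|mu. r p * e k p) = 0" if "k < m" for k
 proof -
  have "(LINT p|mu. r p * e k p) = (LINT p|mu. f p * e k p - (\<Sum>j<m. x j * e j p) * e k p)"
   by (simp add: r_def left_diff_distrib)
  also have "... = (LINT p|mu. f p * e k p) - (LINT p|mu. (\<Sum>j<m. x j * e j p) * e k p)"
   by (intro LINT_diff mu_integrable continuous_on_mult C1M_continuous f eC C1M_lincomb)
  finally show ?thesis using orthonormal_coeff[OF e that] by (simp add: x_def)
 qed
 \<comment> \<open>If the remainder has norm zero it vanishes at every point, by continuity, and the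
   system already spans \<open>f\<close>. Otherwise it is normalised and becomes element
   \<open>m\<close>.\<close>
 let ?n = "\<integral>p. r p * r p \<partial>mu"
 show ?case
 proof (cases "?n = 0")
  case True
  have "f p = (\<Sum>k<m. x k * e k p)" if "p : M" for p
   using mu_zero[OF continuous_on_mult[OF rc rc] _ True that] by (simp add: r_def)
  then show ?thesis using e F by (intro exI[of _ m] exI[of _ e]) auto
 next
  case False
  have "0 <= ?n" by (rule LINT_nonneg) simp
  then have n: "0 < ?n" using False by (intro le_neq_trans) auto
  define e' where "e' = e(m := %p. 1 / sqrt ?n * r p)"
  have "orthonormal (Suc m) e'"
   unfolding orthonormal_def
  proof (intro conjI allI impI)
   show "C1M (e' k)" for k unfolding e'_def fun_upd_def using eC[of k] C1M_cmult[OF r, of "1 / sqrt ?n"]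
    by (cases "k = m") (simp_all only: simp_thms if_True if_False)
   fix j k assume "j < Suc m" "k < Suc m"
   moreover have "(LINT p|mu. (1 / sqrt ?n * r p) * (1 / sqrt ?n * r p)) = 1"
   proof -
    have "(LINT p|mu. (1 / sqrt ?n * r p) * (1 / sqrt ?n * r p)) = (LINT p|mu. 1 / ?n * (r p * r p))"
     using n by (intro LINT_cong refl) (simp add: field_simps)
    then show ?thesis using n by simp
   qed
   moreover have "(LINT p|mu. (1 / sqrt ?n * r p) * e k p) = 0" "(LINT p|mu. e k p * (1 / sqrt ?n * r p)) = 0" if "k < m" for k
    using re[OF that] by (simp_all add: mult.commute)
   ultimately show "(LINT p|mu. e' j p * e' k p) = of_bool (j = k)"
    using e unfolding orthonormal_def e'_def by (cases "j = m"; cases "k = m") simp_all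
  qed
  moreover have e'_sum: "(\<Sum>k<Suc m. (y(m := b)) k * e' k p) = (\<Sum>k<m. y k * e k p) + b * (1 / sqrt ?n * r p)" for y b p
   by (simp add: e'_def)
  have "EX y. ALL p:M. h p = (\<Sum>k<Suc m. y k * e' k p)" if "h : insert f F" for h
  proof (cases "h = f")
   case True
   have "ALL p:M. h p = (\<Sum>k<Suc m. (x(m := sqrt ?n)) k * e' k p)"
    unfolding e'_sum using n True by (simp add: r_def)
   then show ?thesis by (rule exI[of _ "x(m := sqrt ?n)"])
  next
   case False
   then obtain y where y: "ALL p:M. h p = (\<Sum>k<m. y k * e k p)" using F \<open>h : insert f F\<close> by blast
   have "ALL p:M. h p = (\<Sum>k<Suc m. (y(m := 0)) k * e' k p)" unfolding e'_sum using y by simp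
   then show ?thesis by (rule exI[of _ "y(m := 0)"])
  qed
  ultimately show ?thesis by blast
 qed
qed

end

context heat_flow
begin

text \<open>The squared distance between \<open>u s\<close> and \<open>u r\<close>, in L^2 and in
  energy at time \<open>s\<close>, is continuous in \<open>s\<close> and zero at
  \<open>s = r\<close>; its sublevel sets cover the compact interval. The interval must stay away
  from 0, where the solution is merely continuous.\<close>

lemma sampling:
 assumes \<epsilon>: "0 < \<epsilon>" "\<tau> <= T" and \<eta>: "0 < \<eta>"
 shows "EX S. finite S & S \<subseteq> {\<epsilon>..\<tau>} & (ALL s:{\<epsilon>..\<tau>}. EX r:S. (LINT p|mu. (u s p - u r p)\<^sup>2) <= \<eta>\<^sup>2 &
  energy s (%p. u s p - u r p) (%p. u s p - u r p) <= \<eta>\<^sup>2)"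
proof -
 have sub: "s : I" if "s : {\<epsilon>..\<tau>}" for s using that \<epsilon> by simp
 define F where "F r s = (LINT p|mu. (u s p - u r p) * (u s p - u r p) + Gam s (%p. u s p - u r p) (%p. u s p - u r p) p)" for r s
 have F_cont: "continuous_on {\<epsilon>..\<tau>} (F r)" if r: "r : {\<epsilon>..\<tau>}" for r
 proof -
  have "smooth_functions A I (%t. u r)"
   unfolding smooth_functions_iff
  proof
   fix c assume "c : A"
   then show "smooth_on (I \<times> chart_image c) (%q. coord c (u r) (snd q))"
    using smooth_on_affine[OF bounded_linear_snd SM_chart[OF SM_u[OF sub[OF r]]], of c "I \<times> chart_image c" 0] by auto
  qed
  then have d: "smooth_functions A I (%s p. u s p - u r p)" by (rule smooth_functions_diff[OF u_smooth])
  have "continuous_on I (F r)"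
   unfolding F_def
   by (intro mu_integral_continuous smooth_functions_continuous smooth_functions_add smooth_functions_mult smooth_functions_Gam T_interval(2) d)
  then show ?thesis by (rule continuous_on_subset) (use sub in blast)
 qed
 have C: "C1M (%p. u s p - u r p)" if "s : {\<epsilon>..\<tau>}" "r : {\<epsilon>..\<tau>}" for s r
  using that sub by (intro C1M_diff2 SM_C1M SM_u) auto
 have split: "F r s = (LINT p|mu. (u s p - u r p)\<^sup>2) + energy s (%p. u s p - u r p) (%p. u s p - u r p)"
  if "s : {\<epsilon>..\<tau>}" "r : {\<epsilon>..\<tau>}" for s r
 proof -
  note d = C[OF that]
  note dc = C1M_continuous[OF d]
  show ?thesis
   unfolding F_def energy_def power2_eq_square
   by (rule LINT_add[OF mu_integrable[OF continuous_on_mult[OF dc dc]]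
     mu_integrable[OF Gam_continuous[OF I_subset[OF sub[OF that(1)]] d d]]])
 qed
 have "ALL r:{\<epsilon>..\<tau>}. EX O'. open O' & {\<epsilon>..\<tau>} \<inter> F r -` {..<\<eta>\<^sup>2} = {\<epsilon>..\<tau>} \<inter> O'"
 proof
  fix r assume "r : {\<epsilon>..\<tau>}"
  from continuous_openin_preimage_gen[OF F_cont[OF this], of "{..<\<eta>\<^sup>2}"]
  show "EX O'. open O' & {\<epsilon>..\<tau>} \<inter> F r -` {..<\<eta>\<^sup>2} = {\<epsilon>..\<tau>} \<inter> O'" by (simp add: openin_open)
 qed
 from bchoice[OF this] obtain O' where O': "ALL r:{\<epsilon>..\<tau>}. open (O' r) & {\<epsilon>..\<tau>} \<inter> F r -` {..<\<eta>\<^sup>2} = {\<epsilon>..\<tau>} \<inter> O' r" ..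
 have rO: "r : O' r" if r: "r : {\<epsilon>..\<tau>}" for r
 proof -
  have "F r r = 0" unfolding F_def
   by (subst LINT_cong[OF refl, of _ _ "%_. 0"]) (auto simp: Gam_const[OF I_subset[OF sub[OF r]]])
  then have "r : {\<epsilon>..\<tau>} \<inter> F r -` {..<\<eta>\<^sup>2}" using r \<eta> by simp
  then show ?thesis using O' r by blast
 qed
 obtain S where S: "S \<subseteq> {\<epsilon>..\<tau>}" "finite S" "{\<epsilon>..\<tau>} \<subseteq> (UN r:S. O' r)"
  by (rule compactE_image[OF compact_Icc, of "{\<epsilon>..\<tau>}" O']) (use O' rO in auto)
 show ?thesis
 proof (intro exI[of _ S] conjI S(2,1) ballI)
  fix s assume s: "s : {\<epsilon>..\<tau>}"
  then obtain r where r: "r : S" "s : O' r" using S(3) by blast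
  then have r': "r : {\<epsilon>..\<tau>}" using S(1) by blast
  have "s : {\<epsilon>..\<tau>} \<inter> F r -` {..<\<eta>\<^sup>2}" using O' r r' s by blast
  then have "F r s <= \<eta>\<^sup>2" by simp
  moreover have "0 <= (LINT p|mu. (u s p - u r p)\<^sup>2)" by (rule LINT_nonneg) simp
  ultimately have "(LINT p|mu. (u s p - u r p)\<^sup>2) <= \<eta>\<^sup>2 & energy s (%p. u s p - u r p) (%p. u s p - u r p) <= \<eta>\<^sup>2"
   unfolding split[OF s r'] using energy_nonneg[OF I_subset[OF sub[OF s]] C[OF s r']] by linarith
  then show "EX r:S. (LINT p|mu. (u s p - u r p)\<^sup>2) <= \<eta>\<^sup>2 & energy s (%p. u s p - u r p) (%p. u s p - u r p) <= \<eta>\<^sup>2"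
   using r(1) by blast
 qed
qed

end

section \<open>Galerkin approximation of the backward heat flow\<close>

text \<open>The ODE is the weak form of v' = - L v restricted to the span of the first
  \<open>m\<close> functions: the inner product of v' with an element of the span is the energy of v
  with that element (\<open>v_weak\<close>).\<close>

locale galerkin = metric_flow M A T g \<phi>
 for M :: "'a::t2_space set" and A :: "('a, 'n::finite) chart set" and T g \<phi> +
 fixes m :: nat and e :: "nat => 'a => real" and \<tau> C :: real and c :: "nat => real => real"
 assumes e: "orthonormal m e" and \<tau>: "0 < \<tau>" "\<tau> <= T" and C0: "0 <= C"
  and Gdot_le: "!!s a p. s : {0..T} ==> C1M a ==> p : M ==> \<bar>Gdot s a a p\<bar> <= C * Gam s a a p"
  and ode: "!!s k. s : {0..\<tau>} ==> k < m ==> (c k has_real_derivative (\<Sum>j<m. energy s (e j) (e k) * c j s)) (at s within {0..\<tau>})"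
begin

abbreviation "lin x == %p. \<Sum>k<m. x k * e k p"

lemma eC: "C1M (e k)" using e by (simp add: orthonormal_def)

lemma linC: "C1M (lin x)" by (rule C1M_lincomb[OF eC])

lemma inner_lin:
 assumes "C1M F" shows "(LINT p|mu. F p * lin x p) = (\<Sum>k<m. x k * (LINT p|mu. F p * e k p))"
 by (rule inner_sum[OF C1M_continuous[OF assms] eC])

lemma inner_lin_lin: "(LINT p|mu. lin x p * lin y p) = (\<Sum>k<m. y k * x k)"
 unfolding inner_lin[OF linC] by (rule sum.cong[OF refl]) (simp add: orthonormal_coeff[OF e])

lemma energy_lin:
 assumes t: "t : {0..T}" and b: "C1M b" shows "energy t (lin x) b = (\<Sum>j<m. energy t (e j) b * x j)"
 unfolding energy_sum[OF t finite_lessThan C1M_cmult[OF eC] b] energy_cmult[OF t eC b] by (simp add: mult.commute)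

lemma energy_lin_lin:
 assumes t: "t : {0..T}" shows "energy t (lin y) (lin x) = (\<Sum>k<m. x k * (\<Sum>j<m. energy t (e j) (e k) * y j))"
proof -
 have "energy t (lin y) (lin x) = energy t (lin x) (lin y)" by (rule energy_sym[OF t linC linC])
 also have "... = (\<Sum>k<m. energy t (lin y) (e k) * x k)"
  unfolding energy_lin[OF t linC] by (rule sum.cong[OF refl]) (simp add: energy_sym[OF t eC linC])
 finally show ?thesis by (simp add: energy_lin[OF t eC] mult.commute)
qed

sublocale flow: gradient_flow m \<tau> C "%s j k. energy s (e j) (e k)" "%s j k. - (LINT p|mu. Gdot s (e j) (e k) p)" c
proof
 show "0 < \<tau>" "0 <= C" by (fact \<tau>(1) C0)+
 fix s assume s: "s : {0..\<tau>}"
 have sub: "{0..\<tau>} \<subseteq> {0..T}" using \<tau>(2) by auto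
 then have s': "s : {0..T}" using s by blast
 show "energy s (e j) (e k) = energy s (e k) (e j)" for j k by (rule energy_sym[OF s' eC eC])
 show "((%s. energy s (e j) (e k)) has_real_derivative - (LINT p|mu. Gdot s (e j) (e k) p)) (at s within {0..\<tau>})" for j k
  by (rule DERIV_subset[OF energy_DERIV[OF s' eC eC] sub])
 show "0 <= (\<Sum>k<m. x k * (\<Sum>j<m. energy s (e j) (e k) * x j))" for x
  using energy_nonneg[OF s' linC[of x]] by (simp add: energy_lin_lin[OF s'])
 show "(c k has_real_derivative (\<Sum>j<m. energy s (e j) (e k) * c j s)) (at s within {0..\<tau>})" if "k < m" for k by (rule ode[OF s that])
 show "- C * (\<Sum>k<m. x k * (\<Sum>j<m. energy s (e j) (e k) * x j)) <= (\<Sum>k<m. x k * (\<Sum>j<m. - (LINT p|mu. Gdot s (e j) (e k) p) * x j))" for x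
 proof -
  \<comment> \<open>The derivative is computed twice, through the matrix entries and for the fixed
    function \<open>lin x\<close>. Uniqueness identifies the matrix of derivatives with
    \<open>Gdot\<close> on \<open>lin x\<close>, to which \<open>Gdot_le\<close> applies.\<close>
  have "((%s. \<Sum>k<m. x k * (\<Sum>j<m. energy s (e j) (e k) * x j)) has_real_derivative
   (\<Sum>k<m. x k * (\<Sum>j<m. - (LINT p|mu. Gdot s (e j) (e k) p) * x j))) (at s within {0..T})"
   by (intro DERIV_sum DERIV_cmult DERIV_cmult_right energy_DERIV s' eC)
  then have "((%s. energy s (lin x) (lin x)) has_real_derivative (\<Sum>k<m. x k * (\<Sum>j<m. - (LINT p|mu. Gdot s (e j) (e k) p) * x j))) (at s within {0..T})"
   by (rule DERIV_cong_on[OF s', rotated]) (rule energy_lin_lin)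
  from time_deriv_DERIV[OF s' this] have eq: "(\<Sum>k<m. x k * (\<Sum>j<m. - (LINT p|mu. Gdot s (e j) (e k) p) * x j)) = - (LINT p|mu. Gdot s (lin x) (lin x) p)"
   unfolding time_deriv_DERIV[OF s' energy_DERIV[OF s' linC linC]] by (rule sym)
  have "(LINT p|mu. Gdot s (lin x) (lin x) p) <= (LINT p|mu. C * Gam s (lin x) (lin x) p)"
  proof (rule integral_mono)
   show "integrable mu (Gdot s (lin x) (lin x))" by (rule mu_integrable[OF spacetime_slice[OF Gdot_continuous[OF linC linC] s']])
   show "integrable mu (%p. C * Gam s (lin x) (lin x) p)" by (intro mu_integrable continuous_on_mult continuous_on_const Gam_continuous s' linC)
   show "Gdot s (lin x) (lin x) p <= C * Gam s (lin x) (lin x) p" if "p : space mu" for p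
    using Gdot_le[OF s' linC[of x], of p] that by simp
  qed
  then show ?thesis unfolding eq energy_lin_lin[OF s', symmetric] by (simp add: energy_def)
 qed
qed

abbreviation "v s == lin (%k. c k s)"

lemma N_eq: "flow.N s = (LINT p|mu. (v s p)\<^sup>2)"
 using inner_lin_lin[of "%k. c k s" "%k. c k s"] by (simp add: flow.N_def power2_eq_square)

lemma V_eq: "flow.V s = (LINT p|mu. (lin (%k. flow.c' k s) p)\<^sup>2)"
 using inner_lin_lin[of "%k. flow.c' k s" "%k. flow.c' k s"] by (simp add: flow.V_def power2_eq_square)

lemma D_eq: "s : {0..T} ==> flow.D s = energy s (v s) (v s)"
 by (simp add: flow.D_def flow.c'_def energy_lin_lin)

lemma v_weak: "s : {0..T} ==> (LINT p|mu. lin (%k. flow.c' k s) p * lin x p) = energy s (v s) (lin x)"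
 by (simp add: inner_lin_lin energy_lin_lin flow.c'_def)

text \<open>A forward solution lying in the span would have constant pairing with the backward flow.
  The solution itself is not in the span, but it is close to a sample that is, so the derivative of
  the pairing is small relative to V and D.\<close>

lemma pairing:
 assumes h: "heat_flow M A T g \<phi> f u" and \<epsilon>: "0 < \<epsilon>" "\<epsilon> <= \<tau>" and \<eta>: "0 < \<eta>"
  and S: "!!s. s : {\<epsilon>..\<tau>} ==> EX r:S. (LINT p|mu. (u s p - u r p)\<^sup>2) <= \<eta>\<^sup>2 & energy s (%p. u s p - u r p) (%p. u s p - u r p) <= \<eta>\<^sup>2"
  and span: "!!r. r : S ==> r : {0<..T} & (EX x. ALL p:M. u r p = lin x p)"
 shows "\<bar>\<integral>p. u \<epsilon> p * v \<epsilon> p \<partial>mu\<bar> <= \<bar>\<integral>p. u \<tau> p * v \<tau> p \<partial>mu\<bar>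
  + \<eta> * ((1 + (1 + C / 2) * (exp (C * \<tau>) * flow.D \<tau>)) * \<tau> + flow.D \<tau> / 2)"
proof (rule flow.pairing_bound[where \<psi>' = "%s. (LINT p|mu. lin (%k. flow.c' k s) p * u s p) - energy s (v s) (u s)"])
 interpret h: heat_flow M A T g \<phi> f u by (rule h)
 show "0 <= \<epsilon>" "\<epsilon> <= \<tau>" "0 <= \<eta>" using \<epsilon> \<eta> by simp_all
 fix s assume s: "s : {\<epsilon>..\<tau>}"
 have sI: "s : {0<..T}" and s0: "s : {0..\<tau>}" and s': "s : {0..T}" using s \<epsilon> \<tau> by auto
 have us: "SM (u s)" by (rule h.SM_u[OF sI])
 note uC = SM_C1M[OF us]
 have sub: "{\<epsilon>..\<tau>} \<subseteq> {0..T}" "{\<epsilon>..\<tau>} \<subseteq> {0..\<tau>}" using \<epsilon> \<tau> by auto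
 have D: "((%s. \<integral>p. u s p * e k p \<partial>mu) has_real_derivative (LINT p|mu. Lap s (u s) p * e k p)) (at s within {\<epsilon>..\<tau>})" for k
 proof (rule DERIV_subset[OF mu_integral_derivative[OF T_interval(2) sI] sub(1)])
  show "continuous_on M (%p. u s p * e k p)" if "s : {0<..T}" for s
   by (intro continuous_on_mult C1M_continuous eC SM_C1M h.SM_u that)
  have "continuous_on ({0<..T} \<times> M) (%q. e k (snd q))"
   by (rule continuous_on_compose2[OF C1M_continuous[OF eC] continuous_on_snd[OF continuous_on_id]]) auto
  then show "continuous_on ({0<..T} \<times> M) (%q. Lap (fst q) (u (fst q)) (snd q) * e k (snd q))"
   by (intro continuous_on_mult smooth_functions_continuous[OF h.Lap_u_smooth])
  show "((%s. u s p * e k p) has_real_derivative Lap s (u s) p * e k p) (at s within {0..T})" if "s : {0<..T}" "p : M" for s p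
   by (rule DERIV_cmult_right[OF h.u_deriv[OF that]])
 qed
 have eq: "(\<Sum>k<m. c k s * (LINT p|mu. Lap s (u s) p * e k p) + flow.c' k s * (LINT p|mu. u s p * e k p)) =
  (LINT p|mu. lin (%k. flow.c' k s) p * u s p) - energy s (v s) (u s)"
 proof -
  have "energy s (v s) (u s) = - (LINT p|mu. Lap s (u s) p * v s p)"
   unfolding energy_def integration_by_parts[OF s' linC us] by (simp add: mult.commute)
  then show ?thesis
   using inner_lin[OF uC, of "%k. flow.c' k s"] inner_lin[OF SM_C1M[OF SM_Lap[OF s' us]], of "%k. c k s"]
   by (simp add: sum.distrib mult.commute[of "lin _ _"])
 qed
 have "((%s. \<Sum>k<m. c k s * (LINT p|mu. u s p * e k p)) has_real_derivative
  (\<Sum>k<m. c k s * (LINT p|mu. Lap s (u s) p * e k p) + flow.c' k s * (LINT p|mu. u s p * e k p))) (at s within {\<epsilon>..\<tau>})"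
  unfolding flow.c'_def
  by (intro DERIV_sum DERIV_mult' D DERIV_subset[OF ode[OF s0] sub(2)]) simp
 then show "((%s. \<integral>p. u s p * v s p \<partial>mu) has_real_derivative (LINT p|mu. lin (%k. flow.c' k s) p * u s p) - energy s (v s) (u s)) (at s within {\<epsilon>..\<tau>})"
  unfolding eq by (rule DERIV_cong_on[OF s, rotated]) (rule inner_lin, rule SM_C1M, rule h.SM_u, use \<epsilon> \<tau> in simp)
 obtain r where r: "r : S" and r1: "(LINT p|mu. (u s p - u r p)\<^sup>2) <= \<eta>\<^sup>2" and r2: "energy s (%p. u s p - u r p) (%p. u s p - u r p) <= \<eta>\<^sup>2"
  using S[OF s] by blast
 obtain x where rI: "r : {0<..T}" and x: "ALL p:M. u r p = lin x p" using span[OF r] by blast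
 \<comment> \<open>The sample \<open>u r\<close> is an element of the span, where the weak equation
   for \<open>v\<close> is exact; it cancels from the derivative and only the difference
   \<open>d\<close> remains.\<close>
 define d where "d p = u s p - u r p" for p
 have urC: "C1M (u r)" by (rule SM_C1M[OF h.SM_u[OF rI]])
 have dC: "C1M d" unfolding d_def by (intro C1M_diff2 uC urC)
 have vl: "(LINT p|mu. lin (%k. flow.c' k s) p * u r p) = energy s (v s) (u r)"
 proof -
  have "(LINT p|mu. lin (%k. flow.c' k s) p * u r p) = (LINT p|mu. lin (%k. flow.c' k s) p * lin x p)"
   by (rule LINT_cong[OF refl]) (use x in simp)
  also have "... = energy s (v s) (lin x)" by (rule v_weak[OF s'])
  also have "... = energy s (v s) (u r)"
   unfolding energy_def
   by (rule LINT_cong[OF refl]) (simp add: x Gam_cong[OF refl _ s', of "lin x" "u r"])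
  finally show ?thesis .
 qed
 have du: "u s = (%p. d p + u r p)" by (simp add: d_def)
 have "energy s (v s) (u s) = energy s (v s) d + energy s (v s) (u r)"
  unfolding energy_sym[OF s' linC uC] unfolding du energy_add[OF s' dC urC linC] energy_sym[OF s' dC linC] energy_sym[OF s' urC linC] ..
 moreover have "(LINT p|mu. lin (%k. flow.c' k s) p * u s p) =
  (LINT p|mu. lin (%k. flow.c' k s) p * d p) + (LINT p|mu. lin (%k. flow.c' k s) p * u r p)"
  unfolding du distrib_left
  by (intro LINT_add mu_integrable continuous_on_mult C1M_continuous linC dC urC)
 ultimately have "(LINT p|mu. lin (%k. flow.c' k s) p * u s p) - energy s (v s) (u s) = (LINT p|mu. lin (%k. flow.c' k s) p * d p) - energy s (v s) d"
  using vl by simp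
 moreover have "\<bar>\<integral>p. lin (%k. flow.c' k s) p * d p \<partial>mu\<bar> <= \<eta> * flow.V s / 2 + \<eta> / 2"
  unfolding V_eq by (rule product_bound[OF C1M_continuous[OF linC] C1M_continuous[OF dC] \<eta>]) (use r1 in \<open>simp add: d_def\<close>)
 moreover have "\<bar>energy s (v s) d\<bar> <= \<eta> * flow.D s / 2 + \<eta> / 2"
  unfolding D_eq[OF s'] by (rule energy_bound[OF s' linC dC \<eta>]) (use r2 in \<open>simp add: d_def[abs_def]\<close>)
 moreover have "\<eta> * flow.V s / 2 + \<eta> / 2 + (\<eta> * flow.D s / 2 + \<eta> / 2) <= \<eta> * (1 + flow.V s + flow.D s)"
  using mult_nonneg_nonneg[OF less_imp_le[OF \<eta>] flow.V_nonneg[of s]] mult_nonneg_nonneg[OF less_imp_le[OF \<eta>] flow.D_nonneg[OF s0]]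
  by (simp add: algebra_simps)
 ultimately show "\<bar>(LINT p|mu. lin (%k. flow.c' k s) p * u s p) - energy s (v s) (u s)\<bar> <= \<eta> * (1 + flow.V s + flow.D s)"
  by linarith
qed

end

context metric_flow
begin

text \<open>Suppose z is not zero and let v be the Galerkin flow ending in z. At a small time the
  frequency bound says that v has norm at least \<open>N0\<close> and energy at most Q times its
  norm, while orthogonality makes its pairings with all detecting f tiny. \<open>detection\<close>
  excludes this. The constants are fixed in the order Q, d, X, \<zeta>, \<epsilon>, \<eta>, and the
  Galerkin space comes last, so none of them depends on its dimension.\<close>

theorem heat_range_dense:
 assumes heat: "!!f. admissible f ==> heat_flow M A T g \<phi> f (u f)" and \<tau>: "\<tau> : {0<..T}" and z: "C1M z"
  and orth: "!!f. admissible f ==> (LINT q|mu. u f \<tau> q * z q) = 0" and p: "p : M"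
 shows "z p = 0"
proof (rule ccontr)
 assume "z p ~= 0"
 have \<tau>': "0 < \<tau>" "\<tau> <= T" "\<tau> : {0..T}" "\<tau> : {0..\<tau>}" using \<tau> by auto
 note zc = C1M_continuous[OF z]
 let ?N = "\<integral>q. z q * z q \<partial>mu" and ?D = "energy \<tau> z z"
 have N: "0 < ?N"
 proof (rule le_neq_trans)
  show "0 <= ?N" by (rule LINT_nonneg) simp
  show "0 ~= ?N"
  proof
   assume "0 = ?N"
   then have "z p * z p = 0" by (intro mu_zero[OF continuous_on_mult[OF zc zc] _ _ p]) simp_all
   then show False using \<open>z p ~= 0\<close> by simp
  qed
 qed
 have D: "0 <= ?D" by (rule energy_nonneg[OF \<tau>'(3) z])
 obtain C where C: "0 <= C" "!!s a p. s : {0..T} ==> C1M a ==> p : M ==> \<bar>Gdot s a a p\<bar> <= C * Gam s a a p"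
  by (rule Gdot_bound) (rule that, assumption+)
 define Q where "Q = exp (C * \<tau>) * ?D / ?N"
 have Q: "0 <= Q" using D N by (simp add: Q_def)
 \<comment> \<open>Chosen with \<open>d * Q <= 1 / 2\<close>, so that the energy term of the
   detection estimate is absorbed by the norm.\<close>
 define d where "d = 1 / (2 * Q + 1)"
 have d: "0 < d" "d * Q <= 1 / 2" using Q by (auto simp: d_def field_simps)
 obtain X B where X: "finite X" "0 <= B" "!!f. f : X ==> admissible f"
  and detect: "!!w s. C1M w ==> s : {0..T} ==>
   (LINT q|mu. (w q)\<^sup>2) <= d * (LINT q|mu. Gam s w w q) + B * (SUM f:X. (LINT q|mu. f q * w q)\<^sup>2)"
  by (rule detection[OF d(1)]) (rule that, assumption+)
 define N0 where "N0 = exp (- 2 * Q * \<tau>) * ?N"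
 have N0: "0 < N0" using N by (simp add: N0_def)
 \<comment> \<open>All pairings with functions of \<open>X\<close> will be at most 2 \<zeta>: one
   \<zeta> from the drift of the pairing between \<epsilon> and \<tau>, one from replacing f by the
   solution at time \<epsilon>. With this value the pairing term of the estimate is below
   \<open>N0 / 2\<close>.\<close>
 define \<zeta> where "\<zeta> = sqrt (N0 / (16 * (B * real (card X) + 1)))"
 have Bn: "0 <= B * real (card X)" using X(2) by simp
 have \<zeta>: "0 < \<zeta>" "(2 * \<zeta>)\<^sup>2 = N0 / (4 * (B * real (card X) + 1))"
 proof -
  show "0 < \<zeta>" using N0 Bn by (simp add: \<zeta>_def)
  have "\<zeta>\<^sup>2 = N0 / (16 * (B * real (card X) + 1))" using N0 Bn unfolding \<zeta>_def by (intro real_sqrt_pow2) simp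
  moreover have "2\<^sup>2 * (N0 / (16 * y)) = N0 / (4 * y)" for y :: real by simp
  ultimately show "(2 * \<zeta>)\<^sup>2 = N0 / (4 * (B * real (card X) + 1))" unfolding power_mult_distrib by (simp only:)
 qed
 have \<zeta>3: "B * (real (card X) * (2 * \<zeta>)\<^sup>2) < N0 / 2"
 proof -
  have "B * real (card X) * N0 < 2 * (B * real (card X) + 1) * N0" using N0 Bn by (intro mult_strict_right_mono) auto
  then show ?thesis unfolding \<zeta>(2) using Bn by (simp add: field_simps)
 qed
 let ?m = "measure mu M"
 \<comment> \<open>Uniform distance allowed between f and the solution at time \<epsilon>; since |v|
   <= 1 + v^2, the integrated error is at most \<theta> times total mass plus squared norm, and the
   latter does not exceed \<open>?N\<close>.\<close>
 define \<theta> where "\<theta> = \<zeta> / (?m + ?N)"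
 have mN: "0 < ?m + ?N" using N by (simp add: add_nonneg_pos)
 have \<theta>: "0 < \<theta>" "\<theta> * (?m + ?N) = \<zeta>" using \<zeta>(1) mN by (simp_all add: \<theta>_def)
 have "ALL f:X. EX r>0. ALL s:{0..T}. s < r --> (ALL q:M. \<bar>u f s q - f q\<bar> <= \<theta>)"
 proof
  fix f assume f: "f : X"
  interpret h: heat_flow M A T g \<phi> f "u f" by (rule heat[OF X(3)[OF f]])
  obtain r where r: "0 < r" "!!s q. s : {0..T} ==> \<bar>s - 0\<bar> < r ==> q : M ==> \<bar>u f s q - u f 0 q\<bar> <= \<theta>"
   by (rule spacetime_uniform[OF h.u_continuous zero_time \<theta>(1)]) (rule that, assumption+)
  then show "EX r>0. ALL s:{0..T}. s < r --> (ALL q:M. \<bar>u f s q - f q\<bar> <= \<theta>)"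
   by (intro exI[of _ r]) (simp add: h.u_0)
 qed
 from bchoice[OF this] obtain r where r: "ALL f:X. 0 < r f & (ALL s:{0..T}. s < r f --> (ALL q:M. \<bar>u f s q - f q\<bar> <= \<theta>))" ..
 \<comment> \<open>A positive time below \<tau> at which all the finitely many solutions are still
   within \<theta> of their initial values.\<close>
 define \<epsilon> where "\<epsilon> = Min (insert \<tau> (r ` X)) / 2"
 have mp: "0 < Min (insert \<tau> (r ` X))" using X(1) r \<tau>'(1) by (subst Min_gr_iff) auto
 have ml: "Min (insert \<tau> (r ` X)) <= y" if "y : insert \<tau> (r ` X)" for y using X(1) that by (intro Min_le) auto
 have \<epsilon>: "0 < \<epsilon>" "\<epsilon> <= \<tau>" "!!f. f : X ==> \<epsilon> < r f" "\<epsilon> : {0..T}" "\<epsilon> : {0..\<tau>}"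
  using mp ml[of \<tau>] ml[of "r _"] \<tau>' unfolding \<epsilon>_def by force+
 define k where "k = (1 + (1 + C / 2) * (exp (C * \<tau>) * ?D)) * \<tau> + ?D / 2"
 have k: "0 <= k" unfolding k_def using C(1) D \<tau>'(1) by (intro add_nonneg_nonneg mult_nonneg_nonneg) auto
 \<comment> \<open>\<open>k\<close> is the factor in \<open>pairing_bound\<close>; it involves only
   the energy of z and the constant of \<open>Gdot_bound\<close>, so the accuracy of the samples can
   be fixed before the space they span.\<close>
 define \<eta> where "\<eta> = \<zeta> / (k + 1)"
 have \<eta>: "0 < \<eta>" "\<eta> * k <= \<zeta>" using \<zeta>(1) k by (auto simp: \<eta>_def field_simps)
 define sam where "sam f S \<longleftrightarrow> finite S & S \<subseteq> {\<epsilon>..\<tau>} & (ALL s:{\<epsilon>..\<tau>}. EX r:S. (LINT p|mu. (u f s p - u f r p)\<^sup>2) <= \<eta>\<^sup>2 &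
  energy s (%p. u f s p - u f r p) (%p. u f s p - u f r p) <= \<eta>\<^sup>2)" for f S
 have "ALL f:X. EX S. sam f S"
 proof
  fix f assume f: "f : X"
  show "EX S. sam f S"
   unfolding sam_def by (rule heat_flow.sampling[OF heat[OF X(3)[OF f]] \<epsilon>(1) \<tau>'(2) \<eta>(1)])
 qed
 from bchoice[OF this] obtain S where S: "ALL f:X. sam f (S f)" ..
 have SI: "s : {0<..T}" if "f : X" "s : S f" for f s
  using S that \<epsilon>(1) \<tau>'(2) unfolding sam_def by fastforce
 \<comment> \<open>The span contains z itself, so that the flow ends in z exactly and the
   orthogonality can be used at time \<tau>, and all samples of the detecting solutions.\<close>
 define F where "F = insert z (UN f:X. u f ` S f)"
 have "finite F" unfolding F_def using X(1) S by (simp add: sam_def)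
 moreover have "C1M a" if "a : F" for a
  using that z SM_C1M[OF heat_flow.SM_u[OF heat[OF X(3)] SI]] unfolding F_def by blast
 ultimately obtain m e where e: "orthonormal m e" and span: "ALL a:F. EX x. ALL q:M. a q = (\<Sum>k<m. x k * e k q)"
  using gram_schmidt by blast
 have eC: "!!k. C1M (e k)" using e by (simp add: orthonormal_def)
 obtain x where x: "ALL q:M. z q = (\<Sum>k<m. x k * e k q)" using span by (auto simp: F_def)
 have ac: "continuous_on {0..\<tau>} (%s. energy s (e j) (e k))" for j k
  by (rule continuous_on_subset[OF DERIV_continuous_on[OF energy_DERIV[OF _ eC eC]]]) (use \<tau>'(2) in auto)
 obtain c where c: "!!k. k < m ==> c k \<tau> = x k"
  "!!s k. s : {0..\<tau>} ==> k < m ==> (c k has_real_derivative (\<Sum>j<m. energy s (e j) (e k) * c j s)) (at s within {0..\<tau>})"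
  by (rule linear_ode[where z=x and m=m, OF \<tau>'(1) ac]) (rule that, assumption+)
 interpret G: galerkin M A T g \<phi> m e \<tau> C c by unfold_locales (fact e \<tau>'(1,2) C c(2))+
 have v\<tau>: "G.v \<tau> q = z q" if "q : M" for q using x that c(1) by simp
 have N\<tau>: "G.flow.N \<tau> = ?N" unfolding G.N_eq
  by (rule LINT_cong[OF refl]) (use v\<tau> in \<open>simp add: power2_eq_square\<close>)
 have "energy \<tau> (G.v \<tau>) (G.v \<tau>) = ?D" unfolding energy_def
  by (rule LINT_cong[OF refl], rule Gam_cong[OF v\<tau> v\<tau> \<tau>'(3)]) simp_all
 then have D\<tau>: "G.flow.D \<tau> = ?D" unfolding G.D_eq[OF \<tau>'(3)] .
 note fr = G.flow.frequency[unfolded N\<tau> D\<tau> Q_def[symmetric], OF N \<epsilon>(5)]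
 note vC = G.linC[of "%k. c k \<epsilon>"]
 note vc = C1M_continuous[OF vC]
 have NN: "G.flow.N \<epsilon> <= ?N"
  unfolding N\<tau>[symmetric] by (rule DERIV_within_nondecreasing[OF G.flow.N_DERIV]) (use G.flow.D_nonneg \<epsilon> in auto)
 have pair: "(LINT q|mu. f q * G.v \<epsilon> q)\<^sup>2 <= (2 * \<zeta>)\<^sup>2" if f: "f : X" for f
 proof -
  interpret h: heat_flow M A T g \<phi> f "u f" by (rule heat[OF X(3)[OF f]])
  have fc: "continuous_on M f" using X(3)[OF f] by (simp add: pos_continuous_def)
  have uc: "continuous_on M (u f \<epsilon>)" by (rule spacetime_slice[OF h.u_continuous \<epsilon>(4)])
  have "\<bar>\<integral>p. u f \<epsilon> p * G.v \<epsilon> p \<partial>mu\<bar> <= \<bar>\<integral>p. u f \<tau> p * G.v \<tau> p \<partial>mu\<bar> + \<eta> * k"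
   unfolding k_def D\<tau>[symmetric]
  proof (rule G.pairing[OF heat[OF X(3)[OF f]] \<epsilon>(1,2) \<eta>(1)])
   show "EX r:S f. (LINT p|mu. (u f s p - u f r p)\<^sup>2) <= \<eta>\<^sup>2 & energy s (%p. u f s p - u f r p) (%p. u f s p - u f r p) <= \<eta>\<^sup>2"
    if "s : {\<epsilon>..\<tau>}" for s using S f that unfolding sam_def by blast
   show "r : {0<..T} & (EX x. ALL p:M. u f r p = G.lin x p)" if "r : S f" for r
    using SI[OF f that] span f that unfolding F_def by blast
  qed
  moreover have "(LINT p|mu. u f \<tau> p * G.v \<tau> p) = 0"
   unfolding orth[OF X(3)[OF f], symmetric] by (rule LINT_cong[OF refl]) (use v\<tau> in simp)
  ultimately have 1: "\<bar>\<integral>p. u f \<epsilon> p * G.v \<epsilon> p \<partial>mu\<bar> <= \<zeta>" using \<eta>(2) by linarith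
  have "\<bar>\<integral>q. (f q - u f \<epsilon> q) * G.v \<epsilon> q \<partial>mu\<bar> <= (LINT q|mu. \<bar>(f q - u f \<epsilon> q) * G.v \<epsilon> q\<bar>)" by (rule integral_abs_bound)
  also have "... <= (LINT q|mu. \<theta> * (1 + (G.v \<epsilon> q)\<^sup>2))"
  proof (rule integral_mono)
   show "integrable mu (%q. \<bar>(f q - u f \<epsilon> q) * G.v \<epsilon> q\<bar>)" "integrable mu (%q. \<theta> * (1 + (G.v \<epsilon> q)\<^sup>2))"
    by (rule mu_integrable, intro continuous_on_rabs continuous_on_mult continuous_on_diff continuous_on_add continuous_on_const continuous_on_power fc uc vc)+
   fix q assume "q : space mu"
   then have "\<bar>u f \<epsilon> q - f q\<bar> <= \<theta>" using r f \<epsilon>(3)[OF f] \<epsilon>(4) by simp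
   moreover have "\<bar>y\<bar> <= 1 + y\<^sup>2" for y :: real
    using zero_le_power2[of "\<bar>y\<bar> - 1"] by (simp add: power2_eq_square algebra_simps)
   ultimately show "\<bar>(f q - u f \<epsilon> q) * G.v \<epsilon> q\<bar> <= \<theta> * (1 + (G.v \<epsilon> q)\<^sup>2)"
    unfolding abs_mult using \<theta>(1) by (intro mult_mono) (simp_all add: abs_minus_commute)
  qed
  also have "... = \<theta> * (?m + G.flow.N \<epsilon>)"
  proof -
   interpret finite_measure mu by (rule mu_finite)
   have "(LINT q|mu. 1 + (G.v \<epsilon> q)\<^sup>2) = (LINT q|mu. 1) + (LINT q|mu. (G.v \<epsilon> q)\<^sup>2)"
    by (intro LINT_add mu_integrable continuous_on_const continuous_on_power vc)
   then show ?thesis by (simp add: G.N_eq)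
  qed
  also have "... <= \<zeta>" unfolding \<theta>(2)[symmetric] using \<theta>(1) NN by (intro mult_left_mono) auto
  finally have 2: "\<bar>\<integral>q. (f q - u f \<epsilon> q) * G.v \<epsilon> q \<partial>mu\<bar> <= \<zeta>" .
  have "(LINT q|mu. f q * G.v \<epsilon> q) = (LINT q|mu. u f \<epsilon> q * G.v \<epsilon> q + (f q - u f \<epsilon> q) * G.v \<epsilon> q)"
   by (simp add: left_diff_distrib)
  also have "... = (LINT q|mu. u f \<epsilon> q * G.v \<epsilon> q) + (LINT q|mu. (f q - u f \<epsilon> q) * G.v \<epsilon> q)"
   by (intro LINT_add mu_integrable continuous_on_mult continuous_on_diff fc uc vc)
  finally have "\<bar>\<integral>q. f q * G.v \<epsilon> q \<partial>mu\<bar> <= 2 * \<zeta>" using 1 2 by linarith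
  then show ?thesis using power_mono[of "\<bar>\<integral>q. f q * G.v \<epsilon> q \<partial>mu\<bar>" "2 * \<zeta>" 2] by simp
 qed
 \<comment> \<open>Detection at time \<epsilon>: half of the norm absorbs the energy term and the
   pairings give less than \<open>N0 / 2\<close>, contradicting the lower bound \<open>N0\<close>
   from the frequency.\<close>
 have "G.flow.N \<epsilon> <= d * G.flow.D \<epsilon> + B * (SUM f:X. (LINT q|mu. f q * G.v \<epsilon> q)\<^sup>2)"
  using detect[OF vC \<epsilon>(4), folded energy_def] unfolding G.N_eq G.D_eq[OF \<epsilon>(4)] .
 also have "... <= d * (Q * G.flow.N \<epsilon>) + B * (real (card X) * (2 * \<zeta>)\<^sup>2)"
  using d(1) X(2) fr(1) by (intro add_mono mult_left_mono sum_bounded_above pair) auto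
 also have "d * (Q * G.flow.N \<epsilon>) <= 1 / 2 * G.flow.N \<epsilon>"
  using mult_right_mono[OF d(2) G.flow.N_nonneg[of \<epsilon>]] by (simp add: mult.assoc)
 finally have "G.flow.N \<epsilon> < N0" using \<zeta>3 by linarith
 then show False using fr(2) by (simp add: N0_def)
qed

end

subsection \<open>Rigidity\<close>

text \<open>Otherwise moving from \<open>y\<close> along \<open>v\<close> would change the form
  linearly, and a suitable multiple \<open>k\<close> would make it equal to -1.\<close>

lemma psd_null:
 fixes S :: "real^'n^'n"
 assumes psd: "!!y. 0 <= bil S y y" and sym: "transpose S = S" and v: "bil S v v = 0"
 shows "bil S v y = 0"
proof (rule ccontr)
 assume b: "bil S v y ~= 0"
 have s: "bil S y v = bil S v y" unfolding bil_def
  by (metis dot_lmul_matrix inner_commute sym transpose_matrix_vector)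
 have e: "bil S (y + k *\<^sub>R v) (y + k *\<^sub>R v) = bil S y y + 2 * k * bil S v y" for k
  using s v by (simp add: bil_def matrix_vector_right_distrib matrix_vector_mult_scaleR inner_add_left inner_add_right)
 define k where "k = - (bil S y y + 1) / (2 * bil S v y)"
 have "2 * k * bil S v y = - (bil S y y + 1)" using b by (simp add: k_def)
 then show False using psd[of "y + k *\<^sub>R v"] unfolding e by linarith
qed

context metric_flow
begin

lemma Sm_nth: "Sm K t c x $ i $ j = metric_deriv T g t c x $ i $ j / 2 + (SU k. riemann (g t c) x k j k i)
  + hessian (g t c) (coord c (\<phi> t)) x $ i $ j - K * g t c x $ i $ j"
 by (simp add: Sm_def ricci_L_def ricci_def)

lemma Sm_spacetime:
 assumes c: "c : A"
 shows "smooth_on ({0..T} \<times> chart_image c) (%q. Sm K (fst q) c (snd q) $ i $ j)"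
proof -
 note I = T_interval(1)
 have phi: "smooth_on ({0..T} \<times> chart_image c) (%q. coord c (\<phi> (fst q)) (snd q))"
  using phi_smooth c unfolding smooth_functions_iff by blast
 note PD = spacetime_pderiv[OF I open_chart_image[OF c] christoffel_spacetime[OF I c]]
 show ?thesis
  unfolding Sm_nth riemann_def
  by (intro smooth_on_divide smooth_on_intros metric_deriv_spacetime hessian_spacetime[OF I] g_spacetime[OF I] christoffel_spacetime[OF I] PD phi c) simp
qed

lemma Sm_smooth:
 assumes "t : {0..T}" "c : A" shows "smooth_on (chart_image c) (%x. Sm K t c x $ i $ j)"
 by (rule smooth_on_slice[of "{0..T}" _ "%t x. Sm K t c x $ i $ j"])
  (use Sm_spacetime[OF assms(2)] assms(1) in \<open>simp_all add: case_prod_unfold\<close>)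

lemma Sm_sym:
 assumes t: "t : {0..T}" and c: "c : A" and x: "x : chart_image c"
 shows "transpose (Sm K t c x) = Sm K t c x"
proof -
 note L = local_metric_g[OF t c]
 have G: "g s c x $ i $ j = g s c x $ j $ i" if "s : {0..T}" for s i j
  using local_metric.G_symD[OF local_metric_g[OF that c] x] by simp
 have "metric_deriv T g t c x $ i $ j = metric_deriv T g t c x $ j $ i" for i j
  using time_deriv_DERIV[OF t g_comp_time_deriv[OF t c x, of i j]]
   time_deriv_DERIV[OF t DERIV_cong_on[OF t G g_comp_time_deriv[OF t c x, of j i]]] by simp
 then have "Sm K t c x $ i $ j = Sm K t c x $ j $ i" for i j
  using G[OF t] local_metric.ricci_sym[OF L x] local_metric.hessian_sym[OF L x phi_chart_smooth[OF t c]]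
  by (simp add: Sm_def ricci_L_def)
 then show ?thesis by (simp add: vec_eq_iff Finite_Cartesian_Product.transpose_def)
qed

text \<open>The pointwise equality only says that the form vanishes on the gradient of log u.
  Semidefiniteness upgrades it to a kernel condition, and scaling by u replaces log u by u, after
  which the condition is linear in the solution.\<close>

lemma Sm_gradient:
 assumes S: "super_Perelman_Ricci_flow A T K g \<phi>" and t: "t : {0..T}" and u: "SM u" and pos: "!!p. p : M ==> 0 < u p"
  and eq: "!!p. p : M ==> W_integrand A T K g \<phi> t (%q. ln (u q)) p = hessian_norm2 A (g t) (%q. ln (u q)) p"
  and c: "c : A" and x: "x : chart_image c"
 shows "bil (Sm K t c x) (gradient (g t c) (coord c u) x) y = 0"
proof -
 note L = local_metric_g[OF t c]
 let ?p = "chart_inv c x" and ?w = "%q. ln (u q)"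
 let ?v = "gradient (g t c) (coord c ?w) x"
 have p: "?p : fst c" "snd c ?p = x" "?p : M" using chart_inv_in[OF c x] snd_chart_inv[OF c x] chart_inv_M[OF c x] by auto
 have "bil (Sm K t c x) ?v ?v = 0"
  using W_integrand_Sm[OF t SM_ln[OF u pos] c p(1), of K] eq[OF p(3)] by (simp add: p(2))
 then have 0: "bil (Sm K t c x) ?v y = 0" by (rule psd_null[OF Sm_nonneg[OF S t c x] Sm_sym[OF t c x]])
 have "pderiv_coord i (coord c ?w) x = inverse (coord c u x) * pderiv_coord i (coord c u) x" for i
  unfolding coord_arith
  by (rule pderiv_compose[OF C1M_diff[OF SM_C1M[OF u] c x] DERIV_ln]) (simp add: coord_def pos[OF p(3)])
 then have "?v = inverse (coord c u x) *\<^sub>R gradient (g t c) (coord c u) x"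
  by (simp add: vec_eq_iff local_metric.gradient_nth[OF L] sum_distrib_left mult.left_commute)
 with 0 show ?thesis using pos[OF p(3)] by (simp add: bil_def coord_def)
qed

text \<open>The vector field \<open>\<rho> g\<^sup>-\<^sup>1 S \<nabla>h\<close>; its divergence is the function tested against the heat semigroup.\<close>

definition flux :: "real => real => ('a, 'n) chart => (real^'n => real) => 'n => real^'n => real" where
 "flux K t c h i x = r0 c x * (SU j. matrix_inv (g t c x) $ i $ j * (SU k. Sm K t c x $ j $ k *
  (SU l. matrix_inv (g t c x) $ k $ l * pderiv_coord l h x)))"

lemma flux_bil:
 assumes t: "t : {0..T}" and c: "c : A" and x: "x : chart_image c"
 shows "(SU i. pderiv_coord i F x * flux K t c h i x) = r0 c x * bil (Sm K t c x) (gradient (g t c) F x) (gradient (g t c) h x)"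
proof -
 note L = local_metric_g[OF t c]
 have f: "flux K t c h i x = r0 c x * (SU j. matrix_inv (g t c x) $ i $ j * (Sm K t c x *v gradient (g t c) h x) $ j)" for i
  by (simp add: flux_def matrix_vector_mult_def local_metric.gradient_nth[OF L])
 have "(SU i. pderiv_coord i F x * flux K t c h i x) =
  r0 c x * (SU j. (SU i. matrix_inv (g t c x) $ j $ i * pderiv_coord i F x) * (Sm K t c x *v gradient (g t c) h x) $ j)"
  unfolding f sum_distrib_left sum_distrib_right
  by (subst sum.swap) (simp add: local_metric.gi_sym[OF L x, of _ _] mult.assoc mult.left_commute)
 then show ?thesis by (simp add: bil_def inner_vec_def local_metric.gradient_nth[OF L])
qed

lemma flux_Ck:
 assumes t: "t : {0..T}" and c: "c : A" and h: "Ck_on (Suc k) (chart_image c) h"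
 shows "Ck_on k (chart_image c) (flux K t c h i)"
 unfolding flux_def[abs_def]
 by (intro Ck_on_mult Ck_on_sum Ck_on_pderiv[OF open_chart_image[OF c] h] smooth_on_Ck[OF rho_smooth[OF zero_time c]]
   smooth_on_Ck[OF Sm_smooth[OF t c]] smooth_on_Ck[OF local_metric.gi_smooth[OF local_metric_g[OF t c]]])

text \<open>The divergence theorem for \<open>F\<close> times the flux. It is used twice: with
  \<open>F\<close> a heat solution the second summand vanishes, and with \<open>F = h\<close> the
  first does.\<close>

lemma flux_test:
 assumes t: "t : {0..T}" and c: "c : A" and h: "Ck_on 2 (chart_image c) h" and K: "compact Z" "Z \<subseteq> chart_image c"
  and zero: "!!i x. x : chart_image c ==> x ~: Z ==> flux K t c h i x = 0" and F: "Ck_on 1 (chart_image c) F"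
 shows "(LINT x|lborel. indicator (chart_image c) x * (F x * (SU i. pderiv_coord i (flux K t c h i) x)
  + r0 c x * bil (Sm K t c x) (gradient (g t c) F x) (gradient (g t c) h x))) = 0"
proof -
 let ?U = "chart_image c"
 note oU = open_chart_image[OF c]
 have f: "Ck_on 1 ?U (flux K t c h i)" for i
  by (rule flux_Ck[OF t c]) (use h in \<open>simp only: numeral_2_eq_2 One_nat_def\<close>)
 have "(LINT x|lborel. indicator ?U x * (SU i. pderiv_coord i (%y. F y * flux K t c h i y) x)) = 0"
  by (rule divergence_zero[OF oU K Ck_on_mult[OF F f]]) (simp add: zero)
 moreover have "(SU i. pderiv_coord i (%y. F y * flux K t c h i y) x) = F x * (SU i. pderiv_coord i (flux K t c h i) x)
  + r0 c x * bil (Sm K t c x) (gradient (g t c) F x) (gradient (g t c) h x)" if x: "x : ?U" for x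
 proof -
  have "F differentiable (at x)" "flux K t c h i differentiable (at x)" for i using Ck1_iff[OF oU] F f x by blast+
  then show ?thesis unfolding flux_bil[OF t c x, symmetric] by (simp add: pderiv_mult sum.distrib sum_distrib_left)
 qed
 ultimately show ?thesis
  by (subst LINT_cong[OF refl]) (auto simp: indicator_def)
qed

text \<open>For fixed compactly supported \<open>h\<close> the weighted divergence \<open>q\<close>
  of the flux is orthogonal to every solution at time \<open>t\<close>, hence zero by density.
  Testing the flux with \<open>h\<close> itself then leaves a continuous nonnegative integrand of
  integral zero, so the form vanishes on the gradient of \<open>h\<close> at \<open>x0\<close>,
  which can be any direction.\<close>

lemma Sm_zero:
 assumes S: "super_Perelman_Ricci_flow A T K g \<phi>" and heat: "!!f. admissible f ==> heat_flow M A T g \<phi> f (u f)"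
  and eq: "!!f p. admissible f ==> p : M ==> W_integrand A T K g \<phi> t (%q. ln (u f t q)) p = hessian_norm2 A (g t) (%q. ln (u f t q)) p"
  and t: "t : {0<..T}" and c: "c : A" and x0: "x0 : chart_image c"
 shows "Sm K t c x0 = 0"
proof -
 let ?U = "chart_image c"
 have t': "t : {0..T}" using t by simp
 note L = local_metric_g[OF t' c] and oU = open_chart_image[OF c]
 obtain r where r: "0 < r" "cball x0 r \<subseteq> ?U" using oU x0 open_contains_cball by blast
 let ?Z = "cball x0 r"
 have yy: "bil (Sm K t c x0) y y = 0" for y
 proof -
  \<comment> \<open>Lowering the index of \<open>y\<close> makes the gradient of \<open>h\<close> at
    \<open>x0\<close> a multiple of \<open>y\<close>.\<close>
  define \<xi> where "\<xi> = g t c x0 *v y"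
  \<comment> \<open>The fourth truncated power is C^3: the flux costs one derivative and its
    divergence another, and \<open>heat_range_dense\<close> asks for a C^1 function. At the centre
    its value is r^8.\<close>
  define a where "a x = max 0 (r\<^sup>2 - (x - x0) \<bullet> (x - x0)) ^ 4" for x
  define h where "h x = a x * (\<xi> \<bullet> (x - x0))" for x
  have lin: "Ck_on k UNIV (%x :: real^'n. x - x0)" for k by (intro Ck_on_diff Ck_on_bounded_linear Ck_on_const bounded_linear_ident)
  have in1: "Ck_on k UNIV (%x. \<xi> \<bullet> (x - x0))" for k
   by (rule Ck_on_bounded_linear_compose[OF bounded_linear_inner_right lin])
  have sq: "Ck_on k UNIV (%x. r\<^sup>2 - (x - x0) \<bullet> (x - x0))" for k
   unfolding inner_vec_def
   by (intro Ck_on_diff Ck_on_const Ck_on_sum) (simp, intro Ck_on_mult Ck_on_diff Ck_on_const Ck_on_bounded_linear[OF bounded_linear_vec_nth])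
  have aC: "Ck_on 3 UNIV a" unfolding a_def using Ck_on_max_zero_power[OF sq, of 3] by (simp add: eval_nat_numeral del: Ck_on.simps power_Suc)
  have hC: "Ck_on 3 UNIV h" unfolding h_def by (rule Ck_on_mult[OF aC in1])
  have hU: "Ck_on k ?U h" if "k <= 3" for k by (rule Ck_on_mono[OF Ck_on_subset[OF hC subset_UNIV] that])
  have a0: "a x = 0" if "x ~: ?Z" for x
  proof -
   have "r\<^sup>2 < (norm (x - x0))\<^sup>2" using that r(1) by (intro power_strict_mono) (auto simp: dist_norm norm_minus_commute)
   then show ?thesis by (simp add: a_def power2_norm_eq_inner)
  qed
  have PD0: "pderiv_coord i h x = 0" if "x ~: ?Z" for i x
   using pderiv_cong[of "- ?Z" x h "%_. 0" i] that a0 by (simp add: h_def closed_cball open_Compl)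
  have f0: "flux K t c h i x = 0" if "x ~: ?Z" for i x using PD0[OF that] by (simp add: flux_def)
  \<comment> \<open>Dividing by the density makes \<open>q\<close> a function whose pairing with
    respect to \<open>mu\<close> is the Lebesgue integral against the divergence.\<close>
  define q where "q x = (SU i. pderiv_coord i (flux K t c h i) x) / r0 c x" for x
  have r0p: "0 < r0 c x" if "x : ?U" for x by (rule rho_pos[OF zero_time c that])
  have qC: "Ck_on 1 ?U q"
   unfolding q_def
  proof (intro Ck_on_divide Ck_on_sum Ck_on_pderiv[OF oU] flux_Ck[OF t' c] smooth_on_Ck[OF rho_smooth[OF zero_time c]])
   show "Ck_on (Suc (Suc 1)) ?U h" by (rule hU) simp
   show "r0 c x ~= 0" if "x : ?U" for x using r0p[OF that] by simp
  qed
  have q0: "q x = 0" if "x ~: ?Z" for x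
   using pderiv_cong[of "- ?Z" x "flux K t c h _" "%_. 0"] that f0 by (simp add: q_def closed_cball open_Compl)
  note qc = Ck_on_imp_continuous_on[OF qC]
  have z: "C1M (lift c q)" unfolding lift_def[abs_def] by (rule bump_C1M[OF c compact_cball r(2) qC]) (rule q0)
  have "lift c q p = 0" if "p : M" for p
  proof (rule heat_range_dense[OF heat t z _ that])
   fix f assume f: "admissible f"
   interpret h: heat_flow M A T g \<phi> f "u f" by (rule heat[OF f])
   have uS: "SM (u f t)" by (rule h.SM_u[OF t])
   have 0: "bil (Sm K t c x) (gradient (g t c) (coord c (u f t)) x) v = 0" if "x : ?U" for x v
    by (rule Sm_gradient[OF S t' uS _ eq[OF f] c that]) (rule h.u_pos[OF t'])
   have "(LINT p|mu. u f t p * lift c q p) = (LINT p|mu. lift c q p * u f t p)" by (simp add: mult.commute)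
   also have "... = (LINT x|lborel. indicator ?Z x * (r0 c x * (q x * coord c (u f t) x)))"
    by (rule lift_integral[OF c compact_cball r(2) qc _ C1M_continuous[OF SM_C1M[OF uS]]]) (rule q0)
   also have "... = (LINT x|lborel. indicator ?U x * (coord c (u f t) x * (SU i. pderiv_coord i (flux K t c h i) x)
    + r0 c x * bil (Sm K t c x) (gradient (g t c) (coord c (u f t)) x) (gradient (g t c) h x)))"
   proof (rule LINT_cong[OF refl])
    fix x
    show "indicator ?Z x * (r0 c x * (q x * coord c (u f t) x)) = indicator ?U x * (coord c (u f t) x * (SU i. pderiv_coord i (flux K t c h i) x)
     + r0 c x * bil (Sm K t c x) (gradient (g t c) (coord c (u f t)) x) (gradient (g t c) h x))"
    proof (cases "x : ?U")
     case True
     have "(SU i. pderiv_coord i (flux K t c h i) x) = r0 c x * q x" using r0p[OF True] by (simp add: q_def)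
     then show ?thesis using True 0[OF True] q0[of x] by (cases "x : ?Z") (simp_all add: mult.commute)
    next
     case False
     then have "x ~: ?Z" using r(2) by blast
     then show ?thesis using False by simp
    qed
   qed
   also have "... = 0"
    by (rule flux_test[OF t' c hU compact_cball r(2) f0]) (use C1M_chart[OF SM_C1M[OF uS] c] in \<open>simp_all only: One_nat_def numeral_2_eq_2, simp_all\<close>)
   finally show "(LINT p|mu. u f t p * lift c q p) = 0" .
  qed
  then have "q x = 0" if "x : ?U" for x
   using chart_inv_M[OF c that] chart_inv_in[OF c that] snd_chart_inv[OF c that] by (simp add: lift_def) metis
  then have div0: "(SU i. pderiv_coord i (flux K t c h i) x) = 0" if "x : ?U" for x
   using r0p[OF that] that by (force simp: q_def)
  let ?B = "%x. r0 c x * bil (Sm K t c x) (gradient (g t c) h x) (gradient (g t c) h x)"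
  have B0: "?B x = 0" if "x ~: ?Z" for x
  proof -
   have "(\<chi> i. pderiv_coord i h x) = 0" using PD0[OF that] by (simp add: vec_eq_iff)
   then show ?thesis by (simp add: gradient_def bil_def)
  qed
  have Bc: "continuous_on ?U ?B"
  proof (rule continuous_on_eq)
   show "continuous_on ?U (%x. SU i. pderiv_coord i h x * flux K t c h i x)"
    by (intro continuous_on_sum continuous_on_mult Ck_on_imp_continuous_on[OF Ck_on_pderiv[OF oU hU[of "Suc 0"]]]
      Ck_on_imp_continuous_on[OF flux_Ck[OF t' c hU[of "Suc 0"]]]) simp_all
  qed (rule flux_bil[OF t' c])
  have Bn: "0 <= ?B x" if "x : ?U" for x
   using r0p[OF that] Sm_nonneg[OF S t' c that] by (intro mult_nonneg_nonneg) auto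
  have BZ: "indicator ?U x * ?B x = indicator ?Z x * ?B x" for x
   using B0[of x] r(2) by (cases "x : ?Z") (auto simp: subset_iff)
  have Bi: "integrable lborel (%x. indicator ?U x * ?B x)"
   unfolding BZ by (rule borel_cutoff(3)[OF compact_cball continuous_on_subset[OF Bc r(2)]])
  have "(LINT x|lborel. indicator ?U x * (h x * (SU i. pderiv_coord i (flux K t c h i) x) + ?B x)) = 0"
   by (rule flux_test[OF t' c hU compact_cball r(2) f0 hU]) simp_all
  then have "(LINT x|lborel. indicator ?U x * ?B x) = 0"
   by (subst LINT_cong[OF refl, of _ _ "%x. indicator ?U x * (h x * (SU i. pderiv_coord i (flux K t c h i) x) + ?B x)"])
    (auto simp: indicator_def div0)
  then have "(\<integral>\<^sup>+x. ennreal (indicator ?U x * ?B x) \<partial>lborel) = 0"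
   using nn_integral_eq_integral[OF Bi] Bn by (auto simp: indicator_def)
  from continuous_nonneg_zero_lborel[OF oU Bc Bn this x0]
  have B: "bil (Sm K t c x0) (gradient (g t c) h x0) (gradient (g t c) h x0) = 0" using r0p[OF x0] by simp
  have "pderiv_coord i h x0 = r ^ 8 * \<xi> $ i" for i
  proof -
   have d: "a differentiable (at x0)" "(%x. \<xi> \<bullet> (x - x0)) differentiable (at x0)"
    using Ck1_iff[OF open_UNIV] Ck_on_mono[OF aC, of 1] in1 by auto
   have "pderiv_coord i (%x. \<xi> \<bullet> (x - x0)) x0 = \<xi> $ i"
    by (subst pderiv_coord_eq[where D="%v. \<xi> \<bullet> v"]) (auto intro!: derivative_eq_intros simp: inner_axis)
   moreover have "a x0 = r ^ 8" using r(1) by (simp add: a_def power_mult[symmetric])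
   ultimately show ?thesis unfolding h_def by (simp add: pderiv_mult[OF d])
  qed
  then have "(\<chi> i. pderiv_coord i h x0) = r ^ 8 *\<^sub>R \<xi>" by (simp add: vec_eq_iff)
  then have "gradient (g t c) h x0 = r ^ 8 *\<^sub>R y"
   using matrix_inv_left[of "g t c x0"] det_g_pos[OF t' c x0]
   by (simp add: gradient_def \<xi>_def matrix_vector_mult_scaleR matrix_vector_mul_assoc)
  with B r(1) show ?thesis by (simp add: bil_def matrix_vector_mult_scaleR)
 qed
 show ?thesis
 proof (rule bil_matrix_eqI)
  fix v w
  show "bil (Sm K t c x0) v w = bil 0 v w"
   using psd_null[OF Sm_nonneg[OF S t' c x0] Sm_sym[OF t' c x0] yy] by (simp add: bil_def)
 qed
qed

text \<open>Equality is assumed for positive times only; the flow equation at time 0 follows because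
  the tensor is continuous in time.\<close>

lemma Sm_zero_initial:
 assumes Z: "!!t. t : {0<..T} ==> Sm K t c x = 0" and c: "c : A" and x: "x : chart_image c"
 shows "Sm K 0 c x = 0"
proof -
 have "Sm K 0 c x $ i $ j = 0" for i j
 proof -
  have "continuous_on {0..T} (%t. (%q. Sm K (fst q) c (snd q) $ i $ j) (t, x))"
   by (rule continuous_on_compose2[OF smooth_on_imp_continuous_on[OF Sm_spacetime[OF c]]]) (auto intro!: continuous_intros simp: x)
  then have "continuous_on {0..T} (%t. Sm K t c x $ i $ j)" by simp
  from continuous_closed_preimage_constant[OF this closed_atLeastAtMost, of 0]
  have "closed {t : {0..T}. Sm K t c x $ i $ j = 0}" .
  then have "closure {0<..<T} \<subseteq> {t : {0..T}. Sm K t c x $ i $ j = 0}" by (rule closure_minimal[rotated]) (use Z in auto)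
  then show ?thesis using T_pos unfolding closure_greaterThanLessThan[OF T_pos] by (auto simp: subset_iff)
 qed
 then show ?thesis by (simp add: vec_eq_iff)
qed

end

theorem theorem1p5:
  fixes M :: "'a::t2_space set"
    and A :: "('a, 'n::finite) chart set"
    and g :: "real \<Rightarrow> ('a, 'n) tensor2"
    and \<phi> :: "real \<Rightarrow> 'a \<Rightarrow> real"
    and P :: "real \<Rightarrow> ('a \<Rightarrow> real) \<Rightarrow> 'a \<Rightarrow> real"
    and K T :: real
  assumes "compact M" and "smooth_atlas M A" and "0 < T"
    and "smooth_metrics A T g" and "smooth_functions A {0..T} \<phi>"
    and "super_Perelman_Ricci_flow A T K g \<phi>"
    and "conjugate_potential A T g \<phi>"
    and "heat_semigroup M A T g \<phi> P"
  shows
    "(\<forall>f. pos_continuous M f \<longrightarrow> (\<forall>t\<in>{0<..T}.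
        H_entropy M A g \<phi> P K f differentiable (at t within {0..T}) \<and>
        (W_entropy M A T g \<phi> P K f has_real_derivative
           - (1 + exp (2 * K * t)) *
             (\<integral>p. W_integrand A T K g \<phi> t (\<lambda>q. ln (P t f q)) p * P t f p
                \<partial>weighted_volume M A g \<phi> t)) (at t within {0..T}))) \<and>
     (\<forall>f. pos_continuous M f \<longrightarrow> (\<forall>t\<in>{0<..T}.
        time_deriv T (W_entropy M A T g \<phi> P K f) t
          + (1 + exp (2 * K * t)) *
            (\<integral>p. hessian_norm2 A (g t) (\<lambda>q. ln (P t f q)) p * P t f p
               \<partial>weighted_volume M A g \<phi> t) \<le> 0)) \<and>
     ((\<forall>f. pos_continuous M f \<and> \<not> f constant_on M \<longrightarrow> (\<forall>t\<in>{0<..T}.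
        time_deriv T (W_entropy M A T g \<phi> P K f) t
          + (1 + exp (2 * K * t)) *
            (\<integral>p. hessian_norm2 A (g t) (\<lambda>q. ln (P t f q)) p * P t f p
               \<partial>weighted_volume M A g \<phi> t) = 0))
      \<longleftrightarrow> Perelman_Ricci_flow A T K g \<phi>)"
proof -
 interpret metric_flow M A T g \<phi>
  by unfold_locales (fact assms)+
 have heat: "heat_flow M A T g \<phi> f (%t. P t f)" if "pos_continuous M f" for f
  using assms(8) that unfolding heat_semigroup_def by unfold_locales blast+
 let ?W = "W_entropy M A T g \<phi> P K"
 let ?h = "%f t p. hessian_norm2 A (g t) (%q. ln (P t f q)) p"
 let ?i = "%f t p. W_integrand A T K g \<phi> t (%q. ln (P t f q)) p"
 have vol: "weighted_volume M A g \<phi> t = mu" if "t : {0<..T}" for t by (rule weighted_volume_mu) (use that in simp)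
 \<comment> \<open>The difference of the two integrands is the defect tensor on the gradient of log
   u, weighted by the positive solution. Its sign is used for the inequality, and for the pointwise
   equality below.\<close>
 have ge: "0 <= (?i f t p - ?h f t p) * P t f p" if f: "pos_continuous M f" and t: "t : {0<..T}" and p: "p : M" for f t p
 proof -
  interpret h: heat_flow M A T g \<phi> f "%t. P t f" by (rule heat[OF f])
  show ?thesis
   using W_integrand_ge[OF assms(6) h.I_subset[OF t] h.SM_w[OF t] p] h.u_pos[OF h.I_subset[OF t] p] by simp
 qed
 note defect = heat_flow.W_defect[where P=P and K=K, OF heat refl]
 have part1: "ALL f. pos_continuous M f --> (ALL t:{0<..T}. H_entropy M A g \<phi> P K f differentiable (at t within {0..T}) &
  (?W f has_real_derivative - (1 + exp (2 * K * t)) * (LINT p|weighted_volume M A g \<phi> t. ?i f t p * P t f p)) (at t within {0..T}))"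
 proof (intro allI impI ballI conjI)
  fix f t assume f: "pos_continuous M f" and t: "t : {0<..T}"
  show "H_entropy M A g \<phi> P K f differentiable (at t within {0..T})"
   using heat_flow.H_DERIV[where P=P and K=K, OF heat[OF f] refl t] real_differentiable_def by blast
  show "(?W f has_real_derivative - (1 + exp (2 * K * t)) * (LINT p|weighted_volume M A g \<phi> t. ?i f t p * P t f p)) (at t within {0..T})"
   unfolding vol[OF t] by (rule heat_flow.W_DERIV[where P=P and K=K, OF heat[OF f] refl t])
 qed
 have part2: "ALL f. pos_continuous M f --> (ALL t:{0<..T}. time_deriv T (?W f) t
  + (1 + exp (2 * K * t)) * (LINT p|weighted_volume M A g \<phi> t. ?h f t p * P t f p) <= 0)"
 proof (intro allI impI ballI)
  fix f t assume f: "pos_continuous M f" and t: "t : {0<..T}"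
  have "0 <= (1 + exp (2 * K * t)) * (LINT p|mu. (?i f t p - ?h f t p) * P t f p)"
   by (rule mult_nonneg_nonneg[OF _ LINT_nonneg]) (use ge[OF f t] in \<open>simp_all add: add_nonneg_nonneg\<close>)
  then show "time_deriv T (?W f) t + (1 + exp (2 * K * t)) * (LINT p|weighted_volume M A g \<phi> t. ?h f t p * P t f p) <= 0"
   unfolding vol[OF t] defect[OF f t] by linarith
 qed
 have part3: "(ALL f. admissible f --> (ALL t:{0<..T}. time_deriv T (?W f) t
  + (1 + exp (2 * K * t)) * (LINT p|weighted_volume M A g \<phi> t. ?h f t p * P t f p) = 0)) \<longleftrightarrow> Perelman_Ricci_flow A T K g \<phi>"
 proof
  assume eq: "ALL f. admissible f --> (ALL t:{0<..T}. time_deriv T (?W f) t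
   + (1 + exp (2 * K * t)) * (LINT p|weighted_volume M A g \<phi> t. ?h f t p * P t f p) = 0)"
  \<comment> \<open>A continuous nonnegative function with integral zero vanishes at every point;
    only afterwards can the argument be carried out pointwise in charts.\<close>
  have ptw: "?i f t p = ?h f t p" if f: "admissible f" and t: "t : {0<..T}" and p: "p : M" for f t p
  proof -
   have f': "pos_continuous M f" using f by simp
   interpret h: heat_flow M A T g \<phi> f "%t. P t f" by (rule heat[OF f'])
   note t' = h.I_subset[OF t]
   from eq f t have "time_deriv T (?W f) t + (1 + exp (2 * K * t)) * (LINT p|weighted_volume M A g \<phi> t. ?h f t p * P t f p) = 0"
    by blast
   then have "- (1 + exp (2 * K * t)) * (LINT p|mu. (?i f t p - ?h f t p) * P t f p) = 0"
    unfolding vol[OF t] defect[OF f' t] .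
   moreover have "1 + exp (2 * K * t) > 0" by (simp add: add_pos_pos)
   ultimately have "(LINT p|mu. (?i f t p - ?h f t p) * P t f p) = 0" by simp
   then have "(?i f t p - ?h f t p) * P t f p = 0"
    by (intro mu_zero[OF _ ge[OF f' t] _ p] continuous_on_mult continuous_on_diff W_integrand_continuous hessian_norm2_continuous
      t' h.SM_w[OF t] C1M_continuous[OF SM_C1M[OF h.SM_u[OF t]]])
   then show ?thesis using h.u_pos[OF t' p] by simp
  qed
  have Z: "Sm K t c x = 0" if "t : {0<..T}" "c : A" "x : chart_image c" for t c x
   by (rule Sm_zero[OF assms(6) heat ptw[OF _ that(1)] that]) simp_all
  show "Perelman_Ricci_flow A T K g \<phi>"
   unfolding Perelman_iff
  proof (intro ballI)
   fix t c x assume t: "t : {0..T}" and c: "c : A" "x : chart_image c"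
   show "Sm K t c x = 0"
   proof (cases "t = 0")
    case True
    then show ?thesis using Sm_zero_initial[OF Z[OF _ c] c] by simp
   qed (use Z[OF _ c] t in simp)
  qed
 next
  assume "Perelman_Ricci_flow A T K g \<phi>"
  then have Z: "Sm K t c x = 0" if "t : {0..T}" "c : A" "x : chart_image c" for t c x
   unfolding Perelman_iff using that by blast
  show "ALL f. admissible f --> (ALL t:{0<..T}. time_deriv T (?W f) t
   + (1 + exp (2 * K * t)) * (LINT p|weighted_volume M A g \<phi> t. ?h f t p * P t f p) = 0)"
  proof (intro allI impI ballI)
   fix f t assume f: "admissible f" and t: "t : {0<..T}"
   have f': "pos_continuous M f" using f by simp
   interpret h: heat_flow M A T g \<phi> f "%t. P t f" by (rule heat[OF f'])
   note t' = h.I_subset[OF t]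
   have "?i f t p = ?h f t p" if "p : M" for p
   proof -
    obtain c where c: "c : A" "p : fst c" using chart_union \<open>p : M\<close> by blast
    show ?thesis
     unfolding W_integrand_Sm[OF t' h.SM_w[OF t] c] Z[OF t' c(1) snd_in[OF c(2)]] by (simp add: bil_def)
   qed
   then have "(LINT p|mu. (?i f t p - ?h f t p) * P t f p) = (LINT p|mu. 0)"
    by (intro LINT_cong) auto
   then show "time_deriv T (?W f) t + (1 + exp (2 * K * t)) * (LINT p|weighted_volume M A g \<phi> t. ?h f t p * P t f p) = 0"
    unfolding vol[OF t] defect[OF f' t] by simp
  qed
 qed
 show ?thesis by (intro conjI part1 part2 part3)
qed

end
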